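(* For any $n\in\mathbb N$ there exist real numbers $\lambda_{j,n}$, $j\in\mathbb N\cup\{0\}$, such that for any $N\in\mathbb N$ one has the asymptotics $$E_n(T_\alpha)=\frac{1}{\alpha^2}\sum_{j=0}^N\lambda_{j,n}\,\alpha^{2j}+O(\alpha^{2N})\quad\text{as }\alpha\to0,$$ and $\lambda_{0,n}=-\dfrac{1}{(2n-1)^2}$.
   Context: $\mathbb N=\{1,2,\dots\}$. For $\alpha\in(0,\frac{\pi}{2})$ let $U_\alpha=\{(x_1,x_2)\in\mathbb R^2: |\arg(x_1+ix_2)|<\alpha\}$. $T_\alpha$ denotes the self-adjoint operator in $L^2(U_\alpha)$ associated with the closed, lower semibounded sesquilinear form $$t_\alpha(u,u)=\int_{U_\alpha}|\nabla u|^2\,dx-\int_{\partial U_\alpha}|u|^2\,ds,\qquad u\in H^1(U_\alpha),$$ where $ds$ is the one-dimensional Hausdorff measure (the Laplacian with the Robin condition $\partial_\nu u=u$). Its essential spectrum is $[-1,+\infty)$. $E_n(T_\alpha)$ denotes the $n$th discrete eigenvalue of $T_\alpha$ (eigenvalues below $-1$ enumerated in non-decreasing order, counted with multiplicities); for each fixed $n$ it exists for all sufficiently small $\alpha>0$. *)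

theory Defs
  imports "HOL-Analysis.Analysis" "HOL-Library.Landau_Symbols" "HOL-Library.Extended_Nat"
begin

section \<open>One-dimensional Hausdorff measure\<close>

text \<open>
  The condition \<open>bounded\<close> is needed because the library's \<^const>\<open>diameter\<close> is a real number,
  unspecified on unbounded sets. With this normalisation the measure of a line segment
  is its length.
\<close>

definition hausdorff1_pre :: "real \<Rightarrow> 'a::metric_space set \<Rightarrow> ennreal" where
  "hausdorff1_pre \<delta> A =
     (INF C \<in> {C :: nat \<Rightarrow> 'a set. A \<subseteq> (\<Union>i. C i) \<and> (\<forall>i. bounded (C i) \<and> diameter (C i) \<le> \<delta>)}.
        \<Sum>i. ennreal (diameter (C i)))"

definition hausdorff1_outer :: "'a::metric_space set \<Rightarrow> ennreal" where
  "hausdorff1_outer A = (SUP \<delta> \<in> {0<..}. hausdorff1_pre \<delta> A)"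

text \<open>
  \<^const>\<open>hausdorff1_outer\<close> is a metric outer measure, hence countably additive on the Borel
  sets, and \<^const>\<open>measure_of\<close> is its restriction to them.
\<close>

definition hausdorff1 :: "'a::metric_space measure" where
  "hausdorff1 = measure_of UNIV (sets borel) hausdorff1_outer"

abbreviation boundary_measure :: "'a::metric_space set \<Rightarrow> 'a measure" where
  "boundary_measure \<Omega> \<equiv> restrict_space hausdorff1 (frontier \<Omega>)"


section \<open>Square-integrable functions, weak derivatives, Sobolev space, traces\<close>

text \<open>
  Elements of \<open>L\<^sup>2\<close> are represented by functions; functions that agree almost everywhere
  represent the same element, and every notion below respects this identification.
\<close>

definition L2 :: "'a measure \<Rightarrow> ('a \<Rightarrow> complex) set" where
  "L2 M = {u. u \<in> borel_measurable M \<and> integrable M (\<lambda>x. (norm (u x))\<^sup>2)}"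

definition L2_inner :: "'a measure \<Rightarrow> ('a \<Rightarrow> complex) \<Rightarrow> ('a \<Rightarrow> complex) \<Rightarrow> complex" where
  "L2_inner M u v = (\<integral>x. u x * cnj (v x) \<partial>M)"

definition L2_dist_sq :: "'a measure \<Rightarrow> ('a \<Rightarrow> complex) \<Rightarrow> ('a \<Rightarrow> complex) \<Rightarrow> ennreal" where
  "L2_dist_sq M u v = (\<integral>\<^sup>+x. ennreal ((norm (u x - v x))\<^sup>2) \<partial>M)"

definition partial_deriv :: "'a::euclidean_space \<Rightarrow> ('a \<Rightarrow> complex) \<Rightarrow> 'a \<Rightarrow> complex" where
  "partial_deriv b f = (\<lambda>x. frechet_derivative f (at x) b)"

primrec C_k :: "nat \<Rightarrow> ('a::euclidean_space \<Rightarrow> complex) \<Rightarrow> bool" where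
  "C_k 0 f \<longleftrightarrow> continuous_on UNIV f"
| "C_k (Suc k) f \<longleftrightarrow> (\<forall>x. f differentiable (at x)) \<and> (\<forall>b\<in>Basis. C_k k (partial_deriv b f))"

definition test_functions :: "'a::euclidean_space set \<Rightarrow> ('a \<Rightarrow> complex) set" where
  "test_functions \<Omega> =
     {\<phi>. (\<forall>k. C_k k \<phi>) \<and> (\<exists>K. compact K \<and> K \<subseteq> \<Omega> \<and> (\<forall>x. x \<notin> K \<longrightarrow> \<phi> x = 0))}"

definition is_weak_partial ::
  "'a::euclidean_space set \<Rightarrow> 'a \<Rightarrow> ('a \<Rightarrow> complex) \<Rightarrow> ('a \<Rightarrow> complex) \<Rightarrow> bool" where
  "is_weak_partial \<Omega> b u g \<longleftrightarrow>
     g \<in> L2 (lebesgue_on \<Omega>) \<and>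
     (\<forall>\<phi>\<in>test_functions \<Omega>.
        (\<integral>x. u x * partial_deriv b \<phi> x \<partial>lebesgue_on \<Omega>) = - (\<integral>x. g x * \<phi> x \<partial>lebesgue_on \<Omega>))"

definition weak_partial ::
  "'a::euclidean_space set \<Rightarrow> 'a \<Rightarrow> ('a \<Rightarrow> complex) \<Rightarrow> 'a \<Rightarrow> complex" where
  "weak_partial \<Omega> b u = (SOME g. is_weak_partial \<Omega> b u g)"

definition H1 :: "'a::euclidean_space set \<Rightarrow> ('a \<Rightarrow> complex) set" where
  "H1 \<Omega> = {u \<in> L2 (lebesgue_on \<Omega>). \<forall>b\<in>Basis. \<exists>g. is_weak_partial \<Omega> b u g}"

text \<open>
  The trace operator is the closure of the restriction map \<open>\<phi> \<mapsto> \<phi>|\<^bsub>\<partial>\<Omega>\<^esub>\<close> on smooth compactly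
  supported functions on the whole space, from \<open>H\<^sup>1(\<Omega>)\<close> to \<open>L\<^sup>2(\<partial>\<Omega>)\<close>. The codimension of
  \<open>\<partial>\<Omega>\<close> makes this the usual trace only for planar \<open>\<Omega>\<close>.
\<close>

definition is_trace ::
  "'a::euclidean_space set \<Rightarrow> ('a \<Rightarrow> complex) \<Rightarrow> ('a \<Rightarrow> complex) \<Rightarrow> bool" where
  "is_trace \<Omega> u g \<longleftrightarrow>
     g \<in> L2 (boundary_measure \<Omega>) \<and>
     (\<exists>\<phi> :: nat \<Rightarrow> 'a \<Rightarrow> complex.
        (\<forall>k. \<phi> k \<in> test_functions UNIV) \<and>
        (\<lambda>k. L2_dist_sq (lebesgue_on \<Omega>) (\<phi> k) u
            + (\<Sum>b\<in>Basis. L2_dist_sq (lebesgue_on \<Omega>) (partial_deriv b (\<phi> k)) (weak_partial \<Omega> b u)))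
          \<longlonglongrightarrow> 0 \<and>
        (\<lambda>k. L2_dist_sq (boundary_measure \<Omega>) (\<phi> k) g) \<longlonglongrightarrow> 0)"

definition boundary_trace :: "'a::euclidean_space set \<Rightarrow> ('a \<Rightarrow> complex) \<Rightarrow> 'a \<Rightarrow> complex" where
  "boundary_trace \<Omega> u = (SOME g. is_trace \<Omega> u g)"


section \<open>The Robin Laplacian in the sector\<close>

text \<open>The apex is excluded explicitly because the library sets \<open>Arg 0 = 0\<close>.\<close>

definition sector :: "real \<Rightarrow> (real \<times> real) set" where
  "sector \<alpha> = {(x\<^sub>1, x\<^sub>2). Complex x\<^sub>1 x\<^sub>2 \<noteq> 0 \<and> \<bar>Arg (Complex x\<^sub>1 x\<^sub>2)\<bar> < \<alpha>}"

definition robin_form :: "real \<Rightarrow> (real \<times> real \<Rightarrow> complex) \<Rightarrow> (real \<times> real \<Rightarrow> complex) \<Rightarrow> complex" where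
  "robin_form \<alpha> u v =
     (\<Sum>b\<in>Basis. L2_inner (lebesgue_on (sector \<alpha>))
                  (weak_partial (sector \<alpha>) b u) (weak_partial (sector \<alpha>) b v))
     - L2_inner (boundary_measure (sector \<alpha>)) (boundary_trace (sector \<alpha>) u) (boundary_trace (sector \<alpha>) v)"

text \<open>
  The graph of the operator \<open>T\<^sub>\<alpha>\<close> associated with the form: \<open>u\<close> is in its domain and
  \<open>T\<^sub>\<alpha> u = f\<close> iff \<open>u \<in> H\<^sup>1\<close>, \<open>f \<in> L\<^sup>2\<close> and \<open>t\<^sub>\<alpha>(u,v) = \<langle>f,v\<rangle>\<close> for all \<open>v \<in> H\<^sup>1\<close>.
\<close>

definition robin_operator ::
  "real \<Rightarrow> ((real \<times> real \<Rightarrow> complex) \<times> (real \<times> real \<Rightarrow> complex)) set" where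
  "robin_operator \<alpha> =
     {(u, f). u \<in> H1 (sector \<alpha>) \<and> f \<in> L2 (lebesgue_on (sector \<alpha>)) \<and>
              (\<forall>v\<in>H1 (sector \<alpha>). robin_form \<alpha> u v = L2_inner (lebesgue_on (sector \<alpha>)) f v)}"

definition eigenspace :: "real \<Rightarrow> real \<Rightarrow> (real \<times> real \<Rightarrow> complex) set" where
  "eigenspace \<alpha> E = {u. (u, \<lambda>x. complex_of_real E * u x) \<in> robin_operator \<alpha>}"

definition is_eigenvalue :: "real \<Rightarrow> real \<Rightarrow> bool" where
  "is_eigenvalue \<alpha> E \<longleftrightarrow> (\<exists>u\<in>eigenspace \<alpha> E. \<not> (AE x in lebesgue_on (sector \<alpha>). u x = 0))"

definition independent_AE :: "'a measure \<Rightarrow> nat \<Rightarrow> (nat \<Rightarrow> 'a \<Rightarrow> complex) \<Rightarrow> bool" where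
  "independent_AE M k u \<longleftrightarrow>
     (\<forall>c :: nat \<Rightarrow> complex. (AE x in M. (\<Sum>i<k. c i * u i x) = 0) \<longrightarrow> (\<forall>i<k. c i = 0))"

definition multiplicity :: "real \<Rightarrow> real \<Rightarrow> enat" where
  "multiplicity \<alpha> E =
     (SUP k \<in> {k. \<exists>u. (\<forall>i<k. u i \<in> eigenspace \<alpha> E) \<and>
                      independent_AE (lebesgue_on (sector \<alpha>)) k u}. enat k)"

definition discrete_eigenvalues :: "real \<Rightarrow> real set" where
  "discrete_eigenvalues \<alpha> = {E. E < -1 \<and> is_eigenvalue \<alpha> E}"

text \<open>
  \<open>E\<close> occupies position \<open>n\<close> (counting from 1) in the non-decreasing enumeration with
  multiplicities.
\<close>

definition is_nth_eigenvalue :: "real \<Rightarrow> nat \<Rightarrow> real \<Rightarrow> bool" where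
  "is_nth_eigenvalue \<alpha> n E \<longleftrightarrow>
     E \<in> discrete_eigenvalues \<alpha> \<and>
     finite {\<mu> \<in> discrete_eigenvalues \<alpha>. \<mu> < E} \<and>
     (\<Sum>\<mu> | \<mu> \<in> discrete_eigenvalues \<alpha> \<and> \<mu> < E. multiplicity \<alpha> \<mu>) < enat n \<and>
     enat n \<le> (\<Sum>\<mu> | \<mu> \<in> discrete_eigenvalues \<alpha> \<and> \<mu> \<le> E. multiplicity \<alpha> \<mu>)"

lemma is_nth_eigenvalue_unique:
  assumes "is_nth_eigenvalue \<alpha> n E" and "is_nth_eigenvalue \<alpha> n E'"
  shows "E = E'"
proof -
  have False if "is_nth_eigenvalue \<alpha> n E" "is_nth_eigenvalue \<alpha> n E'" "E < E'" for E E'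
  proof -
    have "enat n \<le> (\<Sum>\<mu> | \<mu> \<in> discrete_eigenvalues \<alpha> \<and> \<mu> \<le> E. multiplicity \<alpha> \<mu>)"
      using that unfolding is_nth_eigenvalue_def by blast
    also have "\<dots> \<le> (\<Sum>\<mu> | \<mu> \<in> discrete_eigenvalues \<alpha> \<and> \<mu> < E'. multiplicity \<alpha> \<mu>)"
      using that unfolding is_nth_eigenvalue_def by (intro sum_mono2) auto
    also have "\<dots> < enat n"
      using that unfolding is_nth_eigenvalue_def by blast
    finally show False by simp
  qed
  then show ?thesis using assms by (meson linorder_neqE)
qed

text \<open>
  If there are fewer than \<open>n\<close> eigenvalues below \<open>-1\<close>, the value below is unspecified but does
  not depend on \<open>\<alpha>\<close>. For fixed \<open>n\<close> this happens only for \<open>\<alpha>\<close> bounded away from \<open>0\<close>.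
\<close>

definition nth_eigenvalue :: "real \<Rightarrow> nat \<Rightarrow> real" where
  "nth_eigenvalue \<alpha> n = (THE E. is_nth_eigenvalue \<alpha> n E)"

end

theory Submission
  imports Defs
begin

text \<open>
  The eigenvalue problem can be solved in closed form. Put \<open>c = 2n - 1\<close>; for all small \<open>\<alpha>\<close>
  the \<open>n\<close>-th eigenvalue of \<open>T\<^sub>\<alpha>\<close> equals \<open>- 1 / sin\<^sup>2 (c\<alpha>)\<close>. Since \<open>sin x = x \<Phi>(x\<^sup>2)\<close> with an entire
  function \<open>\<Phi>\<close> and \<open>\<Phi>(0) = 1\<close>, the function \<open>1 / sin\<^sup>2 x\<close> is \<open>x\<^sup>-\<^sup>2\<close> times a power series in \<open>x\<^sup>2\<close>
  with constant term \<open>1\<close>. This is the claimed expansion, with leading coefficient \<open>- 1 / c\<^sup>2\<close>.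

  \<^bold>\<open>The eigenvalues exist.\<close> For \<open>(2M + 1)\<alpha> < \<pi>/2\<close> and \<open>\<kappa> = 1 / sin ((2M + 1)\<alpha>)\<close> the function
  \<open>edge_fun\<close> is a combination of the exponentials \<open>exp (- \<kappa> \<langle>z, e(2j\<alpha>)\<rangle>)\<close>, \<open>\<bar>j\<bar> \<le> M\<close>, where \<open>e(\<theta>)\<close> is the
  unit vector with polar angle \<open>\<theta>\<close>. Each of them satisfies \<open>\<Delta>u = \<kappa>\<^sup>2 u\<close>. The reflection in the ray of
  angle \<open>\<alpha>\<close> maps the directions \<open>2j\<alpha>\<close> to \<open>2(1 - j)\<alpha>\<close>, so on that ray the terms \<open>j\<close> and \<open>1 - j\<close> have
  the same exponential, and the amplitudes are chosen such that their contributions to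
  \<open>\<partial>\<^sub>\<nu>u - u\<close> cancel. The chain of reflections stops because the amplitude with index \<open>M + 1\<close>
  vanishes by the choice of \<open>\<kappa>\<close>. These are the edge waves of Ursell's sloping beach problem.
  Green's formula then gives the weak eigenvalue equation, first against test functions and,
  by density, against all of \<open>H\<^sup>1\<close> (\<open>edge_eigenspace\<close>).

  \<^bold>\<open>There are no others below them.\<close> Write \<open>T = tan \<alpha>\<close> and use the coordinates \<open>(x, xs)\<close>,
  \<open>\<bar>s\<bar> < T\<close>, in the sector. On the slice with fixed \<open>x\<close> replace a function by its mean \<open>m(x)\<close>;
  Poincare's inequality pays for the oscillation, and what remains of the form is, up to a factor
  and an error of at most \<open>12\<close>, the form
  \<open>\<integral> x m'\<^sup>2 - \<beta> m\<^sup>2\<close> with \<open>\<beta> = (1 + T) / sin \<alpha>\<close> (\<open>slice_form_bound\<close>). It belongs to the radial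
  two-dimensional Coulomb operator, whose eigenvalues are \<open>- \<beta>\<^sup>2 / (2j + 1)\<^sup>2\<close> with eigenfunctions
  \<open>e\<^sup>-\<^sup>k\<^sup>x\<close> times a Laguerre polynomial. By Jacobi's identity the form plus
  \<open>\<beta>\<^sup>2 / (2n + 1)\<^sup>2 \<integral> x m\<^sup>2\<close> is nonnegative on functions that vanish at the (at most \<open>n\<close>) zeros of the
  \<open>n\<close>-th eigenfunction (\<open>laguerre_form_nonneg\<close>). Thus \<open>n\<close> linear conditions push the form above
  \<open>lower_const n\<close>, which is about \<open>- 1 / ((2n + 1)\<^sup>2 \<alpha>\<^sup>2)\<close> and hence, for small \<open>\<alpha>\<close>, above
  \<open>- 1 / sin\<^sup>2 ((2n - 1)\<alpha>)\<close>. So at most \<open>n\<close> eigenvalues, counted with multiplicities, are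
  \<open>\<le> - 1 / sin\<^sup>2 ((2n - 1)\<alpha>)\<close> (\<open>eigenvalue_count\<close>). The edge waves with \<open>M < n\<close> already supply
  \<open>n\<close> distinct ones, so the largest of these is the \<open>n\<close>-th (\<open>nth_eigenvalue_eq_edge_value\<close>).

  \<^bold>\<open>Function spaces.\<close> Both parts need that traces exist and that test functions on the plane are
  dense in \<open>H\<^sup>1\<close> of the sector. Density comes from convolution with kernels supported in the
  \<^emph>\<open>reflected\<close> sector, so that values at points of the sector only involve values in the
  sector (\<open>H1_dense\<close>); the trace inequality follows from the divergence theorem
  (\<open>trace_inequality\<close>). The boundary integrals become integrals over \<open>\<real>\<close> because the arc length
  parametrisation of the boundary transports Lebesgue measure to the Hausdorff measure
  (\<open>hausdorff1_bd_param\<close>).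
\<close>

section \<open>Square-integrable functions\<close>

definition L2_norm :: "'a measure \<Rightarrow> ('a \<Rightarrow> complex) \<Rightarrow> real" where
  "L2_norm M f = sqrt (\<integral>x. (norm (f x))\<^sup>2 \<partial>M)"

lemma borel_measurable_cnj [measurable]: "cnj \<in> borel_measurable borel"
  by (intro borel_measurable_continuous_onI continuous_intros)

lemma L2_measurable [measurable_dest]: "f \<in> L2 M \<Longrightarrow> f \<in> borel_measurable M"
  by (simp add: L2_def)

lemma L2_integrable: "f \<in> L2 M \<Longrightarrow> integrable M (\<lambda>x. (norm (f x))\<^sup>2)"
  by (simp add: L2_def)

lemma L2_iff_nn: "f \<in> L2 M \<longleftrightarrow> f \<in> borel_measurable M \<and> (\<integral>\<^sup>+x. ennreal ((norm (f x))\<^sup>2) \<partial>M) < top"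
proof -
  have "integrable M (\<lambda>x. (norm (f x))\<^sup>2) \<longleftrightarrow> (\<integral>\<^sup>+x. ennreal ((norm (f x))\<^sup>2) \<partial>M) < top"
    if [measurable]: "f \<in> borel_measurable M"
    by (subst integrable_iff_bounded) (auto simp: top_unique less_top)
  then show ?thesis by (auto simp: L2_def)
qed

lemma L2_norm_nonneg [simp]: "0 \<le> L2_norm M f"
  by (simp add: L2_norm_def)

lemma L2_norm_sq: "(L2_norm M f)\<^sup>2 = (\<integral>x. (norm (f x))\<^sup>2 \<partial>M)"
  by (simp add: L2_norm_def)

lemma nn_L2_norm: "f \<in> L2 M \<Longrightarrow> (\<integral>\<^sup>+x. ennreal ((norm (f x))\<^sup>2) \<partial>M) = ennreal ((L2_norm M f)\<^sup>2)"
  unfolding L2_norm_sq by (intro nn_integral_eq_integral L2_integrable) auto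

lemma norm_add_sq_le: "(norm (x + y :: 'a::real_normed_vector))\<^sup>2 \<le> 2 * (norm x)\<^sup>2 + 2 * (norm y)\<^sup>2"
proof -
  have "(norm (x + y))\<^sup>2 \<le> (norm x + norm y)\<^sup>2" by (intro power_mono norm_triangle_ineq) simp
  moreover have "0 \<le> (norm x - norm y)\<^sup>2" by simp
  ultimately show ?thesis by (simp add: power2_sum power2_diff)
qed

lemma L2_add: assumes "f \<in> L2 M" "g \<in> L2 M" shows "(\<lambda>x. f x + g x) \<in> L2 M"
  unfolding L2_def
proof safe
  have [measurable]: "f \<in> borel_measurable M" "g \<in> borel_measurable M"
    using assms by (auto dest: L2_measurable)
  show "(\<lambda>x. f x + g x) \<in> borel_measurable M" by measurable
  show "integrable M (\<lambda>x. (norm (f x + g x))\<^sup>2)"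
  proof (rule Bochner_Integration.integrable_bound)
    show "integrable M (\<lambda>x. 2 * (norm (f x))\<^sup>2 + 2 * (norm (g x))\<^sup>2)"
      using assms by (intro Bochner_Integration.integrable_add integrable_mult_right L2_integrable)
  qed (auto simp: norm_add_sq_le)
qed

lemma L2_cmult: assumes "f \<in> L2 M" shows "(\<lambda>x. c * f x) \<in> L2 M"
  using assms unfolding L2_def by (auto simp: norm_mult power_mult_distrib)

lemma L2_zero [simp]: "(\<lambda>x. 0) \<in> L2 M" by (simp add: L2_def)

lemma L2_diff: assumes "f \<in> L2 M" "g \<in> L2 M" shows "(\<lambda>x. f x - g x) \<in> L2 M"
  using L2_add[OF assms(1) L2_cmult[OF assms(2), of "-1"]] by simp

lemma L2_sum: "(\<And>i. i \<in> I \<Longrightarrow> f i \<in> L2 M) \<Longrightarrow> (\<lambda>x. \<Sum>i\<in>I. f i x) \<in> L2 M"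
  by (induction I rule: infinite_finite_induct) (auto intro: L2_add)

lemma L2_mult_integrable:
  assumes "f \<in> L2 M" "g \<in> L2 M" shows "integrable M (\<lambda>x. f x * cnj (g x))"
proof (rule Bochner_Integration.integrable_bound)
  show "integrable M (\<lambda>x. (norm (f x))\<^sup>2 + (norm (g x))\<^sup>2)"
    using assms by (intro Bochner_Integration.integrable_add L2_integrable)
  show "(\<lambda>x. f x * cnj (g x)) \<in> borel_measurable M"
    using assms[THEN L2_measurable] by measurable
  show "AE x in M. norm (f x * cnj (g x)) \<le> norm ((norm (f x))\<^sup>2 + (norm (g x))\<^sup>2)"
  proof (rule AE_I2)
    fix x
    have "0 \<le> (norm (f x) - norm (g x))\<^sup>2" by simp
    then have "2 * (norm (f x) * norm (g x)) \<le> (norm (f x))\<^sup>2 + (norm (g x))\<^sup>2"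
      by (simp add: power2_diff)
    moreover have "0 \<le> norm (f x) * norm (g x)" by simp
    ultimately have "norm (f x) * norm (g x) \<le> (norm (f x))\<^sup>2 + (norm (g x))\<^sup>2" by linarith
    then show "norm (f x * cnj (g x)) \<le> norm ((norm (f x))\<^sup>2 + (norm (g x))\<^sup>2)"
      by (simp add: norm_mult)
  qed
qed

lemma L2_Cauchy_Schwarz:
  assumes f: "f \<in> L2 M" and g: "g \<in> L2 M"
  shows "norm (L2_inner M f g) \<le> L2_norm M f * L2_norm M g"
proof -
  note [measurable] = L2_measurable[OF f] L2_measurable[OF g]
  have int: "integrable M (\<lambda>x. norm (f x * cnj (g x)))"
    using L2_mult_integrable[OF f g] by (rule integrable_norm)
  have "ennreal ((\<integral>x. norm (f x * cnj (g x)) \<partial>M)\<^sup>2) = (\<integral>\<^sup>+x. ennreal (norm (f x * cnj (g x))) \<partial>M)\<^sup>2"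
    by (subst nn_integral_eq_integral[OF int]) (auto simp: ennreal_power)
  also have "\<dots> = (\<integral>\<^sup>+x. ennreal (norm (f x)) * ennreal (norm (g x)) \<partial>M)\<^sup>2"
    by (simp add: norm_mult ennreal_mult)
  also have "\<dots> \<le> (\<integral>\<^sup>+x. (ennreal (norm (f x)))\<^sup>2 \<partial>M) * (\<integral>\<^sup>+x. (ennreal (norm (g x)))\<^sup>2 \<partial>M)"
    by (intro Cauchy_Schwarz_nn_integral) measurable
  also have "\<dots> = ennreal ((L2_norm M f)\<^sup>2) * ennreal ((L2_norm M g)\<^sup>2)"
    by (simp add: nn_L2_norm[OF f, symmetric] nn_L2_norm[OF g, symmetric] ennreal_power)
  also have "\<dots> = ennreal ((L2_norm M f * L2_norm M g)\<^sup>2)"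
    by (simp add: ennreal_mult power_mult_distrib)
  finally have "(\<integral>x. norm (f x * cnj (g x)) \<partial>M)\<^sup>2 \<le> (L2_norm M f * L2_norm M g)\<^sup>2"
    by (simp add: ennreal_le_iff)
  then have "(\<integral>x. norm (f x * cnj (g x)) \<partial>M) \<le> L2_norm M f * L2_norm M g"
    by (rule power2_le_imp_le) simp
  moreover have "norm (L2_inner M f g) \<le> (\<integral>x. norm (f x * cnj (g x)) \<partial>M)"
    unfolding L2_inner_def by (rule integral_norm_bound)
  ultimately show ?thesis by linarith
qed

lemma L2_inner_diff_left:
  "f \<in> L2 M \<Longrightarrow> g \<in> L2 M \<Longrightarrow> h \<in> L2 M \<Longrightarrow> L2_inner M (\<lambda>x. f x - g x) h = L2_inner M f h - L2_inner M g h"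
  unfolding L2_inner_def by (simp add: left_diff_distrib L2_mult_integrable)

lemma L2_inner_diff_right:
  "f \<in> L2 M \<Longrightarrow> g \<in> L2 M \<Longrightarrow> h \<in> L2 M \<Longrightarrow> L2_inner M h (\<lambda>x. f x - g x) = L2_inner M h f - L2_inner M h g"
  unfolding L2_inner_def by (simp add: right_diff_distrib L2_mult_integrable)

lemma L2_inner_cnj: "L2_inner M f g = cnj (L2_inner M g f)"
proof -
  have "L2_inner M f g = (\<integral>x. cnj (g x * cnj (f x)) \<partial>M)" unfolding L2_inner_def
    by (simp add: mult.commute del: Bochner_Integration.integral_cnj)
  also have "\<dots> = cnj (L2_inner M g f)" unfolding L2_inner_def by (rule Bochner_Integration.integral_cnj)
  finally show ?thesis .
qed

lemma L2_inner_self: "L2_inner M f f = complex_of_real ((L2_norm M f)\<^sup>2)"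
  unfolding L2_inner_def L2_norm_sq by (simp add: complex_norm_square[symmetric] del: of_real_power)

lemma L2_inner_sum_sum:
  assumes "\<And>i. i \<in> I \<Longrightarrow> u i \<in> L2 M" "\<And>i. i \<in> J \<Longrightarrow> v i \<in> L2 M"
  shows "L2_inner M (\<lambda>x. \<Sum>i\<in>I. c i * u i x) (\<lambda>x. \<Sum>j\<in>J. d j * v j x)
         = (\<Sum>i\<in>I. \<Sum>j\<in>J. c i * cnj (d j) * L2_inner M (u i) (v j))"
proof -
  have "L2_inner M (\<lambda>x. \<Sum>i\<in>I. c i * u i x) (\<lambda>x. \<Sum>j\<in>J. d j * v j x)
     = (\<integral>x. (\<Sum>i\<in>I. \<Sum>j\<in>J. c i * cnj (d j) * (u i x * cnj (v j x))) \<partial>M)"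
    unfolding L2_inner_def cnj_sum complex_cnj_mult sum_product by (simp add: algebra_simps)
  also have "\<dots> = (\<Sum>i\<in>I. \<Sum>j\<in>J. c i * cnj (d j) * L2_inner M (u i) (v j))"
    unfolding L2_inner_def using assms
    by (simp add: Bochner_Integration.integral_sum Bochner_Integration.integrable_sum L2_mult_integrable)
  finally show ?thesis .
qed

lemma L2_dist_sq_eq: "f \<in> L2 M \<Longrightarrow> g \<in> L2 M \<Longrightarrow> L2_dist_sq M f g = ennreal ((L2_norm M (\<lambda>x. f x - g x))\<^sup>2)"
  unfolding L2_dist_sq_def by (rule nn_L2_norm[OF L2_diff])

lemma L2_dist_sq_sym: "L2_dist_sq M f g = L2_dist_sq M g f"
  unfolding L2_dist_sq_def by (simp add: norm_minus_commute)

lemma L2_dist_sq_triangle: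
  assumes [measurable]: "f \<in> borel_measurable M" "g \<in> borel_measurable M" "h \<in> borel_measurable M"
  shows "L2_dist_sq M f h \<le> 2 * L2_dist_sq M f g + 2 * L2_dist_sq M g h"
proof -
  have "L2_dist_sq M f h \<le> (\<integral>\<^sup>+x. 2 * ennreal ((norm (f x - g x))\<^sup>2) + 2 * ennreal ((norm (g x - h x))\<^sup>2) \<partial>M)"
    unfolding L2_dist_sq_def
  proof (rule nn_integral_mono)
    fix x
    have "(norm (f x - h x))\<^sup>2 \<le> 2 * (norm (f x - g x))\<^sup>2 + 2 * (norm (g x - h x))\<^sup>2"
      using norm_add_sq_le[of "f x - g x" "g x - h x"] by simp
    then have "ennreal ((norm (f x - h x))\<^sup>2) \<le> ennreal (2 * (norm (f x - g x))\<^sup>2 + 2 * (norm (g x - h x))\<^sup>2)"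
      by (rule ennreal_leI)
    then show "ennreal ((norm (f x - h x))\<^sup>2) \<le> 2 * ennreal ((norm (f x - g x))\<^sup>2) + 2 * ennreal ((norm (g x - h x))\<^sup>2)"
      by (simp add: ennreal_plus ennreal_mult)
  qed
  also have "\<dots> = 2 * L2_dist_sq M f g + 2 * L2_dist_sq M g h"
    unfolding L2_dist_sq_def by (subst nn_integral_add) (auto simp: nn_integral_cmult)
  finally show ?thesis .
qed

lemma L2_dist_sq_zero_AE:
  assumes [measurable]: "f \<in> borel_measurable M" "g \<in> borel_measurable M"
  shows "L2_dist_sq M f g = 0 \<longleftrightarrow> (AE x in M. f x = g x)"
  unfolding L2_dist_sq_def by (subst nn_integral_0_iff_AE) auto

lemma tendsto_ennreal_squeeze0:
  fixes f g :: "nat \<Rightarrow> ennreal"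
  assumes "\<And>n. f n \<le> g n" "g \<longlonglongrightarrow> 0" shows "f \<longlonglongrightarrow> 0"
  by (rule tendsto_sandwich[of "\<lambda>_. 0" f sequentially g]) (use assms in auto)

text \<open>
  The right-hand side has the form that the quadratic triangle inequality \<open>L2_dist_sq_triangle\<close>
  produces; sums of this kind occur throughout.
\<close>

lemma tendsto_ennreal_2add0:
  fixes f g :: "nat \<Rightarrow> ennreal"
  assumes "f \<longlonglongrightarrow> 0" "g \<longlonglongrightarrow> 0" shows "(\<lambda>n. 2 * f n + 2 * g n) \<longlonglongrightarrow> 0"
proof -
  have "(\<lambda>n. 2 * f n + 2 * g n) \<longlonglongrightarrow> 2 * 0 + 2 * 0"
    using assms by (intro tendsto_add ennreal_tendsto_cmult) auto
  then show ?thesis by simp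
qed

lemma L2_limit_unique:
  assumes m: "\<And>n. \<phi> n \<in> borel_measurable M" "f \<in> borel_measurable M" "g \<in> borel_measurable M"
    and "(\<lambda>n. L2_dist_sq M (\<phi> n) f) \<longlonglongrightarrow> 0" "(\<lambda>n. L2_dist_sq M (\<phi> n) g) \<longlonglongrightarrow> 0"
  shows "AE x in M. f x = g x"
proof -
  have "(\<lambda>n. L2_dist_sq M f g) \<longlonglongrightarrow> 0"
    by (rule tendsto_ennreal_squeeze0[OF _ tendsto_ennreal_2add0[OF assms(4,5)]])
       (use L2_dist_sq_triangle[OF m(2) m(1) m(3)] in \<open>simp add: L2_dist_sq_sym\<close>)
  then have "L2_dist_sq M f g = 0" using LIMSEQ_unique tendsto_const by blast
  then show ?thesis using L2_dist_sq_zero_AE[OF m(2,3)] by simp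
qed

lemma L2_norm_tendsto0:
  assumes "\<And>n. f n \<in> L2 M" "g \<in> L2 M" "(\<lambda>n. L2_dist_sq M (f n) g) \<longlonglongrightarrow> 0"
  shows "(\<lambda>n. L2_norm M (\<lambda>x. f n x - g x)) \<longlonglongrightarrow> 0"
proof -
  have "(\<lambda>n. ennreal ((L2_norm M (\<lambda>x. f n x - g x))\<^sup>2)) \<longlonglongrightarrow> ennreal 0"
    using assms by (simp add: L2_dist_sq_eq)
  then have "(\<lambda>n. (L2_norm M (\<lambda>x. f n x - g x))\<^sup>2) \<longlonglongrightarrow> 0"
    by (subst (asm) tendsto_ennreal_iff) auto
  then have "(\<lambda>n. sqrt ((L2_norm M (\<lambda>x. f n x - g x))\<^sup>2)) \<longlonglongrightarrow> sqrt 0" by (rule tendsto_real_sqrt)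
  then show ?thesis by simp
qed

lemma L2_inner_tendsto:
  assumes f: "\<And>n. f n \<in> L2 M" "f' \<in> L2 M" "(\<lambda>n. L2_dist_sq M (f n) f') \<longlonglongrightarrow> 0"
    and g: "\<And>n. g n \<in> L2 M" "g' \<in> L2 M" "(\<lambda>n. L2_dist_sq M (g n) g') \<longlonglongrightarrow> 0"
  shows "(\<lambda>n. L2_inner M (f n) (g n)) \<longlonglongrightarrow> L2_inner M f' g'"
proof -
  define a where "a n = L2_norm M (\<lambda>x. f n x - f' x)" for n
  define b where "b n = L2_norm M (\<lambda>x. g n x - g' x)" for n
  have ab: "a \<longlonglongrightarrow> 0" "b \<longlonglongrightarrow> 0"
    unfolding a_def b_def using L2_norm_tendsto0[OF f] L2_norm_tendsto0[OF g] by simp_all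
  have eq: "L2_inner M (f n) (g n) - L2_inner M f' g' =
     L2_inner M (\<lambda>x. f n x - f' x) (\<lambda>x. g n x - g' x) + L2_inner M (\<lambda>x. f n x - f' x) g'
     + L2_inner M f' (\<lambda>x. g n x - g' x)" for n
    unfolding L2_inner_diff_left[OF f(1) f(2) L2_diff[OF g(1) g(2)]] L2_inner_diff_left[OF f(1) f(2) g(2)]
      L2_inner_diff_right[OF g(1) g(2) f(1)] L2_inner_diff_right[OF g(1) g(2) f(2)] by simp
  have "norm (L2_inner M (f n) (g n) - L2_inner M f' g') \<le> a n * b n + a n * L2_norm M g' + L2_norm M f' * b n" for n
  proof -
    have cs: "norm (L2_inner M (\<lambda>x. f n x - f' x) (\<lambda>x. g n x - g' x)) \<le> a n * b n"
      "norm (L2_inner M (\<lambda>x. f n x - f' x) g') \<le> a n * L2_norm M g'"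
      "norm (L2_inner M f' (\<lambda>x. g n x - g' x)) \<le> L2_norm M f' * b n"
      unfolding a_def b_def
      by (rule L2_Cauchy_Schwarz[OF L2_diff[OF f(1,2)] L2_diff[OF g(1,2)]] L2_Cauchy_Schwarz[OF L2_diff[OF f(1,2)] g(2)]
        L2_Cauchy_Schwarz[OF f(2) L2_diff[OF g(1,2)]])+
    show ?thesis unfolding eq by (rule norm_triangle_le, rule add_mono, rule norm_triangle_le, rule add_mono) (rule cs)+
  qed
  moreover have "(\<lambda>n. a n * b n + a n * L2_norm M g' + L2_norm M f' * b n) \<longlonglongrightarrow> 0 * 0 + 0 * L2_norm M g' + L2_norm M f' * 0"
    by (intro tendsto_intros ab)
  ultimately have "(\<lambda>n. L2_inner M (f n) (g n) - L2_inner M f' g') \<longlonglongrightarrow> 0"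
    by (rule Lim_null_comparison[OF always_eventually[OF allI] tendsto_eq_rhs]) simp_all
  then show ?thesis by (simp add: LIM_zero_iff)
qed

text \<open>
  The usual Riesz--Fischer argument, in terms of the extended-real valued distance: traces are
  limits of a Cauchy sequence of restrictions to the boundary.
\<close>

lemma L2_complete:
  assumes f: "\<And>n. f n \<in> L2 M"
    and cauchy: "\<And>e. e > 0 \<Longrightarrow> \<exists>N. \<forall>m\<ge>N. \<forall>n\<ge>N. L2_dist_sq M (f m) (f n) \<le> ennreal e"
  shows "\<exists>g\<in>L2 M. (\<lambda>n. L2_dist_sq M (f n) g) \<longlonglongrightarrow> 0"
proof -
  note [measurable] = L2_measurable[OF f]
  have "\<exists>N. \<forall>m\<ge>N. \<forall>n\<ge>N. L2_dist_sq M (f m) (f n) \<le> ennreal ((1/4) ^ k)" for k :: nat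
    by (rule cauchy) simp
  then obtain N where N: "\<And>k m n. m \<ge> N k \<Longrightarrow> n \<ge> N k \<Longrightarrow> L2_dist_sq M (f m) (f n) \<le> ennreal ((1/4) ^ k)"
    by metis
  \<comment> \<open>Consecutive distances along \<open>f \<circ> s\<close> are at most \<open>4 ^ - k\<close>, so even after weighting the squares by \<open>2 ^ k\<close> their sum is integrable, hence finite almost everywhere.\<close>
  define s where "s k = (\<Sum>i\<le>k. N i) + k" for k
  have s: "s k \<ge> N k" "s k \<ge> k" "s k \<le> s (Suc k)" for k
    by (auto simp: s_def member_le_sum intro: trans_le_add1)
  define a where "a k x = f (s (Suc k)) x - f (s k) x" for k x
  have [measurable]: "a k \<in> borel_measurable M" for k unfolding a_def by measurable
  have "(\<integral>\<^sup>+x. (\<Sum>k. ennreal (2 ^ k) * ennreal ((norm (a k x))\<^sup>2)) \<partial>M)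
      = (\<Sum>k. ennreal (2 ^ k) * L2_dist_sq M (f (s (Suc k))) (f (s k)))"
    unfolding L2_dist_sq_def a_def by (subst nn_integral_suminf) (auto simp: nn_integral_cmult)
  also have "\<dots> \<le> (\<Sum>k. ennreal ((1/2) ^ k))"
  proof (intro suminf_le)
    fix k
    have "ennreal (2 ^ k) * L2_dist_sq M (f (s (Suc k))) (f (s k)) \<le> ennreal (2 ^ k) * ennreal ((1/4) ^ k)"
      using s[of k] by (intro mult_left_mono N) (auto intro: order.trans)
    also have "\<dots> = ennreal ((1/2) ^ k)"
      by (simp add: ennreal_mult[symmetric] power_mult_distrib[symmetric])
    finally show "ennreal (2 ^ k) * L2_dist_sq M (f (s (Suc k))) (f (s k)) \<le> ennreal ((1/2) ^ k)" .
  qed auto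
  also have "\<dots> = ennreal (\<Sum>k. (1/2) ^ k)" by (intro suminf_ennreal2) (auto intro: summable_geometric)
  also have "\<dots> < top" by simp
  finally have "AE x in M. (\<Sum>k. ennreal (2 ^ k) * ennreal ((norm (a k x))\<^sup>2)) \<noteq> \<infinity>"
    by (intro nn_integral_noteq_infinite) (auto simp: less_top)
  then have conv: "AE x in M. convergent (\<lambda>k. f (s k) x)"
  proof eventually_elim
    case (elim x)
    define S where "S = (\<Sum>k. ennreal (2 ^ k) * ennreal ((norm (a k x))\<^sup>2))"
    obtain C where C: "S = ennreal C" "C \<ge> 0" using elim by (cases S) (auto simp: S_def)
    have bound: "norm (a k x) \<le> sqrt C * (sqrt (1/2)) ^ k" for k
    proof -
      have "ennreal (2 ^ k) * ennreal ((norm (a k x))\<^sup>2) \<le> S"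
        unfolding S_def using sum_le_suminf[of "\<lambda>k. ennreal (2 ^ k) * ennreal ((norm (a k x))\<^sup>2)" "{k}"] by simp
      then have "2 ^ k * (norm (a k x))\<^sup>2 \<le> C"
        using C by (simp add: ennreal_mult[symmetric])
      then have "(norm (a k x))\<^sup>2 \<le> C * (1/2) ^ k" by (simp add: field_simps power_divide)
      then have "sqrt ((norm (a k x))\<^sup>2) \<le> sqrt (C * (1/2) ^ k)" by (rule real_sqrt_le_mono)
      then show ?thesis by (simp add: real_sqrt_mult real_sqrt_power)
    qed
    have "summable (\<lambda>k. sqrt C * (sqrt (1/2)) ^ k)"
      by (intro summable_mult summable_geometric) simp
    then have "summable (\<lambda>k. a k x)" by (rule summable_comparison_test'[where N=0]) (use bound in auto)
    then have "convergent (\<lambda>n. \<Sum>k<n. a k x)" by (simp add: summable_iff_convergent)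
    moreover have "(\<Sum>k<n. a k x) = f (s n) x - f (s 0) x" for n
      unfolding a_def by (rule sum_lessThan_telescope)
    ultimately have "convergent (\<lambda>n. f (s n) x - f (s 0) x)" by simp
    then show ?case by (simp add: convergent_diff_const_right_iff)
  qed
  define g where "g x = lim (\<lambda>k. f (s k) x)" for x
  have gm [measurable]: "g \<in> borel_measurable M" unfolding g_def by (intro borel_measurable_lim_metric) simp
  \<comment> \<open>Fatou transfers the Cauchy bound to the limit.\<close>
  have le: "L2_dist_sq M (f n) g \<le> ennreal e" if e: "\<And>m. m \<ge> K \<Longrightarrow> L2_dist_sq M (f n) (f m) \<le> ennreal e" for n K e
  proof -
    have "L2_dist_sq M (f n) g = (\<integral>\<^sup>+x. liminf (\<lambda>k. ennreal ((norm (f n x - f (s k) x))\<^sup>2)) \<partial>M)"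
      unfolding L2_dist_sq_def
    proof (rule nn_integral_cong_AE)
      show "AE x in M. ennreal ((norm (f n x - g x))\<^sup>2) = liminf (\<lambda>k. ennreal ((norm (f n x - f (s k) x))\<^sup>2))"
        using conv
      proof eventually_elim
        case (elim x)
        then have "(\<lambda>k. f (s k) x) \<longlonglongrightarrow> g x" unfolding g_def by (simp add: convergent_LIMSEQ_iff)
        then have "(\<lambda>k. ennreal ((norm (f n x - f (s k) x))\<^sup>2)) \<longlonglongrightarrow> ennreal ((norm (f n x - g x))\<^sup>2)"
          by (intro tendsto_intros)
        from lim_imp_Liminf[OF _ this] show ?case by simp
      qed
    qed
    also have "\<dots> \<le> liminf (\<lambda>k. \<integral>\<^sup>+x. ennreal ((norm (f n x - f (s k) x))\<^sup>2) \<partial>M)"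
      by (rule nn_integral_liminf) measurable
    also have "\<dots> \<le> ennreal e"
    proof (rule Liminf_le)
      have "L2_dist_sq M (f n) (f (s k)) \<le> ennreal e" if "k \<ge> K" for k
        using e s(2)[of k] that by auto
      then show "\<forall>\<^sub>F k in sequentially. (\<integral>\<^sup>+x. ennreal ((norm (f n x - f (s k) x))\<^sup>2) \<partial>M) \<le> ennreal e"
        unfolding eventually_sequentially L2_dist_sq_def by blast
    qed simp
    finally show ?thesis .
  qed
  have lim: "(\<lambda>n. L2_dist_sq M (f n) g) \<longlonglongrightarrow> 0"
  proof (rule order_tendstoI)
    fix a :: ennreal assume "0 < a"
    then obtain b where b: "0 < b" "b < a" using dense by blast
    then obtain e where "b = ennreal e" "0 \<le> e" by (cases b) auto
    with b have e: "0 < e" "ennreal e < a" by auto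
    obtain K where K: "\<And>m n. m \<ge> K \<Longrightarrow> n \<ge> K \<Longrightarrow> L2_dist_sq M (f m) (f n) \<le> ennreal e" using cauchy[OF e(1)] by blast
    have "L2_dist_sq M (f n) g < a" if "n \<ge> K" for n
      using le[of K n e] K[OF that] e(2) by (auto intro: order.strict_trans1)
    then show "\<forall>\<^sub>F n in sequentially. L2_dist_sq M (f n) g < a" unfolding eventually_sequentially by blast
  qed simp
  obtain K where K: "\<And>m n. m \<ge> K \<Longrightarrow> n \<ge> K \<Longrightarrow> L2_dist_sq M (f m) (f n) \<le> ennreal 1"
    using cauchy[of 1] by auto
  have "L2_dist_sq M (f K) g \<le> ennreal 1" by (rule le[of K]) (use K in auto)
  then have "(\<lambda>x. f K x - g x) \<in> L2 M"
    unfolding L2_iff_nn L2_dist_sq_def by (auto intro: order.strict_trans1)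
  then have "(\<lambda>x. f K x - (f K x - g x)) \<in> L2 M" by (rule L2_diff[OF f])
  then have "g \<in> L2 M" by simp
  with lim show ?thesis by blast
qed

section \<open>Smooth functions\<close>

abbreviation smooth :: "('a::euclidean_space \<Rightarrow> complex) \<Rightarrow> bool" where
  "smooth f \<equiv> \<forall>k. C_k k f"

lemma partial_derivI: "(f has_derivative f') (at x) \<Longrightarrow> partial_deriv b f x = f' b"
  unfolding partial_deriv_def by (simp add: frechet_derivative_at[symmetric])

text \<open>
  \<open>C_k\<close> recurses through all iterated partial derivatives, which makes direct inductions awkward.
  A class of differentiable functions that is closed under partial derivatives consists of
  smooth functions; all concrete smoothness proofs exhibit such a class.
\<close>

lemma C_k_family:
  assumes Q: "\<And>f x. f \<in> Q \<Longrightarrow> f differentiable (at x)"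
    and Q': "\<And>f b. f \<in> Q \<Longrightarrow> b \<in> Basis \<Longrightarrow> partial_deriv b f \<in> Q" and f: "f \<in> Q"
  shows "C_k k f"
  using f
proof (induction k arbitrary: f)
  case 0
  then show ?case using Q by (auto intro!: differentiable_imp_continuous_on simp: differentiable_on_def differentiable_at_withinI)
next
  case (Suc k)
  then show ?case using Q Q' by auto
qed

lemma C_k_Suc_imp: "C_k (Suc k) f \<Longrightarrow> C_k k f"
proof (induction k arbitrary: f)
  case 0
  then show ?case
    by (auto intro!: differentiable_imp_continuous_on simp: differentiable_on_def differentiable_at_withinI)
next
  case (Suc k)
  from Suc.prems have "\<forall>x. f differentiable (at x)" "\<forall>b\<in>Basis. C_k (Suc k) (partial_deriv b f)" by auto
  with Suc.IH show ?case by auto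
qed

lemma smooth_differentiable: "smooth f \<Longrightarrow> f differentiable (at x)"
  using C_k.simps(2) by blast

lemma smooth_partial: "smooth f \<Longrightarrow> b \<in> Basis \<Longrightarrow> smooth (partial_deriv b f)"
  using C_k.simps(2) by blast

lemma smooth_continuous: "smooth f \<Longrightarrow> continuous_on A f"
  using C_k.simps(1) continuous_on_subset by blast

lemma smooth_borel: "smooth f \<Longrightarrow> f \<in> borel_measurable borel"
  by (intro borel_measurable_continuous_onI smooth_continuous)

lemma smooth_has_derivative:
  "smooth f \<Longrightarrow> (f has_derivative (\<lambda>h. \<Sum>b\<in>Basis. (h \<bullet> b) *\<^sub>R partial_deriv b f x)) (at x)"
proof -
  assume "smooth f"
  then have d: "(f has_derivative frechet_derivative f (at x)) (at x)"
    using smooth_differentiable frechet_derivative_works by blast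
  then have l: "linear (frechet_derivative f (at x))" by (rule has_derivative_linear)
  have "frechet_derivative f (at x) h = (\<Sum>b\<in>Basis. (h \<bullet> b) *\<^sub>R partial_deriv b f x)" for h
  proof -
    have "frechet_derivative f (at x) h = frechet_derivative f (at x) (\<Sum>b\<in>Basis. (h \<bullet> b) *\<^sub>R b)"
      by (simp add: euclidean_representation)
    also have "\<dots> = (\<Sum>b\<in>Basis. (h \<bullet> b) *\<^sub>R frechet_derivative f (at x) b)"
      using l by (simp add: linear_sum linear_scale)
    finally show ?thesis by (simp add: partial_deriv_def)
  qed
  then have "frechet_derivative f (at x) = (\<lambda>h. \<Sum>b\<in>Basis. (h \<bullet> b) *\<^sub>R partial_deriv b f x)" by blast
  with d show ?thesis by simp
qed

lemma partial_deriv_add: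
  assumes "f differentiable (at x)" "g differentiable (at x)"
  shows "partial_deriv b (\<lambda>x. f x + g x) x = partial_deriv b f x + partial_deriv b g x"
proof -
  have "((\<lambda>x. f x + g x) has_derivative (\<lambda>h. frechet_derivative f (at x) h + frechet_derivative g (at x) h)) (at x)"
    using assms frechet_derivative_works by (intro has_derivative_add) auto
  from partial_derivI[OF this, of b] show ?thesis by (simp only: partial_deriv_def)
qed

lemma partial_deriv_mult:
  assumes "f differentiable (at x)" "g differentiable (at x)"
  shows "partial_deriv b (\<lambda>x. f x * g x) x = f x * partial_deriv b g x + partial_deriv b f x * g x"
proof -
  have "((\<lambda>x. f x * g x) has_derivative (\<lambda>h. f x * frechet_derivative g (at x) h + frechet_derivative f (at x) h * g x)) (at x)"
    using assms frechet_derivative_works by (intro has_derivative_mult) auto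
  from partial_derivI[OF this, of b] show ?thesis by (simp only: partial_deriv_def)
qed

lemma C_k_const: "C_k k (\<lambda>_. c)"
proof (rule C_k_family[where Q="{f. \<exists>c. f = (\<lambda>_. c)}"])
  fix f :: "'a \<Rightarrow> complex" and b :: 'a assume "f \<in> {f. \<exists>c. f = (\<lambda>_. c)}"
  then obtain c where c: "f = (\<lambda>_. c)" by blast
  have "partial_deriv b f = (\<lambda>_. 0)" unfolding c using partial_derivI[OF has_derivative_const] by blast
  then show "partial_deriv b f \<in> {f. \<exists>c. f = (\<lambda>_. c)}" by blast
qed auto

lemma C_k_add: "C_k k f \<Longrightarrow> C_k k g \<Longrightarrow> C_k k (\<lambda>x. f x + g x)"
proof (induction k arbitrary: f g)
  case 0 then show ?case by (auto intro: continuous_on_add)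
next
  case (Suc k)
  have "partial_deriv b (\<lambda>x. f x + g x) = (\<lambda>x. partial_deriv b f x + partial_deriv b g x)" for b
    using Suc.prems by (auto intro!: partial_deriv_add)
  then show ?case using Suc by auto
qed

lemma C_k_mult: "C_k k f \<Longrightarrow> C_k k g \<Longrightarrow> C_k k (\<lambda>x. f x * g x)"
proof (induction k arbitrary: f g)
  case 0 then show ?case by (auto intro: continuous_on_mult)
next
  case (Suc k)
  have "partial_deriv b (\<lambda>x. f x * g x) = (\<lambda>x. f x * partial_deriv b g x + partial_deriv b f x * g x)" for b
    using Suc.prems by (auto intro!: partial_deriv_mult)
  moreover have "C_k k f" "C_k k g" using Suc.prems C_k_Suc_imp by blast+
  ultimately show ?case using Suc by (auto intro!: C_k_add)
qed

lemma C_k_sum: "(\<And>i. i \<in> I \<Longrightarrow> C_k k (f i)) \<Longrightarrow> C_k k (\<lambda>x. \<Sum>i\<in>I. f i x)"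
  by (induction I rule: infinite_finite_induct) (auto intro: C_k_add C_k_const)

lemma C_k_cmult: "C_k k f \<Longrightarrow> C_k k (\<lambda>x. c * f x)"
  by (intro C_k_mult C_k_const)

lemma partial_deriv_cnj:
  assumes "f differentiable (at x)" 
  shows "partial_deriv b (\<lambda>x. cnj (f x)) x = cnj (partial_deriv b f x)"
proof -
  have "((\<lambda>x. cnj (f x)) has_derivative (\<lambda>h. cnj (frechet_derivative f (at x) h))) (at x)"
    using assms frechet_derivative_works by (intro has_derivative_cnj) auto
  from partial_derivI[OF this, of b] show ?thesis by (simp only: partial_deriv_def)
qed

lemma C_k_cnj: "C_k k f \<Longrightarrow> C_k k (\<lambda>x. cnj (f x))"
proof (induction k arbitrary: f)
  case 0 then show ?case by (auto intro: continuous_on_cnj)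
next
  case (Suc k)
  have "partial_deriv b (\<lambda>x. cnj (f x)) = (\<lambda>x. cnj (partial_deriv b f x))" for b
    using Suc.prems by (auto intro!: partial_deriv_cnj)
  moreover have "(\<lambda>x. cnj (f x)) differentiable (at x)" for x
    using Suc.prems has_derivative_cnj unfolding C_k.simps differentiable_def by blast
  ultimately show ?case using Suc by auto
qed

text \<open>
  \<open>F i\<close> is the \<open>i\<close>-th derivative of a function of one variable. Its multiples, composed with an
  affine functional, form a class closed under partial derivatives.
\<close>

lemma smooth_of_real_chain:
  fixes F :: "nat \<Rightarrow> real \<Rightarrow> real" and v :: "'a::euclidean_space"
  assumes F: "\<And>i t. (F i has_real_derivative F (Suc i) t) (at t)"
  shows "smooth (\<lambda>z. complex_of_real (F i (z \<bullet> v + d)))"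
proof
  fix k
  let ?Q = "{f. \<exists>c i. f = (\<lambda>z. complex_of_real (c * F i (z \<bullet> v + d)))}"
  have D: "((\<lambda>z. complex_of_real (c * F i (z \<bullet> v + d))) has_derivative
      (\<lambda>h. complex_of_real (c * ((h \<bullet> v) * F (Suc i) (z \<bullet> v + d))))) (at z)" for c i z
  proof -
    have "((\<lambda>z. F i (z \<bullet> v + d)) has_derivative (\<lambda>h. (h \<bullet> v) * F (Suc i) (z \<bullet> v + d))) (at z)"
      by (rule has_derivative_eq_rhs[OF DERIV_compose_FDERIV[OF F]])
         (auto intro!: derivative_eq_intros simp: algebra_simps)
    then show ?thesis
      by (intro has_derivative_of_real has_derivative_mult_right)
  qed
  show "C_k k (\<lambda>z. complex_of_real (F i (z \<bullet> v + d)))"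
  proof (rule C_k_family[where Q="?Q"])
    show "f differentiable (at x)" if "f \<in> ?Q" for f x using that D unfolding differentiable_def by blast
    show "partial_deriv b f \<in> ?Q" if "f \<in> ?Q" for f b
    proof -
      from that obtain c i where f: "f = (\<lambda>z. complex_of_real (c * F i (z \<bullet> v + d)))" by blast
      have "partial_deriv b f = (\<lambda>z. complex_of_real ((c * (b \<bullet> v)) * F (Suc i) (z \<bullet> v + d)))"
        unfolding f using partial_derivI[OF D] by (simp add: fun_eq_iff mult.assoc)
      then show ?thesis by blast
    qed
    show "(\<lambda>z. complex_of_real (F i (z \<bullet> v + d))) \<in> ?Q" by (rule CollectI) (metis mult_1)
  qed
qed

text \<open>
  The derivatives of the standard flat function \<open>exp (- 1 / t)\<close> on \<open>t > 0\<close> are of the form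
  \<open>p (1 / t) exp (- 1 / t)\<close> with polynomials \<open>p\<close>; keeping \<open>p\<close> as a parameter gives a class
  closed under differentiation.
\<close>

definition flat_poly :: "real poly \<Rightarrow> real \<Rightarrow> real" where
  "flat_poly p t = (if t > 0 then poly p (1 / t) * exp (- (1 / t)) else 0)"

lemma flat_poly_limit: "((\<lambda>t. poly (p :: real poly) (1 / t) * exp (- (1 / t))) \<longlongrightarrow> 0) (at_right 0)"
proof -
  have mono: "((\<lambda>s::real. s ^ n * exp (- s)) \<longlongrightarrow> 0) at_top" for n
    using tendsto_power_div_exp_0[of n] by (simp add: exp_minus field_simps)
  have "((\<lambda>s. \<Sum>i\<le>degree p. coeff p i * (s ^ i * exp (- s))) \<longlongrightarrow> (\<Sum>i\<le>degree p. coeff p i * 0)) at_top"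
    by (intro tendsto_sum tendsto_mult tendsto_const mono)
  then have "((\<lambda>s. poly p s * exp (- s)) \<longlongrightarrow> 0) at_top"
    by (simp add: poly_altdef sum_distrib_right mult.assoc)
  then show ?thesis
    using filterlim_compose[OF _ filterlim_inverse_at_top_right] by (fastforce simp: inverse_eq_divide)
qed

text \<open>
  With \<open>r = 1 / t\<close> one has \<open>dr/dt = - r\<^sup>2\<close>, so \<open>p(r) e\<^sup>-\<^sup>r\<close> has the derivative \<open>r\<^sup>2 (p(r) - p'(r)) e\<^sup>-\<^sup>r\<close>.
\<close>

lemma flat_poly_deriv:
  "(flat_poly p has_real_derivative flat_poly ([:0, 0, 1:] * (p - pderiv p)) t) (at t)"
proof -
  let ?q = "[:0, 0, 1:] * (p - pderiv p)"
  consider "t > 0" | "t < 0" | "t = 0" by linarith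
  then show ?thesis
  proof cases
    case 1
    have "((\<lambda>t. poly p (1 / t) * exp (- (1 / t))) has_real_derivative flat_poly ?q t) (at t)"
      using 1 by (auto intro!: derivative_eq_intros poly_DERIV[THEN DERIV_chain2] simp: flat_poly_def field_simps power2_eq_square)
    then show ?thesis
      by (rule DERIV_cong_ev[THEN iffD1, rotated 3])
         (auto simp: flat_poly_def eventually_nhds intro!: exI[of _ "{0<..}"] 1)
  next
    case 2
    have "((\<lambda>t. 0) has_real_derivative flat_poly ?q t) (at t)"
      using 2 by (simp add: flat_poly_def)
    then show ?thesis
      by (rule DERIV_cong_ev[THEN iffD1, rotated 3])
         (auto simp: flat_poly_def eventually_nhds intro!: exI[of _ "{..<0}"] 2)
  next
    case 3
    have R: "((\<lambda>h. (flat_poly p (0 + h) - flat_poly p 0) / h) \<longlongrightarrow> 0) (at_right 0)"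
    proof (rule Lim_transform_eventually)
      show "((\<lambda>t. poly ([:0, 1:] * p) (1 / t) * exp (- (1 / t))) \<longlongrightarrow> 0) (at_right 0)" by (rule flat_poly_limit)
      show "\<forall>\<^sub>F t in at_right 0. poly ([:0, 1:] * p) (1 / t) * exp (- (1 / t)) = (flat_poly p (0 + t) - flat_poly p 0) / t"
        using eventually_at_right_less[of 0] by eventually_elim (simp add: flat_poly_def)
    qed
    have L: "((\<lambda>h. (flat_poly p (0 + h) - flat_poly p 0) / h) \<longlongrightarrow> 0) (at_left 0)"
    proof (rule Lim_transform_eventually)
      show "\<forall>\<^sub>F t in at_left 0. 0 = (flat_poly p (0 + t) - flat_poly p 0) / t"
        unfolding eventually_at_filter by (auto simp: flat_poly_def)
    qed simp
    have "((\<lambda>h. (flat_poly p (0 + h) - flat_poly p 0) / h) \<longlongrightarrow> 0) (at 0)"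
      using L R by (simp add: filterlim_split_at)
    then show ?thesis unfolding DERIV_def 3 by (simp add: flat_poly_def)
  qed
qed

text \<open>
  A nonnegative smooth function that is positive exactly inside the box \<open>(a, b) \<times> (c, d)\<close>.
\<close>

definition box_bump :: "real \<Rightarrow> real \<Rightarrow> real \<Rightarrow> real \<Rightarrow> real \<times> real \<Rightarrow> complex" where
  "box_bump a b c d z = complex_of_real (flat_poly 1 (fst z - a) * flat_poly 1 (b - fst z) *
      (flat_poly 1 (snd z - c) * flat_poly 1 (d - snd z)))"

lemma flat_smooth: "smooth (\<lambda>z. complex_of_real (flat_poly p (z \<bullet> v + d)))"
proof -
  define F where "F i = flat_poly (((\<lambda>p. [:0, 0, 1:] * (p - pderiv p)) ^^ i) p)" for i
  have "(F i has_real_derivative F (Suc i) t) (at t)" for i t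
    unfolding F_def funpow.simps o_def by (rule flat_poly_deriv)
  from smooth_of_real_chain[of F, OF this, of 0 v d] show ?thesis by (simp add: F_def)
qed

lemma smooth_box_bump: "smooth (box_bump a b c d)"
proof
  fix k
  have "C_k k (\<lambda>z::real \<times> real. complex_of_real (flat_poly 1 (z \<bullet> (1, 0) + (- a))) * complex_of_real (flat_poly 1 (z \<bullet> (-1, 0) + b)) *
    (complex_of_real (flat_poly 1 (z \<bullet> (0, 1) + (- c))) * complex_of_real (flat_poly 1 (z \<bullet> (0, -1) + d))))"
    by (intro C_k_mult flat_smooth[rule_format])
  then show "C_k k (box_bump a b c d)"
    unfolding box_bump_def[abs_def] by (simp add: inner_prod_def inner_real_def algebra_simps)
qed

lemma flat_poly_pos: "flat_poly 1 t \<ge> 0" "t > 0 \<Longrightarrow> flat_poly 1 t > 0" "t \<le> 0 \<Longrightarrow> flat_poly 1 t = 0"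
  by (auto simp: flat_poly_def)

lemma box_bump_support: "z \<notin> {a..b} \<times> {c..d} \<Longrightarrow> box_bump a b c d z = 0"
  by (cases z) (auto simp: box_bump_def flat_poly_def)

lemma box_bump_nonneg: "box_bump a b c d z = complex_of_real (norm (box_bump a b c d z))"
  by (simp add: box_bump_def flat_poly_pos norm_of_real del: of_real_mult)

lemma box_bump_pos: "a < fst z \<Longrightarrow> fst z < b \<Longrightarrow> c < snd z \<Longrightarrow> snd z < d \<Longrightarrow> box_bump a b c d z \<noteq> 0"
  by (auto simp: box_bump_def flat_poly_def)

lemma smooth_affine:
  fixes f :: "'a::euclidean_space \<Rightarrow> complex"
  assumes "smooth f"
  shows "smooth (\<lambda>z. f (a *\<^sub>R z + w))"
    and "b \<in> Basis \<Longrightarrow> partial_deriv b (\<lambda>z. f (a *\<^sub>R z + w)) = (\<lambda>z. complex_of_real a * partial_deriv b f (a *\<^sub>R z + w))"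
proof -
  let ?Q = "{g. \<exists>c f. smooth f \<and> g = (\<lambda>z. c * f (a *\<^sub>R z + w))}"
  have D: "((\<lambda>z. f (a *\<^sub>R z + w)) has_derivative (\<lambda>h. frechet_derivative f (at (a *\<^sub>R z + w)) (a *\<^sub>R h))) (at z)"
    if "smooth f" for f :: "'a \<Rightarrow> complex" and z
  proof -
    have "((\<lambda>z. a *\<^sub>R z + w) has_derivative (\<lambda>h. a *\<^sub>R h)) (at z)" by (auto intro!: derivative_eq_intros)
    moreover have "(f has_derivative frechet_derivative f (at (a *\<^sub>R z + w))) (at (a *\<^sub>R z + w))"
      using smooth_differentiable[OF that] frechet_derivative_works by blast
    ultimately show ?thesis using diff_chain_at[of "\<lambda>z. a *\<^sub>R z + w"] by (simp add: o_def)
  qed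
  have P: "partial_deriv b (\<lambda>z. f (a *\<^sub>R z + w)) z = complex_of_real a * partial_deriv b f (a *\<^sub>R z + w)"
    if "smooth f" for f :: "'a \<Rightarrow> complex" and z b
  proof -
    have "linear (frechet_derivative f (at (a *\<^sub>R z + w)))"
      by (rule linear_frechet_derivative[OF smooth_differentiable[OF that]])
    then show ?thesis using partial_derivI[OF D[OF that]]
      by (simp add: partial_deriv_def linear_scale scaleR_conv_of_real)
  qed
  show "partial_deriv b (\<lambda>z. f (a *\<^sub>R z + w)) = (\<lambda>z. complex_of_real a * partial_deriv b f (a *\<^sub>R z + w))"
    using P[OF assms] by blast
  show "smooth (\<lambda>z. f (a *\<^sub>R z + w))"
  proof
    fix k
    show "C_k k (\<lambda>z. f (a *\<^sub>R z + w))"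
    proof (rule C_k_family[where Q="?Q"])
      show "g differentiable (at x)" if "g \<in> ?Q" for g x
      proof -
        from that obtain c f where f: "smooth f" "g = (\<lambda>z. c * f (a *\<^sub>R z + w))" by blast
        have "(\<lambda>z. f (a *\<^sub>R z + w)) differentiable (at x)" using D[OF f(1)] differentiable_def by blast
        then show ?thesis unfolding f(2) by (intro differentiable_mult differentiable_const)
      qed
      show "partial_deriv b g \<in> ?Q" if "g \<in> ?Q" "b \<in> Basis" for g b
      proof -
        from that obtain c f where f: "smooth f" "g = (\<lambda>z. c * f (a *\<^sub>R z + w))" by blast
        have "partial_deriv b g = (\<lambda>z. (c * complex_of_real a) * partial_deriv b f (a *\<^sub>R z + w))"
        proof
          fix z
          have d: "(\<lambda>z. f (a *\<^sub>R z + w)) differentiable (at z)" using D[OF f(1)] differentiable_def by blast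
          have c0: "partial_deriv b (\<lambda>_::'a. c) z = 0" by (rule partial_derivI[OF has_derivative_const])
          from c0 partial_deriv_mult[OF differentiable_const[of c] d, where b=b]
          show "partial_deriv b g z = (c * complex_of_real a) * partial_deriv b f (a *\<^sub>R z + w)"
            by (simp add: f(2) P[OF f(1)])
        qed
        then show ?thesis using smooth_partial[OF f(1) that(2)] by blast
      qed
      show "(\<lambda>z. f (a *\<^sub>R z + w)) \<in> ?Q" using assms by (intro CollectI exI[of _ 1] exI[of _ f]) auto
    qed
  qed
qed

section \<open>Hausdorff measure on lines\<close>

lemma hausdorff1_pre_antimono: "d \<le> e \<Longrightarrow> hausdorff1_pre e A \<le> hausdorff1_pre d A"
  unfolding hausdorff1_pre_def by (rule INF_superset_mono) (auto intro: order.trans)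

lemma hausdorff1_pre_mono: "A \<subseteq> B \<Longrightarrow> hausdorff1_pre e A \<le> hausdorff1_pre e B"
  unfolding hausdorff1_pre_def by (rule INF_superset_mono) force+

lemma hausdorff1_outer_mono: "A \<subseteq> B \<Longrightarrow> hausdorff1_outer A \<le> hausdorff1_outer B"
  unfolding hausdorff1_outer_def by (intro SUP_mono) (use hausdorff1_pre_mono in blast)

lemma hausdorff1_outer_empty [simp]: "hausdorff1_outer {} = 0"
proof -
  have "hausdorff1_pre d ({}::'a set) \<le> 0" if "d > 0" for d
    unfolding hausdorff1_pre_def
    by (rule INF_lower2[where i="\<lambda>_. {}"]) (use that in auto)
  then show ?thesis
    unfolding hausdorff1_outer_def by (auto intro!: antisym SUP_least)
qed

lemma hausdorff1_pre_le_outer: "d > 0 \<Longrightarrow> hausdorff1_pre d A \<le> hausdorff1_outer A"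
  unfolding hausdorff1_outer_def by (rule SUP_upper) simp

lemma hausdorff1_outer_seq: "hausdorff1_outer A = (SUP n. hausdorff1_pre (1 / real (Suc n)) A)"
  unfolding hausdorff1_outer_def
proof (intro antisym SUP_mono)
  fix d :: real assume "d \<in> {0<..}"
  then obtain n where "1 / real (Suc n) < d" using nat_approx_posE by (metis greaterThan_iff)
  then have "hausdorff1_pre d A \<le> hausdorff1_pre (1 / real (Suc n)) A"
    by (intro hausdorff1_pre_antimono) simp
  then show "\<exists>n\<in>UNIV. hausdorff1_pre d A \<le> hausdorff1_pre (1 / real (Suc n)) A" by blast
next
  fix n :: nat
  show "\<exists>d\<in>{0<..}. hausdorff1_pre (1 / real (Suc n)) A \<le> hausdorff1_pre d A"
    by (intro bexI[of _ "1 / real (Suc n)"]) auto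
qed

lemma hausdorff1_pre_UN_le:
  fixes A :: "nat \<Rightarrow> 'a::metric_space set"
  shows "hausdorff1_pre d (\<Union>i. A i) \<le> (\<Sum>i. hausdorff1_pre d (A i))"
proof (rule ennreal_le_epsilon)
  fix e :: real assume fin: "(\<Sum>i. hausdorff1_pre d (A i)) < top" and e: "0 < e"
  have pos: "0 < e * (1/2) ^ Suc i" for i using e by simp
  have "\<exists>C. A i \<subseteq> (\<Union>j. C j) \<and> (\<forall>j. bounded (C j) \<and> diameter (C j) \<le> d) \<and>
        (\<Sum>j. ennreal (diameter (C j))) \<le> hausdorff1_pre d (A i) + ennreal (e * (1/2) ^ Suc i)" for i
  proof -
    have "hausdorff1_pre d (A i) < top"
      using fin ennreal_suminf_lessD by blast
    then have "hausdorff1_pre d (A i) < hausdorff1_pre d (A i) + ennreal (e * (1/2) ^ Suc i)"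
      using pos[of i] by (simp add: ennreal_zero_less_divide less_top)
    then show ?thesis
      unfolding hausdorff1_pre_def INF_less_iff by (auto intro!: less_imp_le)
  qed
  then obtain C where C: "\<And>i. A i \<subseteq> (\<Union>j. C i j)" "\<And>i j. bounded (C i j)" "\<And>i j. diameter (C i j) \<le> d"
    "\<And>i. (\<Sum>j. ennreal (diameter (C i j))) \<le> hausdorff1_pre d (A i) + ennreal (e * (1/2) ^ Suc i)"
    by metis
  define K where "K = (\<lambda>n. case prod_decode n of (i, j) \<Rightarrow> C i j)"
  have cov: "(\<Union>i. A i) \<subseteq> (\<Union>n. K n)"
  proof
    fix x assume "x \<in> (\<Union>i. A i)"
    then obtain i j where "x \<in> C i j" using C(1) by blast
    then have "x \<in> K (prod_encode (i, j))" by (simp add: K_def)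
    then show "x \<in> (\<Union>n. K n)" by blast
  qed
  have "hausdorff1_pre d (\<Union>i. A i) \<le> (\<Sum>n. ennreal (diameter (K n)))"
    unfolding hausdorff1_pre_def using cov C
    by (intro INF_lower) (auto simp: K_def split: prod.splits)
  also have "\<dots> = (\<Sum>i. \<Sum>j. ennreal (diameter (C i j)))"
    using suminf_ennreal_2dimen[where f="\<lambda>(i,j). ennreal (diameter (C i j))", OF refl]
    by (simp add: K_def o_def case_prod_beta)
  also have "\<dots> \<le> (\<Sum>i. hausdorff1_pre d (A i) + ennreal (e * (1/2) ^ Suc i))"
    by (intro suminf_le C(4)) auto
  also have "\<dots> = (\<Sum>i. hausdorff1_pre d (A i)) + (\<Sum>i. ennreal (e * (1/2) ^ Suc i))"
    by (rule suminf_add[symmetric]) auto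
  also have "(\<Sum>i. ennreal (e * (1/2) ^ Suc i)) = ennreal (\<Sum>i. e * (1/2) ^ Suc i)"
    using e by (intro suminf_ennreal2) (auto intro!: summable_mult summable_geometric simp: summable_Suc_iff)
  also have "(\<Sum>i. e * (1/2) ^ Suc i) = e"
    using power_half_series sums_mult[of "\<lambda>n. (1/2::real) ^ Suc n" 1 e] by (simp add: sums_iff)
  finally show "hausdorff1_pre d (\<Union>i. A i) \<le> (\<Sum>i. hausdorff1_pre d (A i)) + ennreal e" .
qed

lemma hausdorff1_outer_UN_le:
  fixes A :: "nat \<Rightarrow> 'a::metric_space set"
  shows "hausdorff1_outer (\<Union>i. A i) \<le> (\<Sum>i. hausdorff1_outer (A i))"
  unfolding hausdorff1_outer_def[of "\<Union>i. A i"]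
proof (rule SUP_least)
  fix d :: real assume "d \<in> {0<..}"
  then show "hausdorff1_pre d (\<Union>i. A i) \<le> (\<Sum>i. hausdorff1_outer (A i))"
    by (intro order.trans[OF hausdorff1_pre_UN_le] suminf_le hausdorff1_pre_le_outer) auto
qed

lemma hausdorff1_outer_space: "outer_measure_space (Pow UNIV) (hausdorff1_outer :: 'a::metric_space set \<Rightarrow> ennreal)"
  unfolding outer_measure_space_def positive_def increasing_def countably_subadditive_def
  using hausdorff1_outer_UN_le hausdorff1_outer_mono by auto

lemma hausdorff1_outer_Un_le: "hausdorff1_outer (A \<union> B) \<le> hausdorff1_outer A + hausdorff1_outer B"
proof -
  have "subadditive (Pow UNIV) (hausdorff1_outer :: 'a set \<Rightarrow> ennreal)"
    using hausdorff1_outer_space sigma_algebra.axioms(1)[OF sigma_algebra_Pow, THEN algebra.axioms(1)]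
    unfolding outer_measure_space_def by (blast intro: ring_of_sets.countably_subadditive_subadditive)
  then have disj: "hausdorff1_outer (X \<union> Y) \<le> hausdorff1_outer X + hausdorff1_outer Y"
    if "X \<inter> Y = {}" for X Y :: "'a set"
    using that by (auto simp: subadditive_def)
  have "hausdorff1_outer (A \<union> (B - A)) \<le> hausdorff1_outer A + hausdorff1_outer (B - A)"
    by (rule disj) auto
  also have "\<dots> \<le> hausdorff1_outer A + hausdorff1_outer B"
    by (intro add_mono hausdorff1_outer_mono) auto
  finally show ?thesis by simp
qed

text \<open>
  Covers by sets of diameter less than \<open>d\<close> split into a cover of \<open>A\<close> and one of \<open>B\<close>.
\<close>

lemma hausdorff1_outer_separated:
  assumes d: "d > 0" and sep: "\<And>x y. x \<in> A \<Longrightarrow> y \<in> B \<Longrightarrow> d \<le> dist x y"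
  shows "hausdorff1_outer A + hausdorff1_outer B \<le> hausdorff1_outer (A \<union> B)"
proof -
  have pre: "hausdorff1_pre e A + hausdorff1_pre e B \<le> hausdorff1_pre e (A \<union> B)" if e: "e < d" for e
    unfolding hausdorff1_pre_def[of e "A \<union> B"]
  proof (rule INF_greatest)
    fix C :: "nat \<Rightarrow> 'a set"
    assume "C \<in> {C. A \<union> B \<subseteq> (\<Union>i. C i) \<and> (\<forall>i. bounded (C i) \<and> diameter (C i) \<le> e)}"
    then have C: "A \<union> B \<subseteq> (\<Union>i. C i)" "\<And>i. bounded (C i)" "\<And>i. diameter (C i) \<le> e" by auto
    have sub: "diameter (C i \<inter> X) \<le> diameter (C i)" for i X
      by (intro diameter_subset C) auto
    have le: "hausdorff1_pre e X \<le> (\<Sum>i. ennreal (diameter (C i \<inter> X)))" if "X \<subseteq> A \<union> B" for X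
      unfolding hausdorff1_pre_def using C that sub
      by (intro INF_lower) (auto intro: bounded_Int order.trans[OF sub])
    have "hausdorff1_pre e A + hausdorff1_pre e B
        \<le> (\<Sum>i. ennreal (diameter (C i \<inter> A))) + (\<Sum>i. ennreal (diameter (C i \<inter> B)))"
      by (intro add_mono le) auto
    also have "\<dots> = (\<Sum>i. ennreal (diameter (C i \<inter> A)) + ennreal (diameter (C i \<inter> B)))"
      by (rule suminf_add) auto
    also have "\<dots> \<le> (\<Sum>i. ennreal (diameter (C i)))"
    proof (intro suminf_le)
      fix i
      have "C i \<inter> A = {} \<or> C i \<inter> B = {}"
      proof (rule ccontr)
        assume "\<not> ?thesis"
        then obtain x y where xy: "x \<in> C i" "x \<in> A" "y \<in> C i" "y \<in> B" by blast
        have "dist x y \<le> diameter (C i)" by (rule diameter_bounded_bound[OF C(2) xy(1,3)])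
        with sep[OF xy(2,4)] C(3)[of i] e show False by linarith
      qed
      then show "ennreal (diameter (C i \<inter> A)) + ennreal (diameter (C i \<inter> B)) \<le> ennreal (diameter (C i))"
        using sub[of i A] sub[of i B] by (auto intro: ennreal_leI)
    qed auto
    finally show "hausdorff1_pre e A + hausdorff1_pre e B \<le> (\<Sum>i. ennreal (diameter (C i)))" .
  qed
  have inc: "incseq (\<lambda>n. hausdorff1_pre (1 / real (Suc n)) X)" for X :: "'a set"
    by (intro incseq_SucI hausdorff1_pre_antimono) (simp add: frac_le)
  obtain N where N: "1 / real (Suc N) < d" using d nat_approx_posE by blast
  have "hausdorff1_outer A + hausdorff1_outer B
      = (SUP n. hausdorff1_pre (1 / real (Suc n)) A + hausdorff1_pre (1 / real (Suc n)) B)"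
    unfolding hausdorff1_outer_seq by (rule ennreal_SUP_add[symmetric]) (rule inc)+
  also have "\<dots> \<le> hausdorff1_outer (A \<union> B)"
  proof (rule SUP_least)
    fix n
    define m where "m = max n N"
    have m: "1 / real (Suc m) < d" "1 / real (Suc m) \<le> 1 / real (Suc n)"
      using N by (auto simp: m_def max_def frac_le intro: order.strict_trans1[rotated])
    have "hausdorff1_pre (1 / real (Suc n)) A + hausdorff1_pre (1 / real (Suc n)) B
       \<le> hausdorff1_pre (1 / real (Suc m)) A + hausdorff1_pre (1 / real (Suc m)) B"
      by (intro add_mono hausdorff1_pre_antimono m)
    also have "\<dots> \<le> hausdorff1_pre (1 / real (Suc m)) (A \<union> B)" by (rule pre[OF m(1)])
    also have "\<dots> \<le> hausdorff1_outer (A \<union> B)" by (rule hausdorff1_pre_le_outer) simp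
    finally show "hausdorff1_pre (1 / real (Suc n)) A + hausdorff1_pre (1 / real (Suc n)) B
       \<le> hausdorff1_outer (A \<union> B)" .
  qed
  finally show ?thesis .
qed

text \<open>
  Caratheodory's criterion: a metric outer measure is additive on closed sets. Exhaust \<open>A - F\<close> by
  the sets \<open>D n\<close> of points at distance at least \<open>1/(n+1)\<close> from \<open>F\<close>; they are separated from \<open>F\<close>,
  and it remains to see that the measure of \<open>A - F - D n\<close> tends to zero.
\<close>

lemma hausdorff1_outer_closed_le:
  fixes F :: "'a::metric_space set"
  assumes F: "closed F"
  shows "hausdorff1_outer (A \<inter> F) + hausdorff1_outer (A - F) \<le> hausdorff1_outer A"
proof (cases "F = {} \<or> hausdorff1_outer A = top")
  case True then show ?thesis by auto
next
  case False
  then have ne: "F \<noteq> {}" and fin: "hausdorff1_outer A < top" by (auto simp: less_top)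
  let ?H = "hausdorff1_outer :: 'a set \<Rightarrow> ennreal"
  define D where "D n = {x \<in> A. 1 / real (Suc n) \<le> infdist x F}" for n
  define R where "R n = D (Suc n) - D n" for n
  have DF: "?H (A \<inter> F) + ?H (D n) \<le> ?H A" for n
  proof -
    have "?H (A \<inter> F) + ?H (D n) \<le> ?H (A \<inter> F \<union> D n)"
    proof (rule hausdorff1_outer_separated[where d="1 / real (Suc n)"])
      fix x y assume "x \<in> A \<inter> F" "y \<in> D n"
      then show "1 / real (Suc n) \<le> dist x y"
        using infdist_le[of x F y] by (auto simp: D_def dist_commute)
    qed simp
    also have "\<dots> \<le> ?H A" by (rule hausdorff1_outer_mono) (auto simp: D_def)
    finally show ?thesis .
  qed
  \<comment> \<open>Neighbouring shells \<open>R n\<close> touch, but shells whose indices differ by at least \<open>2\<close> are separated. Hence the sums over even and over odd indices are each bounded by the outer measure of \<open>A\<close>.\<close>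
  have step: "(\<Sum>i<k. ?H (R (2 * i + p))) \<le> ?H (\<Union>i<k. R (2 * i + p))" for k p
  proof (induction k)
    case (Suc k)
    have "(\<Sum>i<Suc k. ?H (R (2 * i + p))) \<le> ?H (\<Union>i<k. R (2 * i + p)) + ?H (R (2 * k + p))"
      using Suc by (simp add: add_right_mono)
    also have "\<dots> \<le> ?H ((\<Union>i<k. R (2 * i + p)) \<union> R (2 * k + p))"
    proof (cases "k = 0")
      case False
      then have pos: "0 < 2 * k + p" by simp
      show ?thesis
      proof (rule hausdorff1_outer_separated[where d="1 / real (2 * k + p) - 1 / real (Suc (2 * k + p))"])
        fix x y assume "x \<in> (\<Union>i<k. R (2 * i + p))" and y: "y \<in> R (2 * k + p)"
        then obtain i where i: "i < k" "x \<in> R (2 * i + p)" by blast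
        have "1 / real (2 * k + p) \<le> 1 / real (Suc (Suc (2 * i + p)))"
          using i(1) by (intro divide_left_mono) auto
        moreover have "1 / real (Suc (Suc (2 * i + p))) \<le> infdist x F"
          using i(2) by (auto simp: R_def D_def)
        moreover have "infdist y F < 1 / real (Suc (2 * k + p))"
          using y by (auto simp: R_def D_def)
        moreover have "infdist x F \<le> infdist y F + dist x y" by (rule infdist_triangle)
        ultimately show "1 / real (2 * k + p) - 1 / real (Suc (2 * k + p)) \<le> dist x y" by linarith
      next
        have "1 / real (Suc (2 * k + p)) < 1 / real (2 * k + p)"
          using pos by (intro divide_strict_left_mono) auto
        then show "0 < 1 / real (2 * k + p) - 1 / real (Suc (2 * k + p))" by simp
      qed
    qed simp
    also have "(\<Union>i<k. R (2 * i + p)) \<union> R (2 * k + p) = (\<Union>i<Suc k. R (2 * i + p))"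
      by (auto simp: less_Suc_eq)
    finally show ?case .
  qed simp
  have half: "(\<Sum>i<k. ?H (R (2 * i + p))) \<le> ?H A" for k p
    by (rule order.trans[OF step hausdorff1_outer_mono]) (auto simp: R_def D_def)
  have split: "(\<Sum>n<2 * k. ?H (R n)) = (\<Sum>i<k. ?H (R (2 * i + 0))) + (\<Sum>i<k. ?H (R (2 * i + 1)))" for k
    by (induction k) (simp_all add: algebra_simps)
  have bound: "(\<Sum>n<k. ?H (R n)) \<le> ?H A + ?H A" for k
  proof -
    have "(\<Sum>n<k. ?H (R n)) \<le> (\<Sum>n<2 * k. ?H (R n))" by (intro sum_mono2) auto
    also have "\<dots> \<le> ?H A + ?H A" unfolding split by (intro add_mono half)
    finally show ?thesis .
  qed
  have sumfin: "(\<Sum>n. ?H (R n)) < top"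
  proof -
    have "(\<Sum>n. ?H (R n)) \<le> ?H A + ?H A" by (intro suminf_le_const bound summableI)
    also have "\<dots> < top" using fin by simp
    finally show ?thesis .
  qed
  define r where "r n = enn2real (?H (R n))" for n
  have rH: "?H (R n) = ennreal (r n)" for n
    using ennreal_suminf_lessD[OF sumfin, of n] by (simp add: r_def)
  have r0: "0 \<le> r n" for n by (simp add: r_def)
  have sm: "summable r"
    using sumfin r0 unfolding rH by (intro summable_suminf_not_top) auto
  show ?thesis
  proof (rule ennreal_le_epsilon)
    fix e :: real assume e: "0 < e"
    obtain N where N: "norm (\<Sum>i. r (i + N)) < e" using suminf_exist_split[OF e sm] by blast
    have "A - F \<subseteq> D N \<union> (\<Union>i. R (i + N))"
    proof
      fix x assume x: "x \<in> A - F"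
      then have "0 < infdist x F"
        using F ne by (metis DiffD2 antisym_conv2 in_closed_iff_infdist_zero infdist_nonneg)
      then obtain n where n: "1 / real (Suc n) < infdist x F" using nat_approx_posE by blast
      have "1 / real (Suc (n + N)) \<le> 1 / real (Suc n)" by (simp add: frac_le)
      with n x have ex: "x \<in> D (n + N)" by (auto simp: D_def)
      have "x \<in> D (n + N) \<Longrightarrow> x \<in> D N \<union> (\<Union>i. R (i + N))" for n
        by (induction n) (auto simp: R_def)
      with ex show "x \<in> D N \<union> (\<Union>i. R (i + N))" by blast
    qed
    then have "?H (A - F) \<le> ?H (D N) + ?H (\<Union>i. R (i + N))"
      by (meson hausdorff1_outer_mono hausdorff1_outer_Un_le order.trans)
    also have "?H (\<Union>i. R (i + N)) \<le> (\<Sum>i. ?H (R (i + N)))" by (rule hausdorff1_outer_UN_le)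
    also have "\<dots> = ennreal (\<Sum>i. r (i + N))"
      unfolding rH by (intro suminf_ennreal2 r0) (simp add: sm summable_iff_shift)
    also have "\<dots> \<le> ennreal e" using N by (intro ennreal_leI) simp
    finally have "?H (A \<inter> F) + ?H (A - F) \<le> ?H (A \<inter> F) + (?H (D N) + ennreal e)"
      by (intro add_left_mono) (simp add: add_left_mono)
    also have "\<dots> \<le> ?H A + ennreal e"
      using DF[of N] by (simp add: add.assoc[symmetric] add_right_mono)
    finally show "?H (A \<inter> F) + ?H (A - F) \<le> ?H A + ennreal e" .
  qed
qed

lemma sets_hausdorff1 [measurable_cong, simp]: "sets hausdorff1 = sets (borel :: 'a::metric_space measure)"
  unfolding hausdorff1_def by (simp add: sets_measure_of sets.sigma_sets_eq[of borel, simplified])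

lemma emeasure_hausdorff1:
  fixes A :: "'a::metric_space set"
  assumes A: "A \<in> sets borel"
  shows "emeasure hausdorff1 A = hausdorff1_outer A"
proof -
  let ?H = "hausdorff1_outer :: 'a set \<Rightarrow> ennreal"
  let ?L = "lambda_system UNIV (Pow UNIV) ?H"
  have ms: "measure_space UNIV ?L ?H"
    by (rule sigma_algebra.caratheodory_lemma[OF sigma_algebra_Pow hausdorff1_outer_space])
  have cl: "closed F \<Longrightarrow> F \<in> ?L" for F
    unfolding algebra.lambda_system_eq[OF algebra_Pow]
  proof (auto intro!: antisym hausdorff1_outer_closed_le)
    fix X
    have "?H X = ?H ((X \<inter> F) \<union> (X - F))" by (simp add: Int_Diff_Un)
    then show "?H X \<le> ?H (X \<inter> F) + ?H (X - F)" using hausdorff1_outer_Un_le by metis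
  qed
  then have sub: "sets borel \<subseteq> ?L"
  proof -
    have "sigma_sets UNIV (Collect closed) \<subseteq> ?L"
      using ms cl by (intro sigma_algebra.sigma_sets_subset) (auto simp: measure_space_def)
    moreover have "sets (borel :: 'a measure) = sigma_sets UNIV (Collect closed)"
      unfolding borel_eq_closed by (rule sets_measure_of) simp
    ultimately show ?thesis by simp
  qed
  have "sigma_algebra UNIV (sets (borel :: 'a measure))" using sets.sigma_algebra_axioms[of borel] by simp
  then have "measure_space UNIV (sets borel) ?H" using measure_down[OF ms _ sub] by blast
  then have "measure_space UNIV (sets hausdorff1) ?H" by simp
  then show ?thesis
    using A by (intro emeasure_measure_of[OF hausdorff1_def])
      (auto simp: measure_space_def sets.space_closed)
qed

text \<open>
  Cutting the segment into short pieces bounds its measure from above. Conversely the orthogonal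
  projection of a cover to the line does not increase diameters and covers the interval.
\<close>

lemma hausdorff1_outer_segment:
  fixes a :: "'a::euclidean_space"
  assumes a: "norm a = 1" and lu: "l \<le> u"
  shows "hausdorff1_outer ((\<lambda>t. t *\<^sub>R a) ` {l<..<u}) = ennreal (u - l)"
proof (rule antisym)
  let ?p = "\<lambda>t. t *\<^sub>R a"
  have dp: "dist (?p s) (?p t) = \<bar>s - t\<bar>" for s t
    using a by (simp add: dist_norm scaleR_left_diff_distrib[symmetric])
  show "hausdorff1_outer (?p ` {l<..<u}) \<le> ennreal (u - l)"
    unfolding hausdorff1_outer_def
  proof (rule SUP_least)
    fix d :: real assume "d \<in> {0<..}"
    then obtain n where n: "(u - l) / d < real n" "n > 0"
      by (metis greaterThan_iff less_numeral_extra(3) neq0_conv reals_Archimedean2 order.strict_trans1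
          of_nat_0_le_iff of_nat_0_less_iff max_less_iff_conj)
    define h where "h = (u - l) / real n"
    have h: "0 \<le> h" "h \<le> d" "real n * h = u - l"
      using n lu \<open>d \<in> _\<close> by (auto simp: h_def field_simps)
    define C where "C i = (if i < n then ?p ` {l + real i * h .. l + real (Suc i) * h} else {})" for i
    have diam: "bounded (C i) \<and> diameter (C i) \<le> h" for i
    proof (cases "i < n")
      case True
      have "dist x y \<le> h" if "x \<in> C i" "y \<in> C i" for x y
      proof -
        from that True obtain s t where "x = ?p s" "y = ?p t"
          "s \<in> {l + real i * h .. l + real (Suc i) * h}" "t \<in> {l + real i * h .. l + real (Suc i) * h}"
          unfolding C_def by (simp only: if_True) blast
        then show ?thesis by (auto simp only: dp) (simp add: algebra_simps abs_le_iff)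
      qed
      moreover have "compact (C i)"
        using True by (auto simp: C_def intro!: compact_continuous_image continuous_intros)
      ultimately show ?thesis
        using h by (intro conjI compact_imp_bounded diameter_le) (auto simp: dist_norm)
    qed (use h in \<open>simp add: C_def\<close>)
    have cov: "?p ` {l<..<u} \<subseteq> (\<Union>i. C i)"
    proof (rule image_subsetI)
      fix t assume t: "t \<in> {l<..<u}"
      then have hp: "h > 0" using n lu by (auto simp: h_def)
      define i where "i = nat \<lfloor>(t - l) / h\<rfloor>"
      have "0 \<le> (t - l) / h" using t hp by simp
      then have i: "real i \<le> (t - l) / h" "(t - l) / h < real i + 1"
        unfolding i_def by linarith+
      have "real i * h \<le> t - l" using i(1) hp by (simp add: pos_le_divide_eq)
      also have "\<dots> < real n * h" using t h(3) by simp
      finally have "real i * h < real n * h" .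
      then have "i < n" using hp by simp
      moreover have "t \<in> {l + real i * h .. l + real (Suc i) * h}"
        using i hp by (auto simp: field_simps)
      ultimately have "?p t \<in> C i" unfolding C_def by (simp only: if_True) (rule imageI)
      then show "?p t \<in> (\<Union>i. C i)" by blast
    qed
    have "hausdorff1_pre d (?p ` {l<..<u}) \<le> (\<Sum>i. ennreal (diameter (C i)))"
      unfolding hausdorff1_pre_def using cov diam h(2) by (intro INF_lower) (auto intro: order.trans)
    also have "\<dots> = (\<Sum>i<n. ennreal (diameter (C i)))"
      by (rule suminf_finite) (auto simp: C_def)
    also have "\<dots> \<le> (\<Sum>i<n. ennreal h)" using diam by (intro sum_mono ennreal_leI) auto
    also have "\<dots> = ennreal (u - l)"
      using h by (simp add: ennreal_of_nat_eq_real_of_nat ennreal_mult'[symmetric])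
    finally show "hausdorff1_pre d (?p ` {l<..<u}) \<le> ennreal (u - l)" .
  qed
  have "ennreal (u - l) \<le> hausdorff1_pre 1 (?p ` {l<..<u})"
    unfolding hausdorff1_pre_def
  proof (rule INF_greatest)
    fix C :: "nat \<Rightarrow> 'a set"
    assume "C \<in> {C. ?p ` {l<..<u} \<subseteq> (\<Union>i. C i) \<and> (\<forall>i. bounded (C i) \<and> diameter (C i) \<le> 1)}"
    then have C: "?p ` {l<..<u} \<subseteq> (\<Union>i. C i)" "\<And>i. bounded (C i)" by auto
    \<comment> \<open>Projections to the line are enclosed in intervals, whose lengths are bounded by the diameters.\<close>
    define Q where "Q i = (\<lambda>x. x \<bullet> a) ` C i" for i
    define J where "J i = (if Q i = {} then {} else {Inf (Q i) .. Sup (Q i)})" for i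
    have Qd: "x \<le> y + diameter (C i)" if "x \<in> Q i" "y \<in> Q i" for x y i
    proof -
      from that obtain v w where vw: "v \<in> C i" "w \<in> C i" "x = v \<bullet> a" "y = w \<bullet> a" by (auto simp: Q_def)
      have "x - y = (v - w) \<bullet> a" by (simp add: vw inner_diff_left)
      also have "\<dots> \<le> norm (v - w) * norm a" by (rule norm_cauchy_schwarz)
      also have "\<dots> \<le> diameter (C i)"
        using diameter_bounded_bound[OF C(2) vw(1,2)] a by (simp add: dist_norm)
      finally show ?thesis by simp
    qed
    have Qb: "bounded (Q i)" for i
      unfolding Q_def by (intro bounded_linear_image C(2) bounded_linear_inner_left)
    then have bb: "bdd_below (Q i)" "bdd_above (Q i)" for i
      by (simp_all add: bounded_imp_bdd_below bounded_imp_bdd_above)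
    have mJ: "emeasure lborel (J i) \<le> ennreal (diameter (C i))" for i
    proof (cases "Q i = {}")
      case False
      have "Sup (Q i) \<le> Inf (Q i) + diameter (C i)"
      proof -
        have "x - diameter (C i) \<le> Inf (Q i)" if "x \<in> Q i" for x
          using False Qd[OF that] by (intro cInf_greatest) (auto simp: algebra_simps)
        then show ?thesis using False by (intro cSup_least) (auto simp: algebra_simps)
      qed
      then show ?thesis
        using False bb[of i] by (auto simp: J_def cInf_le_cSup intro!: ennreal_leI)
    qed (simp add: J_def)
    have "{l<..<u} \<subseteq> (\<Union>i. J i)"
    proof
      fix t assume "t \<in> {l<..<u}"
      then obtain i where "?p t \<in> C i" using C(1) by blast
      then have "t \<in> Q i" using a by (force simp: Q_def dot_square_norm)
      then have "t \<in> J i" using bb[of i] by (auto simp: J_def intro: cInf_lower cSup_upper)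
      then show "t \<in> (\<Union>i. J i)" by blast
    qed
    then have "emeasure lborel {l<..<u} \<le> emeasure lborel (\<Union>i. J i)"
      by (intro emeasure_mono) (auto simp: J_def)
    also have "\<dots> \<le> (\<Sum>i. emeasure lborel (J i))"
      by (intro emeasure_subadditive_countably) (auto simp: J_def)
    also have "\<dots> \<le> (\<Sum>i. ennreal (diameter (C i)))" by (intro suminf_le mJ) auto
    finally show "ennreal (u - l) \<le> (\<Sum>i. ennreal (diameter (C i)))" using lu by simp
  qed
  also have "\<dots> \<le> hausdorff1_outer (?p ` {l<..<u})" by (rule hausdorff1_pre_le_outer) simp
  finally show "ennreal (u - l) \<le> hausdorff1_outer (?p ` {l<..<u})" .
qed

text \<open>
  The coordinate along the line maps Hausdorff measure on the line to a Borel measure on \<open>\<real>\<close> that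
  gives each interval its length, and this characterises Lebesgue measure.
\<close>

lemma emeasure_hausdorff1_line:
  fixes a :: "'a::euclidean_space"
  assumes a: "norm a = 1" and B: "B \<in> sets borel"
  shows "(\<lambda>t. t *\<^sub>R a) ` B \<in> sets borel"
    and "emeasure hausdorff1 ((\<lambda>t. t *\<^sub>R a) ` B) = emeasure lborel B"
proof -
  let ?p = "\<lambda>t. t *\<^sub>R a" and ?q = "\<lambda>x. x \<bullet> a"
  define L where "L = {x. ?p (?q x) = x}"
  have qp: "?q (?p t) = t" for t using a by (simp add: dot_square_norm)
  have L: "L \<in> sets borel" unfolding L_def by measurable
  have im: "?p ` B = ?q -` B \<inter> L" for B
    using a by (force simp: L_def dot_square_norm)
  have q: "?q \<in> borel_measurable (restrict_space hausdorff1 L)"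
    by (intro measurable_restrict_space1) (simp add: measurable_cong_sets[OF sets_hausdorff1 refl])
  define M where "M = distr (restrict_space hausdorff1 L) borel ?q"
  have pB: "?p ` B \<in> sets borel" if "B \<in> sets borel" for B
    unfolding im using that L by measurable
  have M: "emeasure M B = emeasure hausdorff1 (?p ` B)" if "B \<in> sets borel" for B
    unfolding M_def using that L pB[OF that]
    by (subst emeasure_distr[OF q that]) (simp add: space_restrict_space emeasure_restrict_space im)
  have "lborel = M"
  proof (rule lborel_eqI)
    fix l u :: real assume "\<And>b. b \<in> Basis \<Longrightarrow> l \<bullet> b \<le> u \<bullet> b"
    then have lu: "l \<le> u" by simp
    have "emeasure M {l<..<u} = emeasure hausdorff1 (?p ` {l<..<u})" by (rule M) simp
    also have "\<dots> = ennreal (u - l)"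
      by (subst emeasure_hausdorff1[OF pB]) (simp_all add: hausdorff1_outer_segment[OF a lu])
    finally show "emeasure M (box l u) = ennreal (\<Prod>b\<in>Basis. (u - l) \<bullet> b)" by (simp add: box_real)
  qed (simp add: M_def)
  then show "emeasure hausdorff1 (?p ` B) = emeasure lborel B" using M[OF B] by simp
  show "?p ` B \<in> sets borel" by (rule pB[OF B])
qed

text \<open>
  Arc length parametrisation of the boundary of the sector: \<open>t > 0\<close> runs through the upper ray
  and \<open>t < 0\<close> through the lower one.
\<close>

definition bd_param :: "real \<Rightarrow> real \<Rightarrow> real \<times> real" where
  "bd_param \<alpha> t = (\<bar>t\<bar> * cos \<alpha>, t * sin \<alpha>)"

lemma bd_param_borel [measurable]: "bd_param \<alpha> \<in> borel_measurable borel"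
  unfolding bd_param_def by (intro borel_measurable_Pair) measurable

text \<open>
  Each of the two rays is an isometric image of a half line, and they meet in a single point only.
\<close>

lemma hausdorff1_bd_param:
  assumes al: "0 < \<alpha>" "\<alpha> < pi / 2"
  shows "range (bd_param \<alpha>) \<in> sets borel"
    and "restrict_space hausdorff1 (range (bd_param \<alpha>)) =
         distr lborel (restrict_space borel (range (bd_param \<alpha>))) (bd_param \<alpha>)"
proof -
  have sc: "sin \<alpha> > 0" "cos \<alpha> > 0" using al by (auto intro: sin_gt_zero cos_gt_zero)
  let ?a = "(cos \<alpha>, sin \<alpha>)" and ?b = "(- cos \<alpha>, sin \<alpha>)"
  let ?p = "bd_param \<alpha>"
  have na: "norm ?a = 1" "norm ?b = 1" by (simp_all add: norm_Pair)
  have split: "?p ` B = (\<lambda>t. t *\<^sub>R ?a) ` (B \<inter> {0..}) \<union> (\<lambda>t. t *\<^sub>R ?b) ` (B \<inter> {..<0})" for B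
  proof -
    have "?p ` B = ?p ` (B \<inter> {0..}) \<union> ?p ` (B \<inter> {..<0})" by force
    also have "?p ` (B \<inter> {0..}) = (\<lambda>t. t *\<^sub>R ?a) ` (B \<inter> {0..})"
      by (intro image_cong) (auto simp: bd_param_def)
    also have "?p ` (B \<inter> {..<0}) = (\<lambda>t. t *\<^sub>R ?b) ` (B \<inter> {..<0})"
      by (intro image_cong) (auto simp: bd_param_def)
    finally show ?thesis .
  qed
  have meas: "?p ` B \<in> sets borel" if "B \<in> sets borel" for B
    unfolding split using that by (intro sets.Un emeasure_hausdorff1_line(1) na) auto
  have em: "emeasure hausdorff1 (?p ` B) = emeasure lborel B" if B: "B \<in> sets borel" for B
  proof -
    have BB: "B \<inter> {0..} \<in> sets borel" "B \<inter> {..<0} \<in> sets borel" using B by auto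
    have "emeasure hausdorff1 (?p ` B) = emeasure hausdorff1 ((\<lambda>t. t *\<^sub>R ?a) ` (B \<inter> {0..}))
        + emeasure hausdorff1 ((\<lambda>t. t *\<^sub>R ?b) ` (B \<inter> {..<0}))"
      unfolding split
    proof (rule plus_emeasure[symmetric])
      show "(\<lambda>t. t *\<^sub>R ?a) ` (B \<inter> {0..}) \<inter> (\<lambda>t. t *\<^sub>R ?b) ` (B \<inter> {..<0}) = {}"
      proof -
        have False if "s * sin \<alpha> = t * sin \<alpha>" "0 \<le> s" "t < 0" for s t using that sc by simp
        then show ?thesis by fastforce
      qed
    qed (use emeasure_hausdorff1_line(1)[OF na(1) BB(1)] emeasure_hausdorff1_line(1)[OF na(2) BB(2)] in simp_all)
    also have "\<dots> = emeasure lborel (B \<inter> {0..}) + emeasure lborel (B \<inter> {..<0})"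
      using emeasure_hausdorff1_line(2)[OF na(1) BB(1)] emeasure_hausdorff1_line(2)[OF na(2) BB(2)] by simp
    also have "\<dots> = emeasure lborel ((B \<inter> {0..}) \<union> (B \<inter> {..<0}))"
      using BB by (intro plus_emeasure) auto
    also have "(B \<inter> {0..}) \<union> (B \<inter> {..<0}) = B" by auto
    finally show ?thesis .
  qed
  show R: "range ?p \<in> sets borel" using meas[of UNIV] by simp
  have mp: "?p \<in> measurable lborel (restrict_space borel (range ?p))"
    by (intro measurable_restrict_space2) auto
  show "restrict_space hausdorff1 (range ?p) = distr lborel (restrict_space borel (range ?p)) ?p"
  proof (rule measure_eqI)
    show "sets (restrict_space hausdorff1 (range ?p)) = sets (distr lborel (restrict_space borel (range ?p)) ?p)"
      by (simp add: sets_restrict_space)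
    fix A assume "A \<in> sets (restrict_space hausdorff1 (range ?p))"
    then have A: "A \<subseteq> range ?p" "A \<in> sets borel" "A \<in> sets (restrict_space borel (range ?p))"
      using R by (auto simp: sets_restrict_space_iff sets_restrict_space)
    have v: "?p -` A \<in> sets borel" using measurable_sets[OF bd_param_borel A(2)] by simp
    have "emeasure (restrict_space hausdorff1 (range ?p)) A = emeasure hausdorff1 (?p ` (?p -` A))"
      using A R by (simp add: emeasure_restrict_space image_vimage_eq Int_absorb2)
    also have "\<dots> = emeasure lborel (?p -` A)" by (rule em[OF v])
    finally show "emeasure (restrict_space hausdorff1 (range ?p)) A =
        emeasure (distr lborel (restrict_space borel (range ?p)) ?p) A"
      using A by (simp add: emeasure_distr[OF mp])
  qed
qed

section \<open>Test functions and integration over the sector\<close>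

lemma test_smooth: "\<phi> \<in> test_functions \<Omega> \<Longrightarrow> smooth \<phi>"
  by (simp add: test_functions_def)

lemma partial_deriv_zero_outside:
  assumes "closed K" "\<And>x. x \<notin> K \<Longrightarrow> f x = 0" "x \<notin> K"
  shows "partial_deriv b f x = 0"
proof -
  have "(f has_derivative (\<lambda>h. 0)) (at x)"
    by (rule has_derivative_transform_within_open[OF has_derivative_const, where s="- K"])
       (use assms in \<open>auto simp: open_Compl\<close>)
  then show ?thesis using partial_derivI by fastforce
qed

lemma test_partial: "\<phi> \<in> test_functions \<Omega> \<Longrightarrow> b \<in> Basis \<Longrightarrow> partial_deriv b \<phi> \<in> test_functions \<Omega>"
  unfolding test_functions_def by (blast intro: smooth_partial[rule_format] partial_deriv_zero_outside compact_imp_closed)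

lemma test_mult: "smooth f \<Longrightarrow> \<phi> \<in> test_functions \<Omega> \<Longrightarrow> (\<lambda>x. f x * \<phi> x) \<in> test_functions \<Omega>"
  unfolding test_functions_def by (auto intro!: C_k_mult)

lemma test_cnj: "\<phi> \<in> test_functions \<Omega> \<Longrightarrow> (\<lambda>x. cnj (\<phi> x)) \<in> test_functions \<Omega>"
  unfolding test_functions_def by (auto intro!: C_k_cnj)

lemma test_cmult: "\<phi> \<in> test_functions \<Omega> \<Longrightarrow> (\<lambda>x. c * \<phi> x) \<in> test_functions \<Omega>"
  by (rule test_mult) (auto intro: C_k_const)

lemma test_add: 
  assumes "\<phi> \<in> test_functions \<Omega>" "\<psi> \<in> test_functions \<Omega>" shows "(\<lambda>x. \<phi> x + \<psi> x) \<in> test_functions \<Omega>"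
proof -
  from assms obtain K L where "compact K" "K \<subseteq> \<Omega>" "\<forall>x. x \<notin> K \<longrightarrow> \<phi> x = 0" "compact L" "L \<subseteq> \<Omega>" "\<forall>x. x \<notin> L \<longrightarrow> \<psi> x = 0"
    unfolding test_functions_def by blast
  then have "compact (K \<union> L) \<and> K \<union> L \<subseteq> \<Omega> \<and> (\<forall>x. x \<notin> K \<union> L \<longrightarrow> \<phi> x + \<psi> x = 0)" by auto
  with assms show ?thesis unfolding test_functions_def by (blast intro: C_k_add)
qed

lemma test_zero: "(\<lambda>x. 0) \<in> test_functions \<Omega>"
  by (auto simp: test_functions_def C_k_const intro: exI[of _ "{}"])

lemma test_diff: "\<phi> \<in> test_functions \<Omega> \<Longrightarrow> \<psi> \<in> test_functions \<Omega> \<Longrightarrow> (\<lambda>x. \<phi> x - \<psi> x) \<in> test_functions \<Omega>"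
  using test_add[OF _ test_cmult[of \<psi> \<Omega> "-1"]] by fastforce

lemma test_sum: "(\<And>i. i \<in> I \<Longrightarrow> \<phi> i \<in> test_functions \<Omega>) \<Longrightarrow> (\<lambda>x. \<Sum>i\<in>I. \<phi> i x) \<in> test_functions \<Omega>"
  by (induction I rule: infinite_finite_induct) (auto intro: test_add test_zero)

lemma partial_deriv_lincomb:
  assumes "\<And>i. i \<in> I \<Longrightarrow> smooth (\<phi> i)"
  shows "partial_deriv b (\<lambda>x. \<Sum>i\<in>I. c i * \<phi> i x) = (\<lambda>x. \<Sum>i\<in>I. c i * partial_deriv b (\<phi> i) x)"
proof
  fix x
  have "((\<lambda>x. \<Sum>i\<in>I. c i * \<phi> i x) has_derivative (\<lambda>h. \<Sum>i\<in>I. c i * frechet_derivative (\<phi> i) (at x) h)) (at x)"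
    using smooth_differentiable[OF assms] frechet_derivative_works
    by (intro has_derivative_sum has_derivative_mult_right) blast
  from partial_derivI[OF this, of b] show "partial_deriv b (\<lambda>x. \<Sum>i\<in>I. c i * \<phi> i x) x = (\<Sum>i\<in>I. c i * partial_deriv b (\<phi> i) x)"
    by (simp only: partial_deriv_def)
qed

lemma test_box:
  fixes \<phi> :: "real \<times> real \<Rightarrow> complex"
  assumes "\<phi> \<in> test_functions \<Omega>"
  obtains R where "R > 0" "\<And>z. z \<notin> {-R..R} \<times> {-R..R} \<Longrightarrow> \<phi> z = 0"
proof -
  from assms obtain K where K: "compact K" "\<forall>x. x \<notin> K \<longrightarrow> \<phi> x = 0" unfolding test_functions_def by blast
  obtain R where R: "R > 0" "\<forall>z\<in>K. norm z \<le> R" using compact_imp_bounded[OF K(1)] bounded_pos by blast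
  have "\<phi> z = 0" if "z \<notin> {-R..R} \<times> {-R..R}" for z
  proof -
    have "norm (fst z) \<le> norm z" "norm (snd z) \<le> norm z"
      using norm_fst_le[of "fst z" "snd z"] norm_snd_le[of "snd z" "fst z"] by simp_all
    then have "z \<notin> K" using that R(2) by (cases z) fastforce
    with K show ?thesis by blast
  qed
  with R(1) that show ?thesis by blast
qed

lemma integrable_box:
  fixes f :: "real \<times> real \<Rightarrow> 'b::{banach, second_countable_topology}"
  assumes c: "continuous_on UNIV f" and z: "\<And>z. z \<notin> {-R..R} \<times> {-R..R} \<Longrightarrow> f z = 0"
  shows "integrable lborel f"
proof -
  have "integrable lborel (\<lambda>x. indicator (cbox (-R, -R) (R, R)) x *\<^sub>R f x)"
    by (rule borel_integrable_compact) (auto intro: continuous_on_subset[OF c])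
  also have "(\<lambda>x. indicator (cbox (-R, -R) (R, R)) x *\<^sub>R f x) = f"
    using z by (fastforce simp: indicator_def cbox_Pair_eq)
  finally show ?thesis .
qed

lemma test_integrable: "\<phi> \<in> test_functions \<Omega> \<Longrightarrow> integrable lborel (\<phi> :: real \<times> real \<Rightarrow> complex)"
  by (metis test_box integrable_box smooth_continuous test_smooth)

lemma fubini_lborel:
  fixes f :: "real \<times> real \<Rightarrow> 'b::{banach, second_countable_topology}"
  assumes "integrable lborel f"
  shows "(\<integral>x. (\<integral>y. f (x, y) \<partial>lborel) \<partial>lborel) = (\<integral>z. f z \<partial>lborel)"
    and "(\<integral>y. (\<integral>x. f (x, y) \<partial>lborel) \<partial>lborel) = (\<integral>z. f z \<partial>lborel)"
proof -
  have i: "integrable (lborel \<Otimes>\<^sub>M lborel) f" using assms by (simp add: lborel_prod)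
  show "(\<integral>x. (\<integral>y. f (x, y) \<partial>lborel) \<partial>lborel) = (\<integral>z. f z \<partial>lborel)"
    using lborel_pair.integral_fst'[OF i] by (simp add: lborel_prod)
  show "(\<integral>y. (\<integral>x. f (x, y) \<partial>lborel) \<partial>lborel) = (\<integral>z. f z \<partial>lborel)"
    using lborel_pair.integral_snd[of "\<lambda>x y. f (x, y)"] i by (simp add: lborel_prod)
qed

lemma Basis_plane: "Basis = {(1::real, 0::real), (0, 1)}"
  by (auto simp: Basis_prod_def)

lemma sum_Basis_plane: "(\<Sum>b\<in>(Basis :: (real \<times> real) set). g b) = g (1, 0) + g (0, 1)"
  by (simp add: Basis_plane)

abbreviation "px \<equiv> partial_deriv (1::real, 0::real)"
abbreviation "py \<equiv> partial_deriv (0::real, 1::real)"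

lemma px_line: "smooth f \<Longrightarrow> ((\<lambda>x. f (x, y)) has_vector_derivative px f (x, y)) (at x within A)"
proof -
  assume f: "smooth f"
  have "((\<lambda>x. (x, y)) has_derivative (\<lambda>h. (h, 0))) (at x within A)" by (auto intro!: derivative_eq_intros)
  from has_derivative_compose[OF this smooth_has_derivative[OF f]]
  show ?thesis by (simp add: has_vector_derivative_def sum_Basis_plane inner_prod_def)
qed

lemma py_line: "smooth f \<Longrightarrow> ((\<lambda>y. f (x, y)) has_vector_derivative py f (x, y)) (at y within A)"
proof -
  assume f: "smooth f"
  have "((\<lambda>y. (x, y)) has_derivative (\<lambda>h. (0, h))) (at y within A)" by (auto intro!: derivative_eq_intros)
  from has_derivative_compose[OF this smooth_has_derivative[OF f]]
  show ?thesis by (simp add: has_vector_derivative_def sum_Basis_plane inner_prod_def)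
qed

lemma integral_partial_deriv_zero:
  fixes f :: "real \<times> real \<Rightarrow> complex"
  assumes f: "f \<in> test_functions \<Omega>" and b: "b \<in> (Basis :: (real \<times> real) set)"
  shows "(\<integral>z. partial_deriv b f z \<partial>lborel) = 0"
proof -
  note s = test_smooth[OF f]
  obtain R where R: "R > 0" "\<And>z. z \<notin> {-R..R} \<times> {-R..R} \<Longrightarrow> f z = 0" using test_box[OF f] by blast
  have p0: "partial_deriv b f z = 0" if "z \<notin> {-R..R} \<times> {-R..R}" for z b
    by (rule partial_deriv_zero_outside[OF _ R(2) that]) (auto intro: closed_Times)
  have i: "integrable lborel (partial_deriv b f)" by (rule test_integrable[OF test_partial[OF f b]])
  from b consider "b = (1, 0)" | "b = (0, 1)" by (auto simp: Basis_plane)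
  then show ?thesis
  proof cases
    case 1
    have "(\<integral>x. px f (x, y) \<partial>lborel) = 0" for y
    proof -
      have "(\<integral>x. px f (x, y) \<partial>lborel) = (\<integral>x. indicator {-R-1..R+1} x *\<^sub>R px f (x, y) \<partial>lborel)"
        by (intro Bochner_Integration.integral_cong) (auto simp: indicator_def intro!: p0)
      also have "\<dots> = f (R + 1, y) - f (- R - 1, y)"
        using R(1) by (intro integral_FTC_Icc px_line s continuous_on_compose2[OF smooth_continuous[OF smooth_partial[OF s]]]
          continuous_intros) (auto simp: Basis_plane)
      also have "\<dots> = 0" using R by auto
      finally show ?thesis .
    qed
    then show ?thesis using fubini_lborel(2)[OF i] 1 by simp
  next
    case 2
    have "(\<integral>y. py f (x, y) \<partial>lborel) = 0" for x
    proof -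
      have "(\<integral>y. py f (x, y) \<partial>lborel) = (\<integral>y. indicator {-R-1..R+1} y *\<^sub>R py f (x, y) \<partial>lborel)"
        by (intro Bochner_Integration.integral_cong) (auto simp: indicator_def intro!: p0)
      also have "\<dots> = f (x, R + 1) - f (x, - R - 1)"
        using R(1) by (intro integral_FTC_Icc py_line s continuous_on_compose2[OF smooth_continuous[OF smooth_partial[OF s]]]
          continuous_intros) (auto simp: Basis_plane)
      also have "\<dots> = 0" using R by auto
      finally show ?thesis .
    qed
    then show ?thesis using fubini_lborel(1)[OF i] 2 by simp
  qed
qed

text \<open>
  In this context \<open>S\<close> is the sector, \<open>U\<close> Lebesgue measure on it, \<open>B\<close> the arc length on its
  boundary and \<open>T\<close> the slope of the upper ray.
\<close>

locale acute =
  fixes \<alpha> :: real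
  assumes pos: "0 < \<alpha>" and acute: "\<alpha> < pi / 2"
begin

abbreviation "S \<equiv> sector \<alpha>"
abbreviation "U \<equiv> lebesgue_on (sector \<alpha>)"
abbreviation "B \<equiv> boundary_measure (sector \<alpha>)"
abbreviation "T \<equiv> tan \<alpha>"

lemma sin_pos: "0 < sin \<alpha>" and cos_pos: "0 < cos \<alpha>" and T_pos: "0 < T"
  using pos acute by (auto intro: sin_gt_zero cos_gt_zero tan_gt_zero)

lemma T_eq: "T = sin \<alpha> / cos \<alpha>" by (simp add: tan_def)

lemma S_eq: "S = {z. 0 < fst z \<and> \<bar>snd z\<bar> < T * fst z}"
proof -
  have "(Complex x y \<noteq> 0 \<and> \<bar>Arg (Complex x y)\<bar> < \<alpha>) \<longleftrightarrow> 0 < x \<and> \<bar>y\<bar> < T * x" for x y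
  proof (cases "0 < x")
    case True
    have "Arg (Complex x y) = arctan (y / x)" using True by (subst arg_conv_arctan) auto
    then have "\<bar>Arg (Complex x y)\<bar> = arctan (\<bar>y\<bar> / x)"
      using True by (cases "y \<ge> 0") (simp_all add: abs_of_neg arctan_minus divide_neg_pos)
    moreover have "arctan (\<bar>y\<bar> / x) < \<alpha> \<longleftrightarrow> \<bar>y\<bar> / x < T"
      using arctan_less_iff[of "\<bar>y\<bar> / x" T] pos acute by (simp add: arctan_tan)
    ultimately show ?thesis using True by (auto simp: pos_divide_less_eq complex_eq_iff)
  next
    case False
    then have "\<not> \<bar>Arg (Complex x y)\<bar> < \<alpha>" if "Complex x y \<noteq> 0"
      using that acute Arg_Re_pos[of "Complex x y"] by auto
    then show ?thesis using False by auto
  qed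
  then show ?thesis unfolding sector_def by auto
qed

lemma open_S: "open S"
  unfolding S_eq by (intro open_Collect_conj open_Collect_less continuous_intros)

lemma S_borel [measurable]: "S \<in> sets borel" using open_S by simp

lemma closure_S: "closure S = {z. \<bar>snd z\<bar> \<le> T * fst z}"
proof (rule antisym)
  show "closure S \<subseteq> {z. \<bar>snd z\<bar> \<le> T * fst z}"
    by (rule closure_minimal) (auto simp: S_eq intro!: closed_Collect_le continuous_intros)
  show "{z. \<bar>snd z\<bar> \<le> T * fst z} \<subseteq> closure S"
  proof
    fix z :: "real \<times> real" assume "z \<in> {z. \<bar>snd z\<bar> \<le> T * fst z}"
    then have z: "\<bar>snd z\<bar> \<le> T * fst z" by simp
    then have z0: "0 \<le> fst z" using mult_pos_neg[OF T_pos, of "fst z"] by linarith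
    have in_S: "(z + (1 / real (Suc n), 0)) \<in> S" for n
    proof -
      have "0 < fst z + 1 / real (Suc n)" using z0 by (intro add_nonneg_pos) simp_all
      moreover have "T * fst z < T * (fst z + 1 / real (Suc n))" using T_pos by simp
      ultimately show ?thesis using z unfolding S_eq by simp
    qed
    have "(\<lambda>n. z + (1 / real (Suc n), 0)) \<longlonglongrightarrow> z + (0, 0)"
      by (rule tendsto_add[OF tendsto_const tendsto_Pair[OF LIMSEQ_Suc[OF lim_1_over_n] tendsto_const]])
    then have "(\<lambda>n. z + (1 / real (Suc n), 0)) \<longlonglongrightarrow> z" by (simp add: zero_prod_def[symmetric])
    with in_S show "z \<in> closure S" unfolding closure_sequential
      by (intro exI[of _ "\<lambda>n. z + (1 / real (Suc n), 0)"] conjI allI)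
  qed
qed

lemma frontier_S: "frontier S = range (bd_param \<alpha>)"
proof -
  have "\<bar>snd z\<bar> \<le> T * fst z \<and> \<not> (0 < fst z \<and> \<bar>snd z\<bar> < T * fst z) \<longleftrightarrow> \<bar>snd z\<bar> = T * fst z" for z :: "real \<times> real"
    using mult_pos_neg[OF T_pos, of "fst z"] by (cases "fst z" "0 :: real" rule: linorder_cases) auto
  then have "frontier S = {z. \<bar>snd z\<bar> = T * fst z}"
    unfolding frontier_def interior_open[OF open_S] closure_S by (auto simp: S_eq)
  also have "\<dots> = range (bd_param \<alpha>)"
  proof (intro antisym subsetI)
    fix z assume "z \<in> {z. \<bar>snd z\<bar> = T * fst z}"
    then have "z = bd_param \<alpha> (snd z / sin \<alpha>)"
      using sin_pos cos_pos by (cases z) (auto simp: bd_param_def T_eq field_simps)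
    then show "z \<in> range (bd_param \<alpha>)" by blast
  qed (use sin_pos cos_pos in \<open>auto simp: bd_param_def T_eq abs_mult\<close>)
  finally show ?thesis .
qed

lemma B_eq: "B = distr lborel (restrict_space borel (range (bd_param \<alpha>))) (bd_param \<alpha>)"
  unfolding frontier_S by (rule hausdorff1_bd_param(2)[OF pos acute])

lemma bd_meas: "bd_param \<alpha> \<in> measurable lborel (restrict_space borel (range (bd_param \<alpha>)))"
  by (intro measurable_restrict_space2) auto

lemma borel_B: "f \<in> borel_measurable borel \<Longrightarrow> f \<in> borel_measurable B"
  unfolding B_eq by (simp add: measurable_restrict_space1)

lemma borel_U: "f \<in> borel_measurable borel \<Longrightarrow> f \<in> borel_measurable U"
  by (intro measurable_restrict_space1) (simp add: measurable_completion)

lemma nn_integral_B: "f \<in> borel_measurable borel \<Longrightarrow> (\<integral>\<^sup>+z. f z \<partial>B) = (\<integral>\<^sup>+t. f (bd_param \<alpha> t) \<partial>lborel)"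
  unfolding B_eq by (intro nn_integral_distr bd_meas) (simp add: measurable_restrict_space1)

lemma integral_B:
  fixes f :: "real \<times> real \<Rightarrow> 'b::{banach, second_countable_topology}"
  shows "f \<in> borel_measurable borel \<Longrightarrow> (\<integral>z. f z \<partial>B) = (\<integral>t. f (bd_param \<alpha> t) \<partial>lborel)"
  unfolding B_eq by (intro integral_distr bd_meas) (simp add: measurable_restrict_space1)

lemma nn_integral_U: "f \<in> borel_measurable borel \<Longrightarrow> (\<integral>\<^sup>+z. f z \<partial>U) = (\<integral>\<^sup>+z. f z * indicator S z \<partial>lborel)"
  by (subst nn_integral_restrict_space) (auto simp: nn_integral_completion)

lemma integral_U:
  fixes f :: "real \<times> real \<Rightarrow> 'b::{banach, second_countable_topology}"
  assumes "f \<in> borel_measurable borel" shows "(\<integral>z. f z \<partial>U) = (\<integral>z. indicator S z *\<^sub>R f z \<partial>lborel)"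
proof -
  have "(\<integral>z. f z \<partial>U) = (\<integral>z. indicator S z *\<^sub>R f z \<partial>lebesgue)"
    by (subst integral_restrict_space) auto
  also have "\<dots> = (\<integral>z. indicator S z *\<^sub>R f z \<partial>lborel)"
    using assms by (intro integral_completion) measurable
  finally show ?thesis .
qed

lemma integrable_U:
  fixes f :: "real \<times> real \<Rightarrow> 'b::{banach, second_countable_topology}"
  assumes "integrable lborel f" shows "integrable U f" "integrable lborel (\<lambda>z. indicator S z *\<^sub>R f z)"
proof -
  show 1: "integrable lborel (\<lambda>z. indicator S z *\<^sub>R f z)" using assms by (intro integrable_mult_indicator) auto
  have m: "f \<in> borel_measurable borel" using borel_measurable_integrable[OF assms] by simp
  have "integrable lebesgue (\<lambda>z. indicator S z *\<^sub>R f z)"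
    using 1 m by (subst integrable_completion) auto
  then show "integrable U f" by (subst integrable_restrict_space) auto
qed

lemma test_L2_U: "\<phi> \<in> test_functions \<Omega> \<Longrightarrow> \<phi> \<in> L2 U"
proof -
  assume t: "\<phi> \<in> test_functions \<Omega>"
  have "(\<lambda>z. \<phi> z * cnj (\<phi> z)) \<in> test_functions \<Omega>" using t by (intro test_mult test_cnj test_smooth)
  then have "integrable U (\<lambda>z. norm (\<phi> z * cnj (\<phi> z)))" by (intro integrable_norm integrable_U test_integrable)
  then have "integrable U (\<lambda>z. (norm (\<phi> z))\<^sup>2)" by (simp add: norm_mult power2_eq_square)
  then show ?thesis using borel_U[OF smooth_borel[OF test_smooth[OF t]]] by (simp add: L2_def)
qed

lemma bd_integrable:
  assumes "\<phi> \<in> test_functions \<Omega>"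
  shows "integrable lborel (\<lambda>t. \<phi> (bd_param \<alpha> t))" "integrable lborel (\<lambda>t. sgn t *\<^sub>R \<phi> (bd_param \<alpha> t))"
proof -
  obtain R where R: "R > 0" "\<And>z. z \<notin> {-R..R} \<times> {-R..R} \<Longrightarrow> \<phi> z = 0" using test_box[OF assms] by blast
  have c: "continuous_on A (\<lambda>t. \<phi> (bd_param \<alpha> t))" for A unfolding bd_param_def
    by (intro continuous_on_compose2[OF smooth_continuous[OF test_smooth[OF assms]]] continuous_intros) auto
  have "integrable lborel (\<lambda>t. indicator {- (R / sin \<alpha>) .. R / sin \<alpha>} t *\<^sub>R \<phi> (bd_param \<alpha> t))"
    by (rule borel_integrable_compact) (auto intro: c)
  also have "(\<lambda>t. indicator {- (R / sin \<alpha>) .. R / sin \<alpha>} t *\<^sub>R \<phi> (bd_param \<alpha> t)) = (\<lambda>t. \<phi> (bd_param \<alpha> t))"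
  proof
    fix t
    have "\<phi> (bd_param \<alpha> t) = 0" if "t \<notin> {- (R / sin \<alpha>) .. R / sin \<alpha>}"
      using that sin_pos by (intro R(2)) (auto simp: bd_param_def field_simps)
    then show "indicator {- (R / sin \<alpha>) .. R / sin \<alpha>} t *\<^sub>R \<phi> (bd_param \<alpha> t) = \<phi> (bd_param \<alpha> t)"
      by (auto simp: indicator_def)
  qed
  finally show i: "integrable lborel (\<lambda>t. \<phi> (bd_param \<alpha> t))" .
  show "integrable lborel (\<lambda>t. sgn t *\<^sub>R \<phi> (bd_param \<alpha> t))"
    by (rule Bochner_Integration.integrable_bound[OF i])
       (use borel_measurable_integrable[OF i] in \<open>auto simp: sgn_if intro!: AE_I2\<close>)
qed

lemma test_L2_B: "\<phi> \<in> test_functions \<Omega> \<Longrightarrow> \<phi> \<in> L2 B"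
proof -
  assume t: "\<phi> \<in> test_functions \<Omega>"
  have "(\<lambda>z. \<phi> z * cnj (\<phi> z)) \<in> test_functions \<Omega>" using t by (intro test_mult test_cnj test_smooth)
  from integrable_norm[OF bd_integrable(1)[OF this]]
  have i: "integrable lborel (\<lambda>t. (norm (\<phi> (bd_param \<alpha> t)))\<^sup>2)" by (simp add: norm_mult power2_eq_square)
  have b: "\<phi> \<in> borel_measurable borel" by (rule smooth_borel[OF test_smooth[OF t]])
  have "integrable B (\<lambda>z. (norm (\<phi> z))\<^sup>2)"
    unfolding B_eq using i b
    by (subst integrable_distr_eq[OF bd_meas]) (auto intro!: measurable_restrict_space1 borel_measurable_power borel_measurable_norm)
  then show ?thesis using borel_B[OF b] by (simp add: L2_def)
qed

text \<open>
  This and the next lemma are the divergence theorem on the sector: the outward unit normal is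
  \<open>(- sin \<alpha>, cos \<alpha>)\<close> on the upper ray and \<open>(- sin \<alpha>, - cos \<alpha>)\<close> on the lower one.
\<close>

lemma integral_px_sector:
  fixes f :: "real \<times> real \<Rightarrow> complex"
  assumes f: "f \<in> test_functions \<Omega>"
  shows "(\<integral>z. px f z \<partial>U) = - sin \<alpha> * (\<integral>t. f (bd_param \<alpha> t) \<partial>lborel)"
proof -
  note s = test_smooth[OF f]
  have pb: "smooth (px f)" using s by (intro smooth_partial) (auto simp: Basis_plane)
  obtain R where R: "R > 0" "\<And>z. z \<notin> {-R..R} \<times> {-R..R} \<Longrightarrow> f z = 0" using test_box[OF f] by blast
  have p0: "px f z = 0" if "z \<notin> {-R..R} \<times> {-R..R}" for z
    by (rule partial_deriv_zero_outside[OF _ R(2) that]) (auto intro: closed_Times)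
  have i: "integrable lborel (px f)" using test_integrable[OF test_partial[OF f]] by (auto simp: Basis_plane)
  have inner: "(\<integral>x. indicator S (x, y) *\<^sub>R px f (x, y) \<partial>lborel) = - f (\<bar>y\<bar> / T, y)" for y
  proof -
    have "(\<integral>x. indicator S (x, y) *\<^sub>R px f (x, y) \<partial>lborel)
        = (\<integral>x. indicator {\<bar>y\<bar> / T .. R + 1 + \<bar>y\<bar> / T} x *\<^sub>R px f (x, y) \<partial>lborel)"
    proof (rule integral_cong_AE)
      show "AE x in lborel. indicator S (x, y) *\<^sub>R px f (x, y) = indicator {\<bar>y\<bar> / T .. R + 1 + \<bar>y\<bar> / T} x *\<^sub>R px f (x, y)"
        using AE_lborel_singleton[of "\<bar>y\<bar> / T"]
      proof eventually_elim
        case (elim x)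
        have "px f (x, y) = 0" if "x > R + 1 + \<bar>y\<bar> / T"
        proof -
          have "0 \<le> \<bar>y\<bar> / T" using T_pos by simp
          then show ?thesis using that by (intro p0) auto
        qed
        moreover have "(x, y) \<in> S \<longleftrightarrow> \<bar>y\<bar> / T < x"
        proof -
          have "\<bar>y\<bar> / T < x \<longleftrightarrow> \<bar>y\<bar> < T * x" using T_pos by (simp add: pos_divide_less_eq mult.commute)
          moreover have "0 < x" if "\<bar>y\<bar> / T < x"
            using that T_pos by (intro le_less_trans[OF _ that]) simp
          ultimately show ?thesis by (auto simp: S_eq)
        qed
        ultimately show ?case using elim by (auto simp: indicator_def)
      qed
      have [measurable]: "(\<lambda>x. px f (x, y)) \<in> borel_measurable borel"
        using measurable_compose[OF _ smooth_borel[OF pb], of "\<lambda>x. (x, y)" borel] by simp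
      show "(\<lambda>x. indicator S (x, y) *\<^sub>R px f (x, y)) \<in> borel_measurable lborel"
        using measurable_compose[of "\<lambda>x. (x, y)" borel borel "indicator S :: _ \<Rightarrow> real"] by simp
      show "(\<lambda>x. indicator {\<bar>y\<bar> / T .. R + 1 + \<bar>y\<bar> / T} x *\<^sub>R px f (x, y)) \<in> borel_measurable lborel"
        by measurable
    qed
    also have "\<dots> = f (R + 1 + \<bar>y\<bar> / T, y) - f (\<bar>y\<bar> / T, y)"
      using R(1) by (intro integral_FTC_Icc px_line s continuous_on_compose2[OF smooth_continuous[OF pb]] continuous_intros) auto
    also have "f (R + 1 + \<bar>y\<bar> / T, y) = 0" 
    proof -
      have "0 \<le> \<bar>y\<bar> / T" using T_pos by simp
      then show ?thesis by (intro R(2)) auto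
    qed
    finally show ?thesis by simp
  qed
  have "(\<integral>z. px f z \<partial>U) = (\<integral>z. indicator S z *\<^sub>R px f z \<partial>lborel)" by (rule integral_U[OF smooth_borel[OF pb]])
  also have "\<dots> = (\<integral>y. (\<integral>x. indicator S (x, y) *\<^sub>R px f (x, y) \<partial>lborel) \<partial>lborel)"
    by (rule fubini_lborel(2)[symmetric]) (rule integrable_U(2)[OF i])
  also have "\<dots> = (\<integral>y. - f (\<bar>y\<bar> / T, y) \<partial>lborel)" by (simp only: inner)
  also have "\<dots> = \<bar>sin \<alpha>\<bar> *\<^sub>R (\<integral>t. - f (\<bar>0 + sin \<alpha> * t\<bar> / T, 0 + sin \<alpha> * t) \<partial>lborel)"
    using sin_pos by (intro lborel_integral_real_affine) auto
  also have "(\<lambda>t. - f (\<bar>0 + sin \<alpha> * t\<bar> / T, 0 + sin \<alpha> * t)) = (\<lambda>t. - f (bd_param \<alpha> t))"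
    using sin_pos cos_pos by (auto simp: bd_param_def T_eq abs_mult mult.commute)
  finally show ?thesis using sin_pos by (simp add: scaleR_conv_of_real)
qed

lemma integral_py_sector:
  fixes f :: "real \<times> real \<Rightarrow> complex"
  assumes f: "f \<in> test_functions \<Omega>"
  shows "(\<integral>z. py f z \<partial>U) = cos \<alpha> * (\<integral>t. sgn t *\<^sub>R f (bd_param \<alpha> t) \<partial>lborel)"
proof -
  note s = test_smooth[OF f]
  have pb: "smooth (py f)" using s by (intro smooth_partial) (auto simp: Basis_plane)
  have i: "integrable lborel (py f)" using test_integrable[OF test_partial[OF f]] by (auto simp: Basis_plane)
  let ?g = "\<lambda>x. indicator {0<..} x *\<^sub>R f (x, T * x)" and ?h = "\<lambda>x. indicator {0<..} x *\<^sub>R f (x, - T * x)"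
  have inner: "(\<integral>y. indicator S (x, y) *\<^sub>R py f (x, y) \<partial>lborel) = ?g x - ?h x" for x
  proof (cases "x > 0")
    case True
    have "(\<integral>y. indicator S (x, y) *\<^sub>R py f (x, y) \<partial>lborel)
        = (\<integral>y. indicator {- T * x .. T * x} y *\<^sub>R py f (x, y) \<partial>lborel)"
    proof (rule integral_cong_AE)
      show "AE y in lborel. indicator S (x, y) *\<^sub>R py f (x, y) = indicator {- T * x .. T * x} y *\<^sub>R py f (x, y)"
        using AE_lborel_singleton[of "T * x"] AE_lborel_singleton[of "- T * x"]
        by eventually_elim (use True in \<open>auto simp: indicator_def S_eq abs_less_iff\<close>)
      have [measurable]: "(\<lambda>y. py f (x, y)) \<in> borel_measurable borel"
        using measurable_compose[OF _ smooth_borel[OF pb], of "\<lambda>y. (x, y)" borel] by simp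
      show "(\<lambda>y. indicator S (x, y) *\<^sub>R py f (x, y)) \<in> borel_measurable lborel"
        using measurable_compose[of "\<lambda>y. (x, y)" borel borel "indicator S :: _ \<Rightarrow> real"] by simp
      show "(\<lambda>y. indicator {- T * x .. T * x} y *\<^sub>R py f (x, y)) \<in> borel_measurable lborel" by measurable
    qed
    also have "\<dots> = f (x, T * x) - f (x, - T * x)"
      using True T_pos by (intro integral_FTC_Icc py_line s continuous_on_compose2[OF smooth_continuous[OF pb]] continuous_intros) auto
    finally show ?thesis using True by simp
  qed (simp add: S_eq)
  have bi: "integrable lborel (\<lambda>t. indicator {0<..} t *\<^sub>R f (bd_param \<alpha> t))"
    "integrable lborel (\<lambda>t. indicator {..<0} t *\<^sub>R f (bd_param \<alpha> t))"
    by (intro integrable_mult_indicator bd_integrable[OF f], simp)+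
  have g: "?g (0 + cos \<alpha> * t) = indicator {0<..} t *\<^sub>R f (bd_param \<alpha> t)" for t
    using cos_pos by (auto simp: indicator_def bd_param_def T_eq zero_less_mult_iff mult.commute)
  have h: "?h (0 + (- cos \<alpha>) * t) = indicator {..<0} t *\<^sub>R f (bd_param \<alpha> t)" for t
    using cos_pos by (auto simp: indicator_def bd_param_def T_eq mult_less_0_iff mult.commute)
  have gi: "integrable lborel ?g"
    using bi(1) lborel_integrable_real_affine_iff[of "cos \<alpha>" ?g 0] cos_pos by (simp only: g)
  have hi: "integrable lborel ?h"
    using bi(2) lborel_integrable_real_affine_iff[of "- cos \<alpha>" ?h 0] cos_pos by (simp only: h)
  have "(\<integral>z. py f z \<partial>U) = (\<integral>z. indicator S z *\<^sub>R py f z \<partial>lborel)" by (rule integral_U[OF smooth_borel[OF pb]])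
  also have "\<dots> = (\<integral>x. (\<integral>y. indicator S (x, y) *\<^sub>R py f (x, y) \<partial>lborel) \<partial>lborel)"
    by (rule fubini_lborel(1)[symmetric]) (rule integrable_U(2)[OF i])
  also have "\<dots> = (\<integral>x. ?g x \<partial>lborel) - (\<integral>x. ?h x \<partial>lborel)"
    unfolding inner by (rule Bochner_Integration.integral_diff[OF gi hi])
  also have "(\<integral>x. ?g x \<partial>lborel) = \<bar>cos \<alpha>\<bar> *\<^sub>R (\<integral>t. ?g (0 + cos \<alpha> * t) \<partial>lborel)"
    using cos_pos by (intro lborel_integral_real_affine) auto
  also have "(\<integral>x. ?h x \<partial>lborel) = \<bar>- cos \<alpha>\<bar> *\<^sub>R (\<integral>t. ?h (0 + (- cos \<alpha>) * t) \<partial>lborel)"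
    using cos_pos by (intro lborel_integral_real_affine) auto
  also have "\<bar>cos \<alpha>\<bar> *\<^sub>R (\<integral>t. ?g (0 + cos \<alpha> * t) \<partial>lborel) - \<bar>- cos \<alpha>\<bar> *\<^sub>R (\<integral>t. ?h (0 + (- cos \<alpha>) * t) \<partial>lborel)
     = cos \<alpha> *\<^sub>R (\<integral>t. indicator {0<..} t *\<^sub>R f (bd_param \<alpha> t) - indicator {..<0} t *\<^sub>R f (bd_param \<alpha> t) \<partial>lborel)"
    unfolding g h Bochner_Integration.integral_diff[OF bi] using cos_pos by (simp add: scaleR_right_diff_distrib)
  also have "(\<lambda>t. indicator {0<..} t *\<^sub>R f (bd_param \<alpha> t) - indicator {..<0} t *\<^sub>R f (bd_param \<alpha> t)) = (\<lambda>t. sgn t *\<^sub>R f (bd_param \<alpha> t))"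
    by (auto simp: indicator_def sgn_if)
  finally show ?thesis by (simp add: scaleR_conv_of_real)
qed

text \<open>
  Apply \<open>integral_px_sector\<close> to \<open>\<bar>f\<bar>\<^sup>2\<close>: the first component of the normal is the
  constant \<open>- sin \<alpha>\<close>, so the horizontal derivative alone controls the boundary values.
\<close>

lemma trace_inequality:
  fixes f :: "real \<times> real \<Rightarrow> complex"
  assumes f: "f \<in> test_functions \<Omega>"
  shows "sin \<alpha> * (L2_norm B f)\<^sup>2 \<le> (L2_norm U f)\<^sup>2 + (L2_norm U (px f))\<^sup>2"
proof -
  note s = test_smooth[OF f]
  have pf: "px f \<in> test_functions \<Omega>" using f by (intro test_partial) (auto simp: Basis_plane)
  let ?F = "\<lambda>z. f z * cnj (f z)"
  have F: "?F \<in> test_functions \<Omega>" using f by (intro test_mult test_cnj s)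
  have pF: "px ?F z = f z * cnj (px f z) + px f z * cnj (f z)" for z
    using smooth_differentiable[OF s] smooth_differentiable[of "\<lambda>z. cnj (f z)" z] s
    by (simp add: partial_deriv_mult partial_deriv_cnj C_k_cnj)
  have "(L2_norm B f)\<^sup>2 = (\<integral>t. (norm (f (bd_param \<alpha> t)))\<^sup>2 \<partial>lborel)"
    unfolding L2_norm_sq B_eq using smooth_borel[OF s]
    by (intro integral_distr bd_meas) (auto intro!: measurable_restrict_space1)
  then have "complex_of_real ((L2_norm B f)\<^sup>2) = (\<integral>t. ?F (bd_param \<alpha> t) \<partial>lborel)"
    by (simp add: complex_norm_square[symmetric] del: of_real_power)
  then have "complex_of_real (sin \<alpha> * (L2_norm B f)\<^sup>2) = - (\<integral>z. px ?F z \<partial>U)"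
    unfolding integral_px_sector[OF F] by simp
  then have "norm (complex_of_real (sin \<alpha> * (L2_norm B f)\<^sup>2)) = norm (\<integral>z. px ?F z \<partial>U)"
    by (simp only: norm_minus_cancel)
  then have "sin \<alpha> * (L2_norm B f)\<^sup>2 = norm (\<integral>z. px ?F z \<partial>U)"
    using sin_pos by (simp only: norm_of_real abs_of_nonneg[OF mult_nonneg_nonneg[OF less_imp_le zero_le_power2]])
  also have "\<dots> \<le> (\<integral>z. (norm (f z))\<^sup>2 + (norm (px f z))\<^sup>2 \<partial>U)"
  proof (rule order.trans[OF integral_norm_bound])
    have "integrable U (px ?F)"
      using test_integrable[OF test_partial[OF F]] by (intro integrable_U) (auto simp: Basis_plane)
    then show "(\<integral>z. norm (px ?F z) \<partial>U) \<le> (\<integral>z. (norm (f z))\<^sup>2 + (norm (px f z))\<^sup>2 \<partial>U)"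
    proof (intro integral_mono Bochner_Integration.integrable_add L2_integrable test_L2_U[OF f] test_L2_U[OF pf])
      fix z
      have "norm (px ?F z) \<le> 2 * (norm (f z) * norm (px f z))"
        unfolding pF by (rule order.trans[OF norm_triangle_ineq]) (simp add: norm_mult)
      also have "\<dots> \<le> (norm (f z))\<^sup>2 + (norm (px f z))\<^sup>2"
        using sum_squares_bound[of "norm (f z)" "norm (px f z)"] by simp
      finally show "norm (px ?F z) \<le> (norm (f z))\<^sup>2 + (norm (px f z))\<^sup>2" .
    qed auto
  qed
  also have "\<dots> = (L2_norm U f)\<^sup>2 + (L2_norm U (px f))\<^sup>2"
    unfolding L2_norm_sq by (intro Bochner_Integration.integral_add L2_integrable test_L2_U[OF f] test_L2_U[OF pf])
  finally show ?thesis .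
qed

end

section \<open>Mollification\<close>

lemma nn_integral_lborel_shift:
  fixes f :: "'a::euclidean_space \<Rightarrow> ennreal"
  assumes [measurable]: "f \<in> borel_measurable borel"
  shows "(\<integral>\<^sup>+x. f (x - z) \<partial>lborel) = (\<integral>\<^sup>+x. f x \<partial>lborel)"
    and "(\<integral>\<^sup>+x. f (z - x) \<partial>lborel) = (\<integral>\<^sup>+x. f x \<partial>lborel)"
proof -
  have 1: "distr lborel borel (\<lambda>x. - z + x) = (lborel :: 'a measure)"
    using lborel_affine[of 1 "- z"] by (simp add: density_1)
  have 2: "distr lborel borel (\<lambda>x. z - x) = (lborel :: 'a measure)"
    using lborel_affine[of "-1" z] by (simp add: density_1)
  have "(\<integral>\<^sup>+x. f x \<partial>lborel) = (\<integral>\<^sup>+x. f x \<partial>distr lborel borel (\<lambda>x. - z + x))" by (simp only: 1)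
  also have "\<dots> = (\<integral>\<^sup>+x. f (x - z) \<partial>lborel)" by (subst nn_integral_distr) auto
  finally show "(\<integral>\<^sup>+x. f (x - z) \<partial>lborel) = (\<integral>\<^sup>+x. f x \<partial>lborel)" by simp
  have "(\<integral>\<^sup>+x. f x \<partial>lborel) = (\<integral>\<^sup>+x. f x \<partial>distr lborel borel (\<lambda>x. z - x))" by (simp only: 2)
  also have "\<dots> = (\<integral>\<^sup>+x. f (z - x) \<partial>lborel)" by (subst nn_integral_distr) auto
  finally show "(\<integral>\<^sup>+x. f (z - x) \<partial>lborel) = (\<integral>\<^sup>+x. f x \<partial>lborel)" by simp
qed

text \<open>
  Continuity of translations in \<open>L\<^sup>1\<close>, at the zero vector.
\<close>

definition L1_translation_cont :: "('a::euclidean_space \<Rightarrow> real) \<Rightarrow> bool" where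
  "L1_translation_cont f \<longleftrightarrow>
     (\<forall>e>0. \<exists>d>0. \<forall>z. norm z < d \<longrightarrow> (\<integral>\<^sup>+x. ennreal \<bar>f (x - z) - f x\<bar> \<partial>lborel) \<le> ennreal e)"

text \<open>
  The property passes to \<open>L\<^sup>1\<close>-limits; it is verified in turn for Lipschitz functions, indicators of
  compact sets, indicators of sets of finite measure, and integrable functions.
\<close>

lemma L1_translation_cont_approx:
  fixes f :: "'a::euclidean_space \<Rightarrow> real"
  assumes [measurable]: "f \<in> borel_measurable borel"
    and ex: "\<And>e. e > 0 \<Longrightarrow> \<exists>g\<in>borel_measurable borel. L1_translation_cont g \<and> (\<integral>\<^sup>+x. ennreal \<bar>f x - g x\<bar> \<partial>lborel) \<le> ennreal e"
  shows "L1_translation_cont f"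
  unfolding L1_translation_cont_def
proof (intro allI impI)
  fix e :: real assume e: "e > 0"
  obtain g where gm [measurable]: "g \<in> borel_measurable borel" and g: "L1_translation_cont g"
    and fg: "(\<integral>\<^sup>+x. ennreal \<bar>f x - g x\<bar> \<partial>lborel) \<le> ennreal (e/3)"
    using ex[of "e/3"] e by auto
  obtain d where d: "d > 0" "\<And>z. norm z < d \<Longrightarrow> (\<integral>\<^sup>+x. ennreal \<bar>g (x - z) - g x\<bar> \<partial>lborel) \<le> ennreal (e/3)"
    using g e unfolding L1_translation_cont_def by (meson divide_pos_pos zero_less_numeral)
  have "(\<integral>\<^sup>+x. ennreal \<bar>f (x - z) - f x\<bar> \<partial>lborel) \<le> ennreal e" if z: "norm z < d" for z
  proof -
    have "(\<integral>\<^sup>+x. ennreal \<bar>f (x - z) - f x\<bar> \<partial>lborel)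
       \<le> (\<integral>\<^sup>+x. ennreal \<bar>f (x - z) - g (x - z)\<bar> + ennreal \<bar>g (x - z) - g x\<bar> + ennreal \<bar>f x - g x\<bar> \<partial>lborel)"
      by (intro nn_integral_mono) (simp add: ennreal_plus[symmetric] ennreal_leI del: ennreal_plus)
    also have "\<dots> = (\<integral>\<^sup>+x. ennreal \<bar>f (x - z) - g (x - z)\<bar> \<partial>lborel) + (\<integral>\<^sup>+x. ennreal \<bar>g (x - z) - g x\<bar> \<partial>lborel)
       + (\<integral>\<^sup>+x. ennreal \<bar>f x - g x\<bar> \<partial>lborel)"
      by (simp add: nn_integral_add)
    also have "(\<integral>\<^sup>+x. ennreal \<bar>f (x - z) - g (x - z)\<bar> \<partial>lborel) = (\<integral>\<^sup>+x. ennreal \<bar>f x - g x\<bar> \<partial>lborel)"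
      by (rule nn_integral_lborel_shift(1)[where f="\<lambda>x. ennreal \<bar>f x - g x\<bar>"]) simp
    also have "(\<integral>\<^sup>+x. ennreal \<bar>f x - g x\<bar> \<partial>lborel) + (\<integral>\<^sup>+x. ennreal \<bar>g (x - z) - g x\<bar> \<partial>lborel)
       + (\<integral>\<^sup>+x. ennreal \<bar>f x - g x\<bar> \<partial>lborel) \<le> ennreal (e/3) + ennreal (e/3) + ennreal (e/3)"
      by (intro add_mono fg d z)
    also have "\<dots> = ennreal e" using e by (simp add: ennreal_plus[symmetric] del: ennreal_plus)
    finally show ?thesis .
  qed
  with d(1) show "\<exists>d>0. \<forall>z. norm z < d \<longrightarrow> (\<integral>\<^sup>+x. ennreal \<bar>f (x - z) - f x\<bar> \<partial>lborel) \<le> ennreal e" by blast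
qed

lemma L1_translation_cont_add:
  fixes f g :: "'a::euclidean_space \<Rightarrow> real"
  assumes [measurable]: "f \<in> borel_measurable borel" "g \<in> borel_measurable borel"
    and f: "L1_translation_cont f" and g: "L1_translation_cont g"
  shows "L1_translation_cont (\<lambda>x. f x + g x)"
  unfolding L1_translation_cont_def
proof (intro allI impI)
  fix e :: real assume e: "e > 0"
  obtain d where d: "d > 0" "\<And>z. norm z < d \<Longrightarrow> (\<integral>\<^sup>+x. ennreal \<bar>f (x - z) - f x\<bar> \<partial>lborel) \<le> ennreal (e/2)"
    using f e unfolding L1_translation_cont_def by (meson divide_pos_pos zero_less_numeral)
  obtain d' where d': "d' > 0" "\<And>z. norm z < d' \<Longrightarrow> (\<integral>\<^sup>+x. ennreal \<bar>g (x - z) - g x\<bar> \<partial>lborel) \<le> ennreal (e/2)"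
    using g e unfolding L1_translation_cont_def by (meson divide_pos_pos zero_less_numeral)
  have "(\<integral>\<^sup>+x. ennreal \<bar>(f (x - z) + g (x - z)) - (f x + g x)\<bar> \<partial>lborel) \<le> ennreal e" if z: "norm z < min d d'" for z
  proof -
    have "(\<integral>\<^sup>+x. ennreal \<bar>(f (x - z) + g (x - z)) - (f x + g x)\<bar> \<partial>lborel)
       \<le> (\<integral>\<^sup>+x. ennreal \<bar>f (x - z) - f x\<bar> + ennreal \<bar>g (x - z) - g x\<bar> \<partial>lborel)"
      by (intro nn_integral_mono) (simp add: ennreal_plus[symmetric] ennreal_leI del: ennreal_plus)
    also have "\<dots> = (\<integral>\<^sup>+x. ennreal \<bar>f (x - z) - f x\<bar> \<partial>lborel) + (\<integral>\<^sup>+x. ennreal \<bar>g (x - z) - g x\<bar> \<partial>lborel)"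
      by (simp add: nn_integral_add)
    also have "\<dots> \<le> ennreal (e/2) + ennreal (e/2)" using z by (intro add_mono d d') auto
    also have "\<dots> = ennreal e" using e by (simp add: ennreal_plus[symmetric] del: ennreal_plus)
    finally show ?thesis .
  qed
  then show "\<exists>d>0. \<forall>z. norm z < d \<longrightarrow> (\<integral>\<^sup>+x. ennreal \<bar>(f (x - z) + g (x - z)) - (f x + g x)\<bar> \<partial>lborel) \<le> ennreal e"
    using d(1) d'(1) by (intro exI[of _ "min d d'"]) auto
qed

lemma L1_translation_cont_cmult:
  fixes f :: "'a::euclidean_space \<Rightarrow> real"
  assumes [measurable]: "f \<in> borel_measurable borel" and f: "L1_translation_cont f"
  shows "L1_translation_cont (\<lambda>x. f x * c)"
  unfolding L1_translation_cont_def
proof (intro allI impI)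
  fix e :: real assume e: "e > 0"
  then have "e / (\<bar>c\<bar> + 1) > 0" by simp
  then obtain d where d: "d > 0" "\<And>z. norm z < d \<Longrightarrow> (\<integral>\<^sup>+x. ennreal \<bar>f (x - z) - f x\<bar> \<partial>lborel) \<le> ennreal (e / (\<bar>c\<bar> + 1))"
    using f unfolding L1_translation_cont_def by meson
  have "(\<integral>\<^sup>+x. ennreal \<bar>f (x - z) * c - f x * c\<bar> \<partial>lborel) \<le> ennreal e" if z: "norm z < d" for z
  proof -
    have "(\<integral>\<^sup>+x. ennreal \<bar>f (x - z) * c - f x * c\<bar> \<partial>lborel) = ennreal \<bar>c\<bar> * (\<integral>\<^sup>+x. ennreal \<bar>f (x - z) - f x\<bar> \<partial>lborel)"
      by (subst nn_integral_cmult[symmetric])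
         (auto simp: ennreal_mult[symmetric] abs_mult[symmetric] algebra_simps intro!: nn_integral_cong)
    also have "\<dots> \<le> ennreal \<bar>c\<bar> * ennreal (e / (\<bar>c\<bar> + 1))" by (intro mult_left_mono d z) simp
    also have "\<dots> = ennreal (\<bar>c\<bar> * (e / (\<bar>c\<bar> + 1)))" using e by (intro ennreal_mult[symmetric]) auto
    also have "\<dots> \<le> ennreal e" using e by (intro ennreal_leI) (simp add: field_simps)
    finally show ?thesis .
  qed
  with d(1) show "\<exists>d>0. \<forall>z. norm z < d \<longrightarrow> (\<integral>\<^sup>+x. ennreal \<bar>f (x - z) * c - f x * c\<bar> \<partial>lborel) \<le> ennreal e" by blast
qed

lemma L1_translation_cont_lipschitz:
  fixes g :: "'a::euclidean_space \<Rightarrow> real"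
  assumes M: "\<And>x y. \<bar>g x - g y\<bar> \<le> M * norm (x - y)" and R: "\<And>x. norm x > R \<Longrightarrow> g x = 0"
  shows "L1_translation_cont g"
  unfolding L1_translation_cont_def
proof (intro allI impI)
  fix e :: real assume e: "e > 0"
  define V where "V = measure lborel (cball (0::'a) (R + 1))"
  define M' where "M' = \<bar>M\<bar> + 1"
  have M': "M' > 0" "\<bar>g x - g y\<bar> \<le> M' * norm (x - y)" for x y
  proof -
    show "M' > 0" by (simp add: M'_def)
    have "M * norm (x - y) \<le> M' * norm (x - y)" by (intro mult_right_mono) (auto simp: M'_def)
    then show "\<bar>g x - g y\<bar> \<le> M' * norm (x - y)" using M[of x y] by linarith
  qed
  have V: "V \<ge> 0" by (simp add: V_def)
  define d where "d = min 1 (e / (M' * (V + 1)))"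
  have d: "d > 0" using e M' V by (simp add: d_def)
  have "(\<integral>\<^sup>+x. ennreal \<bar>g (x - z) - g x\<bar> \<partial>lborel) \<le> ennreal e" if z: "norm z < d" for z
  proof -
    have z1: "norm z \<le> 1" "norm z \<le> e / (M' * (V + 1))" using z by (auto simp: d_def)
    have "(\<integral>\<^sup>+x. ennreal \<bar>g (x - z) - g x\<bar> \<partial>lborel) \<le> (\<integral>\<^sup>+x. ennreal (M' * norm z) * indicator (cball (0::'a) (R + 1)) x \<partial>lborel)"
    proof (rule nn_integral_mono)
      fix x
      show "ennreal \<bar>g (x - z) - g x\<bar> \<le> ennreal (M' * norm z) * indicator (cball 0 (R + 1)) x"
      proof (cases "norm x \<le> R + 1")
        case True
        then show ?thesis using M'(2)[of "x - z" x] by (auto intro!: ennreal_leI)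
      next
        case False
        then have "norm (x - z) > R" using norm_triangle_ineq2[of x z] z1 by linarith
        then show ?thesis using False R by auto
      qed
    qed
    also have "\<dots> = ennreal (M' * norm z) * emeasure lborel (cball (0::'a) (R + 1))"
      by (rule nn_integral_cmult_indicator) simp
    also have "emeasure lborel (cball (0::'a) (R + 1)) = ennreal V"
      unfolding V_def by (intro emeasure_eq_ennreal_measure) (use emeasure_lborel_cball_finite[of "0::'a" "R+1"] in \<open>simp add: less_top[symmetric]\<close>)
    also have "ennreal (M' * norm z) * ennreal V = ennreal (M' * norm z * V)" using V M' by (simp add: ennreal_mult)
    also have "\<dots> \<le> ennreal e"
    proof (rule ennreal_leI)
      have "M' * norm z * V \<le> M' * (e / (M' * (V + 1))) * V"
        using z1 V M' by (intro mult_right_mono mult_left_mono) auto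
      also have "M' * (e / (M' * (V + 1))) * V = e * (V / (V + 1))" using M'(1) by simp
      also have "\<dots> \<le> e * 1" using V e by (intro mult_left_mono) auto
      also have "\<dots> = e" by simp
      finally show "M' * norm z * V \<le> e" .
    qed
    finally show ?thesis .
  qed
  with d show "\<exists>d>0. \<forall>z. norm z < d \<longrightarrow> (\<integral>\<^sup>+x. ennreal \<bar>g (x - z) - g x\<bar> \<partial>lborel) \<le> ennreal e" by blast
qed

lemma L1_translation_cont_compact:
  fixes K :: "'a::euclidean_space set"
  assumes K: "compact K"
  shows "L1_translation_cont (indicator K)"
proof (cases "K = {}")
  case True then show ?thesis unfolding L1_translation_cont_def by (auto intro!: exI[of _ 1])
next
  case False
  have [measurable]: "K \<in> sets borel" using K by (simp add: compact_imp_closed)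
  obtain R where R: "\<And>x. x \<in> K \<Longrightarrow> norm x \<le> R" using compact_imp_bounded[OF K] bounded_iff by blast
  \<comment> \<open>Lipschitz functions decreasing to the indicator of \<open>K\<close>.\<close>
  define g where "g m x = max 0 (1 - real m * infdist x K)" for m :: nat and x
  have gm [measurable]: "g m \<in> borel_measurable borel" for m
    unfolding g_def by (intro borel_measurable_continuous_onI continuous_intros)
  have g0: "g m x = 0" if "m \<ge> 1" "norm x > R + 1" for m x
  proof -
    obtain k where k: "k \<in> K" "infdist x K = dist x k" using infdist_attains_inf[of K x] K False compact_imp_closed by blast
    have "norm x \<le> norm k + dist x k" using norm_triangle_ineq2[of x k] by (simp add: dist_norm)
    then have i: "infdist x K \<ge> 1" using R[OF k(1)] that(2) k(2) by linarith
    have "1 * 1 \<le> real m * infdist x K" using that(1) i by (intro mult_mono) auto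
    then show ?thesis by (simp add: g_def)
  qed
  have T: "L1_translation_cont (g m)" if "m \<ge> 1" for m
  proof (rule L1_translation_cont_lipschitz[where M="real m" and R="R + 1"])
    fix x y
    have "\<bar>infdist x K - infdist y K\<bar> \<le> norm (x - y)"
      using infdist_triangle_abs[of x K y] by (simp add: dist_norm)
    then have "real m * \<bar>infdist x K - infdist y K\<bar> \<le> real m * norm (x - y)" by (intro mult_left_mono) auto
    then have "\<bar>real m * infdist x K - real m * infdist y K\<bar> \<le> real m * norm (x - y)"
      by (simp add: abs_mult right_diff_distrib[symmetric])
    then show "\<bar>g m x - g m y\<bar> \<le> real m * norm (x - y)" unfolding g_def by linarith
  qed (use g0 that in auto)
  have lim: "(\<lambda>m. \<integral>\<^sup>+x. ennreal \<bar>indicator K x - g (Suc m) x\<bar> \<partial>lborel) \<longlonglongrightarrow> (\<integral>\<^sup>+x. 0 \<partial>(lborel :: 'a measure))"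
  proof (rule nn_integral_dominated_convergence[where w="indicator (cball 0 (R + 1))"])
    show "(\<integral>\<^sup>+x. indicator (cball (0::'a) (R + 1)) x \<partial>lborel) < \<infinity>"
      using emeasure_lborel_cball_finite[of "0::'a" "R+1"] by simp
    have "ennreal \<bar>indicator K x - g (Suc m) x\<bar> \<le> indicator (cball 0 (R + 1)) x" for m x
    proof (cases "norm x \<le> R + 1")
      case True
      have "0 \<le> g (Suc m) x" "g (Suc m) x \<le> 1" using infdist_nonneg[of x K] by (auto simp: g_def)
      then have "\<bar>indicator K x - g (Suc m) x\<bar> \<le> 1" by (auto simp: indicator_def)
      then show ?thesis using True by (simp add: ennreal_le_1)
    next
      case False
      then have "x \<notin> K" using R[of x] by force
      then show ?thesis using False g0[of "Suc m" x] by simp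
    qed
    then show "AE x in lborel. ennreal \<bar>indicator K x - g (Suc m) x\<bar> \<le> indicator (cball 0 (R + 1)) x" for m by simp
    have "(\<lambda>m. ennreal \<bar>indicator K x - g (Suc m) x\<bar>) \<longlonglongrightarrow> 0" for x
    proof (cases "x \<in> K")
      case True then show ?thesis by (simp add: g_def)
    next
      case False
      then have "infdist x K > 0"
        using \<open>K \<noteq> {}\<close> in_closed_iff_infdist_zero[of K x] compact_imp_closed[OF K] infdist_nonneg[of x K] by linarith
      then obtain N where N: "1 < real N * infdist x K" using reals_Archimedean3 by blast
      have "g (Suc m) x = 0" if "m \<ge> N" for m
      proof -
        have "real N * infdist x K \<le> real (Suc m) * infdist x K" using that infdist_nonneg[of x K] by (intro mult_right_mono) auto
        then show ?thesis using N by (simp add: g_def)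
      qed
      then have "\<forall>\<^sub>F m in sequentially. ennreal \<bar>indicator K x - g (Suc m) x\<bar> = 0"
        unfolding eventually_sequentially using False by auto
      then show ?thesis by (rule tendsto_eventually)
    qed
    then show "AE x in lborel. (\<lambda>m. ennreal \<bar>indicator K x - g (Suc m) x\<bar>) \<longlonglongrightarrow> 0" by simp
  qed (auto intro!: borel_measurable_indicator borel_closed)
  show ?thesis
  proof (rule L1_translation_cont_approx)
    fix e :: real assume "e > 0"
    then have "\<forall>\<^sub>F m in sequentially. (\<integral>\<^sup>+x. ennreal \<bar>indicator K x - g (Suc m) x\<bar> \<partial>lborel) < ennreal e"
      using lim by (intro order_tendstoD) auto
    then obtain m where "(\<integral>\<^sup>+x. ennreal \<bar>indicator K x - g (Suc m) x\<bar> \<partial>lborel) < ennreal e"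
      unfolding eventually_sequentially by blast
    then show "\<exists>g\<in>borel_measurable borel. L1_translation_cont g \<and> (\<integral>\<^sup>+x. ennreal \<bar>indicator K x - g x\<bar> \<partial>lborel) \<le> ennreal e"
      using T[of "Suc m"] gm by (intro bexI[of _ "g (Suc m)"]) auto
  qed simp
qed

lemma L1_translation_cont_indicator:
  fixes A :: "'a::euclidean_space set"
  assumes A [measurable]: "A \<in> sets borel" and fin: "emeasure lborel A < \<infinity>"
  shows "L1_translation_cont (indicator A)"
proof (rule L1_translation_cont_approx)
  fix e :: real assume e: "e > 0"
  define M where "M = density lborel (indicator A :: 'a \<Rightarrow> ennreal)"
  have M: "emeasure M X = emeasure lborel (X \<inter> A)" if "X \<in> sets borel" for X
    unfolding M_def using that by (subst emeasure_density) (auto simp: indicator_inter_arith[symmetric] Int_commute)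
  have "emeasure M A = (SUP K\<in>{K. K \<subseteq> A \<and> compact K}. emeasure M K)"
    by (rule inner_regular) (use fin A M[of UNIV] in \<open>auto simp: M_def\<close>)
  then have sup: "emeasure lborel A = (SUP K\<in>{K. K \<subseteq> A \<and> compact K}. emeasure M K)" using M[OF A] by simp
  have "\<exists>K. K \<subseteq> A \<and> compact K \<and> emeasure lborel A \<le> emeasure M K + ennreal e"
  proof (cases "emeasure lborel A = 0")
    case True then show ?thesis by (intro exI[of _ "{}"]) auto
  next
    case False
    then have "emeasure lborel A - ennreal e < emeasure lborel A"
      using e fin by (intro ennreal_between) (auto simp: zero_less_iff_neq_zero)
    then obtain K where "K \<subseteq> A" "compact K" "emeasure lborel A - ennreal e < emeasure M K"
      unfolding sup less_SUP_iff by blast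
    then show ?thesis by (intro exI[of _ K]) (auto simp: ennreal_minus_le_iff add.commute dest: less_imp_le)
  qed
  then obtain K where K: "K \<subseteq> A" "compact K" "emeasure lborel A \<le> emeasure M K + ennreal e" by blast
  have [measurable]: "K \<in> sets borel" using K by (simp add: compact_imp_closed)
  have MK: "emeasure M K = emeasure lborel K" using M[of K] K(1) by (simp add: Int_absorb2)
  have "(\<integral>\<^sup>+x. ennreal \<bar>indicator A x - indicator K x\<bar> \<partial>lborel) = (\<integral>\<^sup>+x. indicator (A - K) x \<partial>lborel)"
    using K(1) by (intro nn_integral_cong) (auto simp: indicator_def)
  also have "\<dots> = emeasure lborel A - emeasure lborel K"
  proof -
    have "emeasure lborel K \<noteq> \<infinity>" using emeasure_mono[OF K(1), of lborel] fin by (auto simp: top_unique)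
    then show ?thesis using K(1) by (subst nn_integral_indicator) (auto simp: emeasure_Diff)
  qed
  also have "\<dots> \<le> ennreal e" using K(3) fin unfolding MK by (auto simp: ennreal_minus_le_iff)
  finally show "\<exists>g\<in>borel_measurable borel. L1_translation_cont g \<and> (\<integral>\<^sup>+x. ennreal \<bar>indicator A x - g x\<bar> \<partial>lborel) \<le> ennreal e"
    using L1_translation_cont_compact[OF K(2)] by (intro bexI[of _ "indicator K"]) auto
qed simp

lemma L1_translation_cont_integrable:
  fixes f :: "'a::euclidean_space \<Rightarrow> real"
  assumes "integrable lborel f"
  shows "L1_translation_cont f"
  using assms
proof (induction rule: integrable_induct)
  case (base A c)
  then have "L1_translation_cont (\<lambda>x. indicator A x * c)"
    by (intro L1_translation_cont_cmult L1_translation_cont_indicator) auto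
  then show ?case by simp
next
  case (add f g)
  then show ?case by (intro L1_translation_cont_add) (auto dest: borel_measurable_integrable)
next
  case (lim f s)
  note [measurable] = borel_measurable_integrable[OF lim.hyps(1)] borel_measurable_integrable[OF lim.hyps(4)]
  have l: "(\<lambda>i. \<integral>\<^sup>+x. ennreal \<bar>f x - s i x\<bar> \<partial>lborel) \<longlonglongrightarrow> (\<integral>\<^sup>+x. 0 \<partial>(lborel :: 'a measure))"
  proof (rule nn_integral_dominated_convergence[where w="\<lambda>x. ennreal (3 * \<bar>f x\<bar>)"])
    have "integrable lborel (\<lambda>x. 3 * \<bar>f x\<bar>)" using lim.hyps(4) by simp
    then show "(\<integral>\<^sup>+x. ennreal (3 * \<bar>f x\<bar>) \<partial>lborel) < \<infinity>" by (simp add: nn_integral_eq_integral)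
    show "AE x in lborel. ennreal \<bar>f x - s i x\<bar> \<le> ennreal (3 * \<bar>f x\<bar>)" for i
    proof (rule AE_I2)
      fix x :: 'a
      have "\<bar>s i x\<bar> \<le> 2 * \<bar>f x\<bar>" using lim.hyps(3)[of x i] by simp
      then show "ennreal \<bar>f x - s i x\<bar> \<le> ennreal (3 * \<bar>f x\<bar>)" by (intro ennreal_leI) linarith
    qed
    show "AE x in lborel. (\<lambda>i. ennreal \<bar>f x - s i x\<bar>) \<longlonglongrightarrow> 0"
    proof (rule AE_I2)
      fix x :: 'a
      have "(\<lambda>i. ennreal \<bar>f x - s i x\<bar>) \<longlonglongrightarrow> ennreal \<bar>f x - f x\<bar>"
        using lim.hyps(2)[of x] by (intro tendsto_intros) auto
      then show "(\<lambda>i. ennreal \<bar>f x - s i x\<bar>) \<longlonglongrightarrow> 0" by simp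
    qed
  qed measurable
  show ?case
  proof (rule L1_translation_cont_approx)
    fix e :: real assume "e > 0"
    then have "\<forall>\<^sub>F m in sequentially. (\<integral>\<^sup>+x. ennreal \<bar>f x - s m x\<bar> \<partial>lborel) < ennreal e"
      using l by (intro order_tendstoD) auto
    then obtain m where m: "(\<integral>\<^sup>+x. ennreal \<bar>f x - s m x\<bar> \<partial>lborel) < ennreal e"
      unfolding eventually_sequentially by blast
    have "s m \<in> borel_measurable borel" using borel_measurable_integrable[OF lim.hyps(1)] by simp
    then show "\<exists>g\<in>borel_measurable borel. L1_translation_cont g \<and> (\<integral>\<^sup>+x. ennreal \<bar>f x - g x\<bar> \<partial>lborel) \<le> ennreal e"
      using m lim.IH[of m] by (intro bexI[of _ "s m"]) auto
  qed (use borel_measurable_integrable[OF lim.hyps(4)] in simp)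
qed

text \<open>
  Reduction to \<open>L\<^sup>1\<close>: for nonnegative \<open>a, b\<close> one has \<open>(a - b)\<^sup>2 \<le> \<bar>a\<^sup>2 - b\<^sup>2\<bar>\<close>, and squares of
  \<open>L\<^sup>2\<close> functions are integrable.
\<close>

lemma L2_translation_cont:
  fixes f :: "'a::euclidean_space \<Rightarrow> complex"
  assumes [measurable]: "f \<in> borel_measurable borel" and f: "f \<in> L2 lborel" and e: "e > 0"
  shows "\<exists>d>0. \<forall>z. norm z < d \<longrightarrow> (\<integral>\<^sup>+x. ennreal ((norm (f (x - z) - f x))\<^sup>2) \<partial>lborel) \<le> ennreal e"
proof -
  \<comment> \<open>The positive and negative parts of the real and the imaginary part of \<open>f\<close>.\<close>
  define p where "p j x = (if j = (0::nat) then max 0 (Re (f x)) else if j = 1 then max 0 (- Re (f x))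
     else if j = 2 then max 0 (Im (f x)) else max 0 (- Im (f x)))" for j x
  have pm [measurable]: "p j \<in> borel_measurable borel" for j unfolding p_def by measurable
  have p0: "0 \<le> p j x" for j x by (simp add: p_def)
  have pn: "p j x \<le> norm (f x)" for j x
    using abs_Re_le_cmod[of "f x"] abs_Im_le_cmod[of "f x"] by (auto simp: p_def)
  have "integrable lborel (\<lambda>x. (p j x)\<^sup>2)" for j
    by (rule Bochner_Integration.integrable_bound[OF L2_integrable[OF f]]) (auto intro!: AE_I2 power_mono pn p0)
  then have "L1_translation_cont (\<lambda>x. (p j x)\<^sup>2)" for j by (rule L1_translation_cont_integrable)
  then have "\<forall>j. \<exists>d>0. \<forall>z. norm z < d \<longrightarrow> (\<integral>\<^sup>+x. ennreal \<bar>(p j (x - z))\<^sup>2 - (p j x)\<^sup>2\<bar> \<partial>lborel) \<le> ennreal (e/8)"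
    using e unfolding L1_translation_cont_def by (meson divide_pos_pos zero_less_numeral)
  then obtain d where d: "\<And>j. d j > 0" "\<And>j z. norm z < d j \<Longrightarrow>
      (\<integral>\<^sup>+x. ennreal \<bar>(p j (x - z))\<^sup>2 - (p j x)\<^sup>2\<bar> \<partial>lborel) \<le> ennreal (e/8)"
    by (drule_tac choice) blast
  define D where "D = min (min (d 0) (d 1)) (min (d 2) (d 3))"
  have "(\<integral>\<^sup>+x. ennreal ((norm (f (x - z) - f x))\<^sup>2) \<partial>lborel) \<le> ennreal e" if z: "norm z < D" for z
  proof -
    define q where "q j x = \<bar>(p j (x - z))\<^sup>2 - (p j x)\<^sup>2\<bar>" for j x
    have [measurable]: "q j \<in> borel_measurable borel" for j unfolding q_def by measurable
    have qi: "(\<integral>\<^sup>+x. ennreal (q j x) \<partial>lborel) \<le> ennreal (e/8)" if "j \<in> {0,1,2,3}" for j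
      unfolding q_def using that z by (intro d(2)) (auto simp: D_def)
    have sq: "(a - b)\<^sup>2 \<le> \<bar>a\<^sup>2 - b\<^sup>2\<bar>" if "0 \<le> a" "0 \<le> b" for a b :: real
    proof -
      have "(a - b)\<^sup>2 = \<bar>a - b\<bar> * \<bar>a - b\<bar>" by (simp add: power2_eq_square)
      also have "\<dots> \<le> \<bar>a - b\<bar> * \<bar>a + b\<bar>" using that by (intro mult_left_mono) auto
      also have "\<dots> = \<bar>a\<^sup>2 - b\<^sup>2\<bar>" by (simp add: abs_mult[symmetric] power2_eq_square algebra_simps)
      finally show ?thesis .
    qed
    have pq: "(p j (x - z) - p j x)\<^sup>2 \<le> q j x" for j x unfolding q_def by (intro sq p0)
    have two: "(a - b)\<^sup>2 \<le> 2 * a\<^sup>2 + 2 * b\<^sup>2" for a b :: real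
      using zero_le_power2[of "a + b"] by (simp add: power2_sum power2_diff)
    have "(norm (f (x - z) - f x))\<^sup>2 \<le> 2 * q 0 x + 2 * q 1 x + 2 * q 2 x + 2 * q 3 x" for x
    proof -
      have r: "Re (f (x - z) - f x) = (p 0 (x - z) - p 0 x) - (p 1 (x - z) - p 1 x)"
        "Im (f (x - z) - f x) = (p 2 (x - z) - p 2 x) - (p 3 (x - z) - p 3 x)"
        by (auto simp: p_def max_def)
      have "(norm (f (x - z) - f x))\<^sup>2 = (Re (f (x - z) - f x))\<^sup>2 + (Im (f (x - z) - f x))\<^sup>2" by (rule cmod_power2)
      also have "\<dots> \<le> (2 * (p 0 (x - z) - p 0 x)\<^sup>2 + 2 * (p 1 (x - z) - p 1 x)\<^sup>2) +
          (2 * (p 2 (x - z) - p 2 x)\<^sup>2 + 2 * (p 3 (x - z) - p 3 x)\<^sup>2)"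
        unfolding r by (intro add_mono two)
      also have "\<dots> \<le> 2 * q 0 x + 2 * q 1 x + 2 * q 2 x + 2 * q 3 x"
        using pq[of 0 x] pq[of 1 x] pq[of 2 x] pq[of 3 x] by linarith
      finally show ?thesis .
    qed
    then have le: "ennreal ((norm (f (x - z) - f x))\<^sup>2) \<le> ennreal (2 * q 0 x + 2 * q 1 x + 2 * q 2 x + 2 * q 3 x)" for x
      by (rule ennreal_leI)
    have q0: "0 \<le> q j x" for j x by (simp add: q_def)
    have "ennreal ((norm (f (x - z) - f x))\<^sup>2) \<le> 2 * ennreal (q 0 x) + 2 * ennreal (q 1 x) + 2 * ennreal (q 2 x) + 2 * ennreal (q 3 x)" for x
      using le[of x] by (simp add: ennreal_plus ennreal_mult q0)
    then have "(\<integral>\<^sup>+x. ennreal ((norm (f (x - z) - f x))\<^sup>2) \<partial>lborel)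
        \<le> (\<integral>\<^sup>+x. 2 * ennreal (q 0 x) + 2 * ennreal (q 1 x) + 2 * ennreal (q 2 x) + 2 * ennreal (q 3 x) \<partial>lborel)"
      by (rule nn_integral_mono)
    also have "\<dots> = 2 * (\<integral>\<^sup>+x. ennreal (q 0 x) \<partial>lborel) + 2 * (\<integral>\<^sup>+x. ennreal (q 1 x) \<partial>lborel)
        + 2 * (\<integral>\<^sup>+x. ennreal (q 2 x) \<partial>lborel) + 2 * (\<integral>\<^sup>+x. ennreal (q 3 x) \<partial>lborel)"
      by (simp add: nn_integral_add nn_integral_cmult)
    also have "\<dots> \<le> 2 * ennreal (e/8) + 2 * ennreal (e/8) + 2 * ennreal (e/8) + 2 * ennreal (e/8)"
      by (intro add_mono mult_left_mono qi) auto
    also have "\<dots> = ennreal 2 * ennreal (e/8) + ennreal 2 * ennreal (e/8) + ennreal 2 * ennreal (e/8) + ennreal 2 * ennreal (e/8)" by simp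
    also have "\<dots> = ennreal e"
      using e unfolding ennreal_mult[symmetric, OF zero_le_numeral less_imp_le[OF divide_pos_pos[OF e zero_less_numeral]]]
      by (subst ennreal_plus[symmetric]; simp)+
    finally show ?thesis .
  qed
  moreover have "D > 0" using d(1) by (simp add: D_def)
  ultimately show ?thesis by blast
qed

text \<open>
  Since \<open>k\<close> is a probability density, this is Jensen's inequality; it is proved by the Cauchy--Schwarz inequality.
\<close>

lemma mollify_diff_sq:
  fixes f :: "'a::euclidean_space \<Rightarrow> complex" and k :: "'a \<Rightarrow> real"
  assumes f: "f \<in> L2 lborel" "f \<in> borel_measurable borel"
    and k: "k \<in> borel_measurable borel" "\<And>x. 0 \<le> k x" "(\<integral>\<^sup>+x. ennreal (k x) \<partial>lborel) = 1"
    and int: "integrable lborel (\<lambda>w. f w * complex_of_real (k (x - w)))"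
  shows "ennreal ((norm ((\<integral>w. f w * complex_of_real (k (x - w)) \<partial>lborel) - f x))\<^sup>2)
         \<le> (\<integral>\<^sup>+z. ennreal ((norm (f (x - z) - f x))\<^sup>2) * ennreal (k z) \<partial>lborel)"
proof -
  note [measurable] = f(2) k(1)
  have kx: "(\<integral>\<^sup>+w. ennreal (k (x - w)) \<partial>lborel) = 1"
    using nn_integral_lborel_shift(2)[of "\<lambda>w. ennreal (k w)" x] k(3) by simp
  have ki: "integrable lborel (\<lambda>w. k (x - w))" "(\<integral>w. k (x - w) \<partial>lborel) = 1"
  proof -
    show "integrable lborel (\<lambda>w. k (x - w))" by (rule integrableI_nonneg) (use kx k in auto)
    then show "(\<integral>w. k (x - w) \<partial>lborel) = 1"
      using kx k(2) by (subst (asm) nn_integral_eq_integral) (auto simp: ennreal_eq_1)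
  qed
  have i2: "integrable lborel (\<lambda>w. f x * complex_of_real (k (x - w)))"
    using ki(1) by (intro integrable_mult_right integrable_of_real)
  have "(\<integral>w. f w * complex_of_real (k (x - w)) \<partial>lborel) - f x = (\<integral>w. f w * complex_of_real (k (x - w)) - f x * complex_of_real (k (x - w)) \<partial>lborel)"
    unfolding Bochner_Integration.integral_diff[OF int i2] using ki by simp
  also have "\<dots> = (\<integral>w. (f w - f x) * complex_of_real (k (x - w)) \<partial>lborel)" by (simp add: left_diff_distrib)
  finally have eq: "(\<integral>w. f w * complex_of_real (k (x - w)) \<partial>lborel) - f x = (\<integral>w. (f w - f x) * complex_of_real (k (x - w)) \<partial>lborel)" .
  have i3: "integrable lborel (\<lambda>w. (f w - f x) * complex_of_real (k (x - w)))"
    using Bochner_Integration.integrable_diff[OF int i2] by (simp add: left_diff_distrib)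
  have "ennreal (norm ((\<integral>w. f w * complex_of_real (k (x - w)) \<partial>lborel) - f x)) \<le> (\<integral>\<^sup>+w. ennreal (norm ((f w - f x) * complex_of_real (k (x - w)))) \<partial>lborel)"
    unfolding eq using integral_norm_bound[of lborel "\<lambda>w. (f w - f x) * complex_of_real (k (x - w))"]
    by (subst nn_integral_eq_integral) (use i3 in \<open>auto intro: ennreal_leI integrable_norm\<close>)
  also have "\<dots> = (\<integral>\<^sup>+w. ennreal (norm (f w - f x) * sqrt (k (x - w))) * ennreal (sqrt (k (x - w))) \<partial>lborel)"
    using k(2) by (intro nn_integral_cong) (simp add: norm_mult ennreal_mult[symmetric] mult.assoc)
  finally have "(ennreal (norm ((\<integral>w. f w * complex_of_real (k (x - w)) \<partial>lborel) - f x)))\<^sup>2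
     \<le> (\<integral>\<^sup>+w. ennreal (norm (f w - f x) * sqrt (k (x - w))) * ennreal (sqrt (k (x - w))) \<partial>lborel)\<^sup>2"
    by (intro power_mono) auto
  also have "\<dots> \<le> (\<integral>\<^sup>+w. (ennreal (norm (f w - f x) * sqrt (k (x - w))))\<^sup>2 \<partial>lborel) * (\<integral>\<^sup>+w. (ennreal (sqrt (k (x - w))))\<^sup>2 \<partial>lborel)"
    by (rule Cauchy_Schwarz_nn_integral) measurable
  also have "(\<integral>\<^sup>+w. (ennreal (sqrt (k (x - w))))\<^sup>2 \<partial>lborel) = 1" using k(2) kx by (simp add: ennreal_power)
  also have "(\<integral>\<^sup>+w. (ennreal (norm (f w - f x) * sqrt (k (x - w))))\<^sup>2 \<partial>lborel) = (\<integral>\<^sup>+w. ennreal ((norm (f w - f x))\<^sup>2) * ennreal (k (x - w)) \<partial>lborel)"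
    using k(2) by (intro nn_integral_cong) (simp add: ennreal_power power_mult_distrib ennreal_mult)
  also have "\<dots> = (\<integral>\<^sup>+z. ennreal ((norm (f (x - z) - f x))\<^sup>2) * ennreal (k z) \<partial>lborel)"
    using nn_integral_lborel_shift(2)[of "\<lambda>w. ennreal ((norm (f w - f x))\<^sup>2) * ennreal (k (x - w))" x] by simp
  finally show ?thesis by (simp add: ennreal_power)
qed

text \<open>
  Integrating \<open>mollify_diff_sq\<close> over \<open>x\<close> leaves the translation moduli of \<open>f\<close>, weighted by the kernel, which is concentrated near the origin.
\<close>

lemma mollify_tendsto:
  fixes f :: "'a::euclidean_space \<Rightarrow> complex" and k :: "nat \<Rightarrow> 'a \<Rightarrow> real"
  assumes f: "f \<in> L2 lborel" "f \<in> borel_measurable borel"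
    and k: "\<And>n. k n \<in> borel_measurable borel" "\<And>n x. 0 \<le> k n x" "\<And>n. (\<integral>\<^sup>+x. ennreal (k n x) \<partial>lborel) = 1"
    and int: "\<And>n x. integrable lborel (\<lambda>w. f w * complex_of_real (k n (x - w)))"
    and supp: "\<And>n z. k n z \<noteq> 0 \<Longrightarrow> norm z \<le> r n" "r \<longlonglongrightarrow> 0"
  shows "(\<lambda>n. L2_dist_sq lborel (\<lambda>x. \<integral>w. f w * complex_of_real (k n (x - w)) \<partial>lborel) f) \<longlonglongrightarrow> 0"
proof (rule order_tendstoI)
  fix a :: ennreal assume "0 < a"
  then obtain b where b: "0 < b" "b < a" using dense by blast
  then obtain e where "b = ennreal e" "0 \<le> e" by (cases b) auto
  with b have e: "0 < e" "ennreal e < a" by auto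
  note [measurable] = f(2) k(1)
  obtain d where d: "d > 0" "\<And>z. norm z < d \<Longrightarrow> (\<integral>\<^sup>+x. ennreal ((norm (f (x - z) - f x))\<^sup>2) \<partial>lborel) \<le> ennreal e"
    using L2_translation_cont[OF f(2,1) e(1)] by blast
  have "\<forall>\<^sub>F n in sequentially. r n < d" using supp(2) d(1) by (rule order_tendstoD)
  then show "\<forall>\<^sub>F n in sequentially. L2_dist_sq lborel (\<lambda>x. \<integral>w. f w * complex_of_real (k n (x - w)) \<partial>lborel) f < a"
  proof eventually_elim
    case (elim n)
    have "L2_dist_sq lborel (\<lambda>x. \<integral>w. f w * complex_of_real (k n (x - w)) \<partial>lborel) f
       \<le> (\<integral>\<^sup>+x. \<integral>\<^sup>+z. ennreal ((norm (f (x - z) - f x))\<^sup>2) * ennreal (k n z) \<partial>lborel \<partial>lborel)"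
      unfolding L2_dist_sq_def by (intro nn_integral_mono mollify_diff_sq f k int)
    also have "\<dots> = (\<integral>\<^sup>+z. \<integral>\<^sup>+x. ennreal ((norm (f (x - z) - f x))\<^sup>2) * ennreal (k n z) \<partial>lborel \<partial>lborel)"
      by (rule lborel_pair.Fubini') measurable
    also have "\<dots> = (\<integral>\<^sup>+z. (\<integral>\<^sup>+x. ennreal ((norm (f (x - z) - f x))\<^sup>2) \<partial>lborel) * ennreal (k n z) \<partial>lborel)"
      by (intro nn_integral_cong nn_integral_multc) measurable
    also have "\<dots> \<le> (\<integral>\<^sup>+z. ennreal e * ennreal (k n z) \<partial>lborel)"
    proof (rule nn_integral_mono)
      fix z
      show "(\<integral>\<^sup>+x. ennreal ((norm (f (x - z) - f x))\<^sup>2) \<partial>lborel) * ennreal (k n z) \<le> ennreal e * ennreal (k n z)"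
        using supp(1)[of n z] elim by (cases "k n z = 0") (auto intro!: mult_right_mono d(2))
    qed
    also have "\<dots> = ennreal e" using k(3) by (subst nn_integral_cmult) auto
    finally show ?case using e(2) by (rule order.strict_trans1)
  qed
qed simp

text \<open>
  A nonempty open set is not negligible, so continuity upgrades almost everywhere to everywhere.
\<close>

lemma open_AE_zero:
  fixes f :: "'a::euclidean_space \<Rightarrow> complex"
  assumes A: "open A" and c: "continuous_on A f" and ae: "AE x in lborel. x \<in> A \<longrightarrow> f x = 0" and x: "x \<in> A"
  shows "f x = 0"
proof (rule ccontr)
  assume "f x \<noteq> 0"
  define V where "V = A \<inter> f -` (- {0})"
  have "open V" unfolding V_def by (rule continuous_open_preimage[OF c A]) (simp add: open_Compl)
  moreover have "V \<noteq> {}" using x \<open>f x \<noteq> 0\<close> by (auto simp: V_def)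
  ultimately have "\<not> negligible V" by (rule open_not_negligible)
  moreover have "V \<in> null_sets lebesgue"
  proof -
    have "V \<in> null_sets lborel"
      using ae \<open>open V\<close> by (subst AE_iff_null_sets) (auto simp: V_def elim!: eventually_mono)
    then show ?thesis by (rule null_sets_completionI)
  qed
  ultimately show False by (simp add: negligible_iff_null_sets)
qed

lemma test_bounded:
  assumes "\<phi> \<in> test_functions \<Omega>"
  obtains M where "M \<ge> 0" "\<And>x. norm (\<phi> x) \<le> M"
proof -
  from assms obtain K where K: "compact K" "\<forall>x. x \<notin> K \<longrightarrow> \<phi> x = 0" unfolding test_functions_def by blast
  have "bounded (\<phi> ` K)"
    by (intro compact_imp_bounded compact_continuous_image smooth_continuous test_smooth[OF assms] K)
  then obtain M where M: "\<And>x. x \<in> K \<Longrightarrow> norm (\<phi> x) \<le> M" unfolding bounded_iff by blast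
  have "norm (\<phi> x) \<le> max 0 M" for x using M[of x] K(2) by (cases "x \<in> K") auto
  then show ?thesis using that[of "max 0 M"] by simp
qed

lemma norm_derivative_sum_le:
  fixes h :: "'a::euclidean_space"
  assumes "\<And>b. b \<in> Basis \<Longrightarrow> norm (c b) \<le> M b"
  shows "norm (\<Sum>b\<in>Basis. (h \<bullet> b) *\<^sub>R c b) \<le> (\<Sum>b\<in>Basis. M b) * norm h"
proof -
  have "norm (\<Sum>b\<in>Basis. (h \<bullet> b) *\<^sub>R c b) \<le> (\<Sum>b\<in>Basis. norm h * M b)"
    by (intro sum_norm_le) (auto intro!: mult_mono assms Basis_le_norm)
  then show ?thesis by (simp add: sum_distrib_left mult.commute)
qed

lemma test_lipschitz:
  assumes t: "\<phi> \<in> test_functions \<Omega>"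
  obtains M where "M \<ge> 0" "\<And>x y. norm (\<phi> x - \<phi> y) \<le> M * norm (x - y)"
proof -
  have "\<exists>M\<ge>0. \<forall>x. norm (partial_deriv b \<phi> x) \<le> M" if "b \<in> Basis" for b
    using test_bounded[OF test_partial[OF t that]] by metis
  then obtain M where M: "\<And>b. b \<in> Basis \<Longrightarrow> M b \<ge> 0" "\<And>b x. b \<in> Basis \<Longrightarrow> norm (partial_deriv b \<phi> x) \<le> M b" by metis
  have "norm (\<phi> x - \<phi> y) \<le> (\<Sum>b\<in>Basis. M b) * norm (x - y)" for x y
  proof (rule differentiable_bound[OF convex_UNIV])
    show "(\<phi> has_derivative (\<lambda>h. \<Sum>b\<in>Basis. (h \<bullet> b) *\<^sub>R partial_deriv b \<phi> z)) (at z within UNIV)" for z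
      using smooth_has_derivative[OF test_smooth[OF t]] by simp
    show "onorm (\<lambda>h. \<Sum>b\<in>Basis. (h \<bullet> b) *\<^sub>R partial_deriv b \<phi> z) \<le> (\<Sum>b\<in>Basis. M b)" for z
      by (intro onorm_le norm_derivative_sum_le M)
  qed auto
  moreover have "(\<Sum>b\<in>Basis. M b) \<ge> 0" using M by (intro sum_nonneg)
  ultimately show ?thesis using that by blast
qed

lemma test_taylor:
  assumes t: "\<phi> \<in> test_functions \<Omega>"
  obtains M where "M \<ge> 0"
    "\<And>x y. norm (\<phi> y - \<phi> x - (\<Sum>b\<in>Basis. ((y - x) \<bullet> b) *\<^sub>R partial_deriv b \<phi> x)) \<le> M * (norm (y - x))\<^sup>2"
proof -
  have "\<exists>M\<ge>0. \<forall>x y. norm (partial_deriv b \<phi> x - partial_deriv b \<phi> y) \<le> M * norm (x - y)" if "b \<in> Basis" for b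
    using test_lipschitz[OF test_partial[OF t that]] by metis
  then obtain L where L: "\<And>b. b \<in> Basis \<Longrightarrow> L b \<ge> 0"
    "\<And>b x y. b \<in> Basis \<Longrightarrow> norm (partial_deriv b \<phi> x - partial_deriv b \<phi> y) \<le> L b * norm (x - y)" by metis
  define M where "M = (\<Sum>b\<in>Basis. L b)"
  have M0: "M \<ge> 0" unfolding M_def using L by (intro sum_nonneg)
  have "norm (\<phi> y - \<phi> x - (\<Sum>b\<in>Basis. ((y - x) \<bullet> b) *\<^sub>R partial_deriv b \<phi> x)) \<le> M * (norm (y - x))\<^sup>2" for x y
  proof -
    let ?r = "norm (y - x)"
    let ?g = "\<lambda>z. \<phi> z - (\<Sum>b\<in>Basis. ((z - x) \<bullet> b) *\<^sub>R partial_deriv b \<phi> x)"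
    have "norm (?g y - ?g x) \<le> (M * ?r) * norm (y - x)"
    proof (rule differentiable_bound[where S="cball x ?r"])
      fix z assume z: "z \<in> cball x ?r"
      have "(?g has_derivative (\<lambda>h. (\<Sum>b\<in>Basis. (h \<bullet> b) *\<^sub>R partial_deriv b \<phi> z) - (\<Sum>b\<in>Basis. ((h - 0) \<bullet> b) *\<^sub>R partial_deriv b \<phi> x)))
          (at z within cball x ?r)"
        by (intro derivative_intros has_derivative_at_withinI[OF smooth_has_derivative[OF test_smooth[OF t]]])
      then show "(?g has_derivative (\<lambda>h. \<Sum>b\<in>Basis. (h \<bullet> b) *\<^sub>R (partial_deriv b \<phi> z - partial_deriv b \<phi> x))) (at z within cball x ?r)"
        by (simp add: scaleR_right_diff_distrib sum_subtractf)
      show "onorm (\<lambda>h. \<Sum>b\<in>Basis. (h \<bullet> b) *\<^sub>R (partial_deriv b \<phi> z - partial_deriv b \<phi> x)) \<le> M * ?r"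
      proof (rule onorm_le)
        fix h
        have "norm (\<Sum>b\<in>Basis. (h \<bullet> b) *\<^sub>R (partial_deriv b \<phi> z - partial_deriv b \<phi> x)) \<le> (\<Sum>b\<in>Basis. L b * ?r) * norm h"
        proof (rule norm_derivative_sum_le)
          fix b :: 'a assume b: "b \<in> Basis"
          have "norm (partial_deriv b \<phi> z - partial_deriv b \<phi> x) \<le> L b * norm (z - x)" by (rule L(2)[OF b])
          also have "\<dots> \<le> L b * ?r" using z by (intro mult_left_mono L(1) b) (simp add: dist_norm norm_minus_commute)
          finally show "norm (partial_deriv b \<phi> z - partial_deriv b \<phi> x) \<le> L b * ?r" .
        qed
        then show "norm (\<Sum>b\<in>Basis. (h \<bullet> b) *\<^sub>R (partial_deriv b \<phi> z - partial_deriv b \<phi> x)) \<le> M * ?r * norm h"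
          by (simp add: M_def sum_distrib_right)
      qed
    qed (auto simp: dist_norm norm_minus_commute)
    moreover have "?g y - ?g x = \<phi> y - \<phi> x - (\<Sum>b\<in>Basis. ((y - x) \<bullet> b) *\<^sub>R partial_deriv b \<phi> x)" by simp
    ultimately show ?thesis by (simp only: power2_eq_square mult.assoc)
  qed
  with M0 that show ?thesis by blast
qed

lemma test_reflect:
  assumes "K \<in> test_functions \<Omega>"
  shows "(\<lambda>w. K (x - w)) \<in> test_functions ((\<lambda>z. x - z) ` \<Omega>)"
    and "b \<in> Basis \<Longrightarrow> partial_deriv b (\<lambda>w. K (x - w)) = (\<lambda>w. - partial_deriv b K (x - w))"
proof -
  from assms obtain C where C: "compact C" "C \<subseteq> \<Omega>" "\<forall>x. x \<notin> C \<longrightarrow> K x = 0" unfolding test_functions_def by blast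
  have "smooth (\<lambda>w. K (x - w))" using smooth_affine(1)[OF test_smooth[OF assms], of "-1" x] by simp
  moreover have "compact ((\<lambda>z. x - z) ` C)" by (intro compact_continuous_image continuous_intros C)
  moreover have "K (x - w) = 0" if "w \<notin> (\<lambda>z. x - z) ` C" for w
  proof -
    have "x - w \<notin> C" using that by (metis diff_diff_eq2 add_diff_cancel_left' image_eqI)
    then show ?thesis using C(3) by blast
  qed
  ultimately show "(\<lambda>w. K (x - w)) \<in> test_functions ((\<lambda>z. x - z) ` \<Omega>)"
    unfolding test_functions_def using C(2) by (blast intro: image_mono)
  show "b \<in> Basis \<Longrightarrow> partial_deriv b (\<lambda>w. K (x - w)) = (\<lambda>w. - partial_deriv b K (x - w))"
    using smooth_affine(2)[OF test_smooth[OF assms], of b "-1" x] by simp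
qed

text \<open>
  Convolution is written with the kernel translated, so that all derivatives fall on the smooth
  kernel and \<open>f\<close> need only be square-integrable.
\<close>

definition conv :: "(real \<times> real \<Rightarrow> complex) \<Rightarrow> (real \<times> real \<Rightarrow> complex) \<Rightarrow> real \<times> real \<Rightarrow> complex" where
  "conv f K x = (\<integral>w. f w * K (x - w) \<partial>lborel)"

lemma test_L2_lborel: "\<phi> \<in> test_functions \<Omega> \<Longrightarrow> (\<phi> :: real \<times> real \<Rightarrow> complex) \<in> L2 lborel"
proof -
  assume t: "\<phi> \<in> test_functions \<Omega>"
  have "(\<lambda>z. \<phi> z * cnj (\<phi> z)) \<in> test_functions \<Omega>" using t by (intro test_mult test_cnj test_smooth)
  then have "integrable lborel (\<lambda>z. norm (\<phi> z * cnj (\<phi> z)))" by (intro integrable_norm test_integrable)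
  then have "integrable lborel (\<lambda>z. (norm (\<phi> z))\<^sup>2)" by (simp add: norm_mult power2_eq_square)
  then show ?thesis using smooth_borel[OF test_smooth[OF t]] by (simp add: L2_def)
qed

lemma conv_integrable:
  fixes f K :: "real \<times> real \<Rightarrow> complex"
  assumes "f \<in> L2 lborel" "K \<in> test_functions \<Omega>"
  shows "integrable lborel (\<lambda>w. f w * K (x - w))"
  using L2_mult_integrable[OF assms(1) test_L2_lborel[OF test_cnj[OF test_reflect(1)[OF assms(2), of x]]]] by simp

text \<open>
  The second order Taylor bound for the kernel is uniform, and near \<open>x\<close> only the values of \<open>f\<close> on
  a fixed ball enter, where \<open>f\<close> is integrable.
\<close>

lemma conv_has_derivative:
  assumes f: "f \<in> L2 lborel" and K: "K \<in> test_functions \<Omega>"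
  shows "(conv f K has_derivative (\<lambda>h. \<Sum>b\<in>Basis. (h \<bullet> b) *\<^sub>R conv f (partial_deriv b K) x)) (at x)"
proof -
  obtain M where M: "M \<ge> 0"
    "\<And>x y. norm (K y - K x - (\<Sum>b\<in>Basis. ((y - x) \<bullet> b) *\<^sub>R partial_deriv b K x)) \<le> M * (norm (y - x))\<^sup>2"
    using test_taylor[OF K] by blast
  from K obtain C where C: "compact C" "\<forall>x. x \<notin> C \<longrightarrow> K x = 0" unfolding test_functions_def by blast
  obtain R where R: "R > 0" "\<And>z. z \<in> C \<Longrightarrow> norm z \<le> R" using compact_imp_bounded[OF C(1)] bounded_pos by metis
  have K0: "K z = 0" "partial_deriv b K z = 0" if "norm z > R" for z b
  proof -
    have "z \<notin> C" using R(2)[of z] that by auto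
    then show "K z = 0" "partial_deriv b K z = 0"
      using C(2) partial_deriv_zero_outside[OF compact_imp_closed[OF C(1)], of K z b] by blast+
  qed
  define G where "G = L2_norm lborel f * L2_norm lborel (\<lambda>w. indicator (cball x (R + 1)) w)"
  have ind: "(\<lambda>w. indicator (cball x (R + 1)) w :: complex) \<in> L2 lborel"
  proof -
    have "(\<lambda>w. (norm (indicator (cball x (R + 1)) w :: complex))\<^sup>2) = (indicator (cball x (R + 1)) :: _ \<Rightarrow> real)"
      by (auto simp: indicator_def)
    moreover have "integrable lborel (indicator (cball x (R + 1)) :: _ \<Rightarrow> real)"
      by (rule integrable_real_indicator) (use emeasure_lborel_cball_finite[of x "R+1"] in auto)
    ultimately show ?thesis by (simp add: L2_def borel_measurable_indicator)
  qed
  have nint: "integrable lborel (\<lambda>w. norm (f w) * indicator (cball x (R + 1)) w)"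
    using integrable_norm[OF L2_mult_integrable[OF f ind]]
    by (rule Bochner_Integration.integrable_cong[OF refl, THEN iffD1, rotated]) (auto simp: norm_mult indicator_def)
  define c where "c = (\<integral>w. norm (f w) * indicator (cball x (R + 1)) w \<partial>lborel)"
  have c0: "c \<ge> 0" unfolding c_def by (intro integral_nonneg_AE) auto
  have est: "norm (conv f K y - conv f K x - (\<Sum>b\<in>Basis. ((y - x) \<bullet> b) *\<^sub>R conv f (partial_deriv b K) x)) \<le> c * M * (norm (y - x))\<^sup>2"
    if y: "norm (y - x) \<le> 1" for y
  proof -
    let ?D = "\<lambda>w. K (y - w) - K (x - w) - (\<Sum>b\<in>Basis. ((y - x) \<bullet> b) *\<^sub>R partial_deriv b K (x - w))"
    have pi: "integrable lborel (\<lambda>w. f w * partial_deriv b K (x - w))" if "b \<in> Basis" for b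
      by (rule conv_integrable[OF f test_partial[OF K that]])
    have "conv f K y - conv f K x - (\<Sum>b\<in>Basis. ((y - x) \<bullet> b) *\<^sub>R conv f (partial_deriv b K) x)
      = (\<integral>w. f w * K (y - w) - f w * K (x - w) - (\<Sum>b\<in>Basis. ((y - x) \<bullet> b) *\<^sub>R (f w * partial_deriv b K (x - w))) \<partial>lborel)"
      unfolding conv_def using pi conv_integrable[OF f K]
      by (simp add: Bochner_Integration.integral_diff Bochner_Integration.integral_sum)
    also have "\<dots> = (\<integral>w. f w * ?D w \<partial>lborel)"
      by (intro Bochner_Integration.integral_cong) (auto simp: algebra_simps sum_distrib_left)
    finally have eq: "conv f K y - conv f K x - (\<Sum>b\<in>Basis. ((y - x) \<bullet> b) *\<^sub>R conv f (partial_deriv b K) x) = (\<integral>w. f w * ?D w \<partial>lborel)" .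
    have bd: "norm (f w * ?D w) \<le> (M * (norm (y - x))\<^sup>2) * (norm (f w) * indicator (cball x (R + 1)) w)" for w
    proof (cases "w \<in> cball x (R + 1)")
      case True
      have "norm (?D w) \<le> M * (norm (y - x))\<^sup>2" using M(2)[of "y - w" "x - w"] by simp
      then show ?thesis using True by (simp add: norm_mult mult.commute mult_left_mono)
    next
      case False
      then have "norm (x - w) > R + 1" by (simp add: dist_norm)
      moreover have "norm (x - w) \<le> norm (y - w) + norm (y - x)"
        using norm_triangle_ineq4[of "y - w" "y - x"] by simp
      ultimately have "norm (x - w) > R" "norm (y - w) > R" using y by linarith+
      then show ?thesis using K0 False by simp
    qed
    have "integrable lborel (\<lambda>w. f w * K (y - w) - f w * K (x - w) - (\<Sum>b\<in>Basis. ((y - x) \<bullet> b) *\<^sub>R (f w * partial_deriv b K (x - w))))"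
      using pi by (intro Bochner_Integration.integrable_diff Bochner_Integration.integrable_sum integrable_scaleR_right conv_integrable[OF f K])
    also have "(\<lambda>w. f w * K (y - w) - f w * K (x - w) - (\<Sum>b\<in>Basis. ((y - x) \<bullet> b) *\<^sub>R (f w * partial_deriv b K (x - w)))) = (\<lambda>w. f w * ?D w)"
      by (auto simp: algebra_simps sum_distrib_left)
    finally have "norm (\<integral>w. f w * ?D w \<partial>lborel) \<le> (\<integral>w. (M * (norm (y - x))\<^sup>2) * (norm (f w) * indicator (cball x (R + 1)) w) \<partial>lborel)"
      by (intro order.trans[OF Bochner_Integration.integral_norm_bound] Bochner_Integration.integral_mono integrable_norm integrable_mult_right nint bd)
    also have "\<dots> = c * M * (norm (y - x))\<^sup>2" unfolding c_def by simp
    finally show ?thesis unfolding eq .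
  qed
  show ?thesis unfolding has_derivative_at_alt
  proof (intro conjI allI impI)
    show "bounded_linear (\<lambda>h. \<Sum>b\<in>Basis. (h \<bullet> b) *\<^sub>R conv f (partial_deriv b K) x)"
      by (intro bounded_linear_sum bounded_linear_scaleR_const bounded_linear_inner_left)
    fix e :: real assume e: "e > 0"
    define d where "d = min 1 (e / (c * M + 1))"
    have cM: "c * M \<ge> 0" using c0 M(1) by simp
    have d: "d > 0" using e cM by (simp add: d_def)
    have "norm (conv f K y - conv f K x - (\<Sum>b\<in>Basis. ((y - x) \<bullet> b) *\<^sub>R conv f (partial_deriv b K) x)) \<le> e * norm (y - x)"
      if y: "norm (y - x) < d" for y
    proof -
      have "c * M * norm (y - x) \<le> (c * M + 1) * (e / (c * M + 1))"
        using y cM by (intro mult_mono) (auto simp: d_def)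
      then have "c * M * norm (y - x) \<le> e" using cM by simp
      then have "c * M * norm (y - x) * norm (y - x) \<le> e * norm (y - x)" by (intro mult_right_mono) auto
      then show ?thesis using est[of y] y by (auto simp: d_def power2_eq_square mult.assoc)
    qed
    with d show "\<exists>d>0. \<forall>y. norm (y - x) < d \<longrightarrow>
        norm (conv f K y - conv f K x - (\<Sum>b\<in>Basis. ((y - x) \<bullet> b) *\<^sub>R conv f (partial_deriv b K) x)) \<le> e * norm (y - x)" by blast
  qed
qed

lemma conv_partial:
  assumes "f \<in> L2 lborel" "K \<in> test_functions \<Omega>" "b \<in> Basis"
  shows "partial_deriv b (conv f K) = conv f (partial_deriv b K)"
proof
  fix x
  have "partial_deriv b (conv f K) x = (\<Sum>b'\<in>Basis. (b \<bullet> b') *\<^sub>R conv f (partial_deriv b' K) x)"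
    by (rule partial_derivI[OF conv_has_derivative[OF assms(1,2)]])
  also have "\<dots> = conv f (partial_deriv b K) x"
  proof -
    have "(\<Sum>b'\<in>Basis - {b}. (b \<bullet> b') *\<^sub>R conv f (partial_deriv b' K) x) = 0"
      using assms(3) by (intro sum.neutral) (auto simp: inner_not_same_Basis)
    then show ?thesis using assms(3) by (subst sum.remove[of _ b]) auto
  qed
  finally show "partial_deriv b (conv f K) x = conv f (partial_deriv b K) x" .
qed

lemma conv_smooth:
  assumes f: "f \<in> L2 lborel" and K: "K \<in> test_functions \<Omega>"
  shows "smooth (conv f K)"
proof
  fix k
  show "C_k k (conv f K)"
  proof (rule C_k_family[where Q="{conv f K |K. K \<in> test_functions \<Omega>}"])
    show "g differentiable (at x)" if "g \<in> {conv f K |K. K \<in> test_functions \<Omega>}" for g x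
      using that conv_has_derivative[OF f] unfolding differentiable_def by blast
    show "partial_deriv b g \<in> {conv f K |K. K \<in> test_functions \<Omega>}" if "g \<in> {conv f K |K. K \<in> test_functions \<Omega>}" "b \<in> Basis" for g b
      using that conv_partial[OF f] test_partial by blast
  qed (use K in blast)
qed

context acute begin

lemma AE_sector_iff:
  "(AE x in U. P x) \<longleftrightarrow> (AE x in lebesgue. x \<in> S \<longrightarrow> P x)"
  by (subst AE_restrict_space_iff) auto

text \<open>
  Elements of \<open>L\<^sup>2\<close> over the sector are only Lebesgue measurable; product measures and substitutions
  call for Borel functions on the whole plane, obtained by extending by zero.
\<close>

lemma borel_representative:
  assumes u: "u \<in> L2 U"
  obtains f where "f \<in> borel_measurable borel" "f \<in> L2 lborel" "AE x in U. u x = f x" "\<And>x. x \<notin> S \<Longrightarrow> f x = 0"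
proof -
  have m: "(\<lambda>x. indicator S x *\<^sub>R u x) \<in> borel_measurable lebesgue"
    using L2_measurable[OF u] by (subst (asm) borel_measurable_restrict_space_iff) auto
  then have c: "(\<lambda>x. Re (indicator S x *\<^sub>R u x)) \<in> borel_measurable (completion lborel)"
    "(\<lambda>x. Im (indicator S x *\<^sub>R u x)) \<in> borel_measurable (completion lborel)" by measurable
  obtain r i where ri: "r \<in> borel_measurable lborel" "AE x in lborel. Re (indicator S x *\<^sub>R u x) = r x"
    "i \<in> borel_measurable lborel" "AE x in lborel. Im (indicator S x *\<^sub>R u x) = i x"
    using completion_ex_borel_measurable_real[OF c(1)] completion_ex_borel_measurable_real[OF c(2)] by blast
  define f where "f x = indicator S x *\<^sub>R Complex (r x) (i x)" for x
  have [measurable]: "r \<in> borel_measurable borel" "i \<in> borel_measurable borel" using ri by auto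
  have fm: "f \<in> borel_measurable borel"
    unfolding f_def Complex_eq by measurable
  have ae: "AE x in lborel. indicator S x *\<^sub>R u x = f x"
    using ri(2,4) by eventually_elim (auto simp: f_def complex_eq_iff indicator_def)
  then have ae': "AE x in lebesgue. indicator S x *\<^sub>R u x = f x" by (rule AE_completion)
  have uf: "AE x in U. u x = f x"
    unfolding AE_sector_iff using ae' by eventually_elim (auto simp: indicator_def)
  have "(\<integral>\<^sup>+x. ennreal ((norm (f x))\<^sup>2) \<partial>lborel) = (\<integral>\<^sup>+x. ennreal ((norm (f x))\<^sup>2) * indicator S x \<partial>lborel)"
    by (intro nn_integral_cong) (auto simp: f_def indicator_def)
  also have "\<dots> = (\<integral>\<^sup>+x. ennreal ((norm (f x))\<^sup>2) \<partial>U)" using fm by (intro nn_integral_U[symmetric]) simp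
  also have "\<dots> = (\<integral>\<^sup>+x. ennreal ((norm (u x))\<^sup>2) \<partial>U)" using uf by (intro nn_integral_cong_AE) (auto elim!: eventually_mono)
  also have "\<dots> < top" using u by (simp add: L2_iff_nn)
  finally have "f \<in> L2 lborel" using fm by (simp add: L2_iff_nn)
  with fm uf that show ?thesis by (auto simp: f_def)
qed

lemma L2_dist_U_le: 
  assumes [measurable]: "f \<in> borel_measurable borel" "g \<in> borel_measurable borel"
  shows "L2_dist_sq U f g \<le> L2_dist_sq lborel f g"
proof -
  have "L2_dist_sq U f g = (\<integral>\<^sup>+x. ennreal ((norm (f x - g x))\<^sup>2) * indicator S x \<partial>lborel)"
    unfolding L2_dist_sq_def by (intro nn_integral_U) simp
  also have "\<dots> \<le> L2_dist_sq lborel f g"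
    unfolding L2_dist_sq_def by (intro nn_integral_mono) (auto simp: indicator_def)
  finally show ?thesis .
qed

lemma L2_dist_cong_U: "(AE x in U. f x = f' x) \<Longrightarrow> (AE x in U. g x = g' x) \<Longrightarrow> L2_dist_sq U f g = L2_dist_sq U f' g'"
  unfolding L2_dist_sq_def by (intro nn_integral_cong_AE) (auto elim!: eventually_elim2)

text \<open>
  The support \<open>[-2e, -e] \<times> [-Te/2, Te/2]\<close> lies in the reflected sector. Since the sector is a
  convex cone, \<open>x - w\<close> with \<open>w\<close> in the support and \<open>x \<in> S\<close> stays in \<open>S\<close>; thus mollifying needs
  no extension across the boundary.
\<close>

definition mollifier :: "nat \<Rightarrow> real \<times> real \<Rightarrow> complex" where
  "mollifier n = (let e = 1 / real (Suc n); b = box_bump (- 2 * e) (- e) (- T * e / 2) (T * e / 2)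
     in (\<lambda>z. complex_of_real (1 / (\<integral>z. norm (b z) \<partial>lborel)) * b z))"

text \<open>
  The kernel is a nonnegative approximate identity; nonnegativity is expressed by \<open>mollifier_real\<close>, as the kernel is complex-valued.
\<close>

lemma
  shows mollifier_test: "mollifier n \<in> test_functions (uminus ` S)"
    and mollifier_real: "mollifier n z = complex_of_real (norm (mollifier n z))"
    and mollifier_integral: "(\<integral>\<^sup>+z. ennreal (norm (mollifier n z)) \<partial>lborel) = 1"
    and mollifier_support: "mollifier n z \<noteq> 0 \<Longrightarrow> norm z \<le> (2 + T) * (1 / real (Suc n))"
proof -
  define e where "e = 1 / real (Suc n)"
  define b where "b = box_bump (- 2 * e) (- e) (- T * e / 2) (T * e / 2)"
  define c where "c = (\<integral>z. norm (b z) \<partial>lborel)"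
  have mollifier: "mollifier n = (\<lambda>z. complex_of_real (1 / c) * b z)"
    by (simp add: mollifier_def Let_def e_def b_def c_def)
  have e: "e > 0" by (simp add: e_def)
  have sb: "smooth b" unfolding b_def by (rule smooth_box_bump)
  let ?K = "{- 2 * e .. - e} \<times> {- T * e / 2 .. T * e / 2}"
  have K: "compact ?K" by (intro compact_Times compact_Icc)
  have b0: "b z = 0" if "z \<notin> ?K" for z unfolding b_def by (rule box_bump_support) (use that in simp)
  have KS: "?K \<subseteq> uminus ` S"
  proof
    fix z assume z: "z \<in> ?K"
    have "\<bar>- snd z\<bar> \<le> T * e / 2" using z by (auto simp: abs_le_iff)
    also have "T * e / 2 < T * e" using T_pos e by simp
    also have "\<dots> \<le> T * fst (- z)" using z T_pos by (intro mult_left_mono) auto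
    finally have "- z \<in> S" using z e unfolding S_eq by auto
    then show "z \<in> uminus ` S" by (metis image_eqI minus_minus)
  qed
  have tb: "b \<in> test_functions (uminus ` S)" unfolding test_functions_def using sb K KS b0 by blast
  show "mollifier n \<in> test_functions (uminus ` S)" unfolding mollifier by (rule test_cmult[OF tb])
  have ib: "integrable lborel (\<lambda>z. norm (b z))" by (intro integrable_norm test_integrable[OF tb])
  have c: "c > 0"
  proof -
    have "c \<ge> 0" unfolding c_def by (intro integral_nonneg_AE) auto
    moreover have "c \<noteq> 0"
    proof
      assume "c = 0"
      then have "AE z in lborel. norm (b z) = 0"
        unfolding c_def using integral_nonneg_eq_0_iff_AE[OF ib] by simp
      then have "AE z in lborel. z \<in> UNIV \<longrightarrow> b z = 0" by simp
      then have "b (- (3/2) * e, 0) = 0"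
        by (rule open_AE_zero[OF open_UNIV smooth_continuous[OF sb]]) simp
      moreover have "b (- (3/2) * e, 0) \<noteq> 0" unfolding b_def by (rule box_bump_pos) (use e T_pos in auto)
      ultimately show False by simp
    qed
    ultimately show ?thesis by simp
  qed
  have nm: "norm (mollifier n z) = norm (b z) / c" for z using c by (simp add: mollifier norm_mult norm_divide)
  have br: "b z = complex_of_real (norm (b z))" unfolding b_def by (rule box_bump_nonneg)
  have "mollifier n z = complex_of_real (1 / c) * complex_of_real (norm (b z))" using br by (simp add: mollifier)
  also have "\<dots> = complex_of_real (norm (b z) / c)" by simp
  finally have "mollifier n z = complex_of_real (norm (b z) / c)" .
  from this[folded nm] show "mollifier n z = complex_of_real (norm (mollifier n z))" .
  have "(\<integral>\<^sup>+z. ennreal (norm (mollifier n z)) \<partial>lborel) = ennreal (\<integral>z. norm (b z) / c \<partial>lborel)"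
    unfolding nm using ib c by (intro nn_integral_eq_integral) auto
  also have "(\<integral>z. norm (b z) / c \<partial>lborel) = 1" using c by (simp add: c_def)
  finally show "(\<integral>\<^sup>+z. ennreal (norm (mollifier n z)) \<partial>lborel) = 1" by simp
  show "norm z \<le> (2 + T) * (1 / real (Suc n))" if "mollifier n z \<noteq> 0"
  proof -
    have z: "z \<in> ?K"
    proof (rule ccontr)
      assume "z \<notin> ?K"
      then have "b z = 0" by (rule b0)
      then have "mollifier n z = 0" by (simp add: mollifier)
      with that show False by simp
    qed
    have "norm z \<le> norm (fst z) + norm (snd z)" using norm_Pair_le[of "fst z" "snd z"] by simp
    also have "\<dots> \<le> 2 * e + T * e / 2" using z e T_pos by (intro add_mono) (auto simp: abs_le_iff)
    also have "\<dots> \<le> (2 + T) * e" using e T_pos by (simp add: algebra_simps)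
    finally show ?thesis by (simp add: e_def)
  qed
qed

lemma conv_mollifier_tendsto:
  assumes f: "f \<in> L2 lborel" "f \<in> borel_measurable borel"
  shows "(\<lambda>n. L2_dist_sq lborel (conv f (mollifier n)) f) \<longlonglongrightarrow> 0"
proof -
  have r: "(\<lambda>w. f w * complex_of_real (norm (mollifier n (x - w)))) = (\<lambda>w. f w * mollifier n (x - w))" for n x
    using mollifier_real by metis
  have "(\<lambda>n. L2_dist_sq lborel (\<lambda>x. \<integral>w. f w * complex_of_real (norm (mollifier n (x - w))) \<partial>lborel) f) \<longlonglongrightarrow> 0"
  proof (rule mollify_tendsto[OF f])
    show "(\<lambda>z. norm (mollifier n z)) \<in> borel_measurable borel" for n
      using smooth_borel[OF test_smooth[OF mollifier_test]] by simp
    show "integrable lborel (\<lambda>w. f w * complex_of_real (norm (mollifier n (x - w))))" for n x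
      unfolding r by (rule conv_integrable[OF f(1) mollifier_test])
    show "norm z \<le> (2 + T) * (1 / real (Suc n))" if "norm (mollifier n z) \<noteq> 0" for n z
      using mollifier_support[of n z] that by simp
    have "(\<lambda>n. (2 + T) * (1 / real (Suc n))) \<longlonglongrightarrow> (2 + T) * 0"
      by (intro tendsto_mult tendsto_const LIMSEQ_Suc[OF lim_1_over_n])
    then show "(\<lambda>n. (2 + T) * (1 / real (Suc n))) \<longlonglongrightarrow> 0" by simp
  qed (use mollifier_integral in auto)
  then show ?thesis by (simp only: r conv_def[abs_def])
qed

lemma mollifier_reflect_test:
  assumes "x \<in> S" shows "(\<lambda>w. mollifier n (x - w)) \<in> test_functions S"
proof -
  have "(\<lambda>z. x - z) ` uminus ` S \<subseteq> S"
  proof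
    fix y assume "y \<in> (\<lambda>z. x - z) ` uminus ` S"
    then obtain s where s: "s \<in> S" "y = x + s" by auto
    have "\<bar>snd x + snd s\<bar> < T * (fst x + fst s)"
      using assms s(1) abs_triangle_ineq[of "snd x" "snd s"] unfolding S_eq by (simp add: distrib_left)
    then show "y \<in> S" using assms s unfolding S_eq by simp
  qed
  then show ?thesis using test_reflect(1)[OF mollifier_test[of n], of x] by (force simp: test_functions_def)
qed

lemma conv_eq_U:
  assumes f: "f \<in> borel_measurable borel" "\<And>x. x \<notin> S \<Longrightarrow> f x = 0" and uf: "AE x in U. u x = f x" and u: "u \<in> L2 U"
    and k: "k \<in> borel_measurable borel"
  shows "(\<integral>w. f w * k w \<partial>lborel) = (\<integral>w. u w * k w \<partial>U)"
proof -
  have "(\<integral>w. u w * k w \<partial>U) = (\<integral>w. f w * k w \<partial>U)"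
    using uf L2_measurable[OF u] borel_U[OF f(1)] borel_U[OF k]
    by (intro integral_cong_AE) (auto elim!: eventually_mono)
  also have "\<dots> = (\<integral>w. indicator S w *\<^sub>R (f w * k w) \<partial>lborel)" using f(1) k by (intro integral_U) simp
  also have "\<dots> = (\<integral>w. f w * k w \<partial>lborel)"
    by (intro Bochner_Integration.integral_cong) (auto simp: indicator_def f(2))
  finally show ?thesis ..
qed

text \<open>
  The fundamental lemma of the calculus of variations: the mollified functions vanish identically
  in the sector, since the translated kernels are test functions there.
\<close>

lemma L2_U_zero:
  assumes h: "h \<in> L2 U" and z: "\<And>\<phi>. \<phi> \<in> test_functions S \<Longrightarrow> (\<integral>x. h x * \<phi> x \<partial>U) = 0"
  shows "AE x in U. h x = 0"
proof -
  obtain f where f: "f \<in> borel_measurable borel" "f \<in> L2 lborel" "AE x in U. h x = f x" "\<And>x. x \<notin> S \<Longrightarrow> f x = 0"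
    using borel_representative[OF h] by blast
  have c0: "conv f (mollifier n) x = 0" if "x \<in> S" for n x
    unfolding conv_def using z[OF mollifier_reflect_test[OF that]] smooth_borel[OF test_smooth[OF mollifier_reflect_test[OF that]]]
    by (subst conv_eq_U[OF f(1,4,3) h]) auto
  have ae: "AE x in U. conv f (mollifier n) x = 0" for n
    unfolding AE_sector_iff using c0 by auto
  have "(\<lambda>n. L2_dist_sq U (conv f (mollifier n)) f) \<longlonglongrightarrow> 0"
    by (rule tendsto_ennreal_squeeze0[OF L2_dist_U_le conv_mollifier_tendsto])
       (use f smooth_borel[OF conv_smooth[OF f(2) mollifier_test]] in auto)
  then have "(\<lambda>n. L2_dist_sq U (\<lambda>x. 0) h) \<longlonglongrightarrow> 0"
    using L2_dist_cong_U[OF ae f(3)[THEN AE_symmetric]] by (simp add: L2_dist_cong_U[OF ae] f(3))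
  then have "L2_dist_sq U (\<lambda>x. 0) h = 0" using LIMSEQ_unique tendsto_const by blast
  then have "AE x in U. 0 = h x" using L2_measurable[OF h] by (subst (asm) L2_dist_sq_zero_AE) auto
  then show ?thesis by eventually_elim simp
qed

end

section \<open>Sobolev space and traces on the sector\<close>

context acute begin

lemma weak_partial_works: "u \<in> H1 S \<Longrightarrow> b \<in> Basis \<Longrightarrow> is_weak_partial S b u (weak_partial S b u)"
proof -
  assume "u \<in> H1 S" "b \<in> Basis"
  then have "\<exists>g. is_weak_partial S b u g" by (simp add: H1_def)
  then show ?thesis unfolding weak_partial_def by (rule someI_ex)
qed

lemma weak_partial_L2: "u \<in> H1 S \<Longrightarrow> b \<in> Basis \<Longrightarrow> weak_partial S b u \<in> L2 U"
  using weak_partial_works unfolding is_weak_partial_def by blast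

lemma H1_L2: "u \<in> H1 S \<Longrightarrow> u \<in> L2 U" by (simp add: H1_def)

lemma weak_partial_unique:
  assumes g: "is_weak_partial S b u g" and h: "is_weak_partial S b u h"
  shows "AE x in U. g x = h x"
proof -
  have L: "g \<in> L2 U" "h \<in> L2 U" using g h by (auto simp: is_weak_partial_def)
  have "AE x in U. g x - h x = 0"
  proof (rule L2_U_zero[OF L2_diff[OF L]])
    fix \<phi> assume p: "\<phi> \<in> test_functions S"
    have i: "integrable U (\<lambda>x. v x * \<phi> x)" if "v \<in> L2 U" for v
      using L2_mult_integrable[OF that test_L2_U[OF test_cnj[OF p]]] by simp
    have "(\<integral>x. u x * partial_deriv b \<phi> x \<partial>U) = - (\<integral>x. g x * \<phi> x \<partial>U)"
      "(\<integral>x. u x * partial_deriv b \<phi> x \<partial>U) = - (\<integral>x. h x * \<phi> x \<partial>U)"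
      using g h p unfolding is_weak_partial_def by blast+
    then have "(\<integral>x. g x * \<phi> x \<partial>U) = (\<integral>x. h x * \<phi> x \<partial>U)" by simp
    then show "(\<integral>x. (g x - h x) * \<phi> x \<partial>U) = 0" by (simp add: left_diff_distrib i L)
  qed
  then show ?thesis by eventually_elim simp
qed

text \<open>
  The product of \<open>v\<close> with a test function of the sector is again one, so its derivatives integrate to zero.
\<close>

lemma classical_weak_partial:
  assumes v: "smooth v" and d: "partial_deriv b v \<in> L2 U" and b: "b \<in> Basis"
  shows "is_weak_partial S b v (partial_deriv b v)"
  unfolding is_weak_partial_def
proof (intro conjI d ballI)
  fix \<phi> assume p: "\<phi> \<in> test_functions S"
  from p obtain K where K: "K \<subseteq> S" "\<forall>x. x \<notin> K \<longrightarrow> \<phi> x = 0" "closed K"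
    unfolding test_functions_def using compact_imp_closed by blast
  have z: "\<phi> x = 0" "partial_deriv b \<phi> x = 0" if "x \<notin> S" for x
    using K that partial_deriv_zero_outside[OF K(3), of \<phi> x b] by blast+
  have t: "(\<lambda>x. v x * \<phi> x) \<in> test_functions S" by (rule test_mult[OF v p])
  have vb: "smooth (partial_deriv b v)" by (rule smooth_partial[OF v b])
  have pb: "partial_deriv b \<phi> \<in> test_functions S" by (rule test_partial[OF p b])
  have eq: "partial_deriv b (\<lambda>x. v x * \<phi> x) x = v x * partial_deriv b \<phi> x + partial_deriv b v x * \<phi> x" for x
    by (intro partial_deriv_mult smooth_differentiable v test_smooth[OF p])
  have i1: "integrable lborel (\<lambda>x. v x * partial_deriv b \<phi> x)" by (rule test_integrable[OF test_mult[OF v pb]])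
  have i2: "integrable lborel (\<lambda>x. partial_deriv b v x * \<phi> x)" by (rule test_integrable[OF test_mult[OF vb p]])
  have iU: "(\<integral>x. f x \<partial>U) = (\<integral>x. f x \<partial>lborel)"
    if "f \<in> borel_measurable borel" "\<And>x. x \<notin> S \<Longrightarrow> f x = 0" for f :: "real \<times> real \<Rightarrow> complex"
    unfolding integral_U[OF that(1)] using that(2) by (intro Bochner_Integration.integral_cong) (auto simp: indicator_def)
  have "0 = (\<integral>x. partial_deriv b (\<lambda>x. v x * \<phi> x) x \<partial>lborel)" by (rule integral_partial_deriv_zero[OF t b, symmetric])
  also have "\<dots> = (\<integral>x. v x * partial_deriv b \<phi> x \<partial>lborel) + (\<integral>x. partial_deriv b v x * \<phi> x \<partial>lborel)"
    unfolding eq by (rule Bochner_Integration.integral_add[OF i1 i2])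
  also have "(\<integral>x. v x * partial_deriv b \<phi> x \<partial>lborel) = (\<integral>x. v x * partial_deriv b \<phi> x \<partial>U)"
    by (rule iU[symmetric]) (use z smooth_borel[OF v] smooth_borel[OF test_smooth[OF pb]] in auto)
  also have "(\<integral>x. partial_deriv b v x * \<phi> x \<partial>lborel) = (\<integral>x. partial_deriv b v x * \<phi> x \<partial>U)"
    by (rule iU[symmetric]) (use z smooth_borel[OF vb] smooth_borel[OF test_smooth[OF p]] in auto)
  finally show "(\<integral>x. v x * partial_deriv b \<phi> x \<partial>U) = - (\<integral>x. partial_deriv b v x * \<phi> x \<partial>U)"
    unfolding eq_neg_iff_add_eq_0 by (rule sym)
qed

lemma classical_H1:
  assumes v: "smooth v" "v \<in> L2 U" and d: "\<And>b. b \<in> Basis \<Longrightarrow> partial_deriv b v \<in> L2 U"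
  shows "v \<in> H1 S" "b \<in> Basis \<Longrightarrow> AE x in U. weak_partial S b v x = partial_deriv b v x"
proof -
  show h: "v \<in> H1 S" unfolding H1_def using v classical_weak_partial[OF v(1) d] by blast
  show "b \<in> Basis \<Longrightarrow> AE x in U. weak_partial S b v x = partial_deriv b v x"
    by (rule weak_partial_unique[OF weak_partial_works[OF h] classical_weak_partial[OF v(1) d]])
qed

definition cutoff_bump :: "real \<times> real \<Rightarrow> complex" where
  "cutoff_bump z = box_bump (-1) 1 (-1) 1 z / box_bump (-1) 1 (-1) 1 (0, 0)"

text \<open>
  The support of \<open>cutoff m\<close> grows linearly in \<open>m\<close> and its gradient is of order \<open>1/m\<close>. The summand \<open>0\<close>
  matches the affine substitutions in \<open>smooth_affine\<close>.
\<close>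

definition cutoff :: "nat \<Rightarrow> real \<times> real \<Rightarrow> complex" where
  "cutoff m z = cutoff_bump ((1 / real (Suc m)) *\<^sub>R z + 0)"

lemma cutoff_bump_test: "cutoff_bump \<in> test_functions UNIV"
proof -
  have tb: "box_bump (-1) 1 (-1) 1 \<in> test_functions UNIV"
    unfolding test_functions_def
    by (intro CollectI conjI smooth_box_bump exI[of _ "{-1..1::real} \<times> {-1..1::real}"] compact_Times compact_Icc
        subset_UNIV allI impI box_bump_support)
  have eq: "cutoff_bump = (\<lambda>z. (1 / box_bump (-1) 1 (-1) 1 (0, 0)) * box_bump (-1) 1 (-1) 1 z)"
    by (simp add: cutoff_bump_def fun_eq_iff)
  show ?thesis unfolding eq by (rule test_cmult[OF tb])
qed

lemma cutoff_smooth: "smooth (cutoff m)"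
  unfolding cutoff_def[abs_def] by (rule smooth_affine(1)[OF test_smooth[OF cutoff_bump_test]])

lemma cutoff_partial: "b \<in> Basis \<Longrightarrow> partial_deriv b (cutoff m) z = complex_of_real (1 / real (Suc m)) * partial_deriv b cutoff_bump ((1 / real (Suc m)) *\<^sub>R z + 0)"
  unfolding cutoff_def[abs_def] by (simp only: smooth_affine(2)[OF test_smooth[OF cutoff_bump_test]])

lemma cutoff_test: "cutoff m \<in> test_functions UNIV"
proof -
  from cutoff_bump_test obtain K where K: "compact K" "\<forall>x. x \<notin> K \<longrightarrow> cutoff_bump x = 0" unfolding test_functions_def by blast
  have "cutoff m z = 0" if "z \<notin> (\<lambda>x. real (Suc m) *\<^sub>R x) ` K" for z
  proof -
    have "(1 / real (Suc m)) *\<^sub>R z + 0 \<notin> K"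
    proof
      assume "(1 / real (Suc m)) *\<^sub>R z + 0 \<in> K"
      then have "real (Suc m) *\<^sub>R ((1 / real (Suc m)) *\<^sub>R z + 0) \<in> (\<lambda>x. real (Suc m) *\<^sub>R x) ` K" by (rule imageI)
      moreover have "real (Suc m) *\<^sub>R ((1 / real (Suc m)) *\<^sub>R z + 0) = z"
        by (simp only: add_0_right scaleR_scaleR) simp
      ultimately show False using that by simp
    qed
    then show ?thesis using K(2) unfolding cutoff_def by blast
  qed
  moreover have "compact ((\<lambda>x. real (Suc m) *\<^sub>R x) ` K)" by (rule compact_scaling[OF K(1)])
  ultimately show ?thesis unfolding test_functions_def using cutoff_smooth by blast
qed

lemma cutoff_tendsto: "(\<lambda>m. cutoff m z) \<longlonglongrightarrow> 1"
proof -
  have "(\<lambda>m. (1 / real (Suc m)) *\<^sub>R z + 0) \<longlonglongrightarrow> 0 *\<^sub>R z + 0"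
    by (intro tendsto_add tendsto_scaleR tendsto_const LIMSEQ_Suc[OF lim_1_over_n])
  then have l: "(\<lambda>m. (1 / real (Suc m)) *\<^sub>R z + 0) \<longlonglongrightarrow> 0" by simp
  have "continuous_on UNIV cutoff_bump" by (rule smooth_continuous[OF test_smooth[OF cutoff_bump_test]])
  then have "isCont cutoff_bump 0" using continuous_on_eq_continuous_at[OF open_UNIV] by blast
  then have "(\<lambda>m. cutoff_bump ((1 / real (Suc m)) *\<^sub>R z + 0)) \<longlonglongrightarrow> cutoff_bump 0" by (rule isCont_tendsto_compose[OF _ l])
  moreover have "cutoff_bump 0 = 1"
    using box_bump_pos[of "-1" "(0, 0)" 1 "-1" 1] by (simp add: cutoff_bump_def zero_prod_def)
  ultimately show ?thesis by (simp add: cutoff_def[abs_def])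
qed

lemma L2_cutoff_tendsto:
  assumes f: "f \<in> L2 M" and m: "\<And>m. cutoff m \<in> borel_measurable M"
  shows "(\<lambda>m. L2_dist_sq M (\<lambda>x. cutoff m x * f x) f) \<longlonglongrightarrow> 0"
proof -
  note [measurable] = L2_measurable[OF f] m
  obtain C where C: "C \<ge> 0" "\<And>x. norm (cutoff_bump x) \<le> C" using test_bounded[OF cutoff_bump_test] by blast
  have cb: "norm (cutoff m x) \<le> C" for m x by (simp add: cutoff_def C)
  have "(\<lambda>m. \<integral>\<^sup>+x. ennreal ((norm (cutoff m x * f x - f x))\<^sup>2) \<partial>M) \<longlonglongrightarrow> (\<integral>\<^sup>+x. 0 \<partial>M)"
  proof (rule nn_integral_dominated_convergence[where w="\<lambda>x. ennreal ((C + 1)\<^sup>2) * ennreal ((norm (f x))\<^sup>2)"])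
    show "(\<integral>\<^sup>+x. ennreal ((C + 1)\<^sup>2) * ennreal ((norm (f x))\<^sup>2) \<partial>M) < \<infinity>"
      using f by (subst nn_integral_cmult) (auto simp: L2_iff_nn ennreal_mult_less_top)
    have "(norm (cutoff m x * f x - f x))\<^sup>2 \<le> (C + 1)\<^sup>2 * (norm (f x))\<^sup>2" for m x
    proof -
      have "norm (cutoff m x * f x - f x) = norm (cutoff m x - 1) * norm (f x)"
        by (simp add: norm_mult[symmetric] left_diff_distrib)
      also have "\<dots> \<le> (C + 1) * norm (f x)"
        using norm_triangle_ineq4[of "cutoff m x" 1] cb[of m x] by (intro mult_right_mono) auto
      finally have "(norm (cutoff m x * f x - f x))\<^sup>2 \<le> ((C + 1) * norm (f x))\<^sup>2" by (intro power_mono) auto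
      then show ?thesis by (simp add: power_mult_distrib)
    qed
    then show "AE x in M. ennreal ((norm (cutoff m x * f x - f x))\<^sup>2) \<le> ennreal ((C + 1)\<^sup>2) * ennreal ((norm (f x))\<^sup>2)" for m
      by (intro AE_I2) (simp add: ennreal_mult[symmetric] ennreal_leI)
    have "(\<lambda>m. ennreal ((norm (cutoff m x * f x - f x))\<^sup>2)) \<longlonglongrightarrow> ennreal ((norm (1 * f x - f x))\<^sup>2)" for x
      by (intro tendsto_intros cutoff_tendsto)
    then show "AE x in M. (\<lambda>m. ennreal ((norm (cutoff m x * f x - f x))\<^sup>2)) \<longlonglongrightarrow> 0" by simp
  qed measurable
  then show ?thesis by (simp add: L2_dist_sq_def)
qed

lemma L2_dist_sq_add_le:
  assumes [measurable]: "f \<in> borel_measurable M" "g \<in> borel_measurable M" "h \<in> borel_measurable M"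
  shows "L2_dist_sq M (\<lambda>x. f x + g x) h \<le> 2 * L2_dist_sq M f h + 2 * L2_dist_sq M g (\<lambda>x. 0)"
proof -
  have "L2_dist_sq M (\<lambda>x. f x + g x) h \<le> 2 * L2_dist_sq M (\<lambda>x. f x + g x) f + 2 * L2_dist_sq M f h"
    by (intro L2_dist_sq_triangle) measurable
  also have "L2_dist_sq M (\<lambda>x. f x + g x) f = L2_dist_sq M g (\<lambda>x. 0)" by (simp add: L2_dist_sq_def)
  finally show ?thesis by (simp add: add.commute)
qed

abbreviation H1_dist :: "(real \<times> real \<Rightarrow> complex) \<Rightarrow> (real \<times> real \<Rightarrow> complex) \<Rightarrow> (real \<times> real \<Rightarrow> real \<times> real \<Rightarrow> complex) \<Rightarrow> ennreal" where
  "H1_dist \<phi> u g \<equiv> L2_dist_sq U \<phi> u + (\<Sum>b\<in>Basis. L2_dist_sq U (partial_deriv b \<phi>) (g b))"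

lemma H1_dist_tendsto_iff:
  "(\<lambda>n. H1_dist (\<phi> n) (u n) (g n)) \<longlonglongrightarrow> 0 \<longleftrightarrow>
     (\<lambda>n. L2_dist_sq U (\<phi> n) (u n)) \<longlonglongrightarrow> 0 \<and> (\<forall>b\<in>Basis. (\<lambda>n. L2_dist_sq U (partial_deriv b (\<phi> n)) (g n b)) \<longlonglongrightarrow> 0)" (is "?L \<longleftrightarrow> ?R")
proof
  assume L: ?L
  have "L2_dist_sq U (partial_deriv b (\<phi> n)) (g n b) \<le> H1_dist (\<phi> n) (u n) (g n)" if "b \<in> Basis" for b n
    using that by (intro add_increasing member_le_sum) auto
  then show ?R using L by (auto intro: tendsto_ennreal_squeeze0[OF _ L])
next
  assume ?R
  then have "(\<lambda>n. H1_dist (\<phi> n) (u n) (g n)) \<longlonglongrightarrow> 0 + (\<Sum>b\<in>(Basis::(real\<times>real) set). 0)"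
    by (intro tendsto_add tendsto_sum) auto
  then show ?L by simp
qed

lemma cutoff_H1_tendsto:
  assumes v: "smooth v" "v \<in> L2 U" and d: "\<And>b. b \<in> Basis \<Longrightarrow> partial_deriv b v \<in> L2 U"
  shows "(\<lambda>x. cutoff m x * v x) \<in> test_functions UNIV"
    and "(\<lambda>m. H1_dist (\<lambda>x. cutoff m x * v x) v (\<lambda>b. partial_deriv b v)) \<longlonglongrightarrow> 0"
proof -
  show "(\<lambda>x. cutoff m x * v x) \<in> test_functions UNIV" for m
    using test_mult[OF v(1) cutoff_test[of m]] by (simp add: mult.commute)
  have cm: "cutoff m \<in> borel_measurable U" for m by (rule borel_U[OF smooth_borel[OF cutoff_smooth]])
  show "(\<lambda>m. H1_dist (\<lambda>x. cutoff m x * v x) v (\<lambda>b. partial_deriv b v)) \<longlonglongrightarrow> 0"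
    unfolding H1_dist_tendsto_iff
  proof (intro conjI ballI L2_cutoff_tendsto[OF v(2) cm])
    fix b :: "real \<times> real" assume b: "b \<in> Basis"
    obtain C where C: "C \<ge> 0" "\<And>x. norm (partial_deriv b cutoff_bump x) \<le> C" using test_bounded[OF test_partial[OF cutoff_bump_test b]] by blast
    have eq: "partial_deriv b (\<lambda>x. cutoff m x * v x) = (\<lambda>x. cutoff m x * partial_deriv b v x + partial_deriv b (cutoff m) x * v x)" for m
      by (intro ext partial_deriv_mult smooth_differentiable cutoff_smooth v)
    have [measurable]: "partial_deriv b (cutoff m) \<in> borel_measurable U" for m
      by (rule borel_U[OF smooth_borel[OF smooth_partial[OF cutoff_smooth b]]])
    note [measurable] = cm L2_measurable[OF v(2)] L2_measurable[OF d[OF b]]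
    have "L2_dist_sq U (\<lambda>x. partial_deriv b (cutoff m) x * v x) (\<lambda>x. 0) \<le> ennreal ((C * (1 / real (Suc m)))\<^sup>2) * ennreal ((L2_norm U v)\<^sup>2)" for m
    proof -
      have "L2_dist_sq U (\<lambda>x. partial_deriv b (cutoff m) x * v x) (\<lambda>x. 0)
          \<le> (\<integral>\<^sup>+x. ennreal ((C * (1 / real (Suc m)))\<^sup>2) * ennreal ((norm (v x))\<^sup>2) \<partial>U)"
        unfolding L2_dist_sq_def
      proof (rule nn_integral_mono)
        fix x
        have "norm (partial_deriv b (cutoff m) x) \<le> C * (1 / real (Suc m))"
          using mult_right_mono[OF C(2), of "1 / real (Suc m)"] unfolding cutoff_partial[OF b] norm_mult norm_of_real
          by (simp add: mult.commute)
        then have "norm (partial_deriv b (cutoff m) x) * norm (v x) \<le> (C * (1 / real (Suc m))) * norm (v x)"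
          by (rule mult_right_mono) simp
        then have "(norm (partial_deriv b (cutoff m) x * v x))\<^sup>2 \<le> ((C * (1 / real (Suc m))) * norm (v x))\<^sup>2"
          unfolding norm_mult by (rule power_mono) simp
        then show "ennreal ((norm (partial_deriv b (cutoff m) x * v x - 0))\<^sup>2) \<le> ennreal ((C * (1 / real (Suc m)))\<^sup>2) * ennreal ((norm (v x))\<^sup>2)"
          by (simp only: diff_0_right power_mult_distrib[of "C * _"] ennreal_mult[symmetric] zero_le_power2 ennreal_leI)
      qed
      also have "\<dots> = ennreal ((C * (1 / real (Suc m)))\<^sup>2) * ennreal ((L2_norm U v)\<^sup>2)"
        unfolding nn_L2_norm[OF v(2), symmetric] by (rule nn_integral_cmult) measurable
      finally show ?thesis .
    qed
    moreover have "(\<lambda>m. ennreal ((C * (1 / real (Suc m)))\<^sup>2) * ennreal ((L2_norm U v)\<^sup>2)) \<longlonglongrightarrow> 0"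
    proof -
      have "(\<lambda>m. ennreal ((C * (1 / real (Suc m)))\<^sup>2 * (L2_norm U v)\<^sup>2)) \<longlonglongrightarrow> ennreal ((C * 0)\<^sup>2 * (L2_norm U v)\<^sup>2)"
        by (intro tendsto_ennrealI tendsto_mult tendsto_power tendsto_const LIMSEQ_Suc[OF lim_1_over_n])
      then show ?thesis by (simp add: ennreal_mult[symmetric])
    qed
    ultimately have "(\<lambda>m. L2_dist_sq U (\<lambda>x. partial_deriv b (cutoff m) x * v x) (\<lambda>x. 0)) \<longlonglongrightarrow> 0"
      by (rule tendsto_ennreal_squeeze0)
    from tendsto_ennreal_2add0[OF L2_cutoff_tendsto[OF d[OF b] cm] this]
    show "(\<lambda>m. L2_dist_sq U (partial_deriv b (\<lambda>x. cutoff m x * v x)) (partial_deriv b v)) \<longlonglongrightarrow> 0"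
      unfolding eq by (rule tendsto_ennreal_squeeze0[rotated]) (rule L2_dist_sq_add_le; measurable)
  qed
qed

text \<open>
  For \<open>x\<close> in the sector the kernel \<open>w \<mapsto> mollifier n (x - w)\<close> is a test function of the sector, so the
  weak derivative may be moved from it to \<open>u\<close>.
\<close>

lemma conv_weak_partial:
  assumes u: "u \<in> H1 S" and b: "b \<in> Basis"
    and f: "f \<in> borel_measurable borel" "f \<in> L2 lborel" "AE x in U. u x = f x" "\<And>x. x \<notin> S \<Longrightarrow> f x = 0"
    and g: "g \<in> borel_measurable borel" "g \<in> L2 lborel" "AE x in U. weak_partial S b u x = g x" "\<And>x. x \<notin> S \<Longrightarrow> g x = 0"
    and x: "x \<in> S"
  shows "partial_deriv b (conv f (mollifier n)) x = conv g (mollifier n) x"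
proof -
  let ?k = "\<lambda>w. mollifier n (x - w)"
  have t: "?k \<in> test_functions S" by (rule mollifier_reflect_test[OF x])
  have pk: "partial_deriv b ?k = (\<lambda>w. - partial_deriv b (mollifier n) (x - w))" by (rule test_reflect(2)[OF mollifier_test b])
  have "partial_deriv b (conv f (mollifier n)) x = (\<integral>w. f w * partial_deriv b (mollifier n) (x - w) \<partial>lborel)"
    unfolding conv_partial[OF f(2) mollifier_test b] by (simp add: conv_def)
  also have "\<dots> = (\<integral>w. u w * partial_deriv b (mollifier n) (x - w) \<partial>U)"
  proof (rule conv_eq_U[OF f(1,4,3) H1_L2[OF u]])
    have "(\<lambda>w. - partial_deriv b ?k w) \<in> borel_measurable borel"
      using smooth_borel[OF smooth_partial[OF test_smooth[OF t] b]] by (rule borel_measurable_uminus)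
    then show "(\<lambda>w. partial_deriv b (mollifier n) (x - w)) \<in> borel_measurable borel" unfolding pk by simp
  qed
  also have "\<dots> = - (\<integral>w. u w * partial_deriv b ?k w \<partial>U)" unfolding pk by simp
  also have "\<dots> = (\<integral>w. weak_partial S b u w * ?k w \<partial>U)"
    using weak_partial_works[OF u b] t unfolding is_weak_partial_def by simp
  also have "\<dots> = (\<integral>w. g w * ?k w \<partial>lborel)"
    using conv_eq_U[OF g(1,4,3) weak_partial_L2[OF u b] smooth_borel[OF test_smooth[OF t]]] by (rule sym)
  finally show ?thesis by (simp add: conv_def)
qed

text \<open>
  Mollify, then cut off. Both operations converge in the Sobolev norm, and the support of the
  result is compact in the plane but may meet the boundary of the sector.
\<close>

lemma H1_dense:
  assumes u: "u \<in> H1 S"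
  obtains \<phi> where "\<And>n. \<phi> n \<in> test_functions UNIV" "(\<lambda>n. H1_dist (\<phi> n) u (\<lambda>b. weak_partial S b u)) \<longlonglongrightarrow> 0"
proof -
  obtain f where f: "f \<in> borel_measurable borel" "f \<in> L2 lborel" "AE x in U. u x = f x" "\<And>x. x \<notin> S \<Longrightarrow> f x = 0"
    using borel_representative[OF H1_L2[OF u]] by blast
  have "\<forall>b\<in>Basis. \<exists>g. g \<in> borel_measurable borel \<and> g \<in> L2 lborel \<and> (AE x in U. weak_partial S b u x = g x) \<and> (\<forall>x. x \<notin> S \<longrightarrow> g x = 0)"
  proof
    fix b :: "real \<times> real" assume b: "b \<in> Basis"
    obtain g where "g \<in> borel_measurable borel" "g \<in> L2 lborel" "AE x in U. weak_partial S b u x = g x" "\<And>x. x \<notin> S \<Longrightarrow> g x = 0"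
      using borel_representative[OF weak_partial_L2[OF u b]] by blast
    then show "\<exists>g. g \<in> borel_measurable borel \<and> g \<in> L2 lborel \<and> (AE x in U. weak_partial S b u x = g x) \<and> (\<forall>x. x \<notin> S \<longrightarrow> g x = 0)"
      by blast
  qed
  from bchoice[OF this] obtain G where G: "\<And>b. b \<in> Basis \<Longrightarrow> G b \<in> borel_measurable borel" "\<And>b. b \<in> Basis \<Longrightarrow> G b \<in> L2 lborel"
    "\<And>b. b \<in> Basis \<Longrightarrow> AE x in U. weak_partial S b u x = G b x" "\<And>b x. b \<in> Basis \<Longrightarrow> x \<notin> S \<Longrightarrow> G b x = 0" by blast
  define v where "v n = conv f (mollifier n)" for n
  have vs: "smooth (v n)" for n unfolding v_def by (rule conv_smooth[OF f(2) mollifier_test])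
  have vb: "v n \<in> borel_measurable borel" for n by (rule smooth_borel[OF vs])
  have lim: "(\<lambda>n. L2_dist_sq U (conv h (mollifier n)) w) \<longlonglongrightarrow> 0"
    if "h \<in> borel_measurable borel" "h \<in> L2 lborel" "AE x in U. w x = h x" for h w
  proof -
    have "(\<lambda>n. L2_dist_sq U (conv h (mollifier n)) h) \<longlonglongrightarrow> 0"
      by (rule tendsto_ennreal_squeeze0[OF L2_dist_U_le conv_mollifier_tendsto])
         (use that smooth_borel[OF conv_smooth[OF that(2) mollifier_test]] in auto)
    moreover have "L2_dist_sq U (conv h (mollifier n)) h = L2_dist_sq U (conv h (mollifier n)) w" for n
      using that(3) by (intro L2_dist_cong_U) (auto elim!: eventually_mono)
    ultimately show ?thesis by simp
  qed
  have dS: "AE x in U. partial_deriv b (v n) x = conv (G b) (mollifier n) x" if "b \<in> Basis" for b n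
    unfolding AE_sector_iff v_def using conv_weak_partial[OF u that f G(1-4)[OF that]] by (intro AE_I2) auto
  have dlim: "(\<lambda>n. L2_dist_sq U (partial_deriv b (v n)) (weak_partial S b u)) \<longlonglongrightarrow> 0" if b: "b \<in> Basis" for b
  proof -
    have "L2_dist_sq U (partial_deriv b (v n)) (weak_partial S b u) = L2_dist_sq U (conv (G b) (mollifier n)) (weak_partial S b u)" for n
      by (rule L2_dist_cong_U[OF dS[OF b]]) simp
    then show ?thesis using lim[OF G(1-3)[OF b]] by simp
  qed
  have vlim: "(\<lambda>n. H1_dist (v n) u (\<lambda>b. weak_partial S b u)) \<longlonglongrightarrow> 0"
    unfolding H1_dist_tendsto_iff using dlim lim[OF f(1-3)] by (auto simp: v_def)
  then have "\<forall>\<^sub>F n in sequentially. H1_dist (v n) u (\<lambda>b. weak_partial S b u) < 1" by (rule order_tendstoD) simp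
  \<comment> \<open>From \<open>n0\<close> on the distance to \<open>u\<close> is finite, so the mollified functions and their derivatives are square-integrable over the sector.\<close>
  then obtain n0 where n0: "\<And>n. n \<ge> n0 \<Longrightarrow> H1_dist (v n) u (\<lambda>b. weak_partial S b u) < 1"
    unfolding eventually_sequentially by blast
  have inL2: "h \<in> L2 U" if "L2_dist_sq U h w < 1" "w \<in> L2 U" "h \<in> borel_measurable U" for h w
  proof -
    have "(\<lambda>x. h x - w x) \<in> L2 U"
      using that L2_measurable[OF that(2)] unfolding L2_iff_nn L2_dist_sq_def by (auto intro: order.strict_trans)
    from L2_add[OF this that(2)] show ?thesis by simp
  qed
  have v2: "v n \<in> L2 U" if "n \<ge> n0" for n
  proof (rule inL2[OF _ H1_L2[OF u] borel_U[OF vb]])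
    show "L2_dist_sq U (v n) u < 1" using n0[OF that] by (rule le_less_trans[rotated]) simp
  qed
  have d2: "partial_deriv b (v n) \<in> L2 U" if "n \<ge> n0" "b \<in> Basis" for n b
  proof (rule inL2[OF _ weak_partial_L2[OF u that(2)] borel_U[OF smooth_borel[OF smooth_partial[OF vs that(2)]]]])
    have "L2_dist_sq U (partial_deriv b (v n)) (weak_partial S b u) \<le> H1_dist (v n) u (\<lambda>b. weak_partial S b u)"
      using that by (intro add_increasing member_le_sum) auto
    then show "L2_dist_sq U (partial_deriv b (v n)) (weak_partial S b u) < 1" using n0[OF that(1)] by (rule le_less_trans)
  qed
  have ex_m: "\<exists>m. H1_dist (\<lambda>x. cutoff m x * v n x) (v n) (\<lambda>b. partial_deriv b (v n)) < ennreal (1 / real (Suc n))" if "n \<ge> n0" for n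
  proof -
    have "\<forall>\<^sub>F m in sequentially. H1_dist (\<lambda>x. cutoff m x * v n x) (v n) (\<lambda>b. partial_deriv b (v n)) < ennreal (1 / real (Suc n))"
      by (rule order_tendstoD(2)[OF cutoff_H1_tendsto(2)[OF vs v2[OF that] d2[OF that]]]) auto
    then show ?thesis unfolding eventually_sequentially by blast
  qed
  have "\<forall>n. \<exists>m. n \<ge> n0 \<longrightarrow> H1_dist (\<lambda>x. cutoff m x * v n x) (v n) (\<lambda>b. partial_deriv b (v n)) < ennreal (1 / real (Suc n))"
    using ex_m by blast
  from choice[OF this] obtain m where m: "\<And>n. n \<ge> n0 \<Longrightarrow> H1_dist (\<lambda>x. cutoff (m n) x * v n x) (v n) (\<lambda>b. partial_deriv b (v n)) < ennreal (1 / real (Suc n))" by blast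
  define \<phi> where "\<phi> n = (\<lambda>x. cutoff (m (n + n0)) x * v (n + n0) x)" for n
  have t: "\<phi> n \<in> test_functions UNIV" for n
  proof -
    have "\<phi> n = (\<lambda>x. v (n + n0) x * cutoff (m (n + n0)) x)" by (simp add: \<phi>_def fun_eq_iff)
    then show ?thesis using test_mult[OF vs cutoff_test] by simp
  qed
  have c0: "(\<lambda>n. H1_dist (\<phi> n) (v (n + n0)) (\<lambda>b. partial_deriv b (v (n + n0)))) \<longlonglongrightarrow> 0"
  proof (rule tendsto_ennreal_squeeze0)
    show "H1_dist (\<phi> n) (v (n + n0)) (\<lambda>b. partial_deriv b (v (n + n0))) \<le> ennreal (1 / real (Suc n))" for n
    proof -
      have "1 / real (Suc (n + n0)) \<le> 1 / real (Suc n)" by (intro divide_left_mono) auto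
      then show ?thesis using less_imp_le[OF m[of "n + n0"]] unfolding \<phi>_def by (auto intro: order.trans ennreal_leI)
    qed
    have "(\<lambda>n. ennreal (1 / real (Suc n))) \<longlonglongrightarrow> ennreal 0" by (intro tendsto_ennrealI LIMSEQ_Suc[OF lim_1_over_n])
    then show "(\<lambda>n. ennreal (1 / real (Suc n))) \<longlonglongrightarrow> 0" by simp
  qed
  have v0: "(\<lambda>n. H1_dist (v (n + n0)) u (\<lambda>b. weak_partial S b u)) \<longlonglongrightarrow> 0" by (rule LIMSEQ_ignore_initial_segment[OF vlim])
  have "(\<lambda>n. L2_dist_sq U (\<phi> n) u) \<longlonglongrightarrow> 0"
  proof (rule tendsto_ennreal_squeeze0[OF _ tendsto_ennreal_2add0])
    show "L2_dist_sq U (\<phi> n) u \<le> 2 * L2_dist_sq U (\<phi> n) (v (n + n0)) + 2 * L2_dist_sq U (v (n + n0)) u" for n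
      by (intro L2_dist_sq_triangle L2_measurable[OF test_L2_U[OF t]] borel_U[OF vb] L2_measurable[OF H1_L2[OF u]])
  qed (use c0 v0 in \<open>simp_all only: H1_dist_tendsto_iff\<close>)
  moreover have "(\<lambda>n. L2_dist_sq U (partial_deriv b (\<phi> n)) (weak_partial S b u)) \<longlonglongrightarrow> 0" if b: "b \<in> Basis" for b
  proof (rule tendsto_ennreal_squeeze0[OF _ tendsto_ennreal_2add0])
    show "L2_dist_sq U (partial_deriv b (\<phi> n)) (weak_partial S b u) \<le> 2 * L2_dist_sq U (partial_deriv b (\<phi> n)) (partial_deriv b (v (n + n0)))
       + 2 * L2_dist_sq U (partial_deriv b (v (n + n0))) (weak_partial S b u)" for n
      by (intro L2_dist_sq_triangle L2_measurable[OF test_L2_U[OF test_partial[OF t b]]] L2_measurable[OF weak_partial_L2[OF u b]]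
          borel_U[OF smooth_borel[OF smooth_partial[OF vs b]]])
  qed (use c0 v0 b in \<open>auto simp only: H1_dist_tendsto_iff\<close>)
  ultimately have "(\<lambda>n. H1_dist (\<phi> n) u (\<lambda>b. weak_partial S b u)) \<longlonglongrightarrow> 0" unfolding H1_dist_tendsto_iff by blast
  with t that show ?thesis by blast
qed

lemma trace_dist_le:
  assumes f: "f \<in> test_functions UNIV" and g: "g \<in> test_functions UNIV"
  shows "L2_dist_sq B f g \<le> ennreal (1 / sin \<alpha>) * (L2_dist_sq U f g + L2_dist_sq U (px f) (px g))"
proof -
  have t: "(\<lambda>x. f x - g x) \<in> test_functions UNIV" by (rule test_diff[OF f g])
  have b: "(1, 0) \<in> (Basis :: (real \<times> real) set)" by (simp add: Basis_plane)
  have pd: "px (\<lambda>x. f x - g x) = (\<lambda>x. px f x - px g x)"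
  proof
    fix x
    have "((\<lambda>x. f x - g x) has_derivative (\<lambda>h. frechet_derivative f (at x) h - frechet_derivative g (at x) h)) (at x)"
      by (intro has_derivative_diff frechet_derivative_works[THEN iffD1] smooth_differentiable test_smooth[OF f] test_smooth[OF g])
    from partial_derivI[OF this, of "(1, 0)"] show "px (\<lambda>x. f x - g x) x = px f x - px g x" by (simp only: partial_deriv_def)
  qed
  have le: "(L2_norm B (\<lambda>x. f x - g x))\<^sup>2 \<le> 1 / sin \<alpha> * ((L2_norm U (\<lambda>x. f x - g x))\<^sup>2 + (L2_norm U (\<lambda>x. px f x - px g x))\<^sup>2)"
    using trace_inequality[OF t] sin_pos unfolding pd by (simp add: field_simps)
  show ?thesis
    unfolding L2_dist_sq_eq[OF test_L2_B[OF f] test_L2_B[OF g]] L2_dist_sq_eq[OF test_L2_U[OF f] test_L2_U[OF g]]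
      L2_dist_sq_eq[OF test_L2_U[OF test_partial[OF f b]] test_L2_U[OF test_partial[OF g b]]]
    using le sin_pos by (simp add: ennreal_plus[symmetric] ennreal_mult[symmetric] ennreal_leI del: ennreal_plus)
qed

text \<open>
  By the trace inequality the boundary values of a sequence as in \<open>H1_dense\<close> form a Cauchy sequence.
\<close>

lemma trace_exists:
  assumes u: "u \<in> H1 S" shows "is_trace S u (boundary_trace S u)"
proof -
  obtain \<phi> where t: "\<And>n. \<phi> n \<in> test_functions UNIV" and lim: "(\<lambda>n. H1_dist (\<phi> n) u (\<lambda>b. weak_partial S b u)) \<longlonglongrightarrow> 0"
    using H1_dense[OF u] by blast
  have b: "(1, 0) \<in> (Basis :: (real \<times> real) set)" by (simp add: Basis_plane)
  have l1: "(\<lambda>n. L2_dist_sq U (\<phi> n) u) \<longlonglongrightarrow> 0" "(\<lambda>n. L2_dist_sq U (px (\<phi> n)) (weak_partial S (1, 0) u)) \<longlonglongrightarrow> 0"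
    using lim b by (auto simp only: H1_dist_tendsto_iff)
  define a where "a n = L2_dist_sq U (\<phi> n) u + L2_dist_sq U (px (\<phi> n)) (weak_partial S (1, 0) u)" for n
  have a: "a \<longlonglongrightarrow> 0" unfolding a_def using tendsto_add[OF l1] by simp
  have le: "L2_dist_sq B (\<phi> m) (\<phi> n) \<le> ennreal (2 / sin \<alpha>) * (a m + a n)" for m n
  proof -
    have "L2_dist_sq U (\<phi> m) (\<phi> n) \<le> 2 * L2_dist_sq U (\<phi> m) u + 2 * L2_dist_sq U u (\<phi> n)"
      by (intro L2_dist_sq_triangle L2_measurable[OF test_L2_U[OF t]] L2_measurable[OF H1_L2[OF u]])
    moreover have "L2_dist_sq U (px (\<phi> m)) (px (\<phi> n)) \<le> 2 * L2_dist_sq U (px (\<phi> m)) (weak_partial S (1, 0) u) + 2 * L2_dist_sq U (weak_partial S (1, 0) u) (px (\<phi> n))"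
      by (intro L2_dist_sq_triangle L2_measurable[OF test_L2_U[OF test_partial[OF t b]]] L2_measurable[OF weak_partial_L2[OF u b]])
    ultimately have "L2_dist_sq U (\<phi> m) (\<phi> n) + L2_dist_sq U (px (\<phi> m)) (px (\<phi> n)) \<le> 2 * (a m + a n)"
      unfolding a_def by (rule order.trans[OF add_mono])
        (simp add: L2_dist_sq_sym[of U u] L2_dist_sq_sym[of U "weak_partial S (1, 0) u"] distrib_left add_ac)
    then have "ennreal (1 / sin \<alpha>) * (L2_dist_sq U (\<phi> m) (\<phi> n) + L2_dist_sq U (px (\<phi> m)) (px (\<phi> n))) \<le> ennreal (1 / sin \<alpha>) * (2 * (a m + a n))"
      by (rule mult_left_mono) simp
    also have "\<dots> = ennreal (2 / sin \<alpha>) * (a m + a n)"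
    proof -
      have "ennreal (2 / sin \<alpha>) = ennreal (1 / sin \<alpha>) * 2"
        using sin_pos ennreal_mult[of "1 / sin \<alpha>" 2] by simp
      then show ?thesis by (simp add: mult.assoc)
    qed
    finally show ?thesis using trace_dist_le[OF t[of m] t[of n]] by (rule order.trans[rotated])
  qed
  have "\<exists>g\<in>L2 B. (\<lambda>n. L2_dist_sq B (\<phi> n) g) \<longlonglongrightarrow> 0"
  proof (rule L2_complete[OF test_L2_B[OF t]])
    fix e :: real assume e: "e > 0"
    have "0 < ennreal (e * sin \<alpha> / 4)" using e sin_pos by simp
    then have "\<forall>\<^sub>F n in sequentially. a n < ennreal (e * sin \<alpha> / 4)" by (rule order_tendstoD(2)[OF a])
    then obtain N where N: "\<And>n. n \<ge> N \<Longrightarrow> a n \<le> ennreal (e * sin \<alpha> / 4)" unfolding eventually_sequentially by (meson less_imp_le)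
    have "L2_dist_sq B (\<phi> m) (\<phi> n) \<le> ennreal e" if "m \<ge> N" "n \<ge> N" for m n
    proof -
      have "L2_dist_sq B (\<phi> m) (\<phi> n) \<le> ennreal (2 / sin \<alpha>) * (ennreal (e * sin \<alpha> / 4) + ennreal (e * sin \<alpha> / 4))"
        by (rule order.trans[OF le]) (intro mult_left_mono add_mono N that, simp)
      also have "\<dots> = ennreal (2 / sin \<alpha> * (e * sin \<alpha> / 4 + e * sin \<alpha> / 4))"
        using e sin_pos by (simp add: ennreal_plus[symmetric] ennreal_mult[symmetric] del: ennreal_plus)
      also have "2 / sin \<alpha> * (e * sin \<alpha> / 4 + e * sin \<alpha> / 4) = e" using sin_pos by (simp add: field_simps)
      finally show ?thesis .
    qed
    then show "\<exists>N. \<forall>m\<ge>N. \<forall>n\<ge>N. L2_dist_sq B (\<phi> m) (\<phi> n) \<le> ennreal e" by blast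
  qed
  then obtain g where "g \<in> L2 B" "(\<lambda>n. L2_dist_sq B (\<phi> n) g) \<longlonglongrightarrow> 0" by blast
  then have "is_trace S u g" unfolding is_trace_def using t lim by blast
  then show ?thesis unfolding boundary_trace_def by (rule someI[of "is_trace S u"])
qed

lemma trace_L2: "u \<in> H1 S \<Longrightarrow> boundary_trace S u \<in> L2 B"
  using trace_exists unfolding is_trace_def by blast

lemma H1_approx:
  assumes u: "u \<in> H1 S"
  obtains \<phi> where "\<And>n. \<phi> n \<in> test_functions UNIV" "(\<lambda>n. L2_dist_sq U (\<phi> n) u) \<longlonglongrightarrow> 0"
    "\<And>b. b \<in> Basis \<Longrightarrow> (\<lambda>n. L2_dist_sq U (partial_deriv b (\<phi> n)) (weak_partial S b u)) \<longlonglongrightarrow> 0"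
    "(\<lambda>n. L2_dist_sq B (\<phi> n) (boundary_trace S u)) \<longlonglongrightarrow> 0"
proof -
  from trace_exists[OF u] obtain \<phi> where "\<forall>k. \<phi> k \<in> test_functions UNIV"
    "(\<lambda>k. H1_dist (\<phi> k) u (\<lambda>b. weak_partial S b u)) \<longlonglongrightarrow> 0" "(\<lambda>k. L2_dist_sq B (\<phi> k) (boundary_trace S u)) \<longlonglongrightarrow> 0"
    unfolding is_trace_def by blast
  then show ?thesis using that unfolding H1_dist_tendsto_iff by blast
qed

text \<open>
  The trace of \<open>v\<close> is defined through some approximating sequence; comparing it with the cut-offs
  of \<open>v\<close> by the trace inequality shows that it is the restriction of \<open>v\<close>.
\<close>

lemma classical_trace:
  assumes v: "smooth v" "v \<in> L2 U" and d: "\<And>b. b \<in> Basis \<Longrightarrow> partial_deriv b v \<in> L2 U" and vB: "v \<in> L2 B"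
  shows "AE x in B. boundary_trace S v x = v x"
proof -
  have h: "v \<in> H1 S" by (rule classical_H1(1)[OF v d])
  obtain \<phi> where p: "\<And>n. \<phi> n \<in> test_functions UNIV" "(\<lambda>n. L2_dist_sq U (\<phi> n) v) \<longlonglongrightarrow> 0"
    "\<And>b. b \<in> Basis \<Longrightarrow> (\<lambda>n. L2_dist_sq U (partial_deriv b (\<phi> n)) (weak_partial S b v)) \<longlonglongrightarrow> 0"
    "(\<lambda>n. L2_dist_sq B (\<phi> n) (boundary_trace S v)) \<longlonglongrightarrow> 0" using H1_approx[OF h] by blast
  let ?c = "\<lambda>n x. cutoff n x * v x"
  have b: "(1, 0) \<in> (Basis :: (real \<times> real) set)" by (simp add: Basis_plane)
  have ct: "?c n \<in> test_functions UNIV" for n by (rule cutoff_H1_tendsto(1)[OF v d])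
  have cl: "(\<lambda>n. L2_dist_sq U (?c n) v) \<longlonglongrightarrow> 0" "(\<lambda>n. L2_dist_sq U (px (?c n)) (px v)) \<longlonglongrightarrow> 0"
    using cutoff_H1_tendsto(2)[OF v d] b by (auto simp only: H1_dist_tendsto_iff)
  have pl: "(\<lambda>n. L2_dist_sq U (px (\<phi> n)) (px v)) \<longlonglongrightarrow> 0"
  proof -
    have "L2_dist_sq U (px (\<phi> n)) (weak_partial S (1, 0) v) = L2_dist_sq U (px (\<phi> n)) (px v)" for n
      by (rule L2_dist_cong_U[OF _ classical_H1(2)[OF v d b]]) simp
    then show ?thesis using p(3)[OF b] by simp
  qed
  have m: "\<phi> n \<in> borel_measurable U" "?c n \<in> borel_measurable U" "px (\<phi> n) \<in> borel_measurable U" "px (?c n) \<in> borel_measurable U"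
    "v \<in> borel_measurable U" "px v \<in> borel_measurable U" for n
    using L2_measurable[OF test_L2_U[OF p(1)]] L2_measurable[OF test_L2_U[OF ct]]
      L2_measurable[OF test_L2_U[OF test_partial[OF p(1) b]]] L2_measurable[OF test_L2_U[OF test_partial[OF ct b]]]
      L2_measurable[OF v(2)] L2_measurable[OF d[OF b]] by auto
  have "(\<lambda>n. L2_dist_sq U (?c n) (\<phi> n)) \<longlonglongrightarrow> 0"
    by (rule tendsto_ennreal_squeeze0[OF _ tendsto_ennreal_2add0[OF cl(1) p(2)]])
       (use L2_dist_sq_triangle[OF m(2,5,1)] in \<open>simp add: L2_dist_sq_sym[of U v]\<close>)
  moreover have "(\<lambda>n. L2_dist_sq U (px (?c n)) (px (\<phi> n))) \<longlonglongrightarrow> 0"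
    by (rule tendsto_ennreal_squeeze0[OF _ tendsto_ennreal_2add0[OF cl(2) pl]])
       (use L2_dist_sq_triangle[OF m(4,6,3)] in \<open>simp add: L2_dist_sq_sym[of U "px v"]\<close>)
  ultimately have "(\<lambda>n. ennreal (1 / sin \<alpha>) * (L2_dist_sq U (?c n) (\<phi> n) + L2_dist_sq U (px (?c n)) (px (\<phi> n)))) \<longlonglongrightarrow> ennreal (1 / sin \<alpha>) * (0 + 0)"
    by (intro ennreal_tendsto_cmult tendsto_add) auto
  then have B0: "(\<lambda>n. L2_dist_sq B (?c n) (\<phi> n)) \<longlonglongrightarrow> 0"
    by (intro tendsto_ennreal_squeeze0[OF trace_dist_le[OF ct p(1)]]) simp
  have "(\<lambda>n. L2_dist_sq B (?c n) (boundary_trace S v)) \<longlonglongrightarrow> 0"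
    by (rule tendsto_ennreal_squeeze0[OF L2_dist_sq_triangle tendsto_ennreal_2add0[OF B0 p(4)]])
       (use L2_measurable[OF test_L2_B[OF ct]] L2_measurable[OF test_L2_B[OF p(1)]] L2_measurable[OF trace_L2[OF h]] in auto)
  moreover have "(\<lambda>n. L2_dist_sq B (?c n) v) \<longlonglongrightarrow> 0"
    by (rule L2_cutoff_tendsto[OF vB borel_B[OF smooth_borel[OF cutoff_smooth]]])
  ultimately show ?thesis
    by (intro L2_limit_unique[where \<phi>="?c"] L2_measurable[OF test_L2_B[OF ct]] L2_measurable[OF trace_L2[OF h]] L2_measurable[OF vB])
qed

text \<open>
  The Robin form with classical derivatives and boundary values.
\<close>

definition test_form :: "(real \<times> real \<Rightarrow> complex) \<Rightarrow> (real \<times> real \<Rightarrow> complex) \<Rightarrow> complex" where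
  "test_form \<phi> \<psi> = (\<Sum>b\<in>Basis. L2_inner U (partial_deriv b \<phi>) (partial_deriv b \<psi>)) - L2_inner B \<phi> \<psi>"

end

section \<open>The weak eigenvalue equation for smooth functions\<close>

lemma nn_integral_exp_abs:
  fixes c :: real
  assumes c: "c > 0"
  shows "(\<integral>\<^sup>+x. ennreal (exp (- c * \<bar>x\<bar>)) \<partial>lborel) < top"
proof -
  have half: "(\<integral>\<^sup>+x. ennreal (exp (- c * x)) * indicator {0..} x \<partial>lborel) = ennreal (0 - (- exp (- c * 0) / c))"
  proof (rule nn_integral_FTC_atLeast)
    show "((\<lambda>x. - exp (- c * x) / c) has_real_derivative exp (- c * x)) (at x)" for x
      using c by (auto intro!: derivative_eq_intros)
    have "((\<lambda>x. - exp (- c * x) / c) \<longlongrightarrow> - 0 / c) at_top"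
    proof (intro tendsto_divide tendsto_minus tendsto_const)
      have "filterlim (\<lambda>x. - c * x) at_bot at_top"
        using filterlim_tendsto_neg_mult_at_bot[OF tendsto_const[of "- c"] _ filterlim_ident] c by simp
      then show "((\<lambda>x. exp (- c * x)) \<longlongrightarrow> 0) at_top" by (rule filterlim_compose[OF exp_at_bot])
    qed (use c in simp)
    then show "((\<lambda>x. - exp (- c * x) / c) \<longlongrightarrow> 0) at_top" by simp
  qed auto
  have "(\<integral>\<^sup>+x. ennreal (exp (- c * \<bar>x\<bar>)) \<partial>lborel)
      \<le> (\<integral>\<^sup>+x. ennreal (exp (- c * x)) * indicator {0..} x + ennreal (exp (- c * (- x))) * indicator {0..} (- x) \<partial>lborel)"
    by (intro nn_integral_mono) (auto simp: indicator_def abs_if)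
  also have "\<dots> = (\<integral>\<^sup>+x. ennreal (exp (- c * x)) * indicator {0..} x \<partial>lborel)
      + (\<integral>\<^sup>+x. ennreal (exp (- c * (- x))) * indicator {0..} (- x) \<partial>lborel)"
    by (rule nn_integral_add) measurable
  also have "(\<integral>\<^sup>+x. ennreal (exp (- c * (- x))) * indicator {0..} (- x) \<partial>lborel) = (\<integral>\<^sup>+x. ennreal (exp (- c * x)) * indicator {0..} x \<partial>lborel)"
    using nn_integral_lborel_shift(2)[of "\<lambda>x. ennreal (exp (- c * x)) * indicator {0..} x" 0] by simp
  also have "(\<integral>\<^sup>+x. ennreal (exp (- c * x)) * indicator {0..} x \<partial>lborel) + (\<integral>\<^sup>+x. ennreal (exp (- c * x)) * indicator {0..} x \<partial>lborel) < top"
    unfolding half by simp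
  finally show ?thesis .
qed

definition plane_wave :: "real \<times> real \<Rightarrow> real \<times> real \<Rightarrow> complex" where
  "plane_wave w z = complex_of_real (exp (z \<bullet> w))"

lemma smooth_plane_wave: "smooth (plane_wave w)"
  using smooth_of_real_chain[of "\<lambda>_. exp" 0 w 0] unfolding plane_wave_def[abs_def] by (simp add: DERIV_exp)

lemma partial_plane_wave: "partial_deriv b (plane_wave w) = (\<lambda>z. complex_of_real (b \<bullet> w) * plane_wave w z)"
proof
  fix z
  have "((\<lambda>z. complex_of_real (exp (z \<bullet> w))) has_derivative (\<lambda>h. complex_of_real ((h \<bullet> w) * exp (z \<bullet> w)))) (at z)"
    by (intro has_derivative_of_real) (auto intro!: derivative_eq_intros)
  from partial_derivI[OF this, of b] show "partial_deriv b (plane_wave w) z = complex_of_real (b \<bullet> w) * plane_wave w z"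
    by (simp add: plane_wave_def[abs_def])
qed

context acute begin

text \<open>
  In the closed sector \<open>\<bar>y\<bar> \<le> T x\<close>, so decay in \<open>x\<close> dominates a product of one-dimensional exponentials.
\<close>

lemma decay_L2:
  assumes v: "v \<in> borel_measurable borel" and c: "c > 0"
    and bd: "\<And>z. \<bar>snd z\<bar> \<le> T * fst z \<Longrightarrow> norm (v z) \<le> exp (- c * fst z)"
  shows "v \<in> L2 U" "v \<in> L2 B"
proof -
  have sq: "ennreal ((norm (v z))\<^sup>2) \<le> ennreal (exp (- c * \<bar>fst z\<bar>)) * ennreal (exp (- (c / T) * \<bar>snd z\<bar>))" if z: "\<bar>snd z\<bar> \<le> T * fst z" for z
  proof -
    have "0 \<le> fst z" using z mult_pos_neg[OF T_pos, of "fst z"] by linarith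
    moreover have "\<bar>snd z\<bar> / T \<le> fst z" using z T_pos by (simp add: pos_divide_le_eq mult.commute)
    moreover from this have "c * (\<bar>snd z\<bar> / T) \<le> c * fst z" using c by (intro mult_left_mono) auto
    ultimately have le: "- c * fst z + - c * fst z \<le> - c * \<bar>fst z\<bar> + - c * (\<bar>snd z\<bar> / T)"
      by simp
    have "(norm (v z))\<^sup>2 \<le> (exp (- c * fst z))\<^sup>2" by (intro power_mono bd z) simp
    also have "\<dots> = exp (- c * fst z + - c * fst z)" by (simp only: power2_eq_square exp_add)
    also have "\<dots> \<le> exp (- c * \<bar>fst z\<bar> + - c * (\<bar>snd z\<bar> / T))" using le by simp
    also have "\<dots> = exp (- c * \<bar>fst z\<bar>) * exp (- (c / T) * \<bar>snd z\<bar>)" by (simp add: exp_add[symmetric])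
    finally show ?thesis by (simp add: ennreal_mult[symmetric] ennreal_leI)
  qed
  note [measurable] = v
  have "(\<integral>\<^sup>+z. ennreal ((norm (v z))\<^sup>2) \<partial>U) = (\<integral>\<^sup>+z. ennreal ((norm (v z))\<^sup>2) * indicator S z \<partial>lborel)"
    by (rule nn_integral_U) measurable
  also have "\<dots> \<le> (\<integral>\<^sup>+z. ennreal (exp (- c * \<bar>fst z\<bar>)) * ennreal (exp (- (c / T) * \<bar>snd z\<bar>)) \<partial>lborel)"
  proof (rule nn_integral_mono)
    fix z
    show "ennreal ((norm (v z))\<^sup>2) * indicator S z \<le> ennreal (exp (- c * \<bar>fst z\<bar>)) * ennreal (exp (- (c / T) * \<bar>snd z\<bar>))"
    proof (cases "z \<in> S")
      case True
      then have "\<bar>snd z\<bar> \<le> T * fst z" by (simp add: S_eq less_imp_le)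
      from sq[OF this] show ?thesis using True by simp
    qed simp
  qed
  also have "\<dots> = (\<integral>\<^sup>+z. ennreal (exp (- c * \<bar>fst z\<bar>)) * ennreal (exp (- (c / T) * \<bar>snd z\<bar>)) \<partial>(lborel \<Otimes>\<^sub>M lborel))"
    by (simp add: lborel_prod)
  also have "\<dots> = (\<integral>\<^sup>+x. \<integral>\<^sup>+y. ennreal (exp (- c * \<bar>x\<bar>)) * ennreal (exp (- (c / T) * \<bar>y\<bar>)) \<partial>lborel \<partial>lborel)"
  proof (subst lborel.nn_integral_fst[symmetric])
    have [measurable]: "(fst :: real \<times> real \<Rightarrow> real) \<in> borel_measurable borel" "(snd :: real \<times> real \<Rightarrow> real) \<in> borel_measurable borel"
      by (intro borel_measurable_continuous_onI continuous_intros)+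
    show "(\<lambda>z. ennreal (exp (- c * \<bar>fst z\<bar>)) * ennreal (exp (- (c / T) * \<bar>snd z\<bar>))) \<in> borel_measurable (lborel \<Otimes>\<^sub>M lborel)"
      unfolding lborel_prod by measurable
  qed simp
  also have "\<dots> = (\<integral>\<^sup>+x. ennreal (exp (- c * \<bar>x\<bar>)) \<partial>lborel) * (\<integral>\<^sup>+y. ennreal (exp (- (c / T) * \<bar>y\<bar>)) \<partial>lborel)"
    by (simp add: nn_integral_cmult nn_integral_multc)
  also have "\<dots> < top" using nn_integral_exp_abs[OF c] nn_integral_exp_abs[of "c / T"] c T_pos by (simp add: ennreal_mult_less_top)
  finally show "v \<in> L2 U" using borel_U[OF v] by (simp add: L2_iff_nn)
  have "(\<integral>\<^sup>+z. ennreal ((norm (v z))\<^sup>2) \<partial>B) = (\<integral>\<^sup>+t. ennreal ((norm (v (bd_param \<alpha> t)))\<^sup>2) \<partial>lborel)"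
    by (rule nn_integral_B) measurable
  also have "\<dots> \<le> (\<integral>\<^sup>+t. ennreal (exp (- (c * cos \<alpha>) * \<bar>t\<bar>)) \<partial>lborel)"
  proof (intro nn_integral_mono)
    fix t
    have z: "\<bar>snd (bd_param \<alpha> t)\<bar> \<le> T * fst (bd_param \<alpha> t)"
      using sin_pos cos_pos by (simp add: bd_param_def T_eq abs_mult)
    have "ennreal ((norm (v (bd_param \<alpha> t)))\<^sup>2) \<le> ennreal (exp (- c * \<bar>fst (bd_param \<alpha> t)\<bar>)) * ennreal (exp (- (c / T) * \<bar>snd (bd_param \<alpha> t)\<bar>))"
      by (rule sq[OF z])
    also have "\<dots> \<le> ennreal (exp (- c * \<bar>fst (bd_param \<alpha> t)\<bar>)) * 1"
      using c T_pos by (intro mult_left_mono) (auto simp: ennreal_le_1)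
    also have "\<dots> = ennreal (exp (- (c * cos \<alpha>) * \<bar>t\<bar>))"
      using cos_pos by (simp add: bd_param_def abs_mult mult_ac)
    finally show "ennreal ((norm (v (bd_param \<alpha> t)))\<^sup>2) \<le> ennreal (exp (- (c * cos \<alpha>) * \<bar>t\<bar>))" .
  qed
  also have "\<dots> < top" using nn_integral_exp_abs[of "c * cos \<alpha>"] c cos_pos by simp
  finally show "v \<in> L2 B" using borel_B[OF v] by (simp add: L2_iff_nn)
qed

text \<open>
  By density it suffices to test the eigenvalue equation with test functions of the plane.
\<close>

lemma eigenspaceI:
  assumes u: "smooth u" "u \<in> L2 U" and d: "\<And>b. b \<in> Basis \<Longrightarrow> partial_deriv b u \<in> L2 U" and uB: "u \<in> L2 B"
    and eq: "\<And>\<psi>. \<psi> \<in> test_functions UNIV \<Longrightarrow> test_form u \<psi> = complex_of_real E * L2_inner U u \<psi>"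
  shows "u \<in> eigenspace \<alpha> E"
proof -
  have h: "u \<in> H1 S" by (rule classical_H1(1)[OF u d])
  have form: "robin_form \<alpha> u v = L2_inner U (\<lambda>x. complex_of_real E * u x) v" if v: "v \<in> H1 S" for v
  proof -
    obtain \<psi> where p: "\<And>n. \<psi> n \<in> test_functions UNIV" "(\<lambda>n. L2_dist_sq U (\<psi> n) v) \<longlonglongrightarrow> 0"
      "\<And>b. b \<in> Basis \<Longrightarrow> (\<lambda>n. L2_dist_sq U (partial_deriv b (\<psi> n)) (weak_partial S b v)) \<longlonglongrightarrow> 0"
      "(\<lambda>n. L2_dist_sq B (\<psi> n) (boundary_trace S v)) \<longlonglongrightarrow> 0" using H1_approx[OF v] by blast
    have const: "(\<lambda>n. L2_dist_sq M f f) \<longlonglongrightarrow> 0" for M :: "(real \<times> real) measure" and f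
      by (simp add: L2_dist_sq_def)
    have "(\<lambda>n. (\<Sum>b\<in>Basis. L2_inner U (partial_deriv b u) (partial_deriv b (\<psi> n))) - L2_inner B u (\<psi> n))
      \<longlonglongrightarrow> (\<Sum>b\<in>Basis. L2_inner U (partial_deriv b u) (weak_partial S b v)) - L2_inner B u (boundary_trace S v)"
      by (intro tendsto_diff tendsto_sum L2_inner_tendsto const d p uB weak_partial_L2[OF v] trace_L2[OF v]
          test_L2_U[OF test_partial[OF p(1)]] test_L2_B[OF p(1)])
    moreover have "(\<lambda>n. complex_of_real E * L2_inner U u (\<psi> n)) \<longlonglongrightarrow> complex_of_real E * L2_inner U u v"
      by (intro tendsto_mult tendsto_const L2_inner_tendsto const u p H1_L2[OF v] test_L2_U[OF p(1)])
    ultimately have "(\<Sum>b\<in>Basis. L2_inner U (partial_deriv b u) (weak_partial S b v)) - L2_inner B u (boundary_trace S v)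
        = complex_of_real E * L2_inner U u v"
      using eq[OF p(1)] unfolding test_form_def by (intro LIMSEQ_unique) auto
    moreover have "L2_inner U (weak_partial S b u) (weak_partial S b v) = L2_inner U (partial_deriv b u) (weak_partial S b v)"
      if b: "b \<in> Basis" for b
      unfolding L2_inner_def using classical_H1(2)[OF u d b] L2_measurable[OF d[OF b]] L2_measurable[OF weak_partial_L2[OF h b]]
        L2_measurable[OF weak_partial_L2[OF v b]]
      by (intro integral_cong_AE) (auto elim!: eventually_mono)
    moreover have "L2_inner B (boundary_trace S u) (boundary_trace S v) = L2_inner B u (boundary_trace S v)"
      unfolding L2_inner_def using classical_trace[OF u d uB] L2_measurable[OF uB] L2_measurable[OF trace_L2[OF h]] L2_measurable[OF trace_L2[OF v]]
      by (intro integral_cong_AE) (auto elim!: eventually_mono)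
    ultimately show ?thesis
      unfolding robin_form_def by (simp add: L2_inner_def mult.assoc)
  qed
  then show ?thesis
    unfolding eigenspace_def robin_operator_def using h L2_cmult[OF u(2)] by simp
qed

text \<open>
  Green's formula for a solution of \<open>\<Delta>u = k\<^sup>2 u\<close> with \<open>\<partial>\<^sub>\<nu>u = u\<close>: apply the divergence theorem to
  the vector field \<open>(\<psi>\<^sup>* \<partial>\<^sub>1u, \<psi>\<^sup>* \<partial>\<^sub>2u)\<close>. At the apex, \<open>t = 0\<close>, there is no normal.
\<close>

lemma green_robin:
  assumes u: "smooth u" "u \<in> L2 U" and d: "\<And>b. b \<in> Basis \<Longrightarrow> partial_deriv b u \<in> L2 U" and uB: "u \<in> L2 B"
    and lap: "\<And>z. px (px u) z + py (py u) z = complex_of_real (k\<^sup>2) * u z"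
    and bc: "\<And>t. t \<noteq> 0 \<Longrightarrow> - complex_of_real (sin \<alpha>) * px u (bd_param \<alpha> t) + complex_of_real (sgn t * cos \<alpha>) * py u (bd_param \<alpha> t) = u (bd_param \<alpha> t)"
    and t: "\<psi> \<in> test_functions UNIV"
  shows "test_form u \<psi> = complex_of_real (- k\<^sup>2) * L2_inner U u \<psi>"
proof -
  have b: "(1, 0) \<in> (Basis :: (real \<times> real) set)" "(0, 1) \<in> (Basis :: (real \<times> real) set)" by (simp_all add: Basis_plane)
  let ?c = "\<lambda>z. cnj (\<psi> z)"
  have ct: "?c \<in> test_functions UNIV" by (rule test_cnj[OF t])
  have cp: "partial_deriv b ?c z = cnj (partial_deriv b \<psi> z)" for b z
    by (rule partial_deriv_cnj[OF smooth_differentiable[OF test_smooth[OF t]]])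
  have sx: "smooth (px u)" "smooth (py u)" using smooth_partial[OF u(1)] b by auto
  let ?F = "\<lambda>z. px u z * ?c z" and ?G = "\<lambda>z. py u z * ?c z"
  have F: "?F \<in> test_functions UNIV" and G: "?G \<in> test_functions UNIV" by (intro test_mult sx ct)+
  have pF: "px ?F z = px u z * cnj (px \<psi> z) + px (px u) z * ?c z" for z
    using partial_deriv_mult[OF smooth_differentiable[OF sx(1)] smooth_differentiable[OF test_smooth[OF ct]]] by (simp add: cp)
  have pG: "py ?G z = py u z * cnj (py \<psi> z) + py (py u) z * ?c z" for z
    using partial_deriv_mult[OF smooth_differentiable[OF sx(2)] smooth_differentiable[OF test_smooth[OF ct]]] by (simp add: cp)
  have iF: "integrable U (px ?F)" "integrable U (py ?G)"
    using integrable_U(1)[OF test_integrable[OF test_partial[OF F b(1)]]] integrable_U(1)[OF test_integrable[OF test_partial[OF G b(2)]]] by auto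
  have i: "integrable U (\<lambda>z. px u z * cnj (px \<psi> z))" "integrable U (\<lambda>z. py u z * cnj (py \<psi> z))" "integrable U (\<lambda>z. u z * cnj (\<psi> z))"
    by (intro L2_mult_integrable d b u test_L2_U[OF test_partial[OF t b(1)]] test_L2_U[OF test_partial[OF t b(2)]] test_L2_U[OF t])+
  have "(\<integral>z. px ?F z \<partial>U) + (\<integral>z. py ?G z \<partial>U) = (\<integral>z. px ?F z + py ?G z \<partial>U)"
    by (rule Bochner_Integration.integral_add[symmetric, OF iF])
  also have "\<dots> = (\<integral>z. px u z * cnj (px \<psi> z) + py u z * cnj (py \<psi> z) + complex_of_real (k\<^sup>2) * (u z * cnj (\<psi> z)) \<partial>U)"
  proof (intro Bochner_Integration.integral_cong refl)
    fix z
    have "complex_of_real (k\<^sup>2) * (u z * cnj (\<psi> z)) = (px (px u) z + py (py u) z) * cnj (\<psi> z)" unfolding lap by simp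
    then show "px ?F z + py ?G z = px u z * cnj (px \<psi> z) + py u z * cnj (py \<psi> z) + complex_of_real (k\<^sup>2) * (u z * cnj (\<psi> z))"
      by (simp add: pF pG distrib_right)
  qed
  also have "\<dots> = L2_inner U (px u) (px \<psi>) + L2_inner U (py u) (py \<psi>) + complex_of_real (k\<^sup>2) * L2_inner U u \<psi>"
    unfolding L2_inner_def using i by simp
  finally have 1: "(\<integral>z. px ?F z \<partial>U) + (\<integral>z. py ?G z \<partial>U)
      = L2_inner U (px u) (px \<psi>) + L2_inner U (py u) (py \<psi>) + complex_of_real (k\<^sup>2) * L2_inner U u \<psi>" .
  have "(\<integral>z. px ?F z \<partial>U) + (\<integral>z. py ?G z \<partial>U)
     = (\<integral>t. - complex_of_real (sin \<alpha>) * ?F (bd_param \<alpha> t) + complex_of_real (cos \<alpha>) * (sgn t *\<^sub>R ?G (bd_param \<alpha> t)) \<partial>lborel)"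
  proof -
    have "integrable lborel (\<lambda>t. - complex_of_real (sin \<alpha>) * ?F (bd_param \<alpha> t))"
      "integrable lborel (\<lambda>t. complex_of_real (cos \<alpha>) * (sgn t *\<^sub>R ?G (bd_param \<alpha> t)))"
      by (intro integrable_mult_right bd_integrable(1)[OF F] bd_integrable(2)[OF G])+
    from Bochner_Integration.integral_add[OF this] show ?thesis
      unfolding integral_px_sector[OF F] integral_py_sector[OF G] by (simp only: integral_mult_right_zero of_real_minus)
  qed
  also have "\<dots> = (\<integral>t. u (bd_param \<alpha> t) * ?c (bd_param \<alpha> t) \<partial>lborel)"
  proof (rule integral_cong_AE)
    have m: "u \<in> borel_measurable borel" "?F \<in> borel_measurable borel" "?G \<in> borel_measurable borel" "?c \<in> borel_measurable borel"
      using smooth_borel[OF u(1)] smooth_borel[OF test_smooth[OF F]] smooth_borel[OF test_smooth[OF G]] smooth_borel[OF test_smooth[OF ct]] by auto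
    note [measurable] = measurable_compose[OF bd_param_borel m(1)] measurable_compose[OF bd_param_borel m(2)]
      measurable_compose[OF bd_param_borel m(3)] measurable_compose[OF bd_param_borel m(4)]
    show "(\<lambda>t. - complex_of_real (sin \<alpha>) * ?F (bd_param \<alpha> t) + complex_of_real (cos \<alpha>) * (sgn t *\<^sub>R ?G (bd_param \<alpha> t))) \<in> borel_measurable lborel"
      by measurable
    show "(\<lambda>t. u (bd_param \<alpha> t) * ?c (bd_param \<alpha> t)) \<in> borel_measurable lborel" by measurable
    show "AE t in lborel. - complex_of_real (sin \<alpha>) * ?F (bd_param \<alpha> t) + complex_of_real (cos \<alpha>) * (sgn t *\<^sub>R ?G (bd_param \<alpha> t))
        = u (bd_param \<alpha> t) * ?c (bd_param \<alpha> t)"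
      using AE_lborel_singleton[of "0 :: real"]
    proof eventually_elim
      case (elim t)
      show ?case unfolding bc[OF elim, symmetric] by (simp add: scaleR_conv_of_real algebra_simps)
    qed
  qed
  also have "\<dots> = L2_inner B u \<psi>"
    unfolding L2_inner_def using smooth_borel[OF u(1)] smooth_borel[OF test_smooth[OF ct]] by (intro integral_B[symmetric]) simp
  finally have "L2_inner B u \<psi> = L2_inner U (px u) (px \<psi>) + L2_inner U (py u) (py \<psi>) + complex_of_real (k\<^sup>2) * L2_inner U u \<psi>"
    using 1 by simp
  then show ?thesis by (simp add: test_form_def sum_Basis_plane)
qed

end

section \<open>Edge waves\<close>

locale edge = acute +
  fixes M :: nat
  assumes M_acute: "real (2 * M + 1) * \<alpha> < pi / 2"
begin

definition "\<kappa> = 1 / sin (real (2 * M + 1) * \<alpha>)"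

text \<open>
  The recursion makes the boundary contributions of the directions \<open>2(j + 1)\<alpha>\<close> and \<open>- 2j\<alpha>\<close> cancel on the upper
  ray; see \<open>boundary_sum_upper\<close>. The numerator vanishes for \<open>j = M\<close> by the choice of \<open>\<kappa>\<close>.
\<close>

primrec amp :: "nat \<Rightarrow> real" where
  "amp 0 = 1"
| "amp (Suc j) = amp j * (\<kappa> * sin (real (2 * j + 1) * \<alpha>) - 1) / (\<kappa> * sin (real (2 * j + 1) * \<alpha>) + 1)"

definition wave :: "int \<Rightarrow> real \<times> real" where
  "wave j = (- \<kappa> * cos (2 * real_of_int j * \<alpha>), - \<kappa> * sin (2 * real_of_int j * \<alpha>))"

abbreviation "idx \<equiv> {- int M .. int M}"

definition edge_fun :: "real \<times> real \<Rightarrow> complex" where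
  "edge_fun z = (\<Sum>j\<in>idx. complex_of_real (amp (nat \<bar>j\<bar>)) * plane_wave (wave j) z)"

lemma sin_odd_le: "j \<le> M \<Longrightarrow> 0 < sin (real (2 * j + 1) * \<alpha>)"
proof -
  assume "j \<le> M"
  then have "real (2 * j + 1) * \<alpha> \<le> real (2 * M + 1) * \<alpha>" using pos by (intro mult_right_mono) auto
  moreover have "0 < real (2 * j + 1) * \<alpha>" using pos by (intro mult_pos_pos) auto
  ultimately show ?thesis using M_acute pi_gt_zero by (intro sin_gt_zero) linarith+
qed

lemma sin_M_pos: "0 < sin (real (2 * M + 1) * \<alpha>)"
  by (rule sin_odd_le) simp

lemma \<kappa>_pos: "0 < \<kappa>" unfolding \<kappa>_def using sin_M_pos by simp

lemma amp_nonzero: "j \<le> M \<Longrightarrow> amp j \<noteq> 0"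
proof (induction j)
  case (Suc j)
  have lt: "real (2 * j + 1) * \<alpha> < real (2 * M + 1) * \<alpha>" using Suc pos by (intro mult_strict_right_mono) auto
  have "0 < real (2 * j + 1) * \<alpha>" using pos by (intro mult_pos_pos) auto
  then have "sin (real (2 * j + 1) * \<alpha>) < sin (real (2 * M + 1) * \<alpha>)"
    using lt M_acute by (subst sin_mono_less_eq) auto
  then have "\<kappa> * sin (real (2 * j + 1) * \<alpha>) < 1" unfolding \<kappa>_def using sin_M_pos by (simp add: field_simps)
  moreover have "0 < \<kappa> * sin (real (2 * j + 1) * \<alpha>)" using \<kappa>_pos sin_odd_le[of j] Suc by simp
  ultimately show ?case using Suc by simp
qed simp

lemma amp_recurrence:
  assumes "j \<le> M"
  shows "amp (Suc j) * (\<kappa> * sin (real (2 * j + 1) * \<alpha>) + 1) = amp j * (\<kappa> * sin (real (2 * j + 1) * \<alpha>) - 1)"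
proof -
  have "0 < \<kappa> * sin (real (2 * j + 1) * \<alpha>) + 1" using \<kappa>_pos sin_odd_le[OF assms] by (simp add: add_pos_pos)
  then show ?thesis by simp
qed

lemma amp_Suc_M: "amp (Suc M) = 0"
  using sin_M_pos by (simp add: \<kappa>_def)

text \<open>
  The amplitudes are even in \<open>j\<close>; in this form the recursion covers both signs, including the step to \<open>j = M + 1\<close>, where the amplitude is zero.
\<close>

lemma amp_recurrence_int:
  assumes "- int M \<le> j" "j \<le> int M + 1"
  shows "amp (nat \<bar>j\<bar>) * (\<kappa> * sin ((2 * real_of_int j - 1) * \<alpha>) + 1) = amp (nat \<bar>j - 1\<bar>) * (\<kappa> * sin ((2 * real_of_int j - 1) * \<alpha>) - 1)"
proof (cases "j \<ge> 1")
  case True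
  then have i: "j = int (Suc (nat (j - 1)))" by simp
  then obtain i where i: "j = int (Suc i)" by blast
  then have "i \<le> M" using assms by simp
  from amp_recurrence[OF this] show ?thesis by (simp add: i nat_add_distrib algebra_simps)
next
  case False
  then have "j = - int (nat (- j))" by simp
  then obtain i where i: "j = - int i" by blast
  then have "i \<le> M" using assms by simp
  have n: "nat \<bar>j - 1\<bar> = Suc i" "nat \<bar>j\<bar> = i" by (simp_all add: i)
  have s: "sin ((2 * real_of_int j - 1) * \<alpha>) = - sin (real (2 * i + 1) * \<alpha>)"
  proof -
    have "(2 * real_of_int j - 1) * \<alpha> = - (real (2 * i + 1) * \<alpha>)" by (simp add: i algebra_simps)
    then show ?thesis by (simp only: sin_minus)
  qed
  from amp_recurrence[OF \<open>i \<le> M\<close>] show ?thesis unfolding n s by (simp add: algebra_simps del: amp.simps)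
qed

text \<open>
  The sum is \<open>- (\<partial>\<^sub>\<nu>u - u)\<close> at arc length \<open>t\<close> on the upper ray. The term \<open>j = M + 1\<close> can be added because it vanishes, and then
  the substitution \<open>j \<mapsto> 1 - j\<close>, which is the reflection in this ray, turns the sum into its negative.
\<close>

lemma boundary_sum_upper:
  "(\<Sum>j\<in>idx. amp (nat \<bar>j\<bar>) * (\<kappa> * sin ((2 * real_of_int j - 1) * \<alpha>) + 1) * exp (- \<kappa> * t * cos ((2 * real_of_int j - 1) * \<alpha>))) = 0"
proof -
  let ?f = "\<lambda>j. amp (nat \<bar>j\<bar>) * (\<kappa> * sin ((2 * real_of_int j - 1) * \<alpha>) + 1) * exp (- \<kappa> * t * cos ((2 * real_of_int j - 1) * \<alpha>))"
  let ?J = "{- int M .. int M + 1}"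
  have "?f (int M + 1) = 0"
  proof -
    have "nat \<bar>int M + 1\<bar> = Suc M" by simp
    then have "amp (nat \<bar>int M + 1\<bar>) = 0" using amp_Suc_M by (simp only:)
    then show ?thesis by (simp only: mult_zero_left)
  qed
  moreover have "?J = insert (int M + 1) idx" by auto
  ultimately have ext: "sum ?f idx = sum ?f ?J" by simp
  have "sum ?f ?J = (\<Sum>j\<in>?J. amp (nat \<bar>j - 1\<bar>) * (\<kappa> * sin ((2 * real_of_int j - 1) * \<alpha>) - 1) * exp (- \<kappa> * t * cos ((2 * real_of_int j - 1) * \<alpha>)))"
    using amp_recurrence_int by (intro sum.cong refl) auto
  also have "\<dots> = (\<Sum>j\<in>?J. - ?f j)"
  proof (rule sum.reindex_bij_witness[where i="\<lambda>j. 1 - j" and j="\<lambda>j. 1 - j"])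
    fix j :: int
    have "sin ((2 * real_of_int (1 - j) - 1) * \<alpha>) = - sin ((2 * real_of_int j - 1) * \<alpha>)"
      unfolding sin_minus[symmetric] by (simp add: algebra_simps)
    moreover have "cos ((2 * real_of_int (1 - j) - 1) * \<alpha>) = cos ((2 * real_of_int j - 1) * \<alpha>)"
      using cos_minus[of "(2 * real_of_int j - 1) * \<alpha>"] by (simp add: algebra_simps)
    moreover have "\<bar>1 - j\<bar> = \<bar>j - 1\<bar>" by simp
    ultimately show "- ?f (1 - j) = amp (nat \<bar>j - 1\<bar>) * (\<kappa> * sin ((2 * real_of_int j - 1) * \<alpha>) - 1) * exp (- \<kappa> * t * cos ((2 * real_of_int j - 1) * \<alpha>))"
      by (simp add: algebra_simps)
  qed auto
  also have "\<dots> = - sum ?f ?J" by (rule sum_negf)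
  finally show ?thesis unfolding ext by simp
qed

text \<open>
  The lower ray is the mirror image of the upper one; the reflection is \<open>j \<mapsto> - j\<close>.
\<close>

lemma boundary_sum_lower:
  "(\<Sum>j\<in>idx. amp (nat \<bar>j\<bar>) * (\<kappa> * sin ((2 * real_of_int j + 1) * \<alpha>) - 1) * exp (- \<kappa> * t * cos ((2 * real_of_int j + 1) * \<alpha>))) = 0"
proof -
  have "(\<Sum>j\<in>idx. amp (nat \<bar>j\<bar>) * (\<kappa> * sin ((2 * real_of_int j + 1) * \<alpha>) - 1) * exp (- \<kappa> * t * cos ((2 * real_of_int j + 1) * \<alpha>)))
     = (\<Sum>j\<in>idx. - (amp (nat \<bar>j\<bar>) * (\<kappa> * sin ((2 * real_of_int j - 1) * \<alpha>) + 1) * exp (- \<kappa> * t * cos ((2 * real_of_int j - 1) * \<alpha>))))"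
  proof (rule sum.reindex_bij_witness[where i=uminus and j=uminus])
    fix j :: int
    have arg: "(2 * real_of_int (- j) - 1) * \<alpha> = - ((2 * real_of_int j + 1) * \<alpha>)" by (simp add: algebra_simps)
    have "sin ((2 * real_of_int (- j) - 1) * \<alpha>) = - sin ((2 * real_of_int j + 1) * \<alpha>)"
      unfolding arg by (rule sin_minus)
    moreover have "cos ((2 * real_of_int (- j) - 1) * \<alpha>) = cos ((2 * real_of_int j + 1) * \<alpha>)"
      unfolding arg by (rule cos_minus)
    ultimately show "- (amp (nat \<bar>- j\<bar>) * (\<kappa> * sin ((2 * real_of_int (- j) - 1) * \<alpha>) + 1) * exp (- \<kappa> * t * cos ((2 * real_of_int (- j) - 1) * \<alpha>)))
       = amp (nat \<bar>j\<bar>) * (\<kappa> * sin ((2 * real_of_int j + 1) * \<alpha>) - 1) * exp (- \<kappa> * t * cos ((2 * real_of_int j + 1) * \<alpha>))"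
      by (simp add: algebra_simps)
  qed auto
  then show ?thesis using boundary_sum_upper[of t] by (simp add: sum_negf)
qed

lemma edge_partial: "partial_deriv b edge_fun = (\<lambda>z. \<Sum>j\<in>idx. complex_of_real (amp (nat \<bar>j\<bar>)) * (complex_of_real (b \<bullet> wave j) * plane_wave (wave j) z))"
  unfolding edge_fun_def[abs_def]
  by (subst partial_deriv_lincomb, rule smooth_plane_wave, simp only: partial_plane_wave)

lemma edge_smooth: "smooth edge_fun"
  unfolding edge_fun_def[abs_def] by (intro allI C_k_sum C_k_cmult smooth_plane_wave[rule_format])

lemma plane_wave_L2:
  assumes j: "j \<in> idx" shows "plane_wave (wave j) \<in> L2 U" "plane_wave (wave j) \<in> L2 B"
proof -
  define \<theta> where "\<theta> = \<bar>2 * real_of_int j * \<alpha>\<bar>"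
  have "\<bar>real_of_int j\<bar> \<le> real M" using j by auto
  then have "\<bar>real_of_int j\<bar> * \<alpha> \<le> real M * \<alpha>" using pos by (intro mult_right_mono) auto
  moreover have "\<theta> = 2 * (\<bar>real_of_int j\<bar> * \<alpha>)" using pos by (simp add: \<theta>_def abs_mult)
  moreover have "real (2 * M + 1) * \<alpha> = 2 * (real M * \<alpha>) + \<alpha>" by (simp add: algebra_simps)
  ultimately have th: "0 \<le> \<theta>" "\<theta> + \<alpha> < pi / 2" using M_acute by (linarith | simp add: \<theta>_def)+
  \<comment> \<open>Within the closed sector a point makes an angle of at most \<open>\<theta> + \<alpha> < \<pi>/2\<close> with the direction of the wave, which gives the decay rate \<open>\<kappa>\<delta>\<close> in the first coordinate.\<close>
  define \<delta> where "\<delta> = cos (\<theta> + \<alpha>) / cos \<alpha>"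
  have d: "\<delta> > 0" unfolding \<delta>_def using th pos cos_pos by (intro divide_pos_pos cos_gt_zero) auto
  have de: "\<delta> = cos \<theta> - T * sin \<theta>" unfolding \<delta>_def using cos_pos by (simp add: cos_add T_eq field_simps)
  have sn: "0 \<le> sin \<theta>" using th pos by (intro sin_ge_zero) auto
  have c: "cos (2 * real_of_int j * \<alpha>) = cos \<theta>" unfolding \<theta>_def by (simp add: abs_if)
  have s: "\<bar>sin (2 * real_of_int j * \<alpha>)\<bar> = sin \<theta>" using sn unfolding \<theta>_def by (auto simp: abs_if split: if_splits)
  have bd: "norm (plane_wave (wave j) z) \<le> exp (- (\<kappa> * \<delta>) * fst z)" if z: "\<bar>snd z\<bar> \<le> T * fst z" for z
  proof -
    have "- (snd z * sin (2 * real_of_int j * \<alpha>)) \<le> \<bar>snd z * sin (2 * real_of_int j * \<alpha>)\<bar>" by simp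
    also have "\<dots> = \<bar>snd z\<bar> * sin \<theta>" by (simp add: abs_mult s)
    also have "\<dots> \<le> T * fst z * sin \<theta>" using z sn by (intro mult_right_mono)
    finally have "\<delta> * fst z \<le> fst z * cos (2 * real_of_int j * \<alpha>) + snd z * sin (2 * real_of_int j * \<alpha>)"
      unfolding de c by (simp add: algebra_simps)
    then have "\<kappa> * (\<delta> * fst z) \<le> \<kappa> * (fst z * cos (2 * real_of_int j * \<alpha>) + snd z * sin (2 * real_of_int j * \<alpha>))"
      using \<kappa>_pos by (intro mult_left_mono) auto
    then show ?thesis by (simp add: plane_wave_def wave_def inner_prod_def algebra_simps)
  qed
  have "\<kappa> * \<delta> > 0" using \<kappa>_pos d by simp
  from decay_L2[OF smooth_borel[OF smooth_plane_wave] this bd]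
  show "plane_wave (wave j) \<in> L2 U" "plane_wave (wave j) \<in> L2 B" by auto
qed

lemma edge_eigenspace: "edge_fun \<in> eigenspace \<alpha> (- \<kappa>\<^sup>2)"
proof -
  have u2: "edge_fun \<in> L2 U" "edge_fun \<in> L2 B"
    unfolding edge_fun_def[abs_def] by (intro L2_sum L2_cmult plane_wave_L2; assumption)+
  have d2: "partial_deriv b edge_fun \<in> L2 U" for b
    unfolding edge_partial by (intro L2_sum L2_cmult plane_wave_L2)
  have pp: "partial_deriv b (partial_deriv b edge_fun) z = (\<Sum>j\<in>idx. complex_of_real ((b \<bullet> wave j)\<^sup>2) * (complex_of_real (amp (nat \<bar>j\<bar>)) * plane_wave (wave j) z))" for b z
  proof -
    have "partial_deriv b edge_fun = (\<lambda>z. \<Sum>j\<in>idx. (complex_of_real (amp (nat \<bar>j\<bar>)) * complex_of_real (b \<bullet> wave j)) * plane_wave (wave j) z)"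
      unfolding edge_partial by (simp add: mult.assoc)
    then have "partial_deriv b (partial_deriv b edge_fun) = (\<lambda>z. \<Sum>j\<in>idx. (complex_of_real (amp (nat \<bar>j\<bar>)) * complex_of_real (b \<bullet> wave j)) * (complex_of_real (b \<bullet> wave j) * plane_wave (wave j) z))"
      by (simp only:) (subst partial_deriv_lincomb, rule smooth_plane_wave, simp only: partial_plane_wave)
    then show ?thesis by (simp add: power2_eq_square mult_ac)
  qed
  have lap: "px (px edge_fun) z + py (py edge_fun) z = complex_of_real (\<kappa>\<^sup>2) * edge_fun z" for z
  proof -
    have "((1, 0) \<bullet> wave j)\<^sup>2 + ((0, 1) \<bullet> wave j)\<^sup>2 = \<kappa>\<^sup>2" for j
      by (simp add: wave_def inner_prod_def power_mult_distrib distrib_left[symmetric])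
    then have "complex_of_real (((1, 0) \<bullet> wave j)\<^sup>2) + complex_of_real (((0, 1) \<bullet> wave j)\<^sup>2) = complex_of_real (\<kappa>\<^sup>2)" for j
      by (metis of_real_add)
    then show ?thesis
      unfolding pp sum.distrib[symmetric] distrib_right[symmetric] edge_fun_def by (simp only: sum_distrib_left)
  qed
  have bc: "- complex_of_real (sin \<alpha>) * px edge_fun (bd_param \<alpha> t) + complex_of_real (sgn t * cos \<alpha>) * py edge_fun (bd_param \<alpha> t) = edge_fun (bd_param \<alpha> t)"
    if t: "t \<noteq> 0" for t
  proof -
    \<comment> \<open>The factor by which \<open>\<partial>\<^sub>\<nu> - 1\<close> multiplies the \<open>j\<close>-th wave.\<close>
    define A where "A j = - sin \<alpha> * ((1, 0) \<bullet> wave j) + sgn t * cos \<alpha> * ((0, 1) \<bullet> wave j) - 1" for j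
    define E where "E j = exp (bd_param \<alpha> t \<bullet> wave j)" for j
    have "- complex_of_real (sin \<alpha>) * px edge_fun (bd_param \<alpha> t) + complex_of_real (sgn t * cos \<alpha>) * py edge_fun (bd_param \<alpha> t) - edge_fun (bd_param \<alpha> t)
      = (\<Sum>j\<in>idx. complex_of_real (amp (nat \<bar>j\<bar>) * A j * E j))"
      unfolding edge_partial edge_fun_def A_def E_def plane_wave_def sum_distrib_left sum.distrib[symmetric] sum_subtractf[symmetric]
      by (intro sum.cong refl) (simp add: algebra_simps)
    also have "\<dots> = complex_of_real (\<Sum>j\<in>idx. amp (nat \<bar>j\<bar>) * A j * E j)" by simp
    also have "(\<Sum>j\<in>idx. amp (nat \<bar>j\<bar>) * A j * E j) = 0"
    proof (cases "t > 0")
      case True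
      have A: "A j = - (\<kappa> * sin ((2 * real_of_int j - 1) * \<alpha>) + 1)" for j
        using True by (simp add: A_def wave_def inner_prod_def left_diff_distrib sin_diff algebra_simps)
      have E: "E j = exp (- \<kappa> * t * cos ((2 * real_of_int j - 1) * \<alpha>))" for j
        using True by (simp add: E_def bd_param_def wave_def inner_prod_def left_diff_distrib cos_diff algebra_simps)
      have "(\<Sum>j\<in>idx. amp (nat \<bar>j\<bar>) * A j * E j) = (\<Sum>j\<in>idx. - (amp (nat \<bar>j\<bar>) *
          (\<kappa> * sin ((2 * real_of_int j - 1) * \<alpha>) + 1) * exp (- \<kappa> * t * cos ((2 * real_of_int j - 1) * \<alpha>))))"
        unfolding A E by (intro sum.cong refl) (simp add: algebra_simps)
      then show ?thesis using boundary_sum_upper[of t] by (simp only: sum_negf)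
    next
      case False
      with t have t: "t < 0" by simp
      have "A j = \<kappa> * sin ((2 * real_of_int j + 1) * \<alpha>) - 1" for j
        using t by (simp add: A_def wave_def inner_prod_def distrib_right sin_add algebra_simps)
      moreover have "E j = exp (- \<kappa> * (- t) * cos ((2 * real_of_int j + 1) * \<alpha>))" for j
        using t by (simp add: E_def bd_param_def wave_def inner_prod_def distrib_right cos_add algebra_simps)
      ultimately show ?thesis using boundary_sum_lower[of "- t"] by simp
    qed
    finally show ?thesis by simp
  qed
  have "test_form edge_fun \<psi> = complex_of_real (- \<kappa>\<^sup>2) * L2_inner U edge_fun \<psi>" if "\<psi> \<in> test_functions UNIV" for \<psi>
    by (rule green_robin[OF edge_smooth u2(1) d2 u2(2) lap bc that])
  then show ?thesis by (rule eigenspaceI[OF edge_smooth u2(1) d2 u2(2)])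
qed

text \<open>
  On the axis the waves decay with the rates \<open>\<kappa> cos (2j\<alpha>)\<close>. After multiplication with the inverse of
  the slowest decay only the terms \<open>j = \<plusminus>M\<close> survive at infinity, and \<open>amp M \<noteq> 0\<close>.
\<close>

lemma edge_nonzero: "\<not> (AE x in U. edge_fun x = 0)"
proof
  assume "AE x in U. edge_fun x = 0"
  then have "AE x in lebesgue. x \<in> S \<longrightarrow> edge_fun x = 0" unfolding AE_sector_iff .
  then have ae: "AE x in lborel. x \<in> S \<longrightarrow> edge_fun x = 0" by (simp add: AE_completion_iff)
  have z: "edge_fun (x, 0) = 0" if "x > 0" for x
    by (rule open_AE_zero[OF open_S smooth_continuous[OF edge_smooth] ae]) (use that T_pos in \<open>simp add: S_eq\<close>)
  define g where "g x = (\<Sum>j\<in>idx. amp (nat \<bar>j\<bar>) * exp (- (\<kappa> * (cos (2 * real_of_int j * \<alpha>) - cos (2 * real M * \<alpha>))) * x))" for x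
  have "g x = 0" if "x > 0" for x
  proof -
    have "complex_of_real (\<Sum>j\<in>idx. amp (nat \<bar>j\<bar>) * exp (- \<kappa> * cos (2 * real_of_int j * \<alpha>) * x)) = 0"
      using z[OF that] by (simp add: edge_fun_def plane_wave_def wave_def inner_prod_def mult_ac)
    then have "(\<Sum>j\<in>idx. amp (nat \<bar>j\<bar>) * exp (- \<kappa> * cos (2 * real_of_int j * \<alpha>) * x)) = 0" by (simp only: of_real_eq_0_iff)
    then have "exp (\<kappa> * cos (2 * real M * \<alpha>) * x) * (\<Sum>j\<in>idx. amp (nat \<bar>j\<bar>) * exp (- \<kappa> * cos (2 * real_of_int j * \<alpha>) * x)) = 0" by simp
    then show ?thesis unfolding g_def sum_distrib_left
      by (simp add: mult.left_commute exp_add[symmetric] algebra_simps)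
  qed
  then have "\<forall>\<^sub>F x in at_top. g x = 0" by (rule eventually_mono[OF eventually_gt_at_top[of 0]])
  then have g0: "(g \<longlongrightarrow> 0) at_top" by (rule tendsto_eventually)
  have "(g \<longlongrightarrow> (\<Sum>j\<in>idx. amp (nat \<bar>j\<bar>) * (if \<bar>j\<bar> = int M then 1 else 0))) at_top"
    unfolding g_def
  proof (intro tendsto_sum tendsto_mult tendsto_const)
    fix j assume j: "j \<in> idx"
    let ?d = "\<kappa> * (cos (2 * real_of_int j * \<alpha>) - cos (2 * real M * \<alpha>))"
    show "((\<lambda>x. exp (- ?d * x)) \<longlongrightarrow> (if \<bar>j\<bar> = int M then 1 else 0)) at_top"
    proof (cases "\<bar>j\<bar> = int M")
      case True
      then have "j = int M \<or> j = - int M" by auto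
      then have d0: "?d = 0" by auto
      show ?thesis unfolding d0 using True by simp
    next
      case False
      then have lt: "\<bar>real_of_int j\<bar> < real M" using j by (simp add: abs_less_iff) linarith
      have "cos (2 * real M * \<alpha>) < cos (2 * \<bar>real_of_int j\<bar> * \<alpha>)"
      proof (rule cos_monotone_0_pi)
        show "0 \<le> 2 * \<bar>real_of_int j\<bar> * \<alpha>" using pos by simp
        show "2 * \<bar>real_of_int j\<bar> * \<alpha> < 2 * real M * \<alpha>" using lt pos by simp
        have "real (2 * M + 1) * \<alpha> = 2 * real M * \<alpha> + \<alpha>" by (simp add: algebra_simps)
        then show "2 * real M * \<alpha> \<le> pi" using M_acute pos pi_gt_zero by linarith
      qed
      also have "cos (2 * \<bar>real_of_int j\<bar> * \<alpha>) = cos (2 * real_of_int j * \<alpha>)" by (simp add: abs_if)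
      finally have "?d > 0" using \<kappa>_pos by simp
      then have "filterlim (\<lambda>x. - ?d * x) at_bot at_top"
        using filterlim_tendsto_neg_mult_at_bot[OF tendsto_const[of "- ?d"] _ filterlim_ident] by simp
      from filterlim_compose[OF exp_at_bot this] show ?thesis using False by simp
    qed
  qed
  then have "(\<Sum>j\<in>idx. amp (nat \<bar>j\<bar>) * (if \<bar>j\<bar> = int M then 1 else 0)) = 0"
    using g0 by (intro tendsto_unique) auto
  moreover have "(\<Sum>j\<in>idx. amp (nat \<bar>j\<bar>) * (if \<bar>j\<bar> = int M then 1 else 0)) = (\<Sum>j\<in>idx. amp M * (if \<bar>j\<bar> = int M then 1 else 0))"
    by (intro sum.cong) auto
  moreover have "(\<Sum>j\<in>idx. amp M * (if \<bar>j\<bar> = int M then 1 else 0)) = amp M * (\<Sum>j\<in>idx. if \<bar>j\<bar> = int M then 1 else 0)"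
    by (rule sum_distrib_left[symmetric])
  moreover have "(\<Sum>j\<in>idx. if \<bar>j\<bar> = int M then 1 else 0 :: real) \<ge> (\<Sum>j\<in>{int M}. if \<bar>j\<bar> = int M then 1 else 0)"
    by (intro sum_mono2) auto
  ultimately show False using amp_nonzero[of M] by auto
qed

end

section \<open>Laguerre polynomials and the radial Coulomb form\<close>

text \<open>
  Coefficients of \<open>L\<^sub>n(2kx)\<close>, the Laguerre polynomial normalised by \<open>L\<^sub>n(0) = 1\<close>. The factor
  \<open>j - n\<close> stops the recursion after the index \<open>n\<close>.
\<close>

primrec laguerre_coeff :: "real \<Rightarrow> nat \<Rightarrow> nat \<Rightarrow> real" where
  "laguerre_coeff k n 0 = 1"
| "laguerre_coeff k n (Suc j) = 2 * k * (real j - real n) / (real (Suc j))\<^sup>2 * laguerre_coeff k n j"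

definition laguerre_poly :: "real \<Rightarrow> nat \<Rightarrow> real poly" where
  "laguerre_poly k n = (\<Sum>j\<le>n. monom (laguerre_coeff k n j) j)"

lemma laguerre_coeff_zero: "j > n \<Longrightarrow> laguerre_coeff k n j = 0"
proof (induction j)
  case (Suc j)
  then show ?case by (cases "j = n") auto
qed simp

lemma coeff_laguerre_poly: "coeff (laguerre_poly k n) j = laguerre_coeff k n j"
proof -
  have "coeff (laguerre_poly k n) j = (\<Sum>i\<le>n. if i = j then laguerre_coeff k n i else 0)"
    unfolding laguerre_poly_def by (simp add: coeff_sum)
  also have "\<dots> = laguerre_coeff k n j" using laguerre_coeff_zero[of n j k] by (cases "j \<le> n") auto
  finally show ?thesis .
qed

lemma laguerre_poly_nonzero: "laguerre_poly k n \<noteq> 0"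
  using coeff_laguerre_poly[of k n 0] by auto

lemma degree_laguerre_poly: "degree (laguerre_poly k n) \<le> n"
  by (rule degree_le) (simp add: coeff_laguerre_poly laguerre_coeff_zero)

lemma laguerre_ode:
  "x * poly (pderiv (pderiv (laguerre_poly k n))) x + (1 - 2 * k * x) * poly (pderiv (laguerre_poly k n)) x + 2 * real n * k * poly (laguerre_poly k n) x = 0"
proof -
  let ?p = "laguerre_poly k n"
  have "pCons 0 (pderiv (pderiv ?p)) + pderiv ?p - smult (2 * k) (pCons 0 (pderiv ?p)) + smult (2 * real n * k) ?p = 0"
  proof (rule poly_eqI)
    fix j
    have "(real (Suc j))\<^sup>2 * laguerre_coeff k n (Suc j) = 2 * k * (real j - real n) * laguerre_coeff k n j"
      by simp
    then show "coeff (pCons 0 (pderiv (pderiv ?p)) + pderiv ?p - smult (2 * k) (pCons 0 (pderiv ?p)) + smult (2 * real n * k) ?p) j = coeff 0 j"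
      by (cases j) (simp_all add: coeff_pderiv coeff_laguerre_poly coeff_pCons power2_eq_square algebra_simps del: laguerre_coeff.simps)
  qed
  then have "poly (pCons 0 (pderiv (pderiv ?p)) + pderiv ?p - smult (2 * k) (pCons 0 (pderiv ?p)) + smult (2 * real n * k) ?p) x = 0" by simp
  then show ?thesis by (simp add: algebra_simps)
qed

text \<open>
  The logarithmic derivative of a polynomial has simple poles, with the multiplicities as residues.
\<close>

lemma pderiv_over_poly_limit:
  fixes p :: "real poly"
  assumes p: "p \<noteq> 0"
  shows "((\<lambda>x. (x - r) * poly (pderiv p) x / poly p x) \<longlongrightarrow> real (order r p)) (at r)"
    and "\<forall>\<^sub>F x in at r. poly p x \<noteq> 0"
proof -
  define m where "m = order r p"
  obtain s where s: "p = [:- r, 1:] ^ m * s" "\<not> [:- r, 1:] dvd s" using order_decomp[OF p] m_def by blast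
  have sr: "poly s r \<noteq> 0" using s(2) by (simp add: poly_eq_0_iff_dvd)
  have "(poly s \<longlongrightarrow> poly s r) (at r)" by (rule isContD) simp
  then have es: "\<forall>\<^sub>F x in at r. poly s x \<noteq> 0" using sr by (rule tendsto_imp_eventually_ne)
  have ne: "\<forall>\<^sub>F x in at r. x \<noteq> r" by (simp add: eventually_at_filter)
  have px: "poly p x = (x - r) ^ m * poly s x" for x by (simp add: s(1) poly_power)
  show "\<forall>\<^sub>F x in at r. poly p x \<noteq> 0" using es ne by eventually_elim (simp add: px)
  have dp: "(x - r) * poly (pderiv p) x = (x - r) ^ m * (real m * poly s x + (x - r) * poly (pderiv s) x)" for x
  proof -
    have d1: "((\<lambda>x. (x - r) ^ m * poly s x) has_real_derivative (real m * (x - r) ^ (m - 1)) * poly s x + (x - r) ^ m * poly (pderiv s) x) (at x)"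
      by (auto intro!: derivative_eq_intros)
    have "poly (pderiv p) x = (real m * (x - r) ^ (m - 1)) * poly s x + (x - r) ^ m * poly (pderiv s) x"
    proof (rule DERIV_unique[OF _ d1])
      show "((\<lambda>x. (x - r) ^ m * poly s x) has_real_derivative poly (pderiv p) x) (at x)"
        using poly_DERIV[of p x] unfolding px[abs_def] by simp
    qed
    then show ?thesis by (simp only:) (cases m; simp add: algebra_simps)
  qed
  have "((\<lambda>x. real m + (x - r) * poly (pderiv s) x / poly s x) \<longlongrightarrow> real m + (r - r) * poly (pderiv s) r / poly s r) (at r)"
    using sr by (intro tendsto_intros) auto
  then have "((\<lambda>x. real m + (x - r) * poly (pderiv s) x / poly s x) \<longlongrightarrow> real m) (at r)" by simp
  then show "((\<lambda>x. (x - r) * poly (pderiv p) x / poly p x) \<longlongrightarrow> real (order r p)) (at r)"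
    unfolding m_def[symmetric]
  proof (rule Lim_transform_eventually)
    show "\<forall>\<^sub>F x in at r. real m + (x - r) * poly (pderiv s) x / poly s x = (x - r) * poly (pderiv p) x / poly p x"
      using es ne by eventually_elim (simp add: dp px field_simps)
  qed
qed

text \<open>
  Jacobi's factorisation. With \<open>\<phi>(x) = e\<^sup>-\<^sup>k\<^sup>x L\<^sub>n(2kx)\<close> one has \<open>(x \<phi>')' = (k\<^sup>2 x - b) \<phi>\<close>, and the integrand is
  \<open>x \<phi>\<^sup>2 ((F/\<phi>)')\<^sup>2 + (x (\<phi>'/\<phi>) F\<^sup>2)'\<close>. The total derivative integrates to zero: at the endpoints
  because of the factors \<open>x\<close> and \<open>F\<close>, and across the zeros of \<open>\<phi>\<close> because \<open>F\<close> vanishes there and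
  \<open>\<phi>'/\<phi>\<close> has only simple poles.
\<close>

lemma laguerre_form_nonneg:
  fixes F F' :: "real \<Rightarrow> real"
  assumes k: "k > 0" and b: "b = k * (2 * real n + 1)" and R: "R \<ge> 0"
    and F: "\<And>x. (F has_real_derivative F' x) (at x)" and cF': "continuous_on UNIV F'"
    and FR: "F R = 0" and Z: "\<And>z. poly (laguerre_poly k n) z = 0 \<Longrightarrow> F z = 0"
  shows "0 \<le> integral {0..R} (\<lambda>x. x * (F' x)\<^sup>2 + k\<^sup>2 * x * (F x)\<^sup>2 - b * (F x)\<^sup>2)"
proof -
  let ?p = "laguerre_poly k n"
  \<comment> \<open>\<open>q = \<phi>'/\<phi>\<close> is the logarithmic derivative; it solves a Riccati equation. \<open>G'\<close> is the integrand minus the square.\<close>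
  define q where "q x = poly (pderiv ?p) x / poly ?p x - k" for x
  define G where "G x = (if poly ?p x = 0 then 0 else x * q x * (F x)\<^sup>2)" for x
  define I where "I x = x * (F' x)\<^sup>2 + k\<^sup>2 * x * (F x)\<^sup>2 - b * (F x)\<^sup>2" for x
  define G' where "G' x = I x - (if poly ?p x = 0 then 0 else x * (F' x - q x * F x)\<^sup>2)" for x
  let ?S = "{x. poly ?p x = 0}"
  have fin: "finite ?S" by (rule poly_roots_finite[OF laguerre_poly_nonzero])
  have Fc: "isCont F x" for x using F by (rule DERIV_isCont)
  have dG: "(G has_real_derivative G' x) (at x)" if x: "poly ?p x \<noteq> 0" for x
  proof -
    have q': "(q has_real_derivative (poly (pderiv (pderiv ?p)) x * poly ?p x - poly (pderiv ?p) x * poly (pderiv ?p) x) / (poly ?p x * poly ?p x)) (at x)"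
      unfolding q_def by (rule DERIV_cong, rule DERIV_diff[OF DERIV_divide[OF poly_DERIV poly_DERIV x] DERIV_const]) simp
    have "((\<lambda>x. x * q x * (F x)\<^sup>2) has_real_derivative
       (1 * q x + (poly (pderiv (pderiv ?p)) x * poly ?p x - poly (pderiv ?p) x * poly (pderiv ?p) x) / (poly ?p x * poly ?p x) * x) * (F x)\<^sup>2
        + (2 * F x * F' x) * (x * q x)) (at x)"
      by (rule DERIV_cong, rule DERIV_mult[OF DERIV_mult[OF DERIV_ident q'] DERIV_power[OF F, where n=2]]) simp
    moreover have "(1 * q x + (poly (pderiv (pderiv ?p)) x * poly ?p x - poly (pderiv ?p) x * poly (pderiv ?p) x) / (poly ?p x * poly ?p x) * x) * (F x)\<^sup>2
        + (2 * F x * F' x) * (x * q x) = G' x"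
    proof -
      define P where "P = poly ?p x"
      define P1 where "P1 = poly (pderiv ?p) x"
      define P2 where "P2 = poly (pderiv (pderiv ?p)) x"
      have P0: "P \<noteq> 0" using x by (simp add: P_def)
      have "x * P2 + (1 - 2 * k * x) * P1 + 2 * real n * k * P = 0" unfolding P_def P1_def P2_def by (rule laguerre_ode)
      then have ode: "x * P2 = - ((1 - 2 * k * x) * P1) - 2 * real n * k * P" by linarith
      have qx: "q x = P1 / P - k" by (simp add: q_def P_def P1_def)
      have riccati: "q x + (P2 * P - P1 * P1) / (P * P) * x = k\<^sup>2 * x - b - x * (q x)\<^sup>2"
      proof -
        have "(P2 * P - P1 * P1) / (P * P) * x = (x * P2) / P - x * (P1 / P)\<^sup>2"
          using P0 by (simp add: field_simps power2_eq_square)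
        also have "(x * P2) / P = - (1 - 2 * k * x) * (P1 / P) - 2 * real n * k"
          unfolding ode using P0 by (simp add: field_simps)
        finally show ?thesis unfolding qx b by (simp add: power2_eq_square algebra_simps)
      qed
      have "(1 * q x + (P2 * P - P1 * P1) / (P * P) * x) * (F x)\<^sup>2 + (2 * F x * F' x) * (x * q x)
         = (k\<^sup>2 * x - b - x * (q x)\<^sup>2) * (F x)\<^sup>2 + (2 * F x * F' x) * (x * q x)"
        using riccati by simp
      also have "\<dots> = G' x" using x by (simp add: G'_def I_def power2_eq_square algebra_simps)
      finally show ?thesis by (simp add: P_def P1_def P2_def)
    qed
    ultimately have "((\<lambda>x. x * q x * (F x)\<^sup>2) has_real_derivative G' x) (at x)" by simp
    moreover have "\<forall>\<^sub>F y in nhds x. G y = y * q y * (F y)\<^sup>2"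
    proof -
      have "\<forall>\<^sub>F y in nhds x. poly ?p y \<noteq> 0"
      proof -
        have "(poly ?p \<longlongrightarrow> poly ?p x) (nhds x)" using poly_isCont[of x ?p] by (simp add: isCont_def tendsto_at_iff_tendsto_nhds)
        then show ?thesis using x by (rule tendsto_imp_eventually_ne)
      qed
      then show ?thesis by eventually_elim (simp add: G_def)
    qed
    ultimately show ?thesis using DERIV_cong_ev[of x x G "\<lambda>y. y * q y * (F y)\<^sup>2" "G' x" "G' x"] by simp
  qed
  have cG: "isCont G x" for x
  proof (cases "poly ?p x = 0")
    case False then show ?thesis by (rule DERIV_isCont[OF dG])
  next
    case True
    note lim = pderiv_over_poly_limit[OF laguerre_poly_nonzero[of k n], where r=x]
    have Fx: "F x = 0" by (rule Z[OF True])
    have dq: "((\<lambda>y. F y / (y - x)) \<longlongrightarrow> F' x) (at x)"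
      using F[of x] Fx by (simp add: has_field_derivative_iff)
    have Ft: "(F \<longlongrightarrow> 0) (at x)" using Fc[of x] Fx by (simp add: isCont_def)
    have "((\<lambda>y. y * (((y - x) * poly (pderiv ?p) y / poly ?p y) * ((F y / (y - x)) * F y) - k * (F y)\<^sup>2))
       \<longlongrightarrow> x * (real (order x ?p) * (F' x * 0) - k * 0\<^sup>2)) (at x)"
      by (intro tendsto_intros lim(1) dq Ft)
    then have "((\<lambda>y. y * (((y - x) * poly (pderiv ?p) y / poly ?p y) * ((F y / (y - x)) * F y) - k * (F y)\<^sup>2)) \<longlongrightarrow> 0) (at x)" by simp
    then have "(G \<longlongrightarrow> 0) (at x)"
    proof (rule Lim_transform_eventually)
      have "\<forall>\<^sub>F y in at x. y \<noteq> x" by (simp add: eventually_at_filter)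
      then show "\<forall>\<^sub>F y in at x. y * (((y - x) * poly (pderiv ?p) y / poly ?p y) * ((F y / (y - x)) * F y) - k * (F y)\<^sup>2) = G y"
        using lim(2) by eventually_elim (simp add: G_def q_def field_simps power2_eq_square)
    qed
    then show ?thesis using True by (simp add: isCont_def G_def)
  qed
  have "(G' has_integral (G R - G 0)) {0..R}"
  proof (rule fundamental_theorem_of_calculus_strong[OF fin R])
    show "(G has_vector_derivative G' x) (at x)" if "x \<in> {0..R} - ?S" for x
      using dG that by (simp add: has_real_derivative_iff_has_vector_derivative)
    show "continuous_on {0..R} G" using cG by (simp add: continuous_at_imp_continuous_on)
  qed
  moreover have "G R = 0" "G 0 = 0" using FR by (simp_all add: G_def)
  ultimately have "(G' has_integral 0) {0..R}" by simp
  moreover have "(I has_integral integral {0..R} I) {0..R}"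
  proof (rule integrable_integral, rule integrable_continuous_interval)
    have "continuous_on {0..R} F" using Fc by (simp add: continuous_at_imp_continuous_on)
    then show "continuous_on {0..R} I" unfolding I_def
      by (intro continuous_intros continuous_on_subset[OF cF']) auto
  qed
  ultimately have "0 \<le> integral {0..R} I"
    by (rule has_integral_le) (auto simp: G'_def)
  then show ?thesis unfolding I_def .
qed

section \<open>Estimates on an interval\<close>

text \<open>
  The boundary term is the integral of the derivative of \<open>(\<rho> s / T) f(s)\<^sup>2\<close>; the mixed term
  is estimated with \<open>2ab \<le> a\<^sup>2 + b\<^sup>2\<close>. For constant \<open>f\<close> the term with \<open>\<rho> / T\<close> is sharp, which is what fixes
  the leading order of the eigenvalues.
\<close>

lemma robin_interval:
  fixes f f' :: "real \<Rightarrow> real"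
  assumes T: "T > 0" and f: "\<And>s. s \<in> {-T..T} \<Longrightarrow> (f has_real_derivative f' s) (at s within {-T..T})"
    and c: "continuous_on {-T..T} f'" and rho: "\<rho> \<ge> 0"
  shows "\<rho> * ((f T)\<^sup>2 + (f (- T))\<^sup>2) \<le> integral {-T..T} (\<lambda>s. (f' s)\<^sup>2) + (\<rho> / T + \<rho>\<^sup>2) * integral {-T..T} (\<lambda>s. (f s)\<^sup>2)"
proof -
  have cf: "continuous_on {-T..T} f" using f by (meson DERIV_continuous continuous_on_eq_continuous_within)
  have "((\<lambda>s. \<rho> / T * (f s)\<^sup>2 + \<rho> * s / T * (2 * f s * f' s)) has_integral (\<rho> * T / T * (f T)\<^sup>2 - \<rho> * (- T) / T * (f (- T))\<^sup>2)) {-T..T}"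
  proof (rule fundamental_theorem_of_calculus)
    fix s assume s: "s \<in> {-T..T}"
    have "((\<lambda>s. \<rho> * s / T * (f s)\<^sup>2) has_real_derivative (\<rho> / T * (f s)\<^sup>2 + \<rho> * s / T * (2 * f s * f' s))) (at s within {-T..T})"
      using T by (auto intro!: derivative_eq_intros f[OF s] simp: field_simps)
    then show "((\<lambda>s. \<rho> * s / T * (f s)\<^sup>2) has_vector_derivative (\<rho> / T * (f s)\<^sup>2 + \<rho> * s / T * (2 * f s * f' s))) (at s within {-T..T})"
      by (simp add: has_real_derivative_iff_has_vector_derivative)
  qed (use T in simp)
  moreover have "((\<lambda>s. (f' s)\<^sup>2 + (\<rho> / T + \<rho>\<^sup>2) * (f s)\<^sup>2) has_integral (integral {-T..T} (\<lambda>s. (f' s)\<^sup>2) + (\<rho> / T + \<rho>\<^sup>2) * integral {-T..T} (\<lambda>s. (f s)\<^sup>2))) {-T..T}"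
    by (intro has_integral_add has_integral_mult_right integrable_integral integrable_continuous_interval continuous_intros c cf)
  ultimately have "\<rho> * T / T * (f T)\<^sup>2 - \<rho> * (- T) / T * (f (- T))\<^sup>2 \<le> integral {-T..T} (\<lambda>s. (f' s)\<^sup>2) + (\<rho> / T + \<rho>\<^sup>2) * integral {-T..T} (\<lambda>s. (f s)\<^sup>2)"
  proof (rule has_integral_le)
    fix s assume s: "s \<in> {-T..T}"
    define a where "a = \<rho> * s / T"
    have "0 \<le> (f' s - a * f s)\<^sup>2" by simp
    then have "2 * a * (f s * f' s) \<le> (f' s)\<^sup>2 + a\<^sup>2 * (f s)\<^sup>2" by (simp add: power2_diff power_mult_distrib algebra_simps)
    moreover have "a\<^sup>2 * (f s)\<^sup>2 \<le> \<rho>\<^sup>2 * (f s)\<^sup>2"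
    proof (intro mult_right_mono)
      have "\<bar>s / T\<bar> \<le> 1" using s T by (auto simp: abs_le_iff field_simps)
      then have "(s / T)\<^sup>2 \<le> 1" by (simp add: abs_square_le_1)
      then have "\<rho>\<^sup>2 * (s / T)\<^sup>2 \<le> \<rho>\<^sup>2 * 1" by (intro mult_left_mono) auto
      then show "a\<^sup>2 \<le> \<rho>\<^sup>2" by (simp add: a_def power_mult_distrib power_divide)
    qed simp
    moreover have "\<rho> * s / T * (2 * f s * f' s) = 2 * a * (f s * f' s)" by (simp add: a_def)
    moreover have "(\<rho> / T + \<rho>\<^sup>2) * (f s)\<^sup>2 = \<rho> / T * (f s)\<^sup>2 + \<rho>\<^sup>2 * (f s)\<^sup>2" by (rule distrib_right)
    ultimately show "\<rho> / T * (f s)\<^sup>2 + \<rho> * s / T * (2 * f s * f' s) \<le> (f' s)\<^sup>2 + (\<rho> / T + \<rho>\<^sup>2) * (f s)\<^sup>2"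
      by linarith
  qed
  then show ?thesis using T by (simp add: algebra_simps)
qed

text \<open>
  Constants and functions of mean zero are orthogonal.
\<close>

lemma mean_square_decomposition:
  fixes f :: "real \<Rightarrow> real"
  assumes T: "T > 0" and c: "continuous_on {-T..T} f" and m: "m = integral {-T..T} f / (2 * T)"
  shows "integral {-T..T} (\<lambda>s. (f s)\<^sup>2) = 2 * T * m\<^sup>2 + integral {-T..T} (\<lambda>s. (f s - m)\<^sup>2)"
proof -
  have If: "(f has_integral 2 * T * m) {-T..T}"
    using integrable_integral[OF integrable_continuous_interval[OF c]] T by (simp add: m)
  have K: "((\<lambda>s. m\<^sup>2) has_integral (T - (- T)) *\<^sub>R m\<^sup>2) {-T..T}"
    using has_integral_const_real[of "m\<^sup>2" "- T" T] T by simp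
  have "((\<lambda>s. (f s)\<^sup>2 - 2 * m * f s + m\<^sup>2) has_integral (integral {-T..T} (\<lambda>s. (f s)\<^sup>2) - 2 * m * (2 * T * m) + (T - (- T)) *\<^sub>R m\<^sup>2)) {-T..T}"
    by (intro has_integral_add has_integral_diff has_integral_mult_right If K integrable_integral
        integrable_continuous_interval continuous_intros c)
  moreover have "(\<lambda>s. (f s)\<^sup>2 - 2 * m * f s + m\<^sup>2) = (\<lambda>s. (f s - m)\<^sup>2)" by (simp add: power2_diff algebra_simps)
  ultimately have "integral {-T..T} (\<lambda>s. (f s - m)\<^sup>2) = integral {-T..T} (\<lambda>s. (f s)\<^sup>2) - 2 * m * (2 * T * m) + (T - (- T)) *\<^sub>R m\<^sup>2"
    by (simp add: integral_unique)
  then show ?thesis by (simp add: power2_eq_square algebra_simps)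
qed

text \<open>
  The crude constant comes from bounding the oscillation of \<open>f\<close> pointwise by the Cauchy--Schwarz inequality.
\<close>

lemma poincare_interval:
  fixes f f' :: "real \<Rightarrow> real"
  assumes T: "T > 0" and f: "\<And>s. s \<in> {-T..T} \<Longrightarrow> (f has_real_derivative f' s) (at s within {-T..T})"
    and c: "continuous_on {-T..T} f'" and m: "m = integral {-T..T} f / (2 * T)"
  shows "integral {-T..T} (\<lambda>s. (f s - m)\<^sup>2) \<le> 4 * T\<^sup>2 * integral {-T..T} (\<lambda>s. (f' s)\<^sup>2)"
proof -
  have cf: "continuous_on {-T..T} f" using f by (meson DERIV_continuous continuous_on_eq_continuous_within)
  define D where "D = integral {-T..T} (\<lambda>s. (f' s)\<^sup>2)"
  have Di: "((\<lambda>s. (f' s)\<^sup>2) has_integral D) {-T..T}"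
    unfolding D_def by (intro integrable_integral integrable_continuous_interval continuous_intros c)
  have D0: "D \<ge> 0" unfolding D_def by (intro integral_nonneg integrable_continuous_interval continuous_intros c) auto
  have inc: "(f v - f u)\<^sup>2 \<le> 2 * T * D" if uv: "-T \<le> u" "u < v" "v \<le> T" for u v
  proof -
    \<comment> \<open>Cauchy--Schwarz on \<open>[u, v]\<close>, by integrating \<open>(f' - \<mu>)\<^sup>2 \<ge> 0\<close> with the mean slope \<open>\<mu>\<close>.\<close>
    define \<mu> where "\<mu> = (f v - f u) / (v - u)"
    have sub: "{u..v} \<subseteq> {-T..T}" using uv by auto
    have "(f' has_integral (f v - f u)) {u..v}"
    proof (rule fundamental_theorem_of_calculus)
      fix s assume "s \<in> {u..v}"
      then have "s \<in> {-T..T}" using sub by blast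
      then have "(f has_vector_derivative f' s) (at s within {-T..T})"
        using f by (simp only: has_real_derivative_iff_has_vector_derivative)
      then show "(f has_vector_derivative f' s) (at s within {u..v})"
        by (rule has_vector_derivative_within_subset) (rule sub)
    qed (use uv in simp)
    moreover have "((\<lambda>s. (f' s)\<^sup>2) has_integral (integral {u..v} (\<lambda>s. (f' s)\<^sup>2))) {u..v}"
      by (intro integrable_integral integrable_continuous_interval continuous_intros continuous_on_subset[OF c sub])
    ultimately have "((\<lambda>s. (f' s)\<^sup>2 - 2 * \<mu> * f' s + \<mu>\<^sup>2) has_integral (integral {u..v} (\<lambda>s. (f' s)\<^sup>2) - 2 * \<mu> * (f v - f u) + (v - u) *\<^sub>R \<mu>\<^sup>2)) {u..v}"
    proof (intro has_integral_add has_integral_diff has_integral_mult_right)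
      show "((\<lambda>s. \<mu>\<^sup>2) has_integral (v - u) *\<^sub>R \<mu>\<^sup>2) {u..v}"
        using has_integral_const_real[of "\<mu>\<^sup>2" u v] uv by simp
    qed
    then have "0 \<le> integral {u..v} (\<lambda>s. (f' s)\<^sup>2) - 2 * \<mu> * (f v - f u) + (v - u) *\<^sub>R \<mu>\<^sup>2"
    proof (rule has_integral_nonneg)
      fix s
      have "(f' s)\<^sup>2 - 2 * \<mu> * f' s + \<mu>\<^sup>2 = (f' s - \<mu>)\<^sup>2" by (simp add: power2_diff)
      then show "0 \<le> (f' s)\<^sup>2 - 2 * \<mu> * f' s + \<mu>\<^sup>2" by simp
    qed
    moreover have fv: "f v - f u = \<mu> * (v - u)" using uv by (simp add: \<mu>_def)
    ultimately have "\<mu>\<^sup>2 * (v - u) \<le> integral {u..v} (\<lambda>s. (f' s)\<^sup>2)" unfolding fv by (simp add: power2_eq_square algebra_simps)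
    also have "\<dots> \<le> D" unfolding D_def
      by (intro integral_subset_le sub integrable_continuous_interval continuous_intros c continuous_on_subset[OF c sub]) auto
    finally have le: "\<mu>\<^sup>2 * (v - u) \<le> D" .
    have "(f v - f u)\<^sup>2 = (v - u) * (\<mu>\<^sup>2 * (v - u))" unfolding fv by (simp add: power2_eq_square)
    also have "\<dots> \<le> (2 * T) * D" using uv le by (intro mult_mono) auto
    finally show ?thesis .
  qed
  have inc2: "\<bar>f s - f t\<bar> \<le> sqrt (2 * T * D)" if "s \<in> {-T..T}" "t \<in> {-T..T}" for s t
  proof -
    have "(f s - f t)\<^sup>2 \<le> 2 * T * D"
      using inc[of s t] inc[of t s] that T D0 by (cases s t rule: linorder_cases) (auto simp: power2_commute)
    then show ?thesis by (metis real_sqrt_abs real_sqrt_le_mono)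
  qed
  have pt: "(f s - m)\<^sup>2 \<le> 2 * T * D" if s: "s \<in> {-T..T}" for s
  proof -
    let ?E = "sqrt (2 * T * D)"
    have If: "(f has_integral 2 * T * m) {-T..T}"
      using integrable_integral[OF integrable_continuous_interval[OF cf]] T by (simp add: m)
    have c1: "((\<lambda>_. f s + ?E) has_integral (T - (- T)) *\<^sub>R (f s + ?E)) {-T..T}"
      and c2: "((\<lambda>_. f s - ?E) has_integral (T - (- T)) *\<^sub>R (f s - ?E)) {-T..T}"
      using has_integral_const_real[of "f s + ?E" "- T" T] has_integral_const_real[of "f s - ?E" "- T" T] T by simp_all
    have "2 * T * m \<le> (T - (- T)) *\<^sub>R (f s + ?E)"
      by (rule has_integral_le[OF If c1]) (use inc2[OF s] in \<open>fastforce simp: abs_le_iff\<close>)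
    moreover have "(T - (- T)) *\<^sub>R (f s - ?E) \<le> 2 * T * m"
      by (rule has_integral_le[OF c2 If]) (use inc2[OF s] in \<open>fastforce simp: abs_le_iff\<close>)
    ultimately have "m \<le> f s + ?E" "f s - ?E \<le> m" using T by auto
    then have "\<bar>f s - m\<bar> \<le> ?E" by linarith
    then have "\<bar>f s - m\<bar>\<^sup>2 \<le> ?E\<^sup>2" by (intro power_mono) auto
    then show ?thesis using T D0 by simp
  qed
  have "integral {-T..T} (\<lambda>s. (f s - m)\<^sup>2) \<le> integral {-T..T} (\<lambda>s. 2 * T * D)"
    by (intro integral_le integrable_continuous_interval continuous_intros cf pt)
  also have "\<dots> = 4 * T\<^sup>2 * D" using T by (simp add: power2_eq_square)
  finally show ?thesis unfolding D_def .
qed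

section \<open>A lower bound for the form under finitely many conditions\<close>

context acute begin

lemma integral_lborel_Icc:
  fixes g :: "real \<Rightarrow> real"
  assumes "continuous_on {a..b} g"
  shows "(\<integral>x. indicator {a..b} x *\<^sub>R g x \<partial>lborel) = integral {a..b} g"
proof -
  have "set_integrable lborel {a..b} g"
    unfolding set_integrable_def by (rule borel_integrable_compact) (use assms in auto)
  from set_borel_integral_eq_integral(2)[OF this] show ?thesis by (simp add: set_lebesgue_integral_def)
qed

lemma slice_continuous:
  fixes h :: "real \<times> real \<Rightarrow> real"
  assumes h: "continuous_on UNIV h"
  shows "continuous_on A (\<lambda>s. h (x, x * s))" and "continuous_on A (\<lambda>x. h (x, x * c))"
    and "continuous_on {0..R} (\<lambda>x. integral {-T..T} (\<lambda>s. h (x, x * s)))"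
proof -
  show "continuous_on A (\<lambda>s. h (x, x * s))" "continuous_on A (\<lambda>x. h (x, x * c))"
    by (intro continuous_on_compose2[OF h] continuous_intros; simp)+
  have "continuous_on {0..R} (\<lambda>x. integral (cbox (-T) T) (\<lambda>s. h (x, x * s)))"
  proof (rule integral_continuous_on_param)
    have "continuous_on ({0..R} \<times> cbox (- T) T) (\<lambda>z. h (fst z, fst z * snd z))"
      by (intro continuous_on_compose2[OF h] continuous_intros) auto
    then show "continuous_on ({0..R} \<times> cbox (- T) T) (\<lambda>(x, s). h (x, x * s))" by (simp add: case_prod_beta')
  qed
  then show "continuous_on {0..R} (\<lambda>x. integral {-T..T} (\<lambda>s. h (x, x * s)))" by simp
qed

text \<open>
  Coordinates \<open>(x, xs)\<close> with Jacobian \<open>x\<close>.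
\<close>

lemma integral_U_slices:
  fixes h :: "real \<times> real \<Rightarrow> real"
  assumes h: "continuous_on UNIV h" and R: "R > 0" and z: "\<And>z. z \<notin> {-R..R} \<times> {-R..R} \<Longrightarrow> h z = 0"
  shows "(\<integral>z. h z \<partial>U) = integral {0..R} (\<lambda>x. x * integral {-T..T} (\<lambda>s. h (x, x * s)))"
proof -
  have hb: "h \<in> borel_measurable borel" by (rule borel_measurable_continuous_onI[OF h])
  have i: "integrable lborel h" by (rule integrable_box[OF h z])
  have inner: "(\<integral>y. indicator S (x, y) *\<^sub>R h (x, y) \<partial>lborel) = indicator {0..R} x *\<^sub>R (x * integral {-T..T} (\<lambda>s. h (x, x * s)))" for x
  proof (cases "0 < x \<and> x \<le> R")
    case True
    have "(\<integral>y. indicator S (x, y) *\<^sub>R h (x, y) \<partial>lborel) = \<bar>x\<bar> *\<^sub>R (\<integral>s. indicator S (x, 0 + x * s) *\<^sub>R h (x, 0 + x * s) \<partial>lborel)"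
      using True by (intro lborel_integral_real_affine) auto
    also have "(\<integral>s. indicator S (x, 0 + x * s) *\<^sub>R h (x, 0 + x * s) \<partial>lborel) = (\<integral>s. indicator {-T..T} s *\<^sub>R h (x, x * s) \<partial>lborel)"
    proof (rule integral_cong_AE)
      have [measurable]: "(\<lambda>s. h (x, x * s)) \<in> borel_measurable borel"
        by (intro borel_measurable_continuous_onI slice_continuous(1)[OF h])
      have "(\<lambda>s. indicator S (x, 0 + x * s) :: real) = indicator {-T<..<T}"
      proof
        fix s
        have "\<bar>x * s\<bar> < T * x \<longleftrightarrow> \<bar>s\<bar> < T" using True by (simp add: abs_mult mult.commute[of T])
        then show "indicator S (x, 0 + x * s) = (indicator {-T<..<T} s :: real)"
          using True by (auto simp: S_eq indicator_def abs_less_iff)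
      qed
      then have ind: "indicator S (x, 0 + x * s) = (indicator {-T<..<T} s :: real)" for s by (rule fun_cong)
      show "AE s in lborel. indicator S (x, 0 + x * s) *\<^sub>R h (x, 0 + x * s) = indicator {-T..T} s *\<^sub>R h (x, x * s)"
        unfolding ind using AE_lborel_singleton[of T] AE_lborel_singleton[of "- T"]
        by eventually_elim (auto simp: indicator_def)
      show "(\<lambda>s. indicator S (x, 0 + x * s) *\<^sub>R h (x, 0 + x * s)) \<in> borel_measurable lborel"
        unfolding ind by simp
      show "(\<lambda>s. indicator {-T..T} s *\<^sub>R h (x, x * s)) \<in> borel_measurable lborel" by measurable
    qed
    also have "\<dots> = integral {-T..T} (\<lambda>s. h (x, x * s))" by (rule integral_lborel_Icc[OF slice_continuous(1)[OF h]])
    finally show ?thesis using True by simp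
  next
    case False
    then consider "x \<le> 0" | "x > R" by linarith
    then show ?thesis
    proof cases
      case 1
      then have "indicator S (x, y) = (0::real)" for y by (simp add: S_eq)
      moreover have "indicator {0..R} x *\<^sub>R (x * integral {-T..T} (\<lambda>s. h (x, x * s))) = 0" using 1 by (cases "x = 0") auto
      ultimately show ?thesis by simp
    next
      case 2
      then have "h (x, y) = 0" for y by (intro z) auto
      then show ?thesis using 2 by simp
    qed
  qed
  have "(\<integral>z. h z \<partial>U) = (\<integral>z. indicator S z *\<^sub>R h z \<partial>lborel)" by (rule integral_U[OF hb])
  also have "\<dots> = (\<integral>x. (\<integral>y. indicator S (x, y) *\<^sub>R h (x, y) \<partial>lborel) \<partial>lborel)"
    by (rule fubini_lborel(1)[symmetric]) (rule integrable_U(2)[OF i])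
  also have "\<dots> = (\<integral>x. indicator {0..R} x *\<^sub>R (x * integral {-T..T} (\<lambda>s. h (x, x * s))) \<partial>lborel)" by (simp only: inner)
  also have "\<dots> = integral {0..R} (\<lambda>x. x * integral {-T..T} (\<lambda>s. h (x, x * s)))"
    by (intro integral_lborel_Icc continuous_intros slice_continuous(3)[OF h])
  finally show ?thesis .
qed

lemma integral_B_slices:
  fixes h :: "real \<times> real \<Rightarrow> real"
  assumes h: "continuous_on UNIV h" and R: "R > 0" and z: "\<And>z. z \<notin> {-R..R} \<times> {-R..R} \<Longrightarrow> h z = 0"
  shows "(\<integral>z. h z \<partial>B) = 1 / cos \<alpha> * integral {0..R} (\<lambda>x. h (x, x * T) + h (x, x * (- T)))"
proof -
  have hb: "h \<in> borel_measurable borel" by (rule borel_measurable_continuous_onI[OF h])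
  have c: "continuous_on A (\<lambda>x. h (x, x * T))" "continuous_on A (\<lambda>x. h (x, x * (- T)))" for A
    by (rule slice_continuous(2)[OF h])+
  let ?g = "\<lambda>x. indicator {0..R} x *\<^sub>R h (x, x * T)" and ?k = "\<lambda>x. indicator {0..R} x *\<^sub>R h (x, x * (- T))"
  have gi: "integrable lborel ?g" "integrable lborel ?k" by (intro borel_integrable_compact compact_Icc c)+
  have gi': "integrable lborel (\<lambda>t. ?g (0 + cos \<alpha> * t))" "integrable lborel (\<lambda>t. ?k (0 + (- cos \<alpha>) * t))"
    using gi cos_pos by (intro lborel_integrable_real_affine; simp)+
  have eq: "h (bd_param \<alpha> t) = ?g (0 + cos \<alpha> * t) + ?k (0 + (- cos \<alpha>) * t)" if "t \<noteq> 0" for t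
  proof -
    have h0: "h (x, y) = 0" if "x > R" for x y using that by (intro z) auto
    have cT: "cos \<alpha> * T = sin \<alpha>" using cos_pos by (simp add: T_eq)
    show ?thesis
    proof (cases "t > 0")
      case True
      have "bd_param \<alpha> t = (0 + cos \<alpha> * t, (0 + cos \<alpha> * t) * T)" using True cT by (simp add: bd_param_def mult_ac)
      moreover have "?k (0 + (- cos \<alpha>) * t) = 0"
      proof -
        have "0 + (- cos \<alpha>) * t < 0" using mult_pos_pos[OF cos_pos True] by linarith
        then have "0 + (- cos \<alpha>) * t \<notin> {0..R}" unfolding atLeastAtMost_iff by linarith
        then have i0: "indicator {0..R} (0 + (- cos \<alpha>) * t) = (0::real)" by (rule indicator_simps(2))
        show ?thesis unfolding i0 by (rule scaleR_zero_left)
      qed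
      moreover have "0 < 0 + cos \<alpha> * t" using True cos_pos by simp
      ultimately show ?thesis using h0[of "0 + cos \<alpha> * t"] by (auto simp: indicator_def)
    next
      case False
      with that have t: "t < 0" by simp
      then have p: "0 < 0 + (- cos \<alpha>) * t" using mult_pos_neg[OF cos_pos t] by simp
      have "bd_param \<alpha> t = (0 + (- cos \<alpha>) * t, (0 + (- cos \<alpha>) * t) * (- T))" using t cT by (simp add: bd_param_def mult_ac)
      moreover have "?g (0 + cos \<alpha> * t) = 0" using p by (simp add: indicator_def)
      ultimately show ?thesis using h0[of "0 + (- cos \<alpha>) * t"] p by (auto simp: indicator_def)
    qed
  qed
  have "(\<integral>z. h z \<partial>B) = (\<integral>t. h (bd_param \<alpha> t) \<partial>lborel)" by (rule integral_B[OF hb])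
  also have "\<dots> = (\<integral>t. ?g (0 + cos \<alpha> * t) + ?k (0 + (- cos \<alpha>) * t) \<partial>lborel)"
  proof (rule integral_cong_AE)
    show "(\<lambda>t. h (bd_param \<alpha> t)) \<in> borel_measurable lborel"
      using measurable_compose[OF bd_param_borel hb] by simp
    show "(\<lambda>t. ?g (0 + cos \<alpha> * t) + ?k (0 + (- cos \<alpha>) * t)) \<in> borel_measurable lborel"
      using gi' by (intro borel_measurable_add borel_measurable_integrable)
    show "AE t in lborel. h (bd_param \<alpha> t) = ?g (0 + cos \<alpha> * t) + ?k (0 + (- cos \<alpha>) * t)"
      using AE_lborel_singleton[of "0 :: real"] by eventually_elim (rule eq)
  qed
  also have "\<dots> = (\<integral>t. ?g (0 + cos \<alpha> * t) \<partial>lborel) + (\<integral>t. ?k (0 + (- cos \<alpha>) * t) \<partial>lborel)"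
    by (rule Bochner_Integration.integral_add[OF gi'])
  finally have "cos \<alpha> * (\<integral>z. h z \<partial>B) = cos \<alpha> *\<^sub>R (\<integral>t. ?g (0 + cos \<alpha> * t) \<partial>lborel) + \<bar>- cos \<alpha>\<bar> *\<^sub>R (\<integral>t. ?k (0 + (- cos \<alpha>) * t) \<partial>lborel)"
    using cos_pos by (simp add: distrib_left)
  also have "cos \<alpha> *\<^sub>R (\<integral>t. ?g (0 + cos \<alpha> * t) \<partial>lborel) = (\<integral>x. ?g x \<partial>lborel)"
    using lborel_integral_real_affine[of "cos \<alpha>" ?g 0] cos_pos by simp
  also have "\<bar>- cos \<alpha>\<bar> *\<^sub>R (\<integral>t. ?k (0 + (- cos \<alpha>) * t) \<partial>lborel) = (\<integral>x. ?k x \<partial>lborel)"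
    using lborel_integral_real_affine[of "- cos \<alpha>" ?k 0] cos_pos by simp
  also have "(\<integral>x. ?g x \<partial>lborel) + (\<integral>x. ?k x \<partial>lborel) = integral {0..R} (\<lambda>x. h (x, x * T)) + integral {0..R} (\<lambda>x. h (x, x * (- T)))"
    by (simp only: integral_lborel_Icc[OF c(1)] integral_lborel_Icc[OF c(2)])
  also have "\<dots> = integral {0..R} (\<lambda>x. h (x, x * T) + h (x, x * (- T)))"
    by (intro Henstock_Kurzweil_Integration.integral_add[symmetric] integrable_continuous_interval c)
  finally show ?thesis using cos_pos by (simp add: field_simps)
qed

text \<open>
  The estimate on one slice. Here \<open>f(s) = w(x, xs)\<close>, \<open>wx\<close> and \<open>wy\<close> are the partial derivatives of \<open>w\<close>
  on the slice, \<open>m\<close> is the mean of \<open>f\<close> and \<open>m'\<close>, the mean of the radial derivative, is the derivative of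
  \<open>m\<close> with respect to \<open>x\<close>. To leading order the mean sees the attraction \<open>1 / sin \<alpha>\<close>; everything
  else is absorbed by the transversal derivative, at the price of \<open>12 x\<close> times the square norm.
\<close>

lemma slice_form_bound:
  fixes f wx wy :: "real \<Rightarrow> real"
  assumes x: "x > 0" and T4: "T \<le> 1/4"
    and f: "\<And>s. s \<in> {-T..T} \<Longrightarrow> (f has_real_derivative x * wy s) (at s within {-T..T})"
    and c: "continuous_on {-T..T} wx" "continuous_on {-T..T} wy"
    and m: "m = integral {-T..T} f / (2 * T)" and m': "m' = integral {-T..T} (\<lambda>s. wx s + s * wy s) / (2 * T)"
  shows "2 * T * (x * m'\<^sup>2 / (1 + T) - m\<^sup>2 / sin \<alpha>) - 12 * x * integral {-T..T} (\<lambda>s. (f s)\<^sup>2)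
    \<le> x * integral {-T..T} (\<lambda>s. (wx s)\<^sup>2 + (wy s)\<^sup>2) - 1 / cos \<alpha> * ((f T)\<^sup>2 + (f (- T))\<^sup>2)"
proof -
  have cf: "continuous_on {-T..T} f" using f by (meson DERIV_continuous continuous_on_eq_continuous_within)
  define P where "P = integral {-T..T} (\<lambda>s. (f s)\<^sup>2)"
  define Q where "Q = integral {-T..T} (\<lambda>s. (f s - m)\<^sup>2)"
  define V where "V = integral {-T..T} (\<lambda>s. (wy s)\<^sup>2)"
  define N where "N = integral {-T..T} (\<lambda>s. (wx s + s * wy s)\<^sup>2)"
  define A where "A = integral {-T..T} (\<lambda>s. (wx s)\<^sup>2 + (wy s)\<^sup>2)"
  define Sg where "Sg = (f T)\<^sup>2 + (f (- T))\<^sup>2"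
  have Q0: "Q \<ge> 0" unfolding Q_def by (intro integral_nonneg integrable_continuous_interval continuous_intros cf) auto
  have D: "integral {-T..T} (\<lambda>s. (x * wy s)\<^sup>2) = x\<^sup>2 * V" unfolding V_def by (simp add: power_mult_distrib)
  have cc: "continuous_on {-T..T} (\<lambda>s. x * wy s)" by (intro continuous_intros c)
  \<comment> \<open>The radial derivative costs \<open>1 + T\<close> and leaves the fraction \<open>1 - T \<ge> 3/4\<close> of the transversal energy; one half goes into \<open>r1\<close> and one quarter into \<open>r2\<close>.\<close>
  have A1: "N / (1 + T) + (1 - T) * V \<le> A"
  proof -
    have i: "((\<lambda>s. (wx s + s * wy s)\<^sup>2 * (1 / (1 + T)) + (1 - T) * (wy s)\<^sup>2) has_integral N * (1 / (1 + T)) + (1 - T) * V) {-T..T}"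
      unfolding N_def V_def by (intro has_integral_add has_integral_mult_left has_integral_mult_right integrable_integral
          integrable_continuous_interval continuous_intros c)
    have j: "((\<lambda>s. (wx s)\<^sup>2 + (wy s)\<^sup>2) has_integral A) {-T..T}"
      unfolding A_def by (intro integrable_integral integrable_continuous_interval continuous_intros c)
    have "N * (1 / (1 + T)) + (1 - T) * V \<le> A"
    proof (rule has_integral_le[OF i j])
      fix s assume s: "s \<in> {-T..T}"
      have s2: "s\<^sup>2 \<le> T\<^sup>2" using s T_pos by (simp add: abs_le_square_iff[symmetric] abs_le_iff)
      have "0 \<le> (T * wx s - s * wy s)\<^sup>2" by simp
      then have "T * (2 * wx s * (s * wy s)) \<le> T * (T * (wx s)\<^sup>2) + (s * wy s)\<^sup>2"
        by (simp add: power2_diff power_mult_distrib power2_eq_square algebra_simps)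
      also have "(s * wy s)\<^sup>2 \<le> T * (T * (wy s)\<^sup>2)"
        using mult_right_mono[OF s2, of "(wy s)\<^sup>2"] by (simp add: power_mult_distrib power2_eq_square mult_ac)
      finally have "T * (2 * wx s * (s * wy s)) \<le> T * (T * (wx s)\<^sup>2 + T * (wy s)\<^sup>2)" by (simp add: distrib_left)
      then have "2 * wx s * (s * wy s) \<le> T * (wx s)\<^sup>2 + T * (wy s)\<^sup>2" using T_pos by simp
      moreover have "(s * wy s)\<^sup>2 \<le> T\<^sup>2 * (wy s)\<^sup>2"
        using mult_right_mono[OF s2, of "(wy s)\<^sup>2"] by (simp add: power_mult_distrib)
      ultimately have "(wx s + s * wy s)\<^sup>2 \<le> (1 + T) * ((wx s)\<^sup>2 + T * (wy s)\<^sup>2)"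
        by (simp add: power2_sum power2_eq_square algebra_simps)
      then have "(wx s + s * wy s)\<^sup>2 * (1 / (1 + T)) \<le> (wx s)\<^sup>2 + T * (wy s)\<^sup>2"
        using T_pos by (simp add: pos_divide_le_eq mult.commute)
      then show "(wx s + s * wy s)\<^sup>2 * (1 / (1 + T)) + (1 - T) * (wy s)\<^sup>2 \<le> (wx s)\<^sup>2 + (wy s)\<^sup>2"
        by (simp add: algebra_simps)
    qed
    then show ?thesis by simp
  qed
  have N1: "2 * T * m'\<^sup>2 \<le> N"
  proof -
    have "N = 2 * T * m'\<^sup>2 + integral {-T..T} (\<lambda>s. (wx s + s * wy s - m')\<^sup>2)"
      unfolding N_def by (rule mean_square_decomposition[OF T_pos _ m']) (intro continuous_intros c)
    moreover have "integral {-T..T} (\<lambda>s. (wx s + s * wy s - m')\<^sup>2) \<ge> 0"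
      by (intro integral_nonneg integrable_continuous_interval continuous_intros c) auto
    ultimately show ?thesis by simp
  qed
  have PQ: "P = 2 * T * m\<^sup>2 + Q" unfolding P_def Q_def by (rule mean_square_decomposition[OF T_pos cf m])
  have QV: "Q \<le> 4 * T\<^sup>2 * (x\<^sup>2 * V)"
    using poincare_interval[OF T_pos f cc m] unfolding Q_def[symmetric] D by simp
  have RV: "(2 * x / cos \<alpha>) * Sg \<le> x\<^sup>2 * V + ((2 * x / cos \<alpha>) / T + (2 * x / cos \<alpha>)\<^sup>2) * P"
    using robin_interval[OF T_pos f cc, of "2 * x / cos \<alpha>"] x cos_pos unfolding Sg_def[symmetric] P_def[symmetric] D by simp
  have c2: "1 / 2 \<le> (cos \<alpha>)\<^sup>2"
  proof -
    have "T\<^sup>2 \<le> 1\<^sup>2" using T4 T_pos by (intro power_mono) auto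
    then have "(sin \<alpha>)\<^sup>2 \<le> (cos \<alpha>)\<^sup>2" using cos_pos by (simp add: T_eq power_divide pos_divide_le_eq)
    then show ?thesis using sin_cos_squared_add[of \<alpha>] by linarith
  qed
  have Tc: "T * cos \<alpha> = sin \<alpha>" using cos_pos by (simp add: T_eq)
  have ic2: "1 / (cos \<alpha>)\<^sup>2 \<le> 2" using c2 cos_pos by (simp add: field_simps)
  have V0: "V \<ge> 0" unfolding V_def by (intro integral_nonneg integrable_continuous_interval continuous_intros c) auto
  \<comment> \<open>The choice \<open>\<rho> = 2x / cos \<alpha>\<close> in \<open>robin_interval\<close>.\<close>
  have r1: "Sg / cos \<alpha> \<le> x * V / 2 + P / sin \<alpha> + 4 * x * P"
  proof -
    have P0: "P \<ge> 0" using PQ Q0 T_pos by simp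
    have e1: "((2 * x / cos \<alpha>) / T + (2 * x / cos \<alpha>)\<^sup>2) * P = 2 * x * (P / sin \<alpha> + 2 * x * (1 / (cos \<alpha>)\<^sup>2) * P)"
      using cos_pos T_pos sin_pos unfolding Tc[symmetric] by (simp add: field_simps power2_eq_square)
    have "2 * x * (Sg / cos \<alpha>) \<le> 2 * x * (x * V / 2 + (P / sin \<alpha> + 2 * x * (1 / (cos \<alpha>)\<^sup>2) * P))"
      using RV unfolding e1 by (simp add: power2_eq_square algebra_simps)
    then have "Sg / cos \<alpha> \<le> x * V / 2 + (P / sin \<alpha> + 2 * x * (1 / (cos \<alpha>)\<^sup>2) * P)"
      by (rule mult_left_le_imp_le) (use x in simp)
    moreover have "2 * x * (1 / (cos \<alpha>)\<^sup>2) * P \<le> 2 * x * 2 * P"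
      using x P0 ic2 by (intro mult_right_mono mult_left_mono) auto
    ultimately show ?thesis by simp
  qed
  \<comment> \<open>The oscillating part of \<open>P\<close>, by Poincare's inequality and an arithmetic--geometric mean step with the weights \<open>a\<close> and \<open>b\<close>.\<close>
  have r2: "Q / sin \<alpha> \<le> x * V / 4 + 8 * x * Q"
  proof -
    define a where "a = 1 / (4 * T)"
    define b where "b = 2 * T / sin \<alpha>"
    have ab: "2 * a * b = 1 / sin \<alpha>" using T_pos by (simp add: a_def b_def)
    have b2: "b\<^sup>2 \<le> 8"
    proof -
      have "b = 2 / cos \<alpha>" unfolding b_def Tc[symmetric] using T_pos cos_pos by simp
      then have "b\<^sup>2 = 4 * (1 / (cos \<alpha>)\<^sup>2)" by (simp add: power_divide)
      then show ?thesis using ic2 by simp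
    qed
    have "0 \<le> (a - b * x)\<^sup>2" by simp
    then have "x * (1 / sin \<alpha>) \<le> a\<^sup>2 + b\<^sup>2 * x\<^sup>2" unfolding ab[symmetric] by (simp add: power2_diff power_mult_distrib algebra_simps)
    then have "x * (1 / sin \<alpha>) * Q \<le> (a\<^sup>2 + b\<^sup>2 * x\<^sup>2) * Q" using Q0 by (rule mult_right_mono)
    also have "\<dots> = a\<^sup>2 * Q + b\<^sup>2 * (x\<^sup>2 * Q)" by (simp add: algebra_simps)
    also have "\<dots> \<le> a\<^sup>2 * (4 * T\<^sup>2 * (x\<^sup>2 * V)) + 8 * (x\<^sup>2 * Q)"
      using QV b2 Q0 by (intro add_mono mult_left_mono mult_right_mono) auto
    also have "a\<^sup>2 * (4 * T\<^sup>2 * (x\<^sup>2 * V)) = x\<^sup>2 * V / 4" using T_pos by (simp add: a_def power2_eq_square)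
    finally have "x * (Q / sin \<alpha>) \<le> x * (x * V / 4 + 8 * x * Q)" by (simp add: power2_eq_square algebra_simps)
    then show ?thesis by (rule mult_left_le_imp_le) (use x in simp)
  qed
  have r3: "2 * T * (x * m'\<^sup>2 / (1 + T)) \<le> x * (N / (1 + T))"
  proof -
    have "(2 * T * m'\<^sup>2) * (x / (1 + T)) \<le> N * (x / (1 + T))" using N1 x T_pos by (intro mult_right_mono) auto
    then show ?thesis by (simp add: mult_ac)
  qed
  have r4: "x * (N / (1 + T)) + (3/4) * (x * V) \<le> x * A"
  proof -
    have "(3/4) * V \<le> (1 - T) * V" using T4 V0 by (intro mult_right_mono) auto
    then have "N / (1 + T) + (3/4) * V \<le> A" using A1 by linarith
    then have "x * (N / (1 + T) + (3/4) * V) \<le> x * A" using x by (intro mult_left_mono) auto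
    then show ?thesis by (simp add: distrib_left mult_ac)
  qed
  have r5: "P / sin \<alpha> = 2 * T * (m\<^sup>2 / sin \<alpha>) + Q / sin \<alpha>" unfolding PQ by (simp add: add_divide_distrib)
  have r6: "8 * x * Q \<le> 8 * x * P" using PQ T_pos x by (intro mult_left_mono) auto
  have e: "2 * T * (x * m'\<^sup>2 / (1 + T) - m\<^sup>2 / sin \<alpha>) = 2 * T * (x * m'\<^sup>2 / (1 + T)) - 2 * T * (m\<^sup>2 / sin \<alpha>)" by (rule right_diff_distrib)
  have "2 * T * (x * m'\<^sup>2 / (1 + T) - m\<^sup>2 / sin \<alpha>) - 12 * x * P \<le> x * A - Sg / cos \<alpha>"
    unfolding e using r1 r2 r3 r4 r5 r6 by linarith
  then show ?thesis by (simp add: P_def A_def Sg_def)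
qed

text \<open>
  The rate \<open>k = \<beta> / (2n + 1)\<close> with \<open>\<beta> = (1 + T) / sin \<alpha>\<close>, for which \<open>b = \<beta>\<close> in \<open>laguerre_form_nonneg\<close>.
\<close>

definition decay_rate :: "nat \<Rightarrow> real" where
  "decay_rate n = (1 + T) / sin \<alpha> / (2 * real n + 1)"

text \<open>
  This is \<open>- k\<^sup>2 / (1 + T) - 12\<close> with \<open>k = decay_rate n\<close>.
\<close>

definition lower_const :: "nat \<Rightarrow> real" where
  "lower_const n = - (1 + T) / ((sin \<alpha>)\<^sup>2 * (2 * real n + 1)\<^sup>2) - 12"

text \<open>
  The radii at which the slice means have to vanish: the zeros of the \<open>n\<close>-th radial eigenfunction.
\<close>

definition test_radii :: "nat \<Rightarrow> real set" where
  "test_radii n = {z. poly (laguerre_poly (decay_rate n) n) z = 0}"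

lemma test_radii_finite: "finite (test_radii n)" "card (test_radii n) \<le> n"
proof -
  show "finite (test_radii n)" unfolding test_radii_def by (rule poly_roots_finite[OF laguerre_poly_nonzero])
  show "card (test_radii n) \<le> n" unfolding test_radii_def
    using card_poly_roots_bound[OF laguerre_poly_nonzero] degree_laguerre_poly by (rule order.trans)
qed

text \<open>
  Integrating \<open>slice_form_bound\<close> over the slices bounds the form from below by the radial Coulomb
  form of the slice means \<open>m\<close>, to which \<open>laguerre_form_nonneg\<close> applies. The term \<open>k\<^sup>2 x m\<^sup>2\<close> added for this
  purpose is paid for by \<open>2 T m\<^sup>2 \<le> \<integral> w\<^sup>2\<close> on each slice.
\<close>

lemma real_form_lower_bound:
  fixes w wx wy :: "real \<times> real \<Rightarrow> real"
  assumes T4: "T \<le> 1/4" and R: "R > 0"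
    and w: "\<And>z. (w has_derivative (\<lambda>h. fst h * wx z + snd h * wy z)) (at z)"
    and c: "continuous_on UNIV wx" "continuous_on UNIV wy"
    and z: "\<And>z. z \<notin> {-R..R} \<times> {-R..R} \<Longrightarrow> w z = 0"
    and zx: "\<And>z. z \<notin> {-R..R} \<times> {-R..R} \<Longrightarrow> wx z = 0" and zy: "\<And>z. z \<notin> {-R..R} \<times> {-R..R} \<Longrightarrow> wy z = 0"
    and roots: "\<And>x. x \<in> test_radii n \<Longrightarrow> integral {-T..T} (\<lambda>s. w (x, x * s)) = 0"
  shows "lower_const n * (\<integral>z. (w z)\<^sup>2 \<partial>U) \<le> (\<integral>z. (wx z)\<^sup>2 + (wy z)\<^sup>2 \<partial>U) - (\<integral>z. (w z)\<^sup>2 \<partial>B)"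
proof -
  have cw: "continuous_on UNIV w"
    using w by (meson has_derivative_continuous continuous_at_imp_continuous_on)
  \<comment> \<open>One unit beyond the support, so that the slice mean at the endpoint is zero.\<close>
  define R1 where "R1 = R + 1"
  have R1: "R1 > 0" using R by (simp add: R1_def)
  have out: "p \<notin> {-R..R} \<times> {-R..R}" if "p \<notin> {-R1..R1} \<times> {-R1..R1}" for p using that by (cases p) (auto simp: R1_def)
  have cg: "continuous_on UNIV (\<lambda>z. (w z)\<^sup>2)" "continuous_on UNIV (\<lambda>z. (wx z)\<^sup>2 + (wy z)\<^sup>2)" by (intro continuous_intros cw c)+
  define m where "m x = integral {-T..T} (\<lambda>s. w (x, x * s)) / (2 * T)" for x
  define m' where "m' x = integral {-T..T} (\<lambda>s. wx (x, x * s) + s * wy (x, x * s)) / (2 * T)" for x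
  define P where "P x = integral {-T..T} (\<lambda>s. (w (x, x * s))\<^sup>2)" for x
  define A where "A x = integral {-T..T} (\<lambda>s. (wx (x, x * s))\<^sup>2 + (wy (x, x * s))\<^sup>2)" for x
  define Sg where "Sg x = (w (x, x * T))\<^sup>2 + (w (x, x * (- T)))\<^sup>2" for x
  have IU: "(\<integral>z. (w z)\<^sup>2 \<partial>U) = integral {0..R1} (\<lambda>x. x * P x)"
    unfolding P_def by (rule integral_U_slices[OF cg(1) R1]) (use z out in auto)
  have IA: "(\<integral>z. (wx z)\<^sup>2 + (wy z)\<^sup>2 \<partial>U) = integral {0..R1} (\<lambda>x. x * A x)"
    unfolding A_def by (rule integral_U_slices[OF cg(2) R1]) (use zx zy out in auto)
  have IB: "(\<integral>z. (w z)\<^sup>2 \<partial>B) = 1 / cos \<alpha> * integral {0..R1} Sg"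
    unfolding Sg_def by (rule integral_B_slices[OF cg(1) R1]) (use z out in auto)
  have dx: "((\<lambda>x. w (x, x * s)) has_vector_derivative wx (x, x * s) + s * wy (x, x * s)) (at x within X)" for x s X
  proof -
    have "((\<lambda>x. (x, x * s)) has_derivative (\<lambda>h. (h, h * s))) (at x within X)" by (auto intro!: derivative_eq_intros)
    from has_derivative_compose[OF this w] show ?thesis by (simp add: has_vector_derivative_def algebra_simps)
  qed
  have ds: "((\<lambda>s. w (x, x * s)) has_real_derivative x * wy (x, x * s)) (at s within X)" for x s X
  proof -
    have "((\<lambda>s. (x, x * s)) has_derivative (\<lambda>h. (0, x * h))) (at s within X)" by (auto intro!: derivative_eq_intros)
    from has_derivative_compose[OF this w] show ?thesis
      unfolding has_field_derivative_def by (rule has_derivative_eq_rhs) (simp add: fun_eq_iff mult_ac)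
  qed
  have cpar: "continuous_on (UNIV \<times> cbox (-T) T) (\<lambda>(x, s). wx (x, x * s) + s * wy (x, x * s))"
  proof -
    have "continuous_on (UNIV \<times> cbox (- T) T) (\<lambda>p. wx (fst p, fst p * snd p) + snd p * wy (fst p, fst p * snd p))"
      by (intro continuous_intros continuous_on_compose2[OF c(1)] continuous_on_compose2[OF c(2)]) auto
    then show ?thesis by (simp add: case_prod_beta')
  qed
  have dm: "(m has_real_derivative m' x) (at x)" for x
  proof -
    have "((\<lambda>x. integral (cbox (-T) T) (\<lambda>s. w (x, x * s))) has_vector_derivative integral (cbox (-T) T) (\<lambda>s. wx (x, x * s) + s * wy (x, x * s))) (at x within UNIV)"
      by (rule leibniz_rule_vector_derivative[OF dx _ cpar])
         (auto intro!: integrable_continuous_interval slice_continuous(1)[OF cw])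
    then have "((\<lambda>x. integral {-T..T} (\<lambda>s. w (x, x * s))) has_real_derivative integral {-T..T} (\<lambda>s. wx (x, x * s) + s * wy (x, x * s))) (at x)"
      by (simp add: has_real_derivative_iff_has_vector_derivative)
    then show ?thesis unfolding m_def[abs_def] m'_def by (rule DERIV_cdivide)
  qed
  have cm': "continuous_on UNIV m'"
  proof -
    have "continuous_on UNIV (\<lambda>x. integral (cbox (-T) T) (\<lambda>s. wx (x, x * s) + s * wy (x, x * s)))"
      by (rule integral_continuous_on_param[OF cpar])
    then show ?thesis unfolding m'_def[abs_def] using T_pos by (intro continuous_intros) auto
  qed
  have cm: "continuous_on X m" for X using dm by (meson DERIV_isCont continuous_at_imp_continuous_on)
  have cP: "continuous_on {0..R1} P" unfolding P_def[abs_def] by (rule slice_continuous(3)[OF cg(1)])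
  have cA: "continuous_on {0..R1} A" unfolding A_def[abs_def] by (rule slice_continuous(3)[OF cg(2)])
  have cS: "continuous_on {0..R1} Sg" unfolding Sg_def[abs_def] by (intro continuous_intros slice_continuous(2)[OF cw])
  define k where "k = decay_rate n"
  define \<beta> where "\<beta> = (1 + T) / sin \<alpha>"
  have b: "\<beta> = k * (2 * real n + 1)" by (simp add: \<beta>_def k_def decay_rate_def)
  have k0: "k > 0" unfolding k_def decay_rate_def using T_pos sin_pos by (intro divide_pos_pos) auto
  have jac: "0 \<le> integral {0..R1} (\<lambda>x. x * (m' x)\<^sup>2 + k\<^sup>2 * x * (m x)\<^sup>2 - \<beta> * (m x)\<^sup>2)"
  proof (rule laguerre_form_nonneg[OF k0 b _ dm cm'])
    have "w (R1, y) = 0" for y by (rule z) (simp add: R1_def)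
    then show "m R1 = 0" by (simp add: m_def)
    show "m x = 0" if "poly (laguerre_poly k n) x = 0" for x
      using roots[of x] that by (simp add: m_def test_radii_def k_def)
  qed (use R1 in simp)
  have point: "2 * T / (1 + T) * (x * (m' x)\<^sup>2 + k\<^sup>2 * x * (m x)\<^sup>2 - \<beta> * (m x)\<^sup>2) + lower_const n * (x * P x)
      \<le> x * A x - 1 / cos \<alpha> * Sg x" if x: "x \<in> {0..R1}" for x
  proof -
    have wS: "2 * T * (x * (m' x)\<^sup>2 / (1 + T) - (m x)\<^sup>2 / sin \<alpha>) - 12 * x * P x \<le> x * A x - 1 / cos \<alpha> * Sg x"
    proof (cases "x = 0")
      case True
      \<comment> \<open>On the degenerate slice at the apex both sides agree.\<close>
      have m0: "m x = w (0, 0)" using True T_pos by (simp add: m_def)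
      have Ts: "2 * T / sin \<alpha> = 2 / cos \<alpha>" using sin_pos cos_pos by (simp add: T_eq)
      have "2 * T * ((m x)\<^sup>2 / sin \<alpha>) = 2 * T / sin \<alpha> * (w (0, 0))\<^sup>2" unfolding m0 by simp
      also have "\<dots> = 2 / cos \<alpha> * (w (0, 0))\<^sup>2" unfolding Ts ..
      finally have "2 * T * ((m x)\<^sup>2 / sin \<alpha>) = 2 / cos \<alpha> * (w (0, 0))\<^sup>2" .
      then show ?thesis using True by (simp add: Sg_def)
    next
      case False
      then have "x > 0" using x by simp
      then show ?thesis unfolding P_def A_def Sg_def
        by (rule slice_form_bound[OF _ T4 ds slice_continuous(1)[OF c(1)] slice_continuous(1)[OF c(2)]])
           (simp_all add: m_def m'_def)
    qed
    have mP: "2 * T * (m x)\<^sup>2 \<le> P x"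
    proof -
      have "P x = 2 * T * (m x)\<^sup>2 + integral {-T..T} (\<lambda>s. (w (x, x * s) - m x)\<^sup>2)"
        unfolding P_def by (rule mean_square_decomposition[OF T_pos slice_continuous(1)[OF cw]]) (simp add: m_def)
      moreover have "integral {-T..T} (\<lambda>s. (w (x, x * s) - m x)\<^sup>2) \<ge> 0"
        by (intro integral_nonneg integrable_continuous_interval continuous_intros slice_continuous(1)[OF cw]) auto
      ultimately show ?thesis by simp
    qed
    have lc: "lower_const n = - (k\<^sup>2 / (1 + T)) - 12"
    proof -
      have "k\<^sup>2 / (1 + T) = ((1 + T)\<^sup>2 / (1 + T)) / ((sin \<alpha>)\<^sup>2 * (2 * real n + 1)\<^sup>2)"
        by (simp add: k_def decay_rate_def power_divide power_mult_distrib)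
      moreover have "(1 + T)\<^sup>2 / (1 + T) = 1 + T" using T_pos by (simp add: power2_eq_square)
      ultimately show ?thesis unfolding lower_const_def by (simp only: minus_divide_left)
    qed
    have "k\<^sup>2 / (1 + T) * x * (2 * T * (m x)\<^sup>2) \<le> k\<^sup>2 / (1 + T) * x * P x"
      using mP x T_pos by (intro mult_left_mono) auto
    then have "2 * T / (1 + T) * (k\<^sup>2 * x * (m x)\<^sup>2) + lower_const n * (x * P x) \<le> - 12 * x * P x"
      unfolding lc by (simp add: algebra_simps)
    moreover have "2 * T / (1 + T) * (x * (m' x)\<^sup>2 + k\<^sup>2 * x * (m x)\<^sup>2 - \<beta> * (m x)\<^sup>2)
       = 2 * T * (x * (m' x)\<^sup>2 / (1 + T) - (m x)\<^sup>2 / sin \<alpha>) + 2 * T / (1 + T) * (k\<^sup>2 * x * (m x)\<^sup>2)"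
    proof -
      have "\<beta> / (1 + T) = 1 / sin \<alpha>" using T_pos by (simp add: \<beta>_def)
      then have "(m x)\<^sup>2 / sin \<alpha> = \<beta> / (1 + T) * (m x)\<^sup>2" by simp
      then show ?thesis by (simp only:) (simp add: divide_inverse algebra_simps)
    qed
    ultimately show ?thesis using wS by linarith
  qed
  have i1: "((\<lambda>x. 2 * T / (1 + T) * (x * (m' x)\<^sup>2 + k\<^sup>2 * x * (m x)\<^sup>2 - \<beta> * (m x)\<^sup>2) + lower_const n * (x * P x)) has_integral
     2 * T / (1 + T) * integral {0..R1} (\<lambda>x. x * (m' x)\<^sup>2 + k\<^sup>2 * x * (m x)\<^sup>2 - \<beta> * (m x)\<^sup>2) + lower_const n * integral {0..R1} (\<lambda>x. x * P x)) {0..R1}"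
    by (intro has_integral_add has_integral_mult_right integrable_integral integrable_continuous_interval
        continuous_intros cm cP continuous_on_subset[OF cm']) auto
  have i2: "((\<lambda>x. x * A x - 1 / cos \<alpha> * Sg x) has_integral integral {0..R1} (\<lambda>x. x * A x) - 1 / cos \<alpha> * integral {0..R1} Sg) {0..R1}"
    by (intro has_integral_diff has_integral_mult_right integrable_integral integrable_continuous_interval continuous_intros cA cS)
  have "2 * T / (1 + T) * integral {0..R1} (\<lambda>x. x * (m' x)\<^sup>2 + k\<^sup>2 * x * (m x)\<^sup>2 - \<beta> * (m x)\<^sup>2) + lower_const n * integral {0..R1} (\<lambda>x. x * P x)
     \<le> integral {0..R1} (\<lambda>x. x * A x) - 1 / cos \<alpha> * integral {0..R1} Sg"
    by (rule has_integral_le[OF i1 i2 point])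
  moreover have "0 \<le> 2 * T / (1 + T) * integral {0..R1} (\<lambda>x. x * (m' x)\<^sup>2 + k\<^sup>2 * x * (m x)\<^sup>2 - \<beta> * (m x)\<^sup>2)"
    using jac T_pos by (intro mult_nonneg_nonneg) auto
  ultimately show ?thesis unfolding IU IA IB by linarith
qed

text \<open>
  Real and imaginary part separate.
\<close>

lemma test_form_lower_bound:
  assumes T4: "T \<le> 1/4" and t: "\<psi> \<in> test_functions UNIV"
    and roots: "\<And>x. x \<in> test_radii n \<Longrightarrow> integral {-T..T} (\<lambda>s. \<psi> (x, x * s)) = 0"
  shows "lower_const n * (L2_norm U \<psi>)\<^sup>2 \<le> Re (test_form \<psi> \<psi>)"
proof -
  note s = test_smooth[OF t]
  have b: "(1, 0) \<in> (Basis :: (real \<times> real) set)" "(0, 1) \<in> (Basis :: (real \<times> real) set)" by (simp_all add: Basis_plane)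
  have ts: "px \<psi> \<in> test_functions UNIV" "py \<psi> \<in> test_functions UNIV" using test_partial[OF t] b by auto
  obtain R where R: "R > 0" "\<And>z. z \<notin> {-R..R} \<times> {-R..R} \<Longrightarrow> \<psi> z = 0" using test_box[OF t] by blast
  have p0: "partial_deriv b \<psi> z = 0" if "z \<notin> {-R..R} \<times> {-R..R}" for z b
    by (rule partial_deriv_zero_outside[OF _ R(2) that]) (auto intro: closed_Times)
  have D: "(\<psi> has_derivative (\<lambda>h. fst h *\<^sub>R px \<psi> z + snd h *\<^sub>R py \<psi> z)) (at z)" for z
    using smooth_has_derivative[OF s, of z] by (simp add: sum_Basis_plane inner_prod_def)
  have cs: "continuous_on A \<psi>" "continuous_on A (px \<psi>)" "continuous_on A (py \<psi>)" for A
    using smooth_continuous[OF s] smooth_continuous[OF test_smooth[OF ts(1)]] smooth_continuous[OF test_smooth[OF ts(2)]] by auto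
  have part: "lower_const n * (\<integral>z. (l (\<psi> z))\<^sup>2 \<partial>U) \<le> (\<integral>z. (l (px \<psi> z))\<^sup>2 + (l (py \<psi> z))\<^sup>2 \<partial>U) - (\<integral>z. (l (\<psi> z))\<^sup>2 \<partial>B)"
    if l: "bounded_linear l" for l :: "complex \<Rightarrow> real"
  proof (rule real_form_lower_bound[OF T4 R(1)])
    have l0: "l 0 = 0" using l by (simp add: linear_0 bounded_linear.linear)
    show "((\<lambda>z. l (\<psi> z)) has_derivative (\<lambda>h. fst h * l (px \<psi> z) + snd h * l (py \<psi> z))) (at z)" for z
      using bounded_linear.has_derivative[OF l D[of z]] l by (simp add: linear_add linear_scale bounded_linear.linear)
    show "continuous_on UNIV (\<lambda>z. l (px \<psi> z))" "continuous_on UNIV (\<lambda>z. l (py \<psi> z))"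
      by (intro bounded_linear.continuous_on[OF l] cs)+
    show "l (\<psi> z) = 0" "l (px \<psi> z) = 0" "l (py \<psi> z) = 0" if "z \<notin> {-R..R} \<times> {-R..R}" for z
      using R(2)[OF that] p0[OF that] l0 by auto
    show "integral {-T..T} (\<lambda>s. l (\<psi> (x, x * s))) = 0" if x: "x \<in> test_radii n" for x
    proof -
      have "(\<lambda>s. \<psi> (x, x * s)) integrable_on {-T..T}"
        by (intro integrable_continuous_interval continuous_on_compose2[OF cs(1)[of UNIV]] continuous_intros) auto
      from integral_linear[OF this l] show ?thesis using roots[OF x] l0 by (simp add: o_def)
    qed
  qed
  have split: "(\<integral>z. (norm (f z))\<^sup>2 \<partial>M) = (\<integral>z. (Re (f z))\<^sup>2 \<partial>M) + (\<integral>z. (Im (f z))\<^sup>2 \<partial>M)"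
    and int: "integrable M (\<lambda>z. (Re (f z))\<^sup>2)" "integrable M (\<lambda>z. (Im (f z))\<^sup>2)"
    if f: "f \<in> L2 M" for f and M :: "(real \<times> real) measure"
  proof -
    note [measurable] = L2_measurable[OF f]
    show i: "integrable M (\<lambda>z. (Re (f z))\<^sup>2)" "integrable M (\<lambda>z. (Im (f z))\<^sup>2)"
      by (rule Bochner_Integration.integrable_bound[OF L2_integrable[OF f]]; simp add: cmod_power2)+
    show "(\<integral>z. (norm (f z))\<^sup>2 \<partial>M) = (\<integral>z. (Re (f z))\<^sup>2 \<partial>M) + (\<integral>z. (Im (f z))\<^sup>2 \<partial>M)"
      unfolding cmod_power2 by (rule Bochner_Integration.integral_add[OF i])
  qed
  note LU = test_L2_U[OF t] test_L2_U[OF ts(1)] test_L2_U[OF ts(2)] and LB = test_L2_B[OF t]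
  have "Re (test_form \<psi> \<psi>) = (L2_norm U (px \<psi>))\<^sup>2 + (L2_norm U (py \<psi>))\<^sup>2 - (L2_norm B \<psi>)\<^sup>2"
    by (simp add: test_form_def sum_Basis_plane L2_inner_self del: of_real_power)
  then show ?thesis
    using part[OF bounded_linear_Re] part[OF bounded_linear_Im]
    unfolding L2_norm_sq split[OF LU(1)] split[OF LU(2)] split[OF LU(3)] split[OF LB]
    by (simp add: Bochner_Integration.integral_add int LU distrib_left)
qed

end

section \<open>Counting eigenvalues\<close>

lemma underdetermined_system:
  fixes a :: "'k \<Rightarrow> 'i \<Rightarrow> complex"
  assumes "finite K" "finite I" "card K < card I"
  shows "\<exists>c. (\<exists>i\<in>I. c i \<noteq> 0) \<and> (\<forall>k\<in>K. (\<Sum>i\<in>I. c i * a k i) = 0)"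
  using assms
proof (induction K arbitrary: I a rule: finite_induct)
  case empty
  then have "I \<noteq> {}" by auto
  then show ?case by (intro exI[of _ "\<lambda>_. 1"]) auto
next
  case (insert k K)
  show ?case
  proof (cases "\<forall>i\<in>I. a k i = 0")
    case True
    have "card K < card I" using insert by simp
    from insert.IH[OF insert.prems(1) this, of a] True show ?thesis by auto
  next
    case False
    then obtain j where j: "j \<in> I" "a k j \<noteq> 0" by blast
    define a' where "a' l i = a l i - a k i / a k j * a l j" for l i
    have "card K < card (I - {j})" using insert j by simp
    from insert.IH[OF finite_Diff[OF insert.prems(1)] this, of a']
    obtain c where c: "\<exists>i\<in>I - {j}. c i \<noteq> 0" "\<forall>l\<in>K. (\<Sum>i\<in>I - {j}. c i * a' l i) = 0" by blast
    define d where "d i = (if i = j then - (\<Sum>i\<in>I - {j}. c i * a k i) / a k j else c i)" for i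
    have split: "(\<Sum>i\<in>I. d i * a l i) = d j * a l j + (\<Sum>i\<in>I - {j}. c i * a l i)" for l
    proof -
      have "(\<Sum>i\<in>I. d i * a l i) = d j * a l j + (\<Sum>i\<in>I - {j}. d i * a l i)"
        using insert.prems(1) j(1) by (rule sum.remove)
      also have "(\<Sum>i\<in>I - {j}. d i * a l i) = (\<Sum>i\<in>I - {j}. c i * a l i)" by (intro sum.cong) (auto simp: d_def)
      finally show ?thesis .
    qed
    have "(\<Sum>i\<in>I. d i * a l i) = 0" if "l \<in> insert k K" for l
    proof (cases "l = k")
      case True then show ?thesis unfolding split using j(2) by (simp add: d_def)
    next
      case False
      then have "0 = (\<Sum>i\<in>I - {j}. c i * a' l i)" using c(2) that by auto
      also have "\<dots> = (\<Sum>i\<in>I - {j}. c i * a l i) - (\<Sum>i\<in>I - {j}. c i * a k i) / a k j * a l j"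
        unfolding a'_def sum_divide_distrib sum_distrib_right sum_subtractf[symmetric]
        by (intro sum.cong refl) (simp add: algebra_simps)
      finally show ?thesis unfolding split by (simp add: d_def)
    qed
    moreover have "\<exists>i\<in>I. d i \<noteq> 0" using c(1) by (auto simp: d_def)
    ultimately show ?thesis by blast
  qed
qed

lemma bounded_family_subsequence:
  fixes c :: "nat \<Rightarrow> 'i \<Rightarrow> complex"
  assumes "finite I" "\<And>n i. i \<in> I \<Longrightarrow> norm (c n i) \<le> 1"
  shows "\<exists>r l. strict_mono (r :: nat \<Rightarrow> nat) \<and> (\<forall>i\<in>I. (\<lambda>n. c (r n) i) \<longlonglongrightarrow> l i)"
  using assms
proof (induction I rule: finite_induct)
  case empty
  show ?case by (intro exI[of _ id]) (auto simp: strict_mono_def)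
next
  case (insert j I)
  then obtain r l where r: "strict_mono (r :: nat \<Rightarrow> nat)" "\<And>i. i \<in> I \<Longrightarrow> (\<lambda>n. c (r n) i) \<longlonglongrightarrow> l i" by blast
  have "\<forall>n. c (r n) j \<in> cball 0 1" using insert by simp
  from seq_compactE[OF compact_imp_seq_compact[OF compact_cball] this]
  obtain m s where s: "strict_mono (s :: nat \<Rightarrow> nat)" "((\<lambda>n. c (r n) j) \<circ> s) \<longlonglongrightarrow> m" by blast
  have "(\<lambda>n. c ((r \<circ> s) n) i) \<longlonglongrightarrow> (l(j := m)) i" if i: "i \<in> insert j I" for i
  proof (cases "i = j")
    case True then show ?thesis using s(2) by (simp add: o_def)
  next
    case False
    then have "(\<lambda>n. c (r n) i) \<longlonglongrightarrow> l i" using i r by auto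
    from LIMSEQ_subseq_LIMSEQ[OF this s(1)] show ?thesis using False by (simp add: o_def)
  qed
  moreover have "strict_mono (r \<circ> s)" using r(1) s(1) by (rule strict_mono_o)
  ultimately show ?case by blast
qed

context acute begin

lemma eigenspace_H1: "u \<in> eigenspace \<alpha> E \<Longrightarrow> u \<in> H1 S"
  by (simp add: eigenspace_def robin_operator_def)

lemma eigenspace_form: "u \<in> eigenspace \<alpha> E \<Longrightarrow> v \<in> H1 S \<Longrightarrow> robin_form \<alpha> u v = complex_of_real E * L2_inner U u v"
  by (simp add: eigenspace_def robin_operator_def L2_inner_def mult.assoc)

lemma robin_form_cnj: "robin_form \<alpha> u v = cnj (robin_form \<alpha> v u)"
  unfolding robin_form_def complex_cnj_diff cnj_sum by (subst (1 2) L2_inner_cnj) simp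

text \<open>
  Symmetry of the form, as usual.
\<close>

lemma eigenspace_orthogonal:
  assumes u: "u \<in> eigenspace \<alpha> E" and v: "v \<in> eigenspace \<alpha> E'" and ne: "E \<noteq> E'"
  shows "L2_inner U u v = 0"
proof -
  have "complex_of_real E * L2_inner U u v = robin_form \<alpha> u v" using eigenspace_form[OF u eigenspace_H1[OF v]] by simp
  also have "\<dots> = cnj (robin_form \<alpha> v u)" by (rule robin_form_cnj)
  also have "\<dots> = complex_of_real E' * cnj (L2_inner U v u)" using eigenspace_form[OF v eigenspace_H1[OF u]] by simp
  also have "cnj (L2_inner U v u) = L2_inner U u v" by (rule L2_inner_cnj[symmetric])
  finally have "(complex_of_real E - complex_of_real E') * L2_inner U u v = 0" by (simp add: left_diff_distrib)
  then show ?thesis using ne by simp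
qed

lemma test_form_lincomb:
  assumes "\<And>i. i \<in> I \<Longrightarrow> \<phi> i \<in> test_functions UNIV"
  shows "test_form (\<lambda>x. \<Sum>i\<in>I. c i * \<phi> i x) (\<lambda>x. \<Sum>i\<in>I. c i * \<phi> i x) = (\<Sum>i\<in>I. \<Sum>j\<in>I. c i * cnj (c j) * test_form (\<phi> i) (\<phi> j))"
proof -
  have p: "partial_deriv b (\<lambda>x. \<Sum>i\<in>I. c i * \<phi> i x) = (\<lambda>x. \<Sum>i\<in>I. c i * partial_deriv b (\<phi> i) x)" for b
    using assms test_smooth by (intro partial_deriv_lincomb) blast
  have "test_form (\<lambda>x. \<Sum>i\<in>I. c i * \<phi> i x) (\<lambda>x. \<Sum>i\<in>I. c i * \<phi> i x)
    = (\<Sum>b\<in>Basis. \<Sum>i\<in>I. \<Sum>j\<in>I. c i * cnj (c j) * L2_inner U (partial_deriv b (\<phi> i)) (partial_deriv b (\<phi> j)))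
      - (\<Sum>i\<in>I. \<Sum>j\<in>I. c i * cnj (c j) * L2_inner B (\<phi> i) (\<phi> j))"
    unfolding test_form_def p
    by (intro arg_cong2[where f=minus] sum.cong refl L2_inner_sum_sum test_L2_U[OF test_partial[OF assms]] test_L2_B[OF assms])
  also have "\<dots> = (\<Sum>i\<in>I. \<Sum>j\<in>I. c i * cnj (c j) * test_form (\<phi> i) (\<phi> j))"
  proof -
    have "(\<Sum>b\<in>Basis. \<Sum>i\<in>I. \<Sum>j\<in>I. c i * cnj (c j) * L2_inner U (partial_deriv b (\<phi> i)) (partial_deriv b (\<phi> j)))
       = (\<Sum>i\<in>I. \<Sum>j\<in>I. c i * cnj (c j) * (\<Sum>b\<in>Basis. L2_inner U (partial_deriv b (\<phi> i)) (partial_deriv b (\<phi> j))))"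
      by (simp only: sum_Basis_plane sum.distrib[symmetric] distrib_left)
    then show ?thesis unfolding test_form_def by (simp only: right_diff_distrib sum_subtractf)
  qed
  finally show ?thesis .
qed

text \<open>
  The variational principle for the lower bound. If there were more than \<open>n\<close> functions \<open>u i\<close>, approximate each by test functions
  \<open>\<phi> i k\<close>; some nontrivial combination \<open>\<psi> k\<close> of them satisfies the at most \<open>n\<close> conditions of
  \<open>test_form_lower_bound\<close>. The conditions are imposed on the smooth approximations, and only
  the resulting inequality passes to the limit: it gives a nontrivial combination \<open>v\<close> of the \<open>u i\<close> whose
  form is at least \<open>lower_const n\<close> times its square norm. But the form is at most \<open>\<Lambda>\<close> times the square
  norm, so \<open>v = 0\<close>, contrary to the independence within each eigenspace.
\<close>

lemma eigenvalue_count: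
  fixes u :: "'i \<Rightarrow> real \<times> real \<Rightarrow> complex" and E :: "'i \<Rightarrow> real"
  assumes T4: "T \<le> 1/4" and lc: "\<Lambda> < lower_const n" and I: "finite I"
    and u: "\<And>i. i \<in> I \<Longrightarrow> u i \<in> eigenspace \<alpha> (E i)" and E: "\<And>i. i \<in> I \<Longrightarrow> E i \<le> \<Lambda>"
    and ind: "\<And>c \<mu>. AE x in U. (\<Sum>i\<in>{i\<in>I. E i = \<mu>}. c i * u i x) = 0 \<Longrightarrow> \<forall>i\<in>I. E i = \<mu> \<longrightarrow> c i = 0"
  shows "card I \<le> n"
proof (rule ccontr)
  assume "\<not> card I \<le> n"
  then have card: "card (test_radii n) < card I" using test_radii_finite(2)[of n] by linarith
  note h = eigenspace_H1[OF u]
  have "\<forall>i\<in>I. \<exists>\<phi>. (\<forall>n. \<phi> n \<in> test_functions UNIV) \<and> (\<lambda>n. L2_dist_sq U (\<phi> n) (u i)) \<longlonglongrightarrow> 0 \<and>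
     (\<forall>b\<in>Basis. (\<lambda>n. L2_dist_sq U (partial_deriv b (\<phi> n)) (weak_partial S b (u i))) \<longlonglongrightarrow> 0) \<and>
     (\<lambda>n. L2_dist_sq B (\<phi> n) (boundary_trace S (u i))) \<longlonglongrightarrow> 0"
  proof
    fix i assume i: "i \<in> I"
    obtain \<phi> where p: "\<And>n. \<phi> n \<in> test_functions UNIV" "(\<lambda>n. L2_dist_sq U (\<phi> n) (u i)) \<longlonglongrightarrow> 0"
      "\<And>b. b \<in> Basis \<Longrightarrow> (\<lambda>n. L2_dist_sq U (partial_deriv b (\<phi> n)) (weak_partial S b (u i))) \<longlonglongrightarrow> 0"
      "(\<lambda>n. L2_dist_sq B (\<phi> n) (boundary_trace S (u i))) \<longlonglongrightarrow> 0"
      by (rule H1_approx[OF h[OF i]]) blast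
    show "\<exists>\<phi>. (\<forall>n. \<phi> n \<in> test_functions UNIV) \<and> (\<lambda>n. L2_dist_sq U (\<phi> n) (u i)) \<longlonglongrightarrow> 0 \<and>
     (\<forall>b\<in>Basis. (\<lambda>n. L2_dist_sq U (partial_deriv b (\<phi> n)) (weak_partial S b (u i))) \<longlonglongrightarrow> 0) \<and>
     (\<lambda>n. L2_dist_sq B (\<phi> n) (boundary_trace S (u i))) \<longlonglongrightarrow> 0"
      by (intro exI[of _ \<phi>] conjI allI ballI p)
  qed
  from bchoice[OF this] obtain \<phi> where \<phi>: "\<And>i n. i \<in> I \<Longrightarrow> \<phi> i n \<in> test_functions UNIV"
    "\<And>i. i \<in> I \<Longrightarrow> (\<lambda>n. L2_dist_sq U (\<phi> i n) (u i)) \<longlonglongrightarrow> 0"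
    "\<And>i b. i \<in> I \<Longrightarrow> b \<in> Basis \<Longrightarrow> (\<lambda>n. L2_dist_sq U (partial_deriv b (\<phi> i n)) (weak_partial S b (u i))) \<longlonglongrightarrow> 0"
    "\<And>i. i \<in> I \<Longrightarrow> (\<lambda>n. L2_dist_sq B (\<phi> i n) (boundary_trace S (u i))) \<longlonglongrightarrow> 0" by blast
  have form_lim: "(\<lambda>k. test_form (\<phi> i k) (\<phi> j k)) \<longlonglongrightarrow> complex_of_real (E i) * L2_inner U (u i) (u j)"
    if i: "i \<in> I" and j: "j \<in> I" for i j
  proof -
    have "(\<lambda>k. test_form (\<phi> i k) (\<phi> j k)) \<longlonglongrightarrow> robin_form \<alpha> (u i) (u j)"
      unfolding test_form_def robin_form_def
      by (intro tendsto_diff tendsto_sum L2_inner_tendsto \<phi>(3)[OF i] \<phi>(3)[OF j] \<phi>(4)[OF i] \<phi>(4)[OF j]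
        test_L2_U[OF test_partial[OF \<phi>(1)[OF i]]] test_L2_U[OF test_partial[OF \<phi>(1)[OF j]]] test_L2_B[OF \<phi>(1)[OF i]] test_L2_B[OF \<phi>(1)[OF j]]
        weak_partial_L2[OF h[OF i]] weak_partial_L2[OF h[OF j]] trace_L2[OF h[OF i]] trace_L2[OF h[OF j]])
    then show ?thesis using eigenspace_form[OF u[OF i] h[OF j]] by simp
  qed
  have inner_lim: "(\<lambda>k. L2_inner U (\<phi> i k) (\<phi> j k)) \<longlonglongrightarrow> L2_inner U (u i) (u j)" if i: "i \<in> I" and j: "j \<in> I" for i j
    by (intro L2_inner_tendsto test_L2_U[OF \<phi>(1)[OF i]] test_L2_U[OF \<phi>(1)[OF j]] \<phi>(2)[OF i] \<phi>(2)[OF j] H1_L2[OF h[OF i]] H1_L2[OF h[OF j]])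
  define a where "a k x i = integral {-T..T} (\<lambda>s. \<phi> i k (x, x * s))" for k x i
  have "\<exists>c. (\<forall>i\<in>I. norm (c i) \<le> 1) \<and> (\<exists>i\<in>I. norm (c i) = 1) \<and> (\<forall>x\<in>test_radii n. (\<Sum>i\<in>I. c i * a k x i) = 0)" for k
  proof -
    from underdetermined_system[OF test_radii_finite(1) I card, of "a k"]
    obtain c where c: "\<exists>i\<in>I. c i \<noteq> 0" "\<forall>x\<in>test_radii n. (\<Sum>i\<in>I. c i * a k x i) = 0" by blast
    \<comment> \<open>Normalising the largest coefficient to modulus \<open>1\<close> keeps the limit of the coefficients nonzero.\<close>
    define M where "M = Max ((\<lambda>i. norm (c i)) ` I)"
    have ne: "(\<lambda>i. norm (c i)) ` I \<noteq> {}" and fi: "finite ((\<lambda>i. norm (c i)) ` I)" using c(1) I by auto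
    have le: "norm (c i) \<le> M" if "i \<in> I" for i unfolding M_def using fi that by (intro Max_ge) auto
    have M: "M > 0" using c(1) le by (metis norm_le_zero_iff not_le order.trans)
    obtain i0 where i0: "i0 \<in> I" "norm (c i0) = M" using Max_in[OF fi ne] unfolding M_def by fastforce
    show ?thesis
    proof (intro exI[of _ "\<lambda>i. c i / complex_of_real M"] conjI ballI)
      show "norm (c i / complex_of_real M) \<le> 1" if "i \<in> I" for i using le[OF that] M by (simp add: norm_divide)
      show "\<exists>i\<in>I. norm (c i / complex_of_real M) = 1" using i0 M by (intro bexI[of _ i0]) (simp_all add: norm_divide)
      show "(\<Sum>i\<in>I. c i / complex_of_real M * a k x i) = 0" if "x \<in> test_radii n" for x
        using c(2) that by (simp add: sum_divide_distrib[symmetric])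
    qed
  qed
  then obtain c where c: "\<And>k i. i \<in> I \<Longrightarrow> norm (c k i) \<le> 1" "\<And>k. \<exists>i\<in>I. norm (c k i) = 1"
    "\<And>k x. x \<in> test_radii n \<Longrightarrow> (\<Sum>i\<in>I. c k i * a k x i) = 0" by metis
  obtain r d where r: "strict_mono (r :: nat \<Rightarrow> nat)" "\<And>i. i \<in> I \<Longrightarrow> (\<lambda>k. c (r k) i) \<longlonglongrightarrow> d i"
    using bounded_family_subsequence[OF I, of c] c(1) by blast
  have dne: "\<exists>i\<in>I. d i \<noteq> 0"
  proof (rule ccontr)
    assume "\<not> ?thesis"
    then have d0: "(\<lambda>k. c (r k) i) \<longlonglongrightarrow> 0" if "i \<in> I" for i using r(2)[OF that] that by simp
    have "(\<lambda>k. \<Sum>i\<in>I. norm (c (r k) i)) \<longlonglongrightarrow> (\<Sum>i\<in>I. 0)"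
      by (intro tendsto_sum tendsto_norm_zero d0)
    moreover have "1 \<le> (\<Sum>i\<in>I. norm (c (r k) i))" for k
    proof -
      obtain i where "i \<in> I" "norm (c (r k) i) = 1" using c(2) by blast
      then show ?thesis using I member_le_sum[of i I "\<lambda>i. norm (c (r k) i)"] by simp
    qed
    ultimately have "1 \<le> (\<Sum>i\<in>I. 0 :: real)" by (intro LIMSEQ_le_const) auto
    then show False by simp
  qed
  define \<psi> where "\<psi> k = (\<lambda>x. \<Sum>i\<in>I. c k i * \<phi> i k x)" for k
  have pt: "\<psi> k \<in> test_functions UNIV" for k unfolding \<psi>_def by (intro test_sum test_cmult \<phi>(1))
  have zero: "integral {-T..T} (\<lambda>s. \<psi> k (x, x * s)) = 0" if x: "x \<in> test_radii n" for k x
  proof -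
    have "(\<lambda>s. \<phi> i k (x, x * s)) integrable_on {-T..T}" if "i \<in> I" for i
      by (intro integrable_continuous_interval continuous_on_compose2[OF smooth_continuous[OF test_smooth[OF \<phi>(1)[OF that]], of UNIV]] continuous_intros) auto
    then have "((\<lambda>s. \<psi> k (x, x * s)) has_integral (\<Sum>i\<in>I. c k i * a k x i)) {-T..T}"
      unfolding \<psi>_def a_def by (intro has_integral_sum I has_integral_mult_right integrable_integral)
    then show ?thesis using c(3)[OF x] by (simp add: integral_unique)
  qed
  have low: "lower_const n * Re (L2_inner U (\<psi> k) (\<psi> k)) \<le> Re (test_form (\<psi> k) (\<psi> k))" for k
    using test_form_lower_bound[OF T4 pt zero] by (simp add: L2_inner_self del: of_real_power)
  have tf: "test_form (\<psi> k) (\<psi> k) = (\<Sum>i\<in>I. \<Sum>j\<in>I. c k i * cnj (c k j) * test_form (\<phi> i k) (\<phi> j k))" for k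
    unfolding \<psi>_def by (rule test_form_lincomb[OF \<phi>(1)])
  have ti: "L2_inner U (\<psi> k) (\<psi> k) = (\<Sum>i\<in>I. \<Sum>j\<in>I. c k i * cnj (c k j) * L2_inner U (\<phi> i k) (\<phi> j k))" for k
    unfolding \<psi>_def by (rule L2_inner_sum_sum[OF test_L2_U[OF \<phi>(1)] test_L2_U[OF \<phi>(1)]])
  have "(\<lambda>k. test_form (\<psi> (r k)) (\<psi> (r k))) \<longlonglongrightarrow> (\<Sum>i\<in>I. \<Sum>j\<in>I. d i * cnj (d j) * (complex_of_real (E i) * L2_inner U (u i) (u j)))"
    unfolding tf
    by (intro tendsto_sum tendsto_mult tendsto_cnj r LIMSEQ_subseq_LIMSEQ[OF form_lim r(1), unfolded o_def])
  moreover have "(\<lambda>k. L2_inner U (\<psi> (r k)) (\<psi> (r k))) \<longlonglongrightarrow> (\<Sum>i\<in>I. \<Sum>j\<in>I. d i * cnj (d j) * L2_inner U (u i) (u j))"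
    unfolding ti
    by (intro tendsto_sum tendsto_mult tendsto_cnj r LIMSEQ_subseq_LIMSEQ[OF inner_lim r(1), unfolded o_def])
  ultimately have lim: "lower_const n * Re (\<Sum>i\<in>I. \<Sum>j\<in>I. d i * cnj (d j) * L2_inner U (u i) (u j))
      \<le> Re (\<Sum>i\<in>I. \<Sum>j\<in>I. d i * cnj (d j) * (complex_of_real (E i) * L2_inner U (u i) (u j)))"
    by (intro LIMSEQ_le[OF tendsto_mult[OF tendsto_const tendsto_Re] tendsto_Re]) (use low in auto)
  define F where "F = E ` I"
  define v where "v \<mu> = (\<lambda>x. \<Sum>i\<in>{i\<in>I. E i = \<mu>}. d i * u i x)" for \<mu>
  define q where "q \<mu> = (L2_norm U (v \<mu>))\<^sup>2" for \<mu>
  have finF: "finite F" using I by (simp add: F_def)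
  have uL: "i \<in> I \<Longrightarrow> u i \<in> L2 U" for i by (rule H1_L2[OF h])
  \<comment> \<open>Eigenfunctions for different eigenvalues are orthogonal, so the double sums split into the square norms of the eigenspace components.\<close>
  have group: "(\<Sum>i\<in>I. \<Sum>j\<in>I. d i * cnj (d j) * (complex_of_real (f (E i)) * L2_inner U (u i) (u j))) = complex_of_real (\<Sum>\<mu>\<in>F. f \<mu> * q \<mu>)" for f :: "real \<Rightarrow> real"
  proof -
    have orth: "(\<Sum>j\<in>I. d i * cnj (d j) * (complex_of_real (f (E i)) * L2_inner U (u i) (u j)))
       = (\<Sum>j\<in>{j\<in>I. E j = E i}. d i * cnj (d j) * (complex_of_real (f (E i)) * L2_inner U (u i) (u j)))" if i: "i \<in> I" for i
      using I
    proof (intro sum.mono_neutral_right ballI)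
      fix j assume "j \<in> I - {j \<in> I. E j = E i}"
      then have "L2_inner U (u i) (u j) = 0" by (intro eigenspace_orthogonal[OF u[OF i] u]) auto
      then show "d i * cnj (d j) * (complex_of_real (f (E i)) * L2_inner U (u i) (u j)) = 0" by simp
    qed auto
    have "(\<Sum>i\<in>I. \<Sum>j\<in>I. d i * cnj (d j) * (complex_of_real (f (E i)) * L2_inner U (u i) (u j)))
       = (\<Sum>i\<in>I. \<Sum>j\<in>{j\<in>I. E j = E i}. d i * cnj (d j) * (complex_of_real (f (E i)) * L2_inner U (u i) (u j)))"
      by (intro sum.cong refl orth)
    also have "\<dots> = (\<Sum>\<mu>\<in>F. \<Sum>i\<in>{i\<in>I. E i = \<mu>}. \<Sum>j\<in>{j\<in>I. E j = E i}. d i * cnj (d j) * (complex_of_real (f (E i)) * L2_inner U (u i) (u j)))"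
      unfolding F_def by (rule sum.image_gen[OF I])
    also have "\<dots> = (\<Sum>\<mu>\<in>F. complex_of_real (f \<mu> * q \<mu>))"
    proof (intro sum.cong refl)
      fix \<mu> assume "\<mu> \<in> F"
      have "(\<Sum>i\<in>{i\<in>I. E i = \<mu>}. \<Sum>j\<in>{j\<in>I. E j = E i}. d i * cnj (d j) * (complex_of_real (f (E i)) * L2_inner U (u i) (u j)))
        = (\<Sum>i\<in>{i\<in>I. E i = \<mu>}. \<Sum>j\<in>{j\<in>I. E j = \<mu>}. complex_of_real (f \<mu>) * (d i * cnj (d j) * L2_inner U (u i) (u j)))"
        by (intro sum.cong) (auto simp: mult_ac)
      also have "\<dots> = complex_of_real (f \<mu>) * L2_inner U (v \<mu>) (v \<mu>)"
        unfolding v_def by (subst L2_inner_sum_sum) (auto simp: uL sum_distrib_left)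
      also have "\<dots> = complex_of_real (f \<mu> * q \<mu>)" by (simp add: L2_inner_self q_def)
      finally show "(\<Sum>i\<in>{i\<in>I. E i = \<mu>}. \<Sum>j\<in>{j\<in>I. E j = E i}. d i * cnj (d j) * (complex_of_real (f (E i)) * L2_inner U (u i) (u j)))
         = complex_of_real (f \<mu> * q \<mu>)" .
    qed
    finally show ?thesis by simp
  qed
  have group1: "(\<Sum>i\<in>I. \<Sum>j\<in>I. d i * cnj (d j) * L2_inner U (u i) (u j)) = complex_of_real (\<Sum>\<mu>\<in>F. q \<mu>)"
    using group[of "\<lambda>_. 1"] by simp
  have "lower_const n * (\<Sum>\<mu>\<in>F. q \<mu>) \<le> (\<Sum>\<mu>\<in>F. \<mu> * q \<mu>)"
    using lim unfolding group[of "\<lambda>x. x"] group1 by (simp only: Re_complex_of_real)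
  also have "\<dots> \<le> (\<Sum>\<mu>\<in>F. \<Lambda> * q \<mu>)"
    using E by (intro sum_mono mult_right_mono) (auto simp: F_def q_def)
  also have "\<dots> = \<Lambda> * (\<Sum>\<mu>\<in>F. q \<mu>)" by (rule sum_distrib_left[symmetric])
  finally have "(lower_const n - \<Lambda>) * (\<Sum>\<mu>\<in>F. q \<mu>) \<le> 0" by (simp add: left_diff_distrib)
  then have "(\<Sum>\<mu>\<in>F. q \<mu>) \<le> 0" using lc by (simp add: mult_le_0_iff)
  moreover have "0 \<le> q \<mu>" for \<mu> by (simp add: q_def)
  ultimately have q0: "q \<mu> = 0" if "\<mu> \<in> F" for \<mu>
    using sum_nonneg_eq_0_iff[OF finF, of q] that by (meson antisym sum_nonneg)
  have "d i = 0" if i: "i \<in> I" for i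
  proof -
    have "E i \<in> F" using i by (simp add: F_def)
    then have "L2_norm U (v (E i)) = 0" using q0 by (simp add: q_def)
    moreover have vL: "v (E i) \<in> L2 U" unfolding v_def by (intro L2_sum L2_cmult uL) simp
    ultimately have "(\<integral>\<^sup>+x. ennreal ((norm (v (E i) x))\<^sup>2) \<partial>U) = 0" using nn_L2_norm[OF vL] by simp
    then have "AE x in U. v (E i) x = 0"
      using L2_measurable[OF vL] by (subst (asm) nn_integral_0_iff_AE) auto
    then show ?thesis using ind[of d "E i"] i unfolding v_def by blast
  qed
  with dne show False by blast
qed

end

section \<open>The n-th eigenvalue for small angles\<close>

context acute begin

definition edge_value :: "nat \<Rightarrow> real" where
  "edge_value M = - (1 / sin (real (2 * M + 1) * \<alpha>))\<^sup>2"

lemma edge_value_discrete: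
  assumes M: "real (2 * M + 1) * \<alpha> < pi / 2"
  shows "edge_value M \<in> discrete_eigenvalues \<alpha>"
proof -
  interpret edge \<alpha> M using M by unfold_locales
  have \<kappa>: "edge_value M = - \<kappa>\<^sup>2" by (simp add: edge_value_def \<kappa>_def)
  have "0 < real (2 * M + 1) * \<alpha>" using pos by simp
  then have s: "0 < sin (real (2 * M + 1) * \<alpha>)" using M by (intro sin_gt_zero) linarith+
  have c: "0 < cos (real (2 * M + 1) * \<alpha>)" using M \<open>0 < real (2 * M + 1) * \<alpha>\<close> by (intro cos_gt_zero)
  have "(sin (real (2 * M + 1) * \<alpha>))\<^sup>2 < 1"
    using sin_cos_squared_add[of "real (2 * M + 1) * \<alpha>"] zero_less_power[OF c, of 2] by linarith
  then have "edge_value M < - 1" using s by (simp add: edge_value_def power_divide field_simps)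
  then show ?thesis using edge_eigenspace edge_nonzero
    unfolding discrete_eigenvalues_def is_eigenvalue_def \<kappa> by auto
qed

lemma edge_value_strict_mono:
  assumes "real (2 * N + 1) * \<alpha> < pi / 2" "M < N"
  shows "edge_value M < edge_value N"
proof -
  have "real (2 * M + 1) * \<alpha> < real (2 * N + 1) * \<alpha>" using assms pos by simp
  moreover have p: "0 < real (2 * M + 1) * \<alpha>" using pos by simp
  ultimately have "0 < sin (real (2 * M + 1) * \<alpha>)" "sin (real (2 * M + 1) * \<alpha>) < sin (real (2 * N + 1) * \<alpha>)"
    using assms pi_gt_zero by (auto intro!: sin_gt_zero sin_monotone_2pi simp del: of_nat_add of_nat_mult)
  then have "(1 / sin (real (2 * N + 1) * \<alpha>))\<^sup>2 < (1 / sin (real (2 * M + 1) * \<alpha>))\<^sup>2"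
    by (intro power_strict_mono divide_strict_left_mono) auto
  then show ?thesis by (simp add: edge_value_def)
qed

definition independent_eigenfunctions :: "real \<Rightarrow> nat \<Rightarrow> bool" where
  "independent_eigenfunctions \<mu> k \<longleftrightarrow> (\<exists>u. (\<forall>i<k. u i \<in> eigenspace \<alpha> \<mu>) \<and> independent_AE U k u)"

text \<open>
  The functions of one eigenspace are independent by assumption, and \<open>eigenvalue_count\<close> asks for independence only within each eigenspace.
\<close>

lemma total_count:
  assumes T4: "T \<le> 1/4" and lc: "\<Lambda> < lower_const n" and F: "finite F" "\<And>\<mu>. \<mu> \<in> F \<Longrightarrow> \<mu> \<le> \<Lambda>"
    and k: "\<And>\<mu>. \<mu> \<in> F \<Longrightarrow> independent_eigenfunctions \<mu> (k \<mu>)"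
  shows "(\<Sum>\<mu>\<in>F. k \<mu>) \<le> n"
proof -
  have "\<forall>\<mu>\<in>F. \<exists>u. (\<forall>i<k \<mu>. u i \<in> eigenspace \<alpha> \<mu>) \<and> independent_AE U (k \<mu>) u"
    using k unfolding independent_eigenfunctions_def by blast
  from bchoice[OF this] obtain w where w: "\<And>\<mu> i. \<mu> \<in> F \<Longrightarrow> i < k \<mu> \<Longrightarrow> w \<mu> i \<in> eigenspace \<alpha> \<mu>"
    "\<And>\<mu>. \<mu> \<in> F \<Longrightarrow> independent_AE U (k \<mu>) (w \<mu>)" by blast
  define I where "I = Sigma F (\<lambda>\<mu>. {..<k \<mu>})"
  have "card I \<le> n"
  proof (rule eigenvalue_count[OF T4 lc, of I "\<lambda>p. w (fst p) (snd p)" fst])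
    show "finite I" using F by (simp add: I_def)
    show "w (fst p) (snd p) \<in> eigenspace \<alpha> (fst p)" if "p \<in> I" for p using that w(1) by (auto simp: I_def)
    show "fst p \<le> \<Lambda>" if "p \<in> I" for p using that F(2) by (auto simp: I_def)
    show "\<forall>i\<in>I. fst i = \<mu> \<longrightarrow> c i = 0" if ae: "AE x in U. (\<Sum>i\<in>{i\<in>I. fst i = \<mu>}. c i * w (fst i) (snd i) x) = 0" for c \<mu>
    proof (cases "\<mu> \<in> F")
      case False then show ?thesis by (auto simp: I_def)
    next
      case True
      have "{i\<in>I. fst i = \<mu>} = Pair \<mu> ` {..<k \<mu>}" using True by (auto simp: I_def)
      then have "(\<Sum>i\<in>{i\<in>I. fst i = \<mu>}. c i * w (fst i) (snd i) x) = (\<Sum>i<k \<mu>. c (\<mu>, i) * w \<mu> i x)" for x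
        by (simp add: sum.reindex inj_on_def)
      with ae have "AE x in U. (\<Sum>i<k \<mu>. c (\<mu>, i) * w \<mu> i x) = 0" by simp
      then have "\<forall>i<k \<mu>. c (\<mu>, i) = 0" using w(2)[OF True] unfolding independent_AE_def
        by (elim allE[of _ "\<lambda>i. c (\<mu>, i)"]) blast
      then show ?thesis by (auto simp: I_def)
    qed
  qed
  also have "card I = (\<Sum>\<mu>\<in>F. k \<mu>)" using F by (simp add: I_def)
  finally show ?thesis by simp
qed

lemma independent_eigenfunctions_0: "independent_eigenfunctions \<mu> 0"
  by (simp add: independent_eigenfunctions_def independent_AE_def)

lemma independent_eigenfunctions_1:
  assumes "is_eigenvalue \<alpha> \<mu>"
  shows "independent_eigenfunctions \<mu> 1"
proof -
  obtain u where u: "u \<in> eigenspace \<alpha> \<mu>" "\<not> (AE x in U. u x = 0)"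
    using assms unfolding is_eigenvalue_def by blast
  have "c 0 = 0" if "AE x in U. c (0 :: nat) * u x = 0" for c :: "nat \<Rightarrow> complex"
  proof (rule ccontr)
    assume "c 0 \<noteq> 0"
    then have "AE x in U. u x = 0" using that by simp
    with u(2) show False by blast
  qed
  then show ?thesis unfolding independent_eigenfunctions_def independent_AE_def
    using u(1) by (intro exI[of _ "\<lambda>_. u"]) auto
qed

text \<open>
  Let \<open>D\<close> be the set of eigenvalues up to \<open>edge_value M\<close>. The counting bound forces \<open>D\<close> and all
  multiplicities to be finite with total at most \<open>M + 1\<close>. Since \<open>D\<close> contains the \<open>M + 1\<close> edge values, the
  total is exactly \<open>M + 1\<close>, and removing the topmost eigenvalue lowers it.
\<close>

lemma nth_eigenvalue_eq_edge_value:
  assumes n: "real (2 * M + 1) * \<alpha> < pi / 2" and T4: "T \<le> 1/4" and lc: "edge_value M < lower_const (Suc M)"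
  shows "nth_eigenvalue \<alpha> (Suc M) = edge_value M"
proof -
  define D where "D = {\<mu> \<in> discrete_eigenvalues \<alpha>. \<mu> \<le> edge_value M}"
  have fin_card: "card F \<le> Suc M" if "finite F" "F \<subseteq> D" for F
    using total_count[OF T4 lc that(1), of "\<lambda>_. 1"] independent_eigenfunctions_1 that(2)
    by (auto simp: D_def discrete_eigenvalues_def)
  have D: "finite D"
  proof (rule ccontr)
    assume "infinite D"
    then obtain F where "F \<subseteq> D" "finite F" "card F = Suc (Suc M)" by (rule infinite_arbitrarily_large[THEN exE]) blast
    with fin_card show False by fastforce
  qed
  define k where "k \<mu> = Max {k. independent_eigenfunctions \<mu> k}" for \<mu>
  have finK: "finite {k. independent_eigenfunctions \<mu> k}" if "\<mu> \<in> D" for \<mu>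
  proof (rule finite_subset)
    show "{k. independent_eigenfunctions \<mu> k} \<subseteq> {..Suc M}"
    proof
      fix j assume "j \<in> {k. independent_eigenfunctions \<mu> k}"
      then show "j \<in> {..Suc M}" using total_count[OF T4 lc, of "{\<mu>}" "\<lambda>_. j"] that by (auto simp: D_def)
    qed
  qed simp
  have kK: "independent_eigenfunctions \<mu> (k \<mu>)" if "\<mu> \<in> D" for \<mu>
    using Max_in[OF finK[OF that]] independent_eigenfunctions_0[of \<mu>] unfolding k_def by blast
  have k1: "1 \<le> k \<mu>" if "\<mu> \<in> D" for \<mu>
    unfolding k_def using independent_eigenfunctions_1 that
    by (intro Max_ge finK) (auto simp: D_def discrete_eigenvalues_def)
  have mult: "multiplicity \<alpha> \<mu> = enat (k \<mu>)" if "\<mu> \<in> D" for \<mu>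
    unfolding multiplicity_def independent_eigenfunctions_def[symmetric]
  proof (rule antisym)
    show "(SUP k\<in>{k. independent_eigenfunctions \<mu> k}. enat k) \<le> enat (k \<mu>)"
      using finK[OF that] by (intro SUP_least) (auto simp: k_def)
    show "enat (k \<mu>) \<le> (SUP k\<in>{k. independent_eigenfunctions \<mu> k}. enat k)"
      using kK[OF that] by (intro SUP_upper) simp
  qed
  have le: "(\<Sum>\<mu>\<in>D. k \<mu>) \<le> Suc M"
    by (rule total_count[OF T4 lc D]) (auto simp: D_def intro: kK[unfolded D_def])
  have E_in: "edge_value j \<in> D" if "j \<le> M" for j
  proof -
    have "real (2 * j + 1) * \<alpha> \<le> real (2 * M + 1) * \<alpha>" using that pos by (intro mult_right_mono) auto
    then have "edge_value j \<in> discrete_eigenvalues \<alpha>" using n by (intro edge_value_discrete) linarith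
    moreover have "edge_value j \<le> edge_value M" using edge_value_strict_mono[OF n, of j] that by (cases "j = M") auto
    ultimately show ?thesis by (simp add: D_def)
  qed
  have inj: "inj_on edge_value {..M}"
  proof (rule strict_mono_on_imp_inj_on, rule strict_mono_onI)
    fix i j assume "i \<in> {..M}" "j \<in> {..M}" "i < j"
    have "real (2 * j + 1) * \<alpha> \<le> real (2 * M + 1) * \<alpha>" using \<open>j \<in> _\<close> pos by (intro mult_right_mono) auto
    then show "edge_value i < edge_value j" using n by (intro edge_value_strict_mono \<open>i < j\<close>) linarith
  qed
  have "Suc M = (\<Sum>\<mu>\<in>edge_value ` {..M}. 1)" by (simp add: card_image[OF inj])
  also have "\<dots> \<le> (\<Sum>\<mu>\<in>edge_value ` {..M}. k \<mu>)" using k1 E_in by (intro sum_mono) auto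
  also have "\<dots> \<le> (\<Sum>\<mu>\<in>D. k \<mu>)" using E_in by (intro sum_mono2 D) auto
  finally have eq: "(\<Sum>\<mu>\<in>D. k \<mu>) = Suc M" using le by simp
  have D': "{\<mu> \<in> discrete_eigenvalues \<alpha>. \<mu> < edge_value M} = D - {edge_value M}" by (auto simp: D_def)
  have "(\<Sum>\<mu>\<in>D. k \<mu>) = k (edge_value M) + (\<Sum>\<mu>\<in>D - {edge_value M}. k \<mu>)"
    using E_in[of M] by (intro sum.remove D) simp
  then have lt: "(\<Sum>\<mu>\<in>D - {edge_value M}. k \<mu>) < Suc M" using k1[OF E_in[of M]] eq by simp
  have enat_sum: "(\<Sum>\<mu>\<in>G. multiplicity \<alpha> \<mu>) = enat (\<Sum>\<mu>\<in>G. k \<mu>)" if "G \<subseteq> D" for G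
    using finite_subset[OF that D] that
    by (induction G rule: finite_induct) (auto simp: mult zero_enat_def)
  have nth: "is_nth_eigenvalue \<alpha> (Suc M) (edge_value M)"
    unfolding is_nth_eigenvalue_def D'
  proof (intro conjI)
    show "edge_value M \<in> discrete_eigenvalues \<alpha>" using E_in[of M] by (simp add: D_def)
    show "finite (D - {edge_value M})" using D by simp
    show "(\<Sum>\<mu>\<in>D - {edge_value M}. multiplicity \<alpha> \<mu>) < enat (Suc M)" using lt by (subst enat_sum) auto
    show "enat (Suc M) \<le> (\<Sum>\<mu> | \<mu> \<in> discrete_eigenvalues \<alpha> \<and> \<mu> \<le> edge_value M. multiplicity \<alpha> \<mu>)"
      using enat_sum[of D] eq by (simp add: D_def)
  qed
  show ?thesis unfolding nth_eigenvalue_def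
    by (intro the_equality nth is_nth_eigenvalue_unique[OF _ nth])
qed

end

text \<open>
  After multiplication with \<open>\<alpha>\<^sup>2\<close> the difference tends to \<open>1 / (2M + 1)\<^sup>2 - 1 / (2M + 3)\<^sup>2 > 0\<close>.
\<close>

lemma edge_value_below_lower_const:
  fixes M :: nat
  shows "\<forall>\<^sub>F \<alpha> in at_right 0. - (1 / sin (real (2 * M + 1) * \<alpha>))\<^sup>2 < - (1 + tan \<alpha>) / ((sin \<alpha>)\<^sup>2 * (2 * real (Suc M) + 1)\<^sup>2) - 12"
proof -
  define c where "c = real (2 * M + 1)"
  have c: "c > 0" by (simp add: c_def)
  have sinc: "((\<lambda>\<alpha>. sin (b * \<alpha>) / \<alpha>) \<longlongrightarrow> b) (at_right 0)" for b :: real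
  proof -
    have "((\<lambda>\<alpha>. sin (b * \<alpha>)) has_real_derivative b) (at 0)" by (auto intro!: derivative_eq_intros)
    then have "((\<lambda>\<alpha>. sin (b * \<alpha>) / \<alpha>) \<longlongrightarrow> b) (at 0)" by (simp add: has_field_derivative_iff)
    then show ?thesis by (rule filterlim_mono[OF _ order_refl]) (simp add: at_le)
  qed
  have "((\<lambda>\<alpha>. (1 / (sin (c * \<alpha>) / \<alpha>))\<^sup>2 - (1 + tan \<alpha>) / ((sin (1 * \<alpha>) / \<alpha>)\<^sup>2 * (c + 2)\<^sup>2) - 12 * \<alpha>\<^sup>2)
      \<longlongrightarrow> (1 / c)\<^sup>2 - (1 + tan 0) / (1\<^sup>2 * (c + 2)\<^sup>2) - 12 * 0\<^sup>2) (at_right 0)"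
    using c by (intro tendsto_intros sinc) auto
  then have "((\<lambda>\<alpha>::real. \<alpha>\<^sup>2 * ((1 / sin (c * \<alpha>))\<^sup>2 - (1 + tan \<alpha>) / ((sin \<alpha>)\<^sup>2 * (c + 2)\<^sup>2) - 12)) \<longlongrightarrow> 1 / c\<^sup>2 - 1 / (c + 2)\<^sup>2) (at_right 0)"
    by (simp add: power_divide right_diff_distrib mult_ac)
  moreover have "0 < 1 / c\<^sup>2 - 1 / (c + 2)\<^sup>2" using c by (simp add: frac_less2 power_strict_mono)
  ultimately have "\<forall>\<^sub>F \<alpha> in at_right 0. 0 < \<alpha>\<^sup>2 * ((1 / sin (c * \<alpha>))\<^sup>2 - (1 + tan \<alpha>) / ((sin \<alpha>)\<^sup>2 * (c + 2)\<^sup>2) - 12)"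
    by (rule order_tendstoD(1))
  then show ?thesis
  proof (rule eventually_mono)
    fix \<alpha> :: real assume "0 < \<alpha>\<^sup>2 * ((1 / sin (c * \<alpha>))\<^sup>2 - (1 + tan \<alpha>) / ((sin \<alpha>)\<^sup>2 * (c + 2)\<^sup>2) - 12)"
    then have "0 < (1 / sin (c * \<alpha>))\<^sup>2 - (1 + tan \<alpha>) / ((sin \<alpha>)\<^sup>2 * (c + 2)\<^sup>2) - 12"
      by (simp add: zero_less_mult_iff)
    then have "- (1 / sin (c * \<alpha>))\<^sup>2 < - (1 + tan \<alpha>) / ((sin \<alpha>)\<^sup>2 * (c + 2)\<^sup>2) - 12"
      unfolding minus_divide_left[symmetric] by linarith
    moreover have "c + 2 = 2 * real (Suc M) + 1" by (simp add: c_def)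
    ultimately show "- (1 / sin (real (2 * M + 1) * \<alpha>))\<^sup>2 < - (1 + tan \<alpha>) / ((sin \<alpha>)\<^sup>2 * (2 * real (Suc M) + 1)\<^sup>2) - 12"
      by (simp only: c_def)
  qed
qed

lemma nth_eigenvalue_eventually:
  fixes M :: nat
  shows "\<forall>\<^sub>F \<alpha> in at_right 0. nth_eigenvalue \<alpha> (Suc M) = - (1 / sin (real (2 * M + 1) * \<alpha>))\<^sup>2"
proof -
  have "((\<lambda>\<alpha>. real (2 * M + 1) * \<alpha>) \<longlongrightarrow> real (2 * M + 1) * 0) (at_right 0)" by (intro tendsto_intros)
  then have "\<forall>\<^sub>F \<alpha> in at_right 0. real (2 * M + 1) * \<alpha> < pi / 2" by (rule order_tendstoD) simp
  moreover have "((\<lambda>\<alpha>. tan \<alpha>) \<longlongrightarrow> tan 0) (at_right (0 :: real))" by (intro tendsto_intros) simp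
  then have "\<forall>\<^sub>F \<alpha> in at_right 0. tan \<alpha> < (1/4 :: real)" by (rule order_tendstoD) simp
  moreover have "\<forall>\<^sub>F \<alpha> in at_right 0. \<alpha> < (pi / 2 :: real)" by (rule eventually_at_rightI[of 0 "pi / 2"]) auto
  ultimately show ?thesis using edge_value_below_lower_const[of M] eventually_at_right_less[of "0 :: real"]
  proof eventually_elim
    case (elim \<alpha>)
    interpret acute \<alpha> using elim by unfold_locales auto
    show ?case using nth_eigenvalue_eq_edge_value[of M] elim unfolding edge_value_def lower_const_def by auto
  qed
qed

section \<open>Asymptotic expansion\<close>

text \<open>
  Taylor's formula with remainder for a function with a convergent power series.
\<close>

lemma has_fps_expansion_bigo:
  fixes f :: "real \<Rightarrow> real"
  assumes f: "f has_fps_expansion G"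
  shows "(\<lambda>x. f x - (\<Sum>j<N. fps_nth G j * x ^ j)) \<in> O[at 0](\<lambda>x. x ^ N)"
proof -
  define R where "R = G - (\<Sum>j<N. fps_const (fps_nth G j) * fps_X ^ j)"
  define g where "g x = f x - (\<Sum>j<N. fps_nth G j * x ^ j)" for x
  have g: "g has_fps_expansion R" unfolding g_def R_def
    by (intro has_fps_expansion_diff f has_fps_expansion_sum has_fps_expansion_cmult_left has_fps_expansion_fps_X_power)
  have "fps_nth R k = 0" if "k < N" for k
    using that by (simp add: R_def fps_sum_nth fps_X_power_nth if_distrib[of "(*) _"] cong: if_cong)
  show ?thesis unfolding g_def[symmetric]
  proof (cases "R = 0")
    case True
    then have "\<forall>\<^sub>F x in nhds 0. 0 = g x" using g by (simp add: has_fps_expansion_def)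
    then have "\<forall>\<^sub>F x in at 0. g x = 0" unfolding eventually_at_filter by (rule eventually_mono) simp
    then show "g \<in> O[at 0](\<lambda>x. x ^ N)" by (intro bigoI[of _ 1]) (erule eventually_mono, simp)
  next
    case False
    then have "N \<le> subdegree R" using \<open>\<And>k. k < N \<Longrightarrow> fps_nth R k = 0\<close> by (intro subdegree_geI) auto
    from has_fps_expansion_imp_continuous[OF has_fps_expansion_shift[OF g this refl], of UNIV]
    have "((\<lambda>x. if x = 0 then fps_nth R N else g x / x ^ N) \<longlongrightarrow> fps_nth R N) (at 0)" by (simp add: continuous_within)
    then have "((\<lambda>x. g x / x ^ N) \<longlongrightarrow> fps_nth R N) (at 0)"
      by (rule Lim_transform_eventually) (simp add: eventually_at_filter)
    then show "g \<in> O[at 0](\<lambda>x. x ^ N)"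
      by (rule bigoI_tendsto) (simp only: eventually_at_filter, rule always_eventually, simp)
  qed
qed

text \<open>
  The power series of \<open>sin \<surd>w / \<surd>w\<close> in the variable \<open>w\<close>; using \<open>w = x\<^sup>2\<close> yields an expansion in even powers only.
\<close>

definition sinc_fps :: "real fps" where
  "sinc_fps = Abs_fps (\<lambda>k. (- 1) ^ k / fact (2 * k + 1))"

lemma sin_eq_eval_sinc_fps: "sin x = x * eval_fps sinc_fps (x\<^sup>2)"
proof -
  have "summable (\<lambda>k. (- 1) ^ k / fact (2 * k + 1) * (x\<^sup>2) ^ k)"
  proof (cases "x = 0")
    case False
    have "summable (\<lambda>k. (- 1) ^ k / fact (2 * k + 1) * x ^ (2 * k + 1) / x)"
      by (intro summable_divide sums_summable[OF sin_paired])
    then show ?thesis using False by (simp add: power_mult)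
  next
    case True
    then show ?thesis by (intro summable_finite[of "{0}"]) auto
  qed
  then have "(\<lambda>k. x * ((- 1) ^ k / fact (2 * k + 1) * (x\<^sup>2) ^ k)) sums (x * eval_fps sinc_fps (x\<^sup>2))"
    unfolding eval_fps_def sinc_fps_def fps_nth_Abs_fps by (intro sums_mult summable_sums)
  also have "(\<lambda>k. x * ((- 1) ^ k / fact (2 * k + 1) * (x\<^sup>2) ^ k)) = (\<lambda>k. (- 1) ^ k / fact (2 * k + 1) * x ^ (2 * k + 1))"
    by (simp add: power_mult[symmetric] mult_ac)
  finally show ?thesis using sin_paired sums_unique2 by blast
qed

lemma eval_sinc_fps_expansion: "eval_fps sinc_fps has_fps_expansion sinc_fps"
proof -
  have "summable (\<lambda>k. fps_nth sinc_fps k * 1 ^ k)"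
    using sums_summable[OF sin_paired[of 1]] by (simp add: sinc_fps_def)
  from conv_radius_geI[OF this] have "fps_conv_radius sinc_fps > 0"
    unfolding fps_conv_radius_def by (simp add: one_ereal_def order.strict_trans2[of 0 1])
  then show ?thesis by (simp add: has_fps_expansion_def)
qed

lemma sinc_fps_nth_0: "fps_nth sinc_fps 0 = 1"
  by (simp add: sinc_fps_def)

lemma inverse_sin_sq_expansion:
  defines "G \<equiv> inverse (sinc_fps\<^sup>2)"
  shows "(\<lambda>x. (1 / sin x)\<^sup>2 - (\<Sum>j\<le>N. fps_nth G j * x ^ (2 * j)) / x\<^sup>2) \<in> O[at_right 0](\<lambda>x. x ^ (2 * N))"
proof -
  define f where "f w = inverse ((eval_fps sinc_fps w)\<^sup>2)" for w
  have f: "f has_fps_expansion G"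
    unfolding f_def G_def power2_eq_square by (intro has_fps_expansion_inverse has_fps_expansion_mult eval_sinc_fps_expansion) (simp add: sinc_fps_nth_0)
  have sq: "filterlim (\<lambda>x. x\<^sup>2) (at 0) (at_right (0 :: real))"
  proof (rule filterlim_atI)
    have "((\<lambda>x. x\<^sup>2) \<longlongrightarrow> 0\<^sup>2) (at_right (0 :: real))" by (intro tendsto_intros)
    then show "((\<lambda>x. x\<^sup>2) \<longlongrightarrow> 0) (at_right (0 :: real))" by simp
    show "\<forall>\<^sub>F x in at_right 0. x\<^sup>2 \<noteq> (0 :: real)" by (simp add: eventually_at_filter)
  qed
  from landau_o.big.compose[OF has_fps_expansion_bigo[OF f, of "Suc N"] sq]
  have "(\<lambda>x. f (x\<^sup>2) - (\<Sum>j<Suc N. fps_nth G j * (x\<^sup>2) ^ j)) \<in> O[at_right 0](\<lambda>x. (x\<^sup>2) ^ Suc N)" .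
  then have bound: "(\<lambda>x. (1 / x\<^sup>2) * (f (x\<^sup>2) - (\<Sum>j<Suc N. fps_nth G j * (x\<^sup>2) ^ j))) \<in> O[at_right 0](\<lambda>x. (1 / x\<^sup>2) * (x\<^sup>2) ^ Suc N)"
    by (rule landau_o.big.mult_left)
  have ne: "\<forall>\<^sub>F x in at_right (0::real). x \<noteq> 0" by (simp add: eventually_at_filter)
  then have lhs: "\<forall>\<^sub>F x in at_right 0. (1 / x\<^sup>2) * (f (x\<^sup>2) - (\<Sum>j<Suc N. fps_nth G j * (x\<^sup>2) ^ j))
      = (1 / sin x)\<^sup>2 - (\<Sum>j\<le>N. fps_nth G j * x ^ (2 * j)) / x\<^sup>2"
    unfolding lessThan_Suc_atMost power_mult[symmetric]
    by (rule eventually_mono) (simp add: f_def sin_eq_eval_sinc_fps power_divide power_mult_distrib right_diff_distrib divide_inverse power_inverse mult_ac)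
  from ne have rhs: "\<forall>\<^sub>F x in at_right (0::real). (1 / x\<^sup>2) * (x\<^sup>2) ^ Suc N = x ^ (2 * N)"
    by (rule eventually_mono) (simp add: power_mult)
  show ?thesis
    using bound unfolding landau_o.big.cong[OF rhs] landau_o.big.in_cong[OF lhs] .
qed

theorem theorem4p16:
  fixes n :: nat
  assumes "n \<ge> 1"
  shows "\<exists>l :: nat \<Rightarrow> real.
    (\<forall>N::nat. N \<ge> 1 \<longrightarrow>
       (\<lambda>\<alpha>::real. nth_eigenvalue \<alpha> n - 1 / \<alpha>\<^sup>2 * (\<Sum>j=0..N. l j * \<alpha> ^ (2 * j)))
         \<in> O[at_right 0](\<lambda>\<alpha>. \<alpha> ^ (2 * N))) \<and>
    l 0 = - 1 / (2 * real n - 1)\<^sup>2"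
proof -
  obtain M where M: "n = Suc M" using assms by (cases n) auto
  define c where "c = real (2 * M + 1)"
  have c: "c > 0" and cn: "c = 2 * real n - 1" by (simp_all add: c_def M)
  let ?a = "fps_nth (inverse (sinc_fps\<^sup>2))"
  have lim: "filterlim (\<lambda>\<alpha>. c * \<alpha>) (at_right 0) (at_right 0)"
    using c by (intro filterlim_times_pos[OF filterlim_ident]) auto
  have "(\<lambda>\<alpha>. nth_eigenvalue \<alpha> n - 1 / \<alpha>\<^sup>2 * (\<Sum>j=0..N. (- ?a j * c ^ (2 * j) / c\<^sup>2) * \<alpha> ^ (2 * j))) \<in> O[at_right 0](\<lambda>\<alpha>. \<alpha> ^ (2 * N))" for N
  proof -
    have "(\<lambda>\<alpha>. (1 / sin (c * \<alpha>))\<^sup>2 - (\<Sum>j\<le>N. ?a j * (c * \<alpha>) ^ (2 * j)) / (c * \<alpha>)\<^sup>2) \<in> O[at_right 0](\<lambda>\<alpha>. (c * \<alpha>) ^ (2 * N))"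
      by (rule landau_o.big.compose[OF inverse_sin_sq_expansion lim])
    also have "(\<lambda>\<alpha>. (c * \<alpha>) ^ (2 * N)) \<in> O[at_right 0](\<lambda>\<alpha>. \<alpha> ^ (2 * N))"
      using c by (simp add: power_mult_distrib)
    finally have "(\<lambda>\<alpha>. - ((1 / sin (c * \<alpha>))\<^sup>2 - (\<Sum>j\<le>N. ?a j * (c * \<alpha>) ^ (2 * j)) / (c * \<alpha>)\<^sup>2)) \<in> O[at_right 0](\<lambda>\<alpha>. \<alpha> ^ (2 * N))"
      by (simp only: landau_o.big.uminus_in_iff)
    moreover have "\<forall>\<^sub>F \<alpha> in at_right 0. nth_eigenvalue \<alpha> n - 1 / \<alpha>\<^sup>2 * (\<Sum>j=0..N. (- ?a j * c ^ (2 * j) / c\<^sup>2) * \<alpha> ^ (2 * j))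
       = - ((1 / sin (c * \<alpha>))\<^sup>2 - (\<Sum>j\<le>N. ?a j * (c * \<alpha>) ^ (2 * j)) / (c * \<alpha>)\<^sup>2)"
      using nth_eigenvalue_eventually[of M, folded c_def]
      by (rule eventually_mono)
         (simp add: M atMost_atLeast0 sum_distrib_left sum_divide_distrib sum_negf power_mult_distrib mult_ac del: of_nat_Suc of_nat_add of_nat_mult)
    ultimately show ?thesis by (subst landau_o.big.in_cong) auto
  qed
  then show ?thesis
    by (intro exI[of _ "\<lambda>j. - ?a j * c ^ (2 * j) / c\<^sup>2"]) (simp add: sinc_fps_nth_0 power2_eq_square cn)
qed

end
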